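(* Let $(\mathcal{M},\mathrm{g})$ be a smooth Riemannian manifold without boundary, possibly incomplete, and let $\mathcal{V}$ be a smooth vector bundle over $\mathcal{M}$ equipped with a smooth metric $\mathrm{h}$ and a connection $\nabla$ compatible with $\mathrm{h}$. If the Cauchy boundary $\partial_{C}\mathcal{M}$ is polar, then $\mathrm{W}^{1,2}_{0}(\mathcal{V})=\mathrm{W}^{1,2}(\mathcal{V})$.
   Context: Setting: $\mathcal{M}$ is a smooth manifold without boundary with a smooth Riemannian metric $\mathrm{g}$, possibly incomplete as a metric space; $\mu_{\mathrm g}$ is the volume measure. $\mathcal{V}$ is a smooth vector bundle over $\mathcal{M}$ with smooth fibre metric $\mathrm{h}$ and connection $\nabla$ compatible with $\mathrm{h}$ (i.e. $\nabla \mathrm{h}=0$). $\mathrm{T}^*\mathcal{M}\otimes\mathcal{V}$ carries the metric induced by $\mathrm{g},\mathrm{h}$. $\mathrm{L}^2(\cdot)$ denotes square integrable measurable sections with respect to these metrics and $\mu_{\mathrm g}$ (real spaces are identified with their complexifications), with norm $\|\cdot\|$. Sobolev spaces: $S_1(\mathcal{V})=\{u\in \mathrm{C}^\infty\cap \mathrm{L}^2(\mathcal{V}) : \nabla u\in \mathrm{C}^\infty\cap \mathrm{L}^2(\mathrm{T}^*\mathcal{M}\otimes\mathcal{V})\}$. $\mathrm{W}^{1,2}(\mathcal{V})$ is the closure of $S_1(\mathcal{V})$, and $\mathrm{W}^{1,2}_0(\mathcal{V})$ the closure of $\mathrm{C}^\infty_c(\mathcal{V})$ (smooth compactly supported sections),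 under the norm $\|u\|_{\mathrm{W}^{1,2}}=\|u\|+\|\nabla u\|$; both are regarded as subspaces of $\mathrm{L}^2(\mathcal{V})$. $\mathrm{W}^{1,2}(\mathcal{M})$ is the corresponding space of scalar functions, with $\nabla$ replaced by the exterior derivative $\mathrm{d}$. Cauchy boundary and capacity: $\overline{\mathcal{M}}$ is the metric completion of $\mathcal{M}$ with respect to the Riemannian distance and $\partial_C\mathcal{M}:=\overline{\mathcal{M}}\setminus\mathcal{M}$. Let $\mathcal{O}$ be the collection of open subsets of $\overline{\mathcal{M}}$. For $\Omega\in\mathcal{O}$ put $\mathcal{L}(\Omega)=\{u\in \mathrm{W}^{1,2}(\mathcal{M}) : 0\le u\le 1,\ u|_{\Omega\cap\mathcal{M}}=1\}$ and $\mathrm{Cap}(\Omega)=\inf_{u\in\mathcal{L}(\Omega)}\int_{\mathcal{M}}(|u|^2+|\mathrm{d}u|^2)\,d\mu_{\mathrm g}$ if $\mathcal{L}(\Omega)\neq\emptyset$, $\mathrm{Cap}(\Omega)=\infty$ if $\mathcal{L}(\Omega)=\emptyset$, and $\mathrm{Cap}(\emptyset)=0$. For an arbitrary $\Sigma\subset\overline{\mathcal{M}}$, $\mathrm{Cap}(\Sigma)=\inf\{\mathrm{Cap}(\Omega):\Omega\in\mathcal{O},\ \Sigma\subset\Omega\}$. A set $\Sigma$ is polar if $\mathrm{Cap}(\Sigma)=0$ (in particular $\emptyset$ is polar). *)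

theory Defs
  imports "HOL-Analysis.Analysis"
begin

section \<open>Smooth functions on open subsets of normed spaces\<close>

primrec Ck_on :: "nat \<Rightarrow> 'a::real_normed_vector set \<Rightarrow> ('a \<Rightarrow> 'b::real_normed_vector) \<Rightarrow> bool" where
  "Ck_on 0 S f \<longleftrightarrow> continuous_on S f"
| "Ck_on (Suc k) S f \<longleftrightarrow>
     (\<forall>x\<in>S. f differentiable (at x)) \<and> (\<forall>v. Ck_on k S (\<lambda>x. frechet_derivative f (at x) v))"

definition smooth_on :: "'a::real_normed_vector set \<Rightarrow> ('a \<Rightarrow> 'b::real_normed_vector) \<Rightarrow> bool" where
  "smooth_on S f \<longleftrightarrow> (\<forall>k. Ck_on k S f)"


section \<open>Riemannian manifolds\<close>

text \<open>
  The underlying topological space of the manifold is the type \<open>'m\<close> (Hausdorff and second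
  countable), the dimension is \<open>CARD('n)\<close>. A chart is a pair of its domain and its coordinate map.
  Each point \<open>x\<close> has a preferred chart, \<open>chart_at M x\<close>, and the tangent space at \<open>x\<close> is
  \<open>real^'n\<close>: a tangent vector at \<open>x\<close> is given by its components in the preferred chart.
  The preferred charts vary with \<open>x\<close> without any continuity, so smoothness and measurability of
  tensor fields are always expressed by means of the coordinate frames \<open>coord_vec\<close>
  of the charts of the atlas.
\<close>

type_synonym ('m,'n) chart = "'m set \<times> ('m \<Rightarrow> real^'n)"

record ('m,'n::finite) riem_mfd =
  atlas :: "('m,'n) chart set"
  rmetric :: "'m \<Rightarrow> real^'n \<Rightarrow> real^'n \<Rightarrow> real"

abbreviation chart_inv :: "('m,'n::finite) chart \<Rightarrow> real^'n \<Rightarrow> 'm" where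
  "chart_inv c \<equiv> inv_into (fst c) (snd c)"

definition is_chart :: "('m::topological_space,'n::finite) chart \<Rightarrow> bool" where
  "is_chart c \<longleftrightarrow> open (fst c) \<and> open (snd c ` fst c) \<and>
     homeomorphism (fst c) (snd c ` fst c) (snd c) (chart_inv c)"

definition smooth_atlas :: "('m::topological_space,'n::finite) chart set \<Rightarrow> bool" where
  "smooth_atlas A \<longleftrightarrow> (\<forall>c\<in>A. is_chart c) \<and> (\<Union>c\<in>A. fst c) = UNIV \<and>
     (\<forall>c\<in>A. \<forall>c'\<in>A. smooth_on (snd c ` (fst c \<inter> fst c')) (snd c' \<circ> chart_inv c))"

definition smooth_fun_on :: "('m,'n::finite) riem_mfd \<Rightarrow> 'm set \<Rightarrow> ('m \<Rightarrow> real) \<Rightarrow> bool" where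
  "smooth_fun_on M S f \<longleftrightarrow> (\<forall>c\<in>atlas M. smooth_on (snd c ` (S \<inter> fst c)) (f \<circ> chart_inv c))"

definition chart_at :: "('m,'n::finite) riem_mfd \<Rightarrow> 'm \<Rightarrow> ('m,'n) chart" where
  "chart_at M x = (SOME c. c \<in> atlas M \<and> x \<in> fst c)"

text \<open>The tangent vector at \<open>x\<close> whose components in the chart \<open>c\<close> are \<open>v\<close>:\<close>

definition coord_vec :: "('m,'n::finite) riem_mfd \<Rightarrow> ('m,'n) chart \<Rightarrow> 'm \<Rightarrow> real^'n \<Rightarrow> real^'n" where
  "coord_vec M c x v = frechet_derivative (snd (chart_at M x) \<circ> chart_inv c) (at (snd c x)) v"

definition differential :: "('m,'n::finite) riem_mfd \<Rightarrow> ('m \<Rightarrow> real) \<Rightarrow> 'm \<Rightarrow> real^'n \<Rightarrow> real" where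
  "differential M f x X =
     frechet_derivative (f \<circ> chart_inv (chart_at M x)) (at (snd (chart_at M x) x)) X"

definition inner_product_on :: "'w::real_vector set \<Rightarrow> ('w \<Rightarrow> 'w \<Rightarrow> real) \<Rightarrow> bool" where
  "inner_product_on E b \<longleftrightarrow>
     (\<forall>u\<in>E. \<forall>v\<in>E. b u v = b v u) \<and>
     (\<forall>u\<in>E. \<forall>v\<in>E. \<forall>w\<in>E. \<forall>s t. b (s *\<^sub>R u + t *\<^sub>R v) w = s * b u w + t * b v w) \<and>
     (\<forall>v\<in>E. v \<noteq> 0 \<longrightarrow> 0 < b v v)"

definition riemannian_manifold ::
  "('m::{t2_space,second_countable_topology},'n::finite) riem_mfd \<Rightarrow> bool" where
  "riemannian_manifold M \<longleftrightarrow> smooth_atlas (atlas M) \<and>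
     (\<forall>x. inner_product_on UNIV (rmetric M x)) \<and>
     (\<forall>c\<in>atlas M. \<forall>v w. smooth_fun_on M (fst c)
        (\<lambda>x. rmetric M x (coord_vec M c x v) (coord_vec M c x w)))"


subsection \<open>Volume measure\<close>

definition gram :: "('m,'n::finite) riem_mfd \<Rightarrow> ('m,'n) chart \<Rightarrow> 'm \<Rightarrow> real^'n^'n" where
  "gram M c x = (\<chi> i j. rmetric M x (coord_vec M c x (axis i 1)) (coord_vec M c x (axis j 1)))"

text \<open>The unique Borel measure that is \<open>sqrt (det g) dx\<close> in every chart:\<close>

definition vol :: "('m::{t2_space,second_countable_topology},'n::finite) riem_mfd \<Rightarrow> 'm measure" where
  "vol M = (THE \<mu>. sets \<mu> = sets borel \<and>
     (\<forall>c\<in>atlas M. \<forall>B\<in>sets borel. B \<subseteq> fst c \<longrightarrow>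
        emeasure \<mu> B =
          (\<integral>\<^sup>+p. ennreal (sqrt (det (gram M c (chart_inv c p)))) * indicator (snd c ` B) p \<partial>lborel)))"


subsection \<open>Riemannian distance\<close>

definition piecewise_C1_curve ::
  "('m::{t2_space,second_countable_topology},'n::finite) riem_mfd \<Rightarrow> (real \<Rightarrow> 'm) \<Rightarrow> bool" where
  "piecewise_C1_curve M \<gamma> \<longleftrightarrow> continuous_on {0..1} \<gamma> \<and>
     (\<exists>S. finite S \<and>
        (\<forall>c\<in>atlas M. (snd c \<circ> \<gamma>) C1_differentiable_on {t \<in> {0<..<1} - S. \<gamma> t \<in> fst c}))"

definition velocity :: "('m,'n::finite) riem_mfd \<Rightarrow> (real \<Rightarrow> 'm) \<Rightarrow> real \<Rightarrow> real^'n" where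
  "velocity M \<gamma> t = vector_derivative (snd (chart_at M (\<gamma> t)) \<circ> \<gamma>) (at t)"

definition curve_length :: "('m,'n::finite) riem_mfd \<Rightarrow> (real \<Rightarrow> 'm) \<Rightarrow> ennreal" where
  "curve_length M \<gamma> =
     (\<integral>\<^sup>+t. ennreal (sqrt (rmetric M (\<gamma> t) (velocity M \<gamma> t) (velocity M \<gamma> t))) * indicator {0..1} t \<partial>lborel)"

text \<open>The manifold need not be connected; points in different components have distance \<open>\<infinity>\<close>.\<close>

definition rdist ::
  "('m::{t2_space,second_countable_topology},'n::finite) riem_mfd \<Rightarrow> 'm \<Rightarrow> 'm \<Rightarrow> ennreal" where
  "rdist M x y = (INF \<gamma>\<in>{\<gamma>. piecewise_C1_curve M \<gamma> \<and> \<gamma> 0 = x \<and> \<gamma> 1 = y}. curve_length M \<gamma>)"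


subsection \<open>Metric completion and Cauchy boundary\<close>

text \<open>
  The completion consists of the equivalence classes of Cauchy sequences with respect to the
  Riemannian distance; the manifold is embedded into it by the constant sequences.
  (The library's metric spaces are not used here as \<open>rdist\<close> may be infinite.)
\<close>

definition cauchy_seqs ::
  "('m::{t2_space,second_countable_topology},'n::finite) riem_mfd \<Rightarrow> (nat \<Rightarrow> 'm) set" where
  "cauchy_seqs M = {s. \<forall>e>0. \<exists>N. \<forall>m\<ge>N. \<forall>n\<ge>N. rdist M (s m) (s n) < e}"

definition cauchy_rel ::
  "('m::{t2_space,second_countable_topology},'n::finite) riem_mfd \<Rightarrow> ((nat \<Rightarrow> 'm) \<times> (nat \<Rightarrow> 'm)) set" where
  "cauchy_rel M = {(s,t). s \<in> cauchy_seqs M \<and> t \<in> cauchy_seqs M \<and>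
     (\<lambda>n. rdist M (s n) (t n)) \<longlonglongrightarrow> 0}"

definition completion ::
  "('m::{t2_space,second_countable_topology},'n::finite) riem_mfd \<Rightarrow> (nat \<Rightarrow> 'm) set set" where
  "completion M = cauchy_seqs M // cauchy_rel M"

definition embed ::
  "('m::{t2_space,second_countable_topology},'n::finite) riem_mfd \<Rightarrow> 'm \<Rightarrow> (nat \<Rightarrow> 'm) set" where
  "embed M x = cauchy_rel M `` {\<lambda>_. x}"

definition cdist ::
  "('m::{t2_space,second_countable_topology},'n::finite) riem_mfd \<Rightarrow>
     (nat \<Rightarrow> 'm) set \<Rightarrow> (nat \<Rightarrow> 'm) set \<Rightarrow> ennreal" where
  "cdist M \<xi> \<eta> = lim (\<lambda>n. rdist M ((SOME s. s \<in> \<xi>) n) ((SOME t. t \<in> \<eta>) n))"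

definition open_in_completion ::
  "('m::{t2_space,second_countable_topology},'n::finite) riem_mfd \<Rightarrow> (nat \<Rightarrow> 'm) set set \<Rightarrow> bool" where
  "open_in_completion M \<Omega> \<longleftrightarrow> \<Omega> \<subseteq> completion M \<and>
     (\<forall>\<xi>\<in>\<Omega>. \<exists>e>0. \<forall>\<eta>\<in>completion M. cdist M \<xi> \<eta> < e \<longrightarrow> \<eta> \<in> \<Omega>)"

definition cauchy_boundary ::
  "('m::{t2_space,second_countable_topology},'n::finite) riem_mfd \<Rightarrow> (nat \<Rightarrow> 'm) set set" where
  "cauchy_boundary M = completion M - range (embed M)"


section \<open>Vector bundles with metric and connection\<close>

text \<open>
  A bundle is given by its fibres, which are linear subspaces of some real vector space \<open>'w\<close>
  (so that sections are functions \<open>'m \<Rightarrow> 'w\<close>), its rank \<open>r\<close>, and a set of local trivialisations.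
  A local trivialisation consists of its domain \<open>U\<close> and a function \<open>\<phi>\<close> such that, for every
  \<open>x \<in> U\<close>, \<open>\<phi> x\<close> is a linear isomorphism from the fibre at \<open>x\<close> to
  \<open>coord_space r\<close>, the standard \<open>r\<close>-dimensional space. The type \<open>'w\<close> carries no topology and
  the way in which the fibres sit in it is irrelevant; the smooth structure stems from the local
  trivialisations alone. The connection maps a smooth section \<open>u\<close>, a point \<open>x\<close> and a tangent
  vector at \<open>x\<close> to an element of the fibre at \<open>x\<close>.
\<close>

record ('m,'n::finite,'w) vbundle =
  fibre :: "'m \<Rightarrow> 'w set"
  brank :: nat
  trivs :: "('m set \<times> ('m \<Rightarrow> 'w \<Rightarrow> nat \<Rightarrow> real)) set"
  fmetric :: "'m \<Rightarrow> 'w \<Rightarrow> 'w \<Rightarrow> real"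
  conn :: "('m \<Rightarrow> 'w) \<Rightarrow> 'm \<Rightarrow> real^'n \<Rightarrow> 'w"

definition coord_space :: "nat \<Rightarrow> (nat \<Rightarrow> real) set" where
  "coord_space r = {a. \<forall>i\<ge>r. a i = 0}"

definition smooth_vbundle ::
  "('m::{t2_space,second_countable_topology},'n::finite) riem_mfd \<Rightarrow>
     ('m,'n,'w::real_vector) vbundle \<Rightarrow> bool" where
  "smooth_vbundle M V \<longleftrightarrow>
     (\<forall>x. subspace (fibre V x)) \<and>
     (\<Union>(U,\<phi>)\<in>trivs V. U) = UNIV \<and>
     (\<forall>(U,\<phi>)\<in>trivs V. open U \<and>
        (\<forall>x\<in>U. bij_betw (\<phi> x) (fibre V x) (coord_space (brank V)) \<and>
           (\<forall>v\<in>fibre V x. \<forall>w\<in>fibre V x. \<forall>s t i.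
              \<phi> x (s *\<^sub>R v + t *\<^sub>R w) i = s * \<phi> x v i + t * \<phi> x w i))) \<and>
     (\<forall>(U,\<phi>)\<in>trivs V. \<forall>(U',\<phi>')\<in>trivs V. \<forall>a\<in>coord_space (brank V). \<forall>i<brank V.
        smooth_fun_on M (U \<inter> U') (\<lambda>x. \<phi>' x (inv_into (fibre V x) (\<phi> x) a) i))"

definition smooth_fmetric ::
  "('m::{t2_space,second_countable_topology},'n::finite) riem_mfd \<Rightarrow>
     ('m,'n,'w::real_vector) vbundle \<Rightarrow> bool" where
  "smooth_fmetric M V \<longleftrightarrow>
     (\<forall>x. inner_product_on (fibre V x) (fmetric V x)) \<and>
     (\<forall>(U,\<phi>)\<in>trivs V. \<forall>a\<in>coord_space (brank V). \<forall>b\<in>coord_space (brank V).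
        smooth_fun_on M U (\<lambda>x. fmetric V x (inv_into (fibre V x) (\<phi> x) a)
                                            (inv_into (fibre V x) (\<phi> x) b)))"

definition smooth_section_on ::
  "('m,'n::finite) riem_mfd \<Rightarrow> ('m,'n,'w::real_vector) vbundle \<Rightarrow> 'm set \<Rightarrow> ('m \<Rightarrow> 'w) \<Rightarrow> bool" where
  "smooth_section_on M V S u \<longleftrightarrow> (\<forall>x\<in>S. u x \<in> fibre V x) \<and>
     (\<forall>(U,\<phi>)\<in>trivs V. \<forall>i<brank V. smooth_fun_on M (S \<inter> U) (\<lambda>x. \<phi> x (u x) i))"

abbreviation smooth_section ::
  "('m,'n::finite) riem_mfd \<Rightarrow> ('m,'n,'w::real_vector) vbundle \<Rightarrow> ('m \<Rightarrow> 'w) \<Rightarrow> bool" where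
  "smooth_section M V u \<equiv> smooth_section_on M V UNIV u"

definition meas_section_on ::
  "('m::topological_space,'n::finite) riem_mfd \<Rightarrow> ('m,'n,'w::real_vector) vbundle \<Rightarrow>
     'm set \<Rightarrow> ('m \<Rightarrow> 'w) \<Rightarrow> bool" where
  "meas_section_on M V S u \<longleftrightarrow> (\<forall>x\<in>S. u x \<in> fibre V x) \<and>
     (\<forall>(U,\<phi>)\<in>trivs V. \<forall>i<brank V.
        (\<lambda>x. \<phi> x (u x) i) \<in> borel_measurable (restrict_space borel (S \<inter> U)))"

text \<open>Sections of the tensor product of the cotangent bundle with \<open>V\<close> are families of linear maps
  from the tangent spaces to the fibres of \<open>V\<close>:\<close>

definition smooth_form ::
  "('m,'n::finite) riem_mfd \<Rightarrow> ('m,'n,'w::real_vector) vbundle \<Rightarrow> ('m \<Rightarrow> real^'n \<Rightarrow> 'w) \<Rightarrow> bool" where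
  "smooth_form M V \<alpha> \<longleftrightarrow> (\<forall>x. linear (\<alpha> x) \<and> range (\<alpha> x) \<subseteq> fibre V x) \<and>
     (\<forall>c\<in>atlas M. \<forall>v. smooth_section_on M V (fst c) (\<lambda>x. \<alpha> x (coord_vec M c x v)))"

definition meas_form ::
  "('m::topological_space,'n::finite) riem_mfd \<Rightarrow> ('m,'n,'w::real_vector) vbundle \<Rightarrow>
     ('m \<Rightarrow> real^'n \<Rightarrow> 'w) \<Rightarrow> bool" where
  "meas_form M V \<alpha> \<longleftrightarrow> (\<forall>x. linear (\<alpha> x) \<and> range (\<alpha> x) \<subseteq> fibre V x) \<and>
     (\<forall>c\<in>atlas M. \<forall>v. meas_section_on M V (fst c) (\<lambda>x. \<alpha> x (coord_vec M c x v)))"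

definition connection ::
  "('m::{t2_space,second_countable_topology},'n::finite) riem_mfd \<Rightarrow>
     ('m,'n,'w::real_vector) vbundle \<Rightarrow> bool" where
  "connection M V \<longleftrightarrow>
     (\<forall>u. smooth_section M V u \<longrightarrow> smooth_form M V (conn V u)) \<and>
     (\<forall>u v x X. smooth_section M V u \<and> smooth_section M V v \<longrightarrow>
        conn V (\<lambda>y. u y + v y) x X = conn V u x X + conn V v x X) \<and>
     (\<forall>f u x X. smooth_fun_on M UNIV f \<and> smooth_section M V u \<longrightarrow>
        conn V (\<lambda>y. f y *\<^sub>R u y) x X = differential M f x X *\<^sub>R u x + f x *\<^sub>R conn V u x X)"

definition metric_compatible ::
  "('m::{t2_space,second_countable_topology},'n::finite) riem_mfd \<Rightarrow>
     ('m,'n,'w::real_vector) vbundle \<Rightarrow> bool" where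
  "metric_compatible M V \<longleftrightarrow>
     (\<forall>u v x X. smooth_section M V u \<and> smooth_section M V v \<longrightarrow>
        differential M (\<lambda>y. fmetric V y (u y) (v y)) x X =
          fmetric V x (conn V u x X) (v x) + fmetric V x (u x) (conn V v x X))"


section \<open>Sobolev spaces\<close>

definition sect_sq :: "('m,'n::finite,'w::real_vector) vbundle \<Rightarrow> ('m \<Rightarrow> 'w) \<Rightarrow> 'm \<Rightarrow> real" where
  "sect_sq V u x = fmetric V x (u x) (u x)"

text \<open>The metric induced on the tensor product, \<open>\<Sum>i j. g\<^sup>i\<^sup>j h(\<alpha>\<^sub>i, \<alpha>\<^sub>j)\<close>, where the standard basis
  of \<open>real^'n\<close> is used as basis of the tangent space:\<close>

definition form_sq ::
  "('m,'n::finite) riem_mfd \<Rightarrow> ('m,'n,'w::real_vector) vbundle \<Rightarrow> ('m \<Rightarrow> real^'n \<Rightarrow> 'w) \<Rightarrow> 'm \<Rightarrow> real" where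
  "form_sq M V \<alpha> x =
     (let G = (\<chi> i j. rmetric M x (axis i 1) (axis j 1)) :: real^'n^'n in
      \<Sum>i\<in>UNIV. \<Sum>j\<in>UNIV. matrix_inv G $ i $ j * fmetric V x (\<alpha> x (axis i 1)) (\<alpha> x (axis j 1)))"

text \<open>Elements of \<open>L\<^sup>2\<close> are represented by functions, that is, they are not identified when they agree
  almost everywhere. All subspaces of \<open>L2_sections\<close> considered below are invariant under changes on
  null sets.\<close>

definition L2_sections ::
  "('m::{t2_space,second_countable_topology},'n::finite) riem_mfd \<Rightarrow>
     ('m,'n,'w::real_vector) vbundle \<Rightarrow> ('m \<Rightarrow> 'w) set" where
  "L2_sections M V = {u. meas_section_on M V UNIV u \<and> integrable (vol M) (sect_sq V u)}"

definition L2_forms ::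
  "('m::{t2_space,second_countable_topology},'n::finite) riem_mfd \<Rightarrow>
     ('m,'n,'w::real_vector) vbundle \<Rightarrow> ('m \<Rightarrow> real^'n \<Rightarrow> 'w) set" where
  "L2_forms M V = {\<alpha>. meas_form M V \<alpha> \<and> integrable (vol M) (form_sq M V \<alpha>)}"

definition section_norm ::
  "('m::{t2_space,second_countable_topology},'n::finite) riem_mfd \<Rightarrow>
     ('m,'n,'w::real_vector) vbundle \<Rightarrow> ('m \<Rightarrow> 'w) \<Rightarrow> real" where
  "section_norm M V u = sqrt (\<integral>x. sect_sq V u x \<partial>vol M)"

definition form_norm ::
  "('m::{t2_space,second_countable_topology},'n::finite) riem_mfd \<Rightarrow>
     ('m,'n,'w::real_vector) vbundle \<Rightarrow> ('m \<Rightarrow> real^'n \<Rightarrow> 'w) \<Rightarrow> real" where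
  "form_norm M V \<alpha> = sqrt (\<integral>x. form_sq M V \<alpha> x \<partial>vol M)"

definition S1 ::
  "('m::{t2_space,second_countable_topology},'n::finite) riem_mfd \<Rightarrow>
     ('m,'n,'w::real_vector) vbundle \<Rightarrow> ('m \<Rightarrow> 'w) set" where
  "S1 M V = {u. smooth_section M V u \<and> u \<in> L2_sections M V \<and>
     smooth_form M V (conn V u) \<and> conn V u \<in> L2_forms M V}"

definition Ccinf ::
  "('m::{t2_space,second_countable_topology},'n::finite) riem_mfd \<Rightarrow>
     ('m,'n,'w::real_vector) vbundle \<Rightarrow> ('m \<Rightarrow> 'w) set" where
  "Ccinf M V = {u. smooth_section M V u \<and> compact (closure {x. u x \<noteq> 0})}"

text \<open>\<open>has_grad M V D u \<alpha>\<close>: \<open>u\<close> belongs to the closure of \<open>D\<close> in the norm \<open>\<parallel>u\<parallel> + \<parallel>\<nabla>u\<parallel>\<close>, and \<open>\<alpha>\<close> is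
  the continuous extension of \<open>\<nabla>\<close> to \<open>u\<close>. As \<open>L\<^sup>2\<close> is complete, the Cauchy sequences in this
  norm are exactly those for which such limits \<open>u\<close> and \<open>\<alpha>\<close> exist; passing to \<open>u\<close> realises the
  closure as a subspace of \<open>L\<^sup>2\<close>.\<close>

definition has_grad ::
  "('m::{t2_space,second_countable_topology},'n::finite) riem_mfd \<Rightarrow>
     ('m,'n,'w::real_vector) vbundle \<Rightarrow> ('m \<Rightarrow> 'w) set \<Rightarrow> ('m \<Rightarrow> 'w) \<Rightarrow> ('m \<Rightarrow> real^'n \<Rightarrow> 'w) \<Rightarrow> bool" where
  "has_grad M V D u \<alpha> \<longleftrightarrow> u \<in> L2_sections M V \<and> \<alpha> \<in> L2_forms M V \<and>
     (\<exists>s::nat \<Rightarrow> 'm \<Rightarrow> 'w. (\<forall>k. s k \<in> D) \<and>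
        (\<lambda>k. section_norm M V (\<lambda>x. s k x - u x) +
              form_norm M V (\<lambda>x X. conn V (s k) x X - \<alpha> x X)) \<longlonglongrightarrow> 0)"

definition W12 ::
  "('m::{t2_space,second_countable_topology},'n::finite) riem_mfd \<Rightarrow>
     ('m,'n,'w::real_vector) vbundle \<Rightarrow> ('m \<Rightarrow> 'w) set" where
  "W12 M V = {u. \<exists>\<alpha>. has_grad M V (S1 M V) u \<alpha>}"

definition W12_0 ::
  "('m::{t2_space,second_countable_topology},'n::finite) riem_mfd \<Rightarrow>
     ('m,'n,'w::real_vector) vbundle \<Rightarrow> ('m \<Rightarrow> 'w) set" where
  "W12_0 M V = {u. \<exists>\<alpha>. has_grad M V (Ccinf M V) u \<alpha>}"


section \<open>Capacity\<close>

text \<open>Scalar functions are the sections of the trivial line bundle with connection \<open>d\<close>.\<close>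

definition scalar_bundle :: "('m,'n::finite) riem_mfd \<Rightarrow> ('m,'n,real) vbundle" where
  "scalar_bundle M = \<lparr>fibre = (\<lambda>_. UNIV), brank = 1,
     trivs = {(UNIV, \<lambda>_ a i. if i = 0 then a else 0)},
     fmetric = (\<lambda>_ a b. a * b), conn = differential M\<rparr>"

definition test_funs ::
  "('m::{t2_space,second_countable_topology},'n::finite) riem_mfd \<Rightarrow>
     (nat \<Rightarrow> 'm) set set \<Rightarrow> ('m \<Rightarrow> real) set" where
  "test_funs M \<Omega> = {u \<in> W12 M (scalar_bundle M).
     (AE x in vol M. 0 \<le> u x \<and> u x \<le> 1) \<and> (AE x in vol M. embed M x \<in> \<Omega> \<longrightarrow> u x = 1)}"

text \<open>The infimum over the empty set is \<open>\<infinity>\<close> in \<^typ>\<open>ennreal\<close>.\<close>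

definition cap_open ::
  "('m::{t2_space,second_countable_topology},'n::finite) riem_mfd \<Rightarrow> (nat \<Rightarrow> 'm) set set \<Rightarrow> ennreal" where
  "cap_open M \<Omega> = (if \<Omega> = {} then 0 else
     Inf {ennreal (\<integral>x. (sect_sq (scalar_bundle M) u x + form_sq M (scalar_bundle M) \<alpha> x) \<partial>vol M) | u \<alpha>.
            u \<in> test_funs M \<Omega> \<and> has_grad M (scalar_bundle M) (S1 M (scalar_bundle M)) u \<alpha>})"

definition cap ::
  "('m::{t2_space,second_countable_topology},'n::finite) riem_mfd \<Rightarrow> (nat \<Rightarrow> 'm) set set \<Rightarrow> ennreal" where
  "cap M \<Sigma> = (INF \<Omega>\<in>{\<Omega>. open_in_completion M \<Omega> \<and> \<Sigma> \<subseteq> \<Omega>}. cap_open M \<Omega>)"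

definition polar ::
  "('m::{t2_space,second_countable_topology},'n::finite) riem_mfd \<Rightarrow> (nat \<Rightarrow> 'm) set set \<Rightarrow> bool" where
  "polar M \<Sigma> \<longleftrightarrow> cap M \<Sigma> = 0"

end

theory Submission imports Defs
begin

text \<open>
  Truncation by \<open>u / (1 + \<bar>u\<bar>\<^sup>2 / k)\<close> reduces the theorem to the approximation of bounded sections
  \<open>u\<close> of \<^const>\<open>S1\<close> by sections with compact support. Polarity yields an open neighbourhood
  \<open>\<Omega>\<close> of the Cauchy boundary and a function \<open>f\<close> of small energy that equals 1 on \<open>\<Omega>\<close>.
  A Cauchy sequence outside of \<open>\<Omega>\<close> converges in the manifold, that is, the complement of \<open>\<Omega>\<close> is complete,
  and this suffices for a smooth function \<open>\<phi>\<close> with compact support and values in \<open>[0, 1]\<close> that is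
  close to 1 on a given compact set and has a small gradient outside of \<open>\<Omega>\<close>. Then
  \<open>s = \<phi> (1 - f) u\<close> is close to \<open>u\<close>: the term \<open>(1 - f) d\<phi> \<otimes> u\<close> of \<open>\<nabla>s\<close> vanishes on \<open>\<Omega>\<close> and is
  small elsewhere, and \<open>\<phi> df \<otimes> u\<close> is small because \<open>u\<close> is bounded. As \<open>\<phi>\<close> has compact support,
  \<open>f\<close> may finally be replaced by a smooth function.
\<close>

section \<open>Calculus of smooth functions\<close>

text \<open>That the complement of \<Omega> is complete says nothing about points of \<Omega>, so
  the argument behind Hopf-Rinow cannot be applied to the Riemannian distance itself. It is applied
  to a modified metric that is complete on the whole manifold and at most twice the truncated
  distance near that complement.

  The order of the choices matters. The energy of f does not control the integral of f^2
  |\<nabla>u|^2, because |\<nabla>u| is unbounded even if u is bounded. Hence the density |u|^2 +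
  |\<nabla>u|^2 is split at a level first; then f and \<Omega> are chosen with an energy small
  relative to this level and to the bound of u; then \<phi>, which depends on \<Omega>; and only
  then the smooth replacement of f, whose error is multiplied by a constant depending on \<phi>.
  Until this last step f is merely a limit of smooth functions with limit gradient a, so that a
  formal expression \<open>cut_form\<close> has to stand for \<nabla>(\<phi>(1 - f)u).\<close>

lemma Ck_on_subset: "Ck_on k S f \<Longrightarrow> T \<subseteq> S \<Longrightarrow> Ck_on k T f"
proof (induction k arbitrary: f)
  case 0 then show ?case using continuous_on_subset by auto
qed auto

lemma Ck_on_cong:
  assumes "open S" "\<And>x. x \<in> S \<Longrightarrow> f x = g x" "Ck_on k S f"
  shows "Ck_on k S g"
  using assms(2,3)
proof (induction k arbitrary: f g)
  case 0 then show ?case using continuous_on_cong[of S S f g] by simp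
next
  case (Suc k)
  have d: "(g has_derivative frechet_derivative f (at x)) (at x)" if "x \<in> S" for x
    using Suc.prems that assms(1) has_derivative_transform_within_open[of f _ x UNIV S g]
    by (simp add: frechet_derivative_works)
  then have e: "frechet_derivative g (at x) = frechet_derivative f (at x)" if "x \<in> S" for x
    using frechet_derivative_at[OF d[OF that]] by simp
  have "Ck_on k S (\<lambda>x. frechet_derivative g (at x) v)" for v
    by (rule Suc.IH[of "\<lambda>x. frechet_derivative f (at x) v"]) (use Suc.prems e in auto)
  then show ?case using d by (auto simp: differentiable_def)
qed

text \<open>On an open set the derivative at a point is unique, so a derivative in any convenient
  closed form may stand for \<open>frechet_derivative\<close>.\<close>

lemma Ck_on_SucI:
  assumes "open S" "\<And>x. x \<in> S \<Longrightarrow> (f has_derivative f' x) (at x)" "\<And>v. Ck_on k S (\<lambda>x. f' x v)"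
  shows "Ck_on (Suc k) S f"
proof -
  have "Ck_on k S (\<lambda>x. frechet_derivative f (at x) v)" for v
    by (rule Ck_on_cong[OF assms(1) _ assms(3)[of v]])
      (use frechet_derivative_at[OF assms(2)] in auto)
  then show ?thesis using assms(2) by (auto simp: differentiable_def)
qed

lemma Ck_on_local:
  assumes "\<And>x. x \<in> S \<Longrightarrow> \<exists>T. open T \<and> x \<in> T \<and> Ck_on k T f"
  shows "Ck_on k S f"
  using assms
proof (induction k arbitrary: f)
  case 0
  then have "isCont f x" if "x \<in> S" for x
    using that by (metis Ck_on.simps(1) continuous_on_eq_continuous_at)
  then show ?case by (simp add: continuous_at_imp_continuous_on)
next
  case (Suc k)
  have "Ck_on k S (\<lambda>x. frechet_derivative f (at x) v)" for v
    by (rule Suc.IH) (use Suc.prems in \<open>auto; fastforce\<close>)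
  moreover have "f differentiable (at x)" if "x \<in> S" for x
    using Suc.prems[OF that] by auto
  ultimately show ?case by simp
qed

lemma Ck_on_SucD: "Ck_on (Suc k) S f \<Longrightarrow> Ck_on k S f"
proof (induction k arbitrary: f)
  case 0
  then show ?case
    by (auto intro!: continuous_at_imp_continuous_on differentiable_imp_continuous_within)
qed auto

lemma Ck_on_const: "Ck_on k S (\<lambda>x. c)"
  by (induction k arbitrary: c) auto

lemma Ck_on_bounded_linear:
  assumes "bounded_linear f" shows "Ck_on k S f"
proof (cases k)
  case 0 then show ?thesis by (simp add: assms linear_continuous_on)
next
  case (Suc n)
  have "frechet_derivative f (at x) = f" for x
    using frechet_derivative_at[OF bounded_linear.has_derivative[OF assms has_derivative_ident]] by simp
  moreover have "f differentiable (at x)" for x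
    using assms bounded_linear_imp_differentiable by blast
  ultimately show ?thesis using Suc by (simp add: Ck_on_const)
qed

lemma Ck_on_add:
  assumes "open S" "Ck_on k S f" "Ck_on k S g" shows "Ck_on k S (\<lambda>x. f x + g x)"
  using assms(2,3)
proof (induction k arbitrary: f g)
  case 0 then show ?case by (auto intro: continuous_on_add)
next
  case (Suc k)
  show ?case
    by (rule Ck_on_SucI[where f'="\<lambda>x v. frechet_derivative f (at x) v + frechet_derivative g (at x) v", OF assms(1)])
      (use Suc in \<open>auto intro!: has_derivative_add simp: frechet_derivative_works\<close>)
qed

lemma Ck_on_sum:
  assumes "open S" "\<And>i. i \<in> I \<Longrightarrow> Ck_on k S (f i)" shows "Ck_on k S (\<lambda>x. \<Sum>i\<in>I. f i x)"
  using assms(2)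
proof (induction I rule: infinite_finite_induct)
  case (insert i I) then show ?case by (simp add: Ck_on_add[OF assms(1)])
qed (auto simp: Ck_on_const)

lemma Ck_on_bilinear:
  assumes "bounded_bilinear B" "open S" "Ck_on k S f" "Ck_on k S g"
  shows "Ck_on k S (\<lambda>x. B (f x) (g x))"
  using assms(3,4)
proof (induction k arbitrary: f g)
  case 0 then show ?case using bounded_bilinear.continuous_on[OF assms(1)] by auto
next
  case (Suc k)
  show ?case
  proof (rule Ck_on_SucI[where f'="\<lambda>x v. B (f x) (frechet_derivative g (at x) v) + B (frechet_derivative f (at x) v) (g x)", OF assms(2)])
    fix v
    show "Ck_on k S (\<lambda>x. B (f x) (frechet_derivative g (at x) v) + B (frechet_derivative f (at x) v) (g x))"
      using Suc.prems Suc.prems[THEN Ck_on_SucD] by (intro Ck_on_add[OF assms(2)] Suc.IH) auto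
  qed (use Suc in \<open>auto intro!: bounded_bilinear.FDERIV[OF assms(1)] simp: frechet_derivative_works\<close>)
qed

text \<open>\<open>Ck_on\<close> differentiates in fixed directions only, whereas the chain rule
  produces \<open>?g' (f x) (?f' x v)\<close>, whose direction moves with \<open>x\<close>.
  Expanding that direction in \<open>Basis\<close> leaves sums of products of scalar components with
  derivatives of \<open>g\<close> in fixed directions, to which the induction hypothesis
  applies.\<close>

lemma Ck_on_compose:
  fixes f :: "'a::real_normed_vector \<Rightarrow> 'b::euclidean_space" and g :: "'b \<Rightarrow> 'c::real_normed_vector"
  assumes "open S" "Ck_on k S f" "Ck_on k T g" "f ` S \<subseteq> T"
  shows "Ck_on k S (g \<circ> f)"
  using assms(2,3)
proof (induction k arbitrary: g)
  case 0 then show ?case using assms(4) continuous_on_compose continuous_on_subset by (metis Ck_on.simps(1))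
next
  case (Suc k)
  let ?f' = "\<lambda>x. frechet_derivative f (at x)" and ?g' = "\<lambda>y. frechet_derivative g (at y)"
  have df: "(f has_derivative ?f' x) (at x)" if "x \<in> S" for x
    using Suc.prems(1) that by (auto simp: frechet_derivative_works)
  have dg: "(g has_derivative ?g' (f x)) (at (f x))" if "x \<in> S" for x
    using Suc.prems(2) that assms(4) by (auto simp: frechet_derivative_works)
  show ?case
  proof (rule Ck_on_SucI[where f'="\<lambda>x v. \<Sum>b\<in>Basis. (?f' x v \<bullet> b) *\<^sub>R ?g' (f x) b", OF assms(1)])
    fix x assume x: "x \<in> S"
    have "(g \<circ> f has_derivative ?g' (f x) \<circ> ?f' x) (at x)"
      using diff_chain_at[OF df dg] x by blast
    moreover have "?g' (f x) (?f' x v) = (\<Sum>b\<in>Basis. (?f' x v \<bullet> b) *\<^sub>R ?g' (f x) b)" for v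
    proof -
      have l: "linear (?g' (f x))" using has_derivative_linear[OF dg[OF x]] .
      have "?g' (f x) (?f' x v) = ?g' (f x) (\<Sum>b\<in>Basis. (?f' x v \<bullet> b) *\<^sub>R b)"
        by (simp add: euclidean_representation)
      then show ?thesis by (simp add: linear_sum[OF l] linear_scale[OF l])
    qed
    ultimately show "(g \<circ> f has_derivative (\<lambda>v. \<Sum>b\<in>Basis. (?f' x v \<bullet> b) *\<^sub>R ?g' (f x) b)) (at x)"
      by (simp add: comp_def)
  next
    fix v
    have "Ck_on k S (\<lambda>x. ?f' x v \<bullet> b)" for b
      by (rule Ck_on_bilinear[OF bounded_bilinear_inner assms(1)]) (use Suc.prems in \<open>auto simp: Ck_on_const\<close>)
    moreover have "Ck_on k S ((\<lambda>y. ?g' y b) \<circ> f)" for b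
      by (rule Suc.IH) (use Suc.prems Ck_on_SucD[OF Suc.prems(1)] in auto)
    ultimately show "Ck_on k S (\<lambda>x. \<Sum>b\<in>Basis. (?f' x v \<bullet> b) *\<^sub>R ?g' (f x) b)"
      by (intro Ck_on_sum Ck_on_bilinear[OF bounded_bilinear_scaleR] assms(1)) (auto simp: comp_def)
  qed
qed

lemma smooth_on_subset: "smooth_on S f \<Longrightarrow> T \<subseteq> S \<Longrightarrow> smooth_on T f"
  unfolding smooth_on_def using Ck_on_subset by blast

lemma smooth_on_cong:
  "open S \<Longrightarrow> (\<And>x. x \<in> S \<Longrightarrow> f x = g x) \<Longrightarrow> smooth_on S f \<Longrightarrow> smooth_on S g"
  unfolding smooth_on_def using Ck_on_cong by blast

lemma smooth_on_local:
  "(\<And>x. x \<in> S \<Longrightarrow> \<exists>T. open T \<and> x \<in> T \<and> smooth_on T f) \<Longrightarrow> smooth_on S f"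
  unfolding smooth_on_def by (meson Ck_on_local)

lemma smooth_on_const: "smooth_on S (\<lambda>x. c)"
  by (simp add: smooth_on_def Ck_on_const)

lemma smooth_on_bounded_linear: "bounded_linear f \<Longrightarrow> smooth_on S f"
  by (simp add: smooth_on_def Ck_on_bounded_linear)

lemma smooth_on_ident: "smooth_on S (\<lambda>x. x)"
  by (rule smooth_on_bounded_linear) (rule bounded_linear_ident)

lemma smooth_on_add: "open S \<Longrightarrow> smooth_on S f \<Longrightarrow> smooth_on S g \<Longrightarrow> smooth_on S (\<lambda>x. f x + g x)"
  by (simp add: smooth_on_def Ck_on_add)

lemma smooth_on_bilinear:
  "bounded_bilinear B \<Longrightarrow> open S \<Longrightarrow> smooth_on S f \<Longrightarrow> smooth_on S g \<Longrightarrow> smooth_on S (\<lambda>x. B (f x) (g x))"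
  by (simp add: smooth_on_def Ck_on_bilinear)

lemmas smooth_on_scaleR = smooth_on_bilinear[OF bounded_bilinear_scaleR]

lemma smooth_on_mult:
  fixes f g :: "'a::real_normed_vector \<Rightarrow> real"
  shows "open S \<Longrightarrow> smooth_on S f \<Longrightarrow> smooth_on S g \<Longrightarrow> smooth_on S (\<lambda>x. f x * g x)"
  by (rule smooth_on_bilinear[OF bounded_bilinear_mult])

lemma smooth_on_diff:
  assumes "open S" "smooth_on S f" "smooth_on S g" shows "smooth_on S (\<lambda>x. f x - g x)"
  using smooth_on_add[OF assms(1,2) smooth_on_scaleR[OF assms(1) smooth_on_const assms(3), of "-1"]] by simp

lemma smooth_on_compose:
  fixes f :: "'a::real_normed_vector \<Rightarrow> 'b::euclidean_space"
  shows "open S \<Longrightarrow> smooth_on S f \<Longrightarrow> smooth_on T g \<Longrightarrow> f ` S \<subseteq> T \<Longrightarrow> smooth_on S (g \<circ> f)"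
  unfolding smooth_on_def using Ck_on_compose by blast

lemma smooth_on_imp_continuous_on: "smooth_on S f \<Longrightarrow> continuous_on S f"
  unfolding smooth_on_def by (metis Ck_on.simps(1))

lemma smooth_on_imp_differentiable: "smooth_on S f \<Longrightarrow> x \<in> S \<Longrightarrow> f differentiable (at x)"
  unfolding smooth_on_def by (metis Ck_on.simps(2))

lemma smooth_on_has_derivative:
  "smooth_on S f \<Longrightarrow> x \<in> S \<Longrightarrow> (f has_derivative frechet_derivative f (at x)) (at x)"
  using smooth_on_imp_differentiable frechet_derivative_works by blast

lemma smooth_on_frechet_derivative:
  "smooth_on S f \<Longrightarrow> smooth_on S (\<lambda>x. frechet_derivative f (at x) v)"
  unfolding smooth_on_def by (metis Ck_on.simps(2))

lemma smooth_on_inverse: "smooth_on (- {0}) (inverse :: real \<Rightarrow> real)"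
proof -
  have "Ck_on k (- {0}) (inverse :: real \<Rightarrow> real)" for k
  proof (induction k)
    case 0 show ?case by (auto intro!: continuous_intros)
  next
    case (Suc k)
    have "Ck_on k (- {0}) (\<lambda>x. (inverse x * inverse x) * (- v))" for v :: real
      by (intro Ck_on_bilinear[OF bounded_bilinear_mult] Ck_on_const Suc) auto
    then show ?case
      by (intro Ck_on_SucI[where f'="\<lambda>x v. (inverse x * inverse x) * (- v)"])
        (auto intro!: derivative_eq_intros)
  qed
  then show ?thesis by (simp add: smooth_on_def)
qed

section \<open>Bump functions and mollification\<close>

text \<open>The derivatives of exp(-1/t), extended by 0, are combinations of the functions t^(-k)
  exp(-1/t). Treating the whole family at once allows smoothness to be proved by one induction with
  \<open>k\<close> arbitrary.\<close>

definition flat_exp :: "nat \<Rightarrow> real \<Rightarrow> real" where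
  "flat_exp k t = (if 0 < t then inverse t ^ k * exp (- inverse t) else 0)"

text \<open>With s = 1/t and m = k + 2 this is exp s >= (s/m)^m. The two powers by which m exceeds k
  become the factor t^2, which makes every member of the family differentiable at 0 with derivative
  0.\<close>

lemma flat_exp_le: "\<bar>flat_exp k t\<bar> \<le> real (k + 2) ^ (k + 2) * t\<^sup>2"
proof (cases "0 < t")
  case True
  define s m where "s = inverse t" and "m = k + 2"
  have s: "0 < s" using True by (simp add: s_def)
  have "(s / real m) ^ m \<le> (1 + s / real m) ^ m"
    using s by (intro power_mono) (auto simp: m_def)
  also have "\<dots> \<le> exp s"
    using s by (intro exp_ge_one_plus_x_over_n_power_n) (auto simp: m_def)
  finally have "s ^ m \<le> real m ^ m * exp s"
    by (simp add: power_divide divide_simps m_def mult.commute)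
  then have "s ^ k * s\<^sup>2 * exp (- s) \<le> real m ^ m"
    by (simp add: exp_minus divide_simps m_def power_add power2_eq_square mult_ac)
  then have "s ^ k * exp (- s) \<le> real m ^ m * t\<^sup>2"
    using True by (simp add: s_def power2_eq_square field_simps)
  then show ?thesis using True by (simp add: flat_exp_def s_def m_def)
qed (simp add: flat_exp_def)

lemma DERIV_flat_exp:
  "(flat_exp k has_real_derivative flat_exp (k + 2) t - real k * flat_exp (k + 1) t) (at t)"
proof -
  consider "t < 0" | "0 < t" | "t = 0" by linarith
  then show ?thesis
  proof cases
    case 1
    have "((\<lambda>_. 0) has_real_derivative 0) (at t)" by simp
    then have "(flat_exp k has_real_derivative 0) (at t)"
      by (rule has_field_derivative_transform_within_open[of _ _ _ "{..<0}"])
        (use 1 in \<open>auto simp: flat_exp_def\<close>)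
    then show ?thesis using 1 by (simp add: flat_exp_def)
  next
    case 2
    have "((\<lambda>t. inverse t ^ k * exp (- inverse t)) has_real_derivative
        inverse t ^ (k + 2) * exp (- inverse t) - real k * (inverse t ^ (k + 1) * exp (- inverse t))) (at t)"
    proof -
      have "((\<lambda>t. inverse t ^ k) has_real_derivative - real k * inverse t ^ (k + 1)) (at t)"
        using DERIV_power[OF DERIV_inverse[of t UNIV], of k] 2
        by (cases k) (auto simp: power2_eq_square algebra_simps)
      moreover have "((\<lambda>t. exp (- inverse t)) has_real_derivative exp (- inverse t) * inverse t ^ 2) (at t)"
        using 2 by (auto intro!: derivative_eq_intros simp: power2_eq_square)
      ultimately show ?thesis
        using DERIV_mult by (auto intro!: DERIV_cong[OF DERIV_mult] simp: algebra_simps power2_eq_square)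
    qed
    then have "(flat_exp k has_real_derivative
        inverse t ^ (k + 2) * exp (- inverse t) - real k * (inverse t ^ (k + 1) * exp (- inverse t))) (at t)"
      by (rule has_field_derivative_transform_within_open[of _ _ _ "{0<..}"])
        (use 2 in \<open>auto simp: flat_exp_def\<close>)
    then show ?thesis using 2 by (simp add: flat_exp_def)
  next
    case 3
    define C where "C = real (k + 2) ^ (k + 2)"
    have "((\<lambda>s. C * \<bar>s\<bar>) \<longlongrightarrow> 0) (at 0)"
      using tendsto_mult_right_zero[OF tendsto_rabs_zero[OF tendsto_ident_at]] by blast
    moreover have "\<forall>\<^sub>F s in at 0. norm ((flat_exp k (0 + s) - flat_exp k 0) / s) \<le> C * \<bar>s\<bar>"
      unfolding eventually_at_filter
    proof (intro always_eventually allI impI)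
      fix s :: real assume "s \<noteq> 0"
      then show "norm ((flat_exp k (0 + s) - flat_exp k 0) / s) \<le> C * \<bar>s\<bar>"
        using flat_exp_le[of k s]
        by (simp add: flat_exp_def[of k 0] C_def divide_le_eq power2_eq_square mult.assoc)
    qed
    ultimately have "((\<lambda>s. (flat_exp k (0 + s) - flat_exp k 0) / s) \<longlongrightarrow> 0) (at 0)"
      by (rule Lim_null_comparison[rotated])
    then show ?thesis using 3 by (simp add: DERIV_def flat_exp_def)
  qed
qed

lemma smooth_on_flat_exp: "smooth_on UNIV (flat_exp k)"
proof -
  have "Ck_on n UNIV (flat_exp k)" for n
  proof (induction n arbitrary: k)
    case 0
    show ?case using DERIV_isCont[OF DERIV_flat_exp] by (simp add: continuous_at_imp_continuous_on)
  next
    case (Suc n)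
    show ?case
    proof (rule Ck_on_SucI[where f'="\<lambda>t v. (flat_exp (k + 2) t + (- real k) * flat_exp (k + 1) t) * v"])
      show "(flat_exp k has_derivative (\<lambda>v. (flat_exp (k + 2) t + (- real k) * flat_exp (k + 1) t) * v)) (at t)" for t
        using DERIV_flat_exp[of k t] by (simp add: has_field_derivative_def)
      show "Ck_on n UNIV (\<lambda>t. (flat_exp (k + 2) t + (- real k) * flat_exp (k + 1) t) * v)" for v
        by (intro Ck_on_bilinear[OF bounded_bilinear_mult] Ck_on_add Ck_on_const Suc) auto
    qed simp
  qed
  then show ?thesis by (simp add: smooth_on_def)
qed

lemma flat_exp_nonneg: "0 \<le> flat_exp k t"
  by (simp add: flat_exp_def)

lemma flat_exp_pos_iff: "0 < flat_exp k t \<longleftrightarrow> 0 < t"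
  by (simp add: flat_exp_def)

lemma smooth_on_flat_exp_dist:
  fixes a :: "'a::euclidean_space"
  shows "smooth_on UNIV (\<lambda>x. flat_exp 0 (c + s * ((x - a) \<bullet> (x - a))))"
proof -
  have "smooth_on UNIV (\<lambda>x. c + s * ((x - a) \<bullet> (x - a)))"
    by (intro smooth_on_add smooth_on_mult smooth_on_bilinear[OF bounded_bilinear_inner]
        smooth_on_diff smooth_on_const smooth_on_ident) auto
  from smooth_on_compose[OF open_UNIV this smooth_on_flat_exp] show ?thesis by (simp add: comp_def)
qed

lemma smooth_bump_exists:
  fixes a :: "'a::euclidean_space"
  assumes "0 < r" "r < R"
  obtains \<beta> :: "'a \<Rightarrow> real" where "smooth_on UNIV \<beta>" "\<And>x. 0 \<le> \<beta> x" "\<And>x. \<beta> x \<le> 1"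
    "\<And>x. x \<in> cball a r \<Longrightarrow> \<beta> x = 1" "\<And>x. x \<notin> ball a R \<Longrightarrow> \<beta> x = 0"
proof
  \<comment> \<open>\<open>?p\<close> is positive exactly inside the ball of radius
    \<open>R\<close>, and \<open>?q\<close> exactly outside the closed ball of radius
    \<open>r\<close>. Since r < R they have no common zero, so the quotient of \<open>?p\<close> by
    the sum is smooth.\<close>
  let ?p = "\<lambda>x. flat_exp 0 (R\<^sup>2 + (-1) * ((x - a) \<bullet> (x - a)))"
  let ?q = "\<lambda>x. flat_exp 0 (- r\<^sup>2 + 1 * ((x - a) \<bullet> (x - a)))"
  let ?b = "\<lambda>x. ?p x * inverse (?p x + ?q x)"
  have sq: "(x - a) \<bullet> (x - a) = (dist a x)\<^sup>2" for x
    by (simp add: dist_norm power2_norm_eq_inner[symmetric] norm_minus_commute)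
  have rR: "r\<^sup>2 < R\<^sup>2" using assms by (intro power_strict_mono) auto
  have "?p x + ?q x \<noteq> 0" for x
  proof -
    have "0 < ?p x \<or> 0 < ?q x" unfolding flat_exp_pos_iff using rR by linarith
    then show ?thesis using flat_exp_nonneg by (metis add_nonneg_eq_0_iff less_irrefl)
  qed
  then have nz: "0 < ?p x + ?q x" for x
    using flat_exp_nonneg by (metis add_nonneg_nonneg less_le)
  show "smooth_on UNIV ?b"
  proof (rule smooth_on_mult)
    have "smooth_on UNIV (inverse \<circ> (\<lambda>x. ?p x + ?q x))"
    proof (rule smooth_on_compose[OF _ _ smooth_on_inverse])
      show "smooth_on UNIV (\<lambda>x. ?p x + ?q x)"
        by (rule smooth_on_add[OF open_UNIV smooth_on_flat_exp_dist smooth_on_flat_exp_dist])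
      show "range (\<lambda>x. ?p x + ?q x) \<subseteq> - {0}"
      proof clarify
        fix x assume "?p x + ?q x = 0"
        with nz[of x] show False by linarith
      qed
    qed simp
    then show "smooth_on UNIV (\<lambda>x. inverse (?p x + ?q x))" by (simp add: comp_def)
  qed (rule open_UNIV, rule smooth_on_flat_exp_dist)
  show "0 \<le> ?b x" for x using nz[of x] flat_exp_nonneg by simp
  show "?b x \<le> 1" for x using nz[of x] flat_exp_nonneg[of 0 "- r\<^sup>2 + 1 * ((x - a) \<bullet> (x - a))"]
    by (simp add: divide_inverse[symmetric])
  show "?b x = 1" if "x \<in> cball a r" for x
  proof -
    have "(dist a x)\<^sup>2 \<le> r\<^sup>2" using that assms by (intro power_mono) auto
    then have "?q x = 0" unfolding sq by (simp add: flat_exp_def)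
    then show ?thesis using nz[of x] by simp
  qed
  show "?b x = 0" if "x \<notin> ball a R" for x
  proof -
    have "R\<^sup>2 \<le> (dist a x)\<^sup>2" using that assms by (intro power_mono) auto
    then show ?thesis unfolding sq by (simp add: flat_exp_def)
  qed
qed

section \<open>Mollification by a smooth kernel\<close>

lemma smooth_on_convolution:
  fixes F :: "'a::euclidean_space \<Rightarrow> real"
  assumes F: "continuous_on UNIV F" and k: "smooth_on UNIV k"
  shows "smooth_on UNIV (\<lambda>y. integral (cbox a b) (\<lambda>w. k (y - w) * F w))"
proof -
  have "Ck_on n UNIV (\<lambda>y. integral (cbox a b) (\<lambda>w. k (y - w) * F w))"
    if "smooth_on UNIV k" for n and k :: "'a \<Rightarrow> real"
    using that
  proof (induction n arbitrary: k)
    case 0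
    note [continuous_intros] = continuous_on_compose2[OF smooth_on_imp_continuous_on[OF 0]]
      continuous_on_compose2[OF F]
    show ?case
      unfolding Ck_on.simps
      by (intro integral_continuous_on_param) (auto simp: split_beta intro!: continuous_intros)
  next
    case (Suc n)
    let ?k' = "\<lambda>x. frechet_derivative k (at x)"
    note dk = smooth_on_has_derivative[OF Suc.prems UNIV_I]
    note [continuous_intros] = continuous_on_compose2[OF smooth_on_imp_continuous_on[OF Suc.prems]]
      continuous_on_compose2[OF F]
      continuous_on_compose2[OF smooth_on_imp_continuous_on[OF smooth_on_frechet_derivative[OF Suc.prems]]]
    have bl: "bounded_linear (?k' x)" for x using dk has_derivative_bounded_linear by blast
    \<comment> \<open>The Leibniz rule asks for the derivative of the integrand as a continuous
      family of bounded linear maps. In each direction the result is again a convolution, with a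
      directional derivative of \<open>k\<close> as kernel; this is why the induction runs over all
      kernels.\<close>
    define D where "D y w = F w *\<^sub>R Blinfun (?k' (y - w))" for y w
    have D: "blinfun_apply (D y w) v = ?k' (y - w) v * F w" for y w v
      unfolding D_def by (simp add: blinfun.scaleR_left bounded_linear_Blinfun_apply[OF bl])
    have contD: "continuous_on (UNIV \<times> cbox a b) (\<lambda>(y, w). D y w)"
      by (rule continuous_on_blinfun_componentwise) (auto simp: split_beta D intro!: continuous_intros)
    have "((\<lambda>y. integral (cbox a b) (\<lambda>w. k (y - w) * F w)) has_derivative integral (cbox a b) (D y)) (at y within UNIV)" for y
    proof (rule leibniz_rule[OF _ _ contD])
      fix x t
      have "((\<lambda>y. k (y - t)) has_derivative ?k' (x - t)) (at x)"
        using diff_chain_at[OF has_derivative_diff[OF has_derivative_ident has_derivative_const] dk, of t x]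
        by (simp add: comp_def)
      then have "((\<lambda>y. k (y - t) * F t) has_derivative (\<lambda>v. ?k' (x - t) v * F t)) (at x)"
        by (rule has_derivative_mult_left)
      then show "((\<lambda>y. k (y - t) * F t) has_derivative blinfun_apply (D x t)) (at x within UNIV)"
        by (simp add: D[abs_def])
    next
      show "(\<lambda>w. k (x - w) * F w) integrable_on cbox a b" for x
        by (intro integrable_continuous) (auto intro!: continuous_intros)
    qed auto
    note lb = this
    have bi: "blinfun_apply (integral (cbox a b) (D y)) v = integral (cbox a b) (\<lambda>w. ?k' (y - w) v * F w)" for y v
    proof -
      have "D y integrable_on cbox a b"
      proof (rule integrable_continuous)
        have "continuous_on (cbox a b) (\<lambda>w. (\<lambda>(y, w). D y w) (y, w))"
          by (rule continuous_on_compose2[OF contD]) (auto intro!: continuous_on_Pair)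
        then show "continuous_on (cbox a b) (D y)" by simp
      qed
      then show ?thesis by (simp add: blinfun_apply_integral D)
    qed
    have der: "((\<lambda>y. integral (cbox a b) (\<lambda>w. k (y - w) * F w)) has_derivative
        (\<lambda>v. integral (cbox a b) (\<lambda>w. ?k' (y - w) v * F w))) (at y)" for y
    proof -
      have "blinfun_apply (integral (cbox a b) (D y)) = (\<lambda>v. integral (cbox a b) (\<lambda>w. ?k' (y - w) v * F w))"
        by (rule ext) (rule bi)
      with lb[of y] show ?thesis by simp
    qed
    show ?case
      by (rule Ck_on_SucI[OF open_UNIV der]) (intro Suc.IH smooth_on_frechet_derivative Suc.prems)
  qed
  then show ?thesis using k by (simp add: smooth_on_def)
qed

text \<open>\<open>G x\<close> is an average of F(x + z) over the ball of radius \<delta>, with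
  weights that do not depend on \<open>x\<close>. Hence bounds of F pass to G, and bounds of F(x +
  z) - F(y + z) pass to G x - G y. The last form carries Lipschitz estimates over to the derivative
  of G although F is not differentiable.\<close>

lemma mollification:
  fixes F :: "'a::euclidean_space \<Rightarrow> real"
  assumes F: "continuous_on UNIV F" "\<And>x. x \<notin> cbox a b \<Longrightarrow> F x = 0" and "0 < \<delta>"
  obtains G where "smooth_on UNIV G"
    "\<And>x c. (\<And>z. z \<in> cball 0 \<delta> \<Longrightarrow> F (x + z) \<le> c) \<Longrightarrow> G x \<le> c"
    "\<And>x c. (\<And>z. z \<in> cball 0 \<delta> \<Longrightarrow> c \<le> F (x + z)) \<Longrightarrow> c \<le> G x"
    "\<And>x y c. (\<And>z. z \<in> cball 0 \<delta> \<Longrightarrow> F (x + z) - F (y + z) \<le> c) \<Longrightarrow> G x - G y \<le> c"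
proof
  \<comment> \<open>The kernel is radial, hence even: the substitution w = y + z turns k(y - w) into
    k(-z) = k(z).\<close>
  define k0 :: "'a \<Rightarrow> real" where "k0 x = flat_exp 0 (\<delta>\<^sup>2 + (-1) * ((x - 0) \<bullet> (x - 0)))" for x
  have sm0: "smooth_on UNIV k0" unfolding k0_def by (rule smooth_on_flat_exp_dist)
  have k0n: "0 \<le> k0 x" "k0 (- x) = k0 x" for x by (auto simp: k0_def flat_exp_nonneg)
  have k0z: "k0 x = 0" if "x \<notin> ball 0 \<delta>" for x
  proof -
    have "\<delta>\<^sup>2 \<le> (norm x)\<^sup>2" using that assms(3) by (intro power_mono) auto
    then show ?thesis by (simp add: k0_def flat_exp_def power2_norm_eq_inner)
  qed
  have k0p: "0 < k0 x" if "x \<in> ball 0 \<delta>" for x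
  proof -
    have "(norm x)\<^sup>2 < \<delta>\<^sup>2" using that by (intro power_strict_mono) auto
    then show ?thesis by (simp add: k0_def flat_exp_pos_iff power2_norm_eq_inner)
  qed
  have c0: "continuous_on UNIV k0" using sm0 smooth_on_imp_continuous_on by blast
  have int_cont: "integrable lborel (\<lambda>z. k0 z * g z)" if "continuous_on UNIV g" for g :: "'a \<Rightarrow> real"
  proof -
    have "integrable lborel (\<lambda>z. indicator (cball 0 \<delta>) z *\<^sub>R (k0 z * g z))"
      by (rule borel_integrable_compact[OF compact_cball])
        (intro continuous_on_mult continuous_on_subset[OF c0] continuous_on_subset[OF that] subset_UNIV)
    also have "(\<lambda>z. indicator (cball 0 \<delta>) z *\<^sub>R (k0 z * g z)) = (\<lambda>z. k0 z * g z)"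
      using k0z by (auto simp: indicator_def fun_eq_iff)
    finally show ?thesis .
  qed
  define I where "I = (LINT z|lborel. k0 z)"
  have int0: "integrable lborel k0" using int_cont[of "\<lambda>_. 1"] by simp
  have "I \<noteq> 0"
  proof
    assume "I = 0"
    then have "AE z in lborel. k0 z = 0"
      using integral_nonneg_eq_0_iff_AE[OF int0] k0n by (simp add: I_def)
    moreover have "k0 z = 0 \<longrightarrow> z \<notin> ball 0 \<delta>" for z using k0p[of z] by auto
    ultimately have "AE z in lborel. z \<notin> ball (0::'a) \<delta>" by (auto elim: eventually_mono)
    then have "ball (0::'a) \<delta> \<in> null_sets lebesgue"
      by (intro null_sets_completionI) (simp add: AE_iff_null_sets)
    then have "negligible (ball (0::'a) \<delta>)"
      by (simp add: negligible_iff_null_sets)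
    moreover have "\<not> negligible (ball (0::'a) \<delta>)"
      using assms(3) by (simp add: open_not_negligible)
    ultimately show False by blast
  qed
  then have I: "0 < I" using integral_nonneg_AE[of k0 lborel] k0n unfolding I_def by (simp add: less_le)
  define k where "k z = k0 z * inverse I" for z
  have kn: "0 \<le> k x" "k (- x) = k x" for x using I k0n by (auto simp: k_def)
  have ik: "integrable lborel (\<lambda>z. k z * g z)" if "continuous_on UNIV g" for g
    using int_cont[OF that] by (auto simp: k_def mult.assoc mult.left_commute[of _ "inverse I"])
  have k1: "(LINT z|lborel. k z * c) = c" for c
    using I int0 by (simp add: k_def I_def[symmetric])
  have smk: "smooth_on UNIV k" unfolding k_def by (intro smooth_on_mult sm0 smooth_on_const open_UNIV)
  \<comment> \<open>As an integral over a fixed box outside of which F vanishes, the convolution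
    depends on \<open>y\<close> through the kernel only and can be differentiated. Translation then
    recovers the form as an average.\<close>
  define G where "G y = integral (cbox a b) (\<lambda>w. k (y - w) * F w)" for y
  show "smooth_on UNIV G" unfolding G_def by (rule smooth_on_convolution[OF F(1) smk])
  have cont: "continuous_on UNIV (\<lambda>z. F (x + z))" for x
    by (rule continuous_on_compose2[OF F(1)]) (auto intro!: continuous_intros)
  have G: "G y = (LINT z|lborel. k z * F (y + z))" for y
  proof -
    have i: "integrable lborel (\<lambda>z. k z * F (y + z))" by (rule ik[OF cont])
    have m: "(\<lambda>w. k (y - w) * F w) \<in> borel_measurable borel"
      by (intro borel_measurable_continuous_onI continuous_on_mult F(1)
          continuous_on_compose2[OF smooth_on_imp_continuous_on[OF smk]]) (auto intro!: continuous_intros)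
    have kk: "k (y - (y + z)) = k z" for z using kn(2)[of z] by simp
    have "integrable (distr lborel borel ((+) y)) (\<lambda>w. k (y - w) * F w)"
      by (subst integrable_distr_eq) (use i m kk in auto)
    then have "integral UNIV (\<lambda>w. k (y - w) * F w) = (LINT w|lborel. k (y - w) * F w)"
      by (intro integral_lborel) (simp add: lborel_distr_plus)
    also have "\<dots> = (LINT w|distr lborel borel ((+) y). k (y - w) * F w)"
      by (simp add: lborel_distr_plus)
    also have "\<dots> = (LINT z|lborel. k z * F (y + z))"
      by (subst integral_distr) (use m kk in auto)
    finally have "(LINT z|lborel. k z * F (y + z)) = integral UNIV (\<lambda>w. k (y - w) * F w)" by simp
    also have "\<dots> = integral UNIV (\<lambda>w. if w \<in> cbox a b then k (y - w) * F w else 0)"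
      by (intro arg_cong[where f="integral UNIV"]) (use F(2) in auto)
    finally show ?thesis by (simp add: G_def integral_restrict_UNIV)
  qed
  have k0z': "k z = 0" if "z \<notin> cball 0 \<delta>" for z using k0z[of z] that by (simp add: k_def)
  have le: "(LINT z|lborel. k z * f z) \<le> c"
    if "continuous_on UNIV f" "\<And>z. z \<in> cball 0 \<delta> \<Longrightarrow> f z \<le> c" for f :: "'a \<Rightarrow> real" and c
  proof -
    have "(LINT z|lborel. k z * f z) \<le> (LINT z|lborel. k z * c)"
    proof (intro integral_mono ik that continuous_on_const)
      fix z
      show "k z * f z \<le> k z * c"
        using that(2)[of z] kn(1)[of z] k0z'[of z] mult_left_mono[of "f z" c "k z"] by (cases "z \<in> cball 0 \<delta>") auto
    qed
    then show ?thesis unfolding k1 .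
  qed
  show "G x \<le> c" if "\<And>z. z \<in> cball 0 \<delta> \<Longrightarrow> F (x + z) \<le> c" for x c
    unfolding G by (rule le[OF cont that])
  show "c \<le> G x" if "\<And>z. z \<in> cball 0 \<delta> \<Longrightarrow> c \<le> F (x + z)" for x c
    using le[of "\<lambda>z. - F (x + z)" "- c"] that continuous_on_minus[OF cont[of x]] by (simp add: G)
  show "G x - G y \<le> c" if "\<And>z. z \<in> cball 0 \<delta> \<Longrightarrow> F (x + z) - F (y + z) \<le> c" for x y c
  proof -
    have "G x - G y = (LINT z|lborel. k z * (F (x + z) - F (y + z)))"
      by (simp add: G right_diff_distrib Bochner_Integration.integral_diff[OF ik[OF cont] ik[OF cont]])
    also have "\<dots> \<le> c" by (rule le) (auto intro!: continuous_on_diff cont that)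
    finally show ?thesis .
  qed
qed

section \<open>Charts and differentials\<close>

text \<open>With \<open>f\<close> a coordinate map this is the Jacobian of a change of charts, hence
  \<open>coord_vec\<close>; with \<open>f\<close> a function and \<open>c\<close> the preferred
  chart it is \<open>differential\<close>. One chain rule covers both.\<close>

definition chart_deriv :: "('m, 'n::finite) chart \<Rightarrow> ('m \<Rightarrow> 'b::real_normed_vector) \<Rightarrow> 'm \<Rightarrow> real^'n \<Rightarrow> 'b" where
  "chart_deriv c f x = frechet_derivative (f \<circ> chart_inv c) (at (snd c x))"

lemma coord_vec_eq: "coord_vec M c x = chart_deriv c (snd (chart_at M x)) x"
  by (simp add: coord_vec_def chart_deriv_def fun_eq_iff)

lemma differential_eq: "differential M f x = chart_deriv (chart_at M x) f x"
  by (simp add: differential_def chart_deriv_def fun_eq_iff)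

locale riem =
  fixes M :: "('m::{t2_space,second_countable_topology}, 'n::finite) riem_mfd"
  assumes riemannian: "riemannian_manifold M"
begin

lemma chart:
  assumes "c \<in> atlas M"
  shows open_chart_domain: "open (fst c)"
    and homeomorphism_chart: "homeomorphism (fst c) (snd c ` fst c) (snd c) (chart_inv c)"
    and open_chart_range: "open (snd c ` fst c)"
  using riemannian assms unfolding riemannian_manifold_def smooth_atlas_def is_chart_def by blast+

lemma chart_inv_chart: "c \<in> atlas M \<Longrightarrow> x \<in> fst c \<Longrightarrow> chart_inv c (snd c x) = x"
  using homeomorphism_apply1[OF homeomorphism_chart] .

lemma chart_chart_inv: "c \<in> atlas M \<Longrightarrow> p \<in> snd c ` fst c \<Longrightarrow> snd c (chart_inv c p) = p"
  using homeomorphism_apply2[OF homeomorphism_chart] .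

lemma chart_inv_mem: "p \<in> snd c ` fst c \<Longrightarrow> chart_inv c p \<in> fst c"
  by (rule inv_into_into)

lemma continuous_on_chart: "c \<in> atlas M \<Longrightarrow> continuous_on (fst c) (snd c)"
  using homeomorphism_cont1[OF homeomorphism_chart] .

lemma continuous_on_chart_inv: "c \<in> atlas M \<Longrightarrow> continuous_on (snd c ` fst c) (chart_inv c)"
  using homeomorphism_cont2[OF homeomorphism_chart] .

lemma inj_on_chart: "c \<in> atlas M \<Longrightarrow> inj_on (snd c) (fst c)"
  by (rule inj_on_inverseI) (rule chart_inv_chart)

lemma chart_image_eq_vimage:
  assumes "c \<in> atlas M"
  shows "snd c ` (S \<inter> fst c) = snd c ` fst c \<inter> chart_inv c -` S"
  using assms by (auto simp: chart_inv_chart)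

lemma chart_inv_image_eq_vimage:
  assumes "c \<in> atlas M" "B \<subseteq> snd c ` fst c"
  shows "chart_inv c ` B = fst c \<inter> snd c -` B"
proof (intro equalityI subsetI)
  fix x assume "x \<in> fst c \<inter> snd c -` B"
  then show "x \<in> chart_inv c ` B" using chart_inv_chart[OF assms(1), of x] by (metis Int_iff imageI vimageE)
next
  fix x assume "x \<in> chart_inv c ` B"
  then obtain p where "p \<in> B" "x = chart_inv c p" by blast
  then show "x \<in> fst c \<inter> snd c -` B"
    using assms(2) chart_inv_mem[of p c] chart_chart_inv[OF assms(1), of p] by auto
qed

lemma open_chart_image:
  assumes "c \<in> atlas M" "open S" shows "open (snd c ` (S \<inter> fst c))"
  unfolding chart_image_eq_vimage[OF assms(1)]
  using continuous_open_preimage[OF continuous_on_chart_inv open_chart_range] assms by blast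

lemma open_chart_inv_image:
  assumes "c \<in> atlas M" "open B" "B \<subseteq> snd c ` fst c" shows "open (chart_inv c ` B)"
  unfolding chart_inv_image_eq_vimage[OF assms(1,3)]
  using continuous_open_preimage[OF continuous_on_chart open_chart_domain] assms by blast

lemma compact_chart_inv_image:
  assumes "c \<in> atlas M" "compact K" "K \<subseteq> snd c ` fst c" shows "compact (chart_inv c ` K)"
  using assms continuous_on_chart_inv continuous_on_subset compact_continuous_image by blast

lemma chart_at: "chart_at M x \<in> atlas M" "x \<in> fst (chart_at M x)"
proof -
  have "\<exists>c. c \<in> atlas M \<and> x \<in> fst c"
    using riemannian unfolding riemannian_manifold_def smooth_atlas_def by blast
  then have "chart_at M x \<in> atlas M \<and> x \<in> fst (chart_at M x)"
    unfolding chart_at_def by (rule someI_ex)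
  then show "chart_at M x \<in> atlas M" "x \<in> fst (chart_at M x)" by auto
qed

lemma chart_cball:
  assumes "c \<in> atlas M" "x \<in> fst c" "open U" "x \<in> U"
  obtains R where "0 < R" "cball (snd c x) R \<subseteq> snd c ` (U \<inter> fst c)"
  using open_contains_cball[of "snd c ` (U \<inter> fst c)"] open_chart_image[OF assms(1,3)] assms by blast

lemma smooth_transition:
  "c \<in> atlas M \<Longrightarrow> c' \<in> atlas M \<Longrightarrow> smooth_on (snd c ` (fst c \<inter> fst c')) (snd c' \<circ> chart_inv c)"
  using riemannian by (auto simp: riemannian_manifold_def smooth_atlas_def)

section \<open>Smooth functions on subsets of the manifold\<close>

lemma smooth_fun_onD: "smooth_fun_on M S f \<Longrightarrow> c \<in> atlas M \<Longrightarrow> smooth_on (snd c ` (S \<inter> fst c)) (f \<circ> chart_inv c)"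
  by (simp add: smooth_fun_on_def)

lemma smooth_fun_on_subset: "smooth_fun_on M S f \<Longrightarrow> T \<subseteq> S \<Longrightarrow> smooth_fun_on M T f"
  unfolding smooth_fun_on_def using smooth_on_subset by (metis Int_mono image_mono order_refl)

lemma smooth_fun_on_cong:
  assumes "open S" "\<And>x. x \<in> S \<Longrightarrow> f x = g x" "smooth_fun_on M S f"
  shows "smooth_fun_on M S g"
  unfolding smooth_fun_on_def
proof
  fix c assume c: "c \<in> atlas M"
  show "smooth_on (snd c ` (S \<inter> fst c)) (g \<circ> chart_inv c)"
    by (rule smooth_on_cong[OF open_chart_image[OF c assms(1)] _ smooth_fun_onD[OF assms(3) c]])
      (use assms c in \<open>auto simp: chart_inv_chart\<close>)
qed

lemma smooth_fun_on_local:
  assumes "\<And>x. x \<in> S \<Longrightarrow> \<exists>T. open T \<and> x \<in> T \<and> smooth_fun_on M T f"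
  shows "smooth_fun_on M S f"
  unfolding smooth_fun_on_def
proof
  fix c assume c: "c \<in> atlas M"
  show "smooth_on (snd c ` (S \<inter> fst c)) (f \<circ> chart_inv c)"
  proof (rule smooth_on_local)
    fix p assume "p \<in> snd c ` (S \<inter> fst c)"
    then obtain x where x: "x \<in> S" "x \<in> fst c" "p = snd c x" by auto
    from assms[OF x(1)] obtain T where "open T" "x \<in> T" "smooth_fun_on M T f" by blast
    then show "\<exists>T. open T \<and> p \<in> T \<and> smooth_on T (f \<circ> chart_inv c)"
      using x c by (intro exI[of _ "snd c ` (T \<inter> fst c)"]) (auto intro: open_chart_image smooth_fun_onD)
  qed
qed

lemma smooth_fun_on_const: "smooth_fun_on M S (\<lambda>x. k)"
  by (simp add: smooth_fun_on_def comp_def smooth_on_const)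

lemma smooth_fun_on_add:
  assumes "open S" "smooth_fun_on M S f" "smooth_fun_on M S g" shows "smooth_fun_on M S (\<lambda>x. f x + g x)"
  using assms smooth_on_add[OF open_chart_image[OF _ assms(1)]] by (fastforce simp: smooth_fun_on_def comp_def)

lemma smooth_fun_on_mult:
  assumes "open S" "smooth_fun_on M S f" "smooth_fun_on M S g" shows "smooth_fun_on M S (\<lambda>x. f x * g x)"
  using assms smooth_on_mult[OF open_chart_image[OF _ assms(1)]] by (fastforce simp: smooth_fun_on_def comp_def)

lemma smooth_fun_on_diff:
  assumes "open S" "smooth_fun_on M S f" "smooth_fun_on M S g" shows "smooth_fun_on M S (\<lambda>x. f x - g x)"
  using assms smooth_on_diff[OF open_chart_image[OF _ assms(1)]] by (fastforce simp: smooth_fun_on_def comp_def)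

lemma smooth_fun_on_sum:
  assumes "open S" "\<And>i. i \<in> I \<Longrightarrow> smooth_fun_on M S (f i)" shows "smooth_fun_on M S (\<lambda>x. \<Sum>i\<in>I. f i x)"
  using assms(2) by (induction I rule: infinite_finite_induct)
    (auto simp: smooth_fun_on_const intro!: smooth_fun_on_add assms(1))

lemma smooth_fun_on_prod:
  assumes "open S" "\<And>i. i \<in> I \<Longrightarrow> smooth_fun_on M S (f i)" shows "smooth_fun_on M S (\<lambda>x. \<Prod>i\<in>I. f i x)"
  using assms(2) by (induction I rule: infinite_finite_induct)
    (auto simp: smooth_fun_on_const intro!: smooth_fun_on_mult assms(1))

lemma smooth_fun_on_compose:
  assumes "open S" "smooth_fun_on M S f" "smooth_on T g" "f ` S \<subseteq> T"
  shows "smooth_fun_on M S (\<lambda>x. g (f x))"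
  unfolding smooth_fun_on_def
proof
  fix c assume c: "c \<in> atlas M"
  have "smooth_on (snd c ` (S \<inter> fst c)) (g \<circ> (f \<circ> chart_inv c))"
    by (rule smooth_on_compose[OF open_chart_image[OF c assms(1)] smooth_fun_onD[OF assms(2) c] assms(3)])
      (use assms(4) c in \<open>auto simp: chart_inv_chart\<close>)
  then show "smooth_on (snd c ` (S \<inter> fst c)) ((\<lambda>x. g (f x)) \<circ> chart_inv c)" by (simp add: comp_def)
qed

lemma smooth_fun_on_chart:
  assumes c: "c \<in> atlas M" and W: "open W" "W \<subseteq> fst c" and F: "smooth_on (snd c ` W) F"
  shows "smooth_fun_on M W (F \<circ> snd c)"
  unfolding smooth_fun_on_def
proof
  fix c' assume c': "c' \<in> atlas M"
  have "smooth_on (snd c' ` (W \<inter> fst c')) (F \<circ> (snd c \<circ> chart_inv c'))"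
    using W c c' by (intro smooth_on_compose[OF open_chart_image smooth_on_subset[OF smooth_transition] F])
      (auto simp: chart_inv_chart)
  then show "smooth_on (snd c' ` (W \<inter> fst c')) (F \<circ> snd c \<circ> chart_inv c')" by (simp add: comp_assoc)
qed

lemma smooth_fun_on_continuous_on:
  assumes "open S" "smooth_fun_on M S f" shows "continuous_on S f"
proof (intro continuous_at_imp_continuous_on ballI)
  fix x assume x: "x \<in> S"
  let ?c = "chart_at M x"
  have "continuous_on (S \<inter> fst ?c) ((f \<circ> chart_inv ?c) \<circ> snd ?c)"
    by (rule continuous_on_compose[OF continuous_on_subset[OF continuous_on_chart[OF chart_at(1)]]
          smooth_on_imp_continuous_on[OF smooth_fun_onD[OF assms(2) chart_at(1)]]]) auto
  then have "continuous_on (S \<inter> fst ?c) f"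
    by (rule continuous_on_eq) (auto simp: chart_inv_chart chart_at)
  then show "isCont f x"
    using x chart_at open_Int[OF assms(1) open_chart_domain[OF chart_at(1)]]
    by (metis IntI continuous_on_eq_continuous_at)
qed

text \<open>Closedness of \<open>K\<close> makes the function vanish on a whole neighbourhood of
  every point outside \<open>K\<close>.\<close>

lemma smooth_fun_on_zero_extend:
  assumes "open U" "smooth_fun_on M U f" "closed K" "K \<subseteq> U" "\<And>x. x \<notin> K \<Longrightarrow> f x = 0"
  shows "smooth_fun_on M UNIV f"
proof (rule smooth_fun_on_local)
  fix x
  show "\<exists>T. open T \<and> x \<in> T \<and> smooth_fun_on M T f"
  proof (cases "x \<in> K")
    case True then show ?thesis using assms by auto
  next
    case False
    have "smooth_fun_on M (- K) f"
      by (rule smooth_fun_on_cong[OF _ _ smooth_fun_on_const[of _ 0]]) (use assms in auto)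
    then show ?thesis using False assms(3) by blast
  qed
qed

section \<open>Changes of charts, tangent vectors and the differential\<close>

lemma chart_deriv_chain:
  assumes c: "c \<in> atlas M" "c' \<in> atlas M" "x \<in> fst c" "x \<in> fst c'"
    and f: "(f \<circ> chart_inv c') differentiable (at (snd c' x))"
  shows "(f \<circ> chart_inv c has_derivative (\<lambda>v. chart_deriv c' f x (chart_deriv c (snd c') x v))) (at (snd c x))"
    and "chart_deriv c f x v = chart_deriv c' f x (chart_deriv c (snd c') x v)"
proof -
  let ?W = "snd c ` (fst c \<inter> fst c')"
  have W: "open ?W" "snd c x \<in> ?W"
    using c open_chart_image[OF c(1) open_chart_domain[OF c(2)]] by (auto simp: Int_commute)
  have "(snd c' \<circ> chart_inv c has_derivative chart_deriv c (snd c') x) (at (snd c x))"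
    unfolding chart_deriv_def
    by (rule smooth_on_has_derivative[OF smooth_transition[OF c(1,2)] W(2)])
  moreover have "(f \<circ> chart_inv c' has_derivative chart_deriv c' f x) (at ((snd c' \<circ> chart_inv c) (snd c x)))"
    using f c by (simp add: chart_deriv_def frechet_derivative_works chart_inv_chart)
  ultimately have "((f \<circ> chart_inv c') \<circ> (snd c' \<circ> chart_inv c) has_derivative
      chart_deriv c' f x \<circ> chart_deriv c (snd c') x) (at (snd c x))"
    by (rule diff_chain_at)
  then show *: "(f \<circ> chart_inv c has_derivative (\<lambda>v. chart_deriv c' f x (chart_deriv c (snd c') x v))) (at (snd c x))"
    unfolding comp_def[of "chart_deriv c' f x"]
    by (rule has_derivative_transform_within_open[OF _ W]) (auto simp: chart_inv_chart c)
  then show "chart_deriv c f x v = chart_deriv c' f x (chart_deriv c (snd c') x v)"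
    using fun_cong[OF frechet_derivative_at[OF *], of v] by (simp add: chart_deriv_def)
qed

lemma chart_deriv_self:
  assumes "c \<in> atlas M" "x \<in> fst c"
  shows "chart_deriv c (snd c) x v = v"
proof -
  have "((\<lambda>p. p) has_derivative (\<lambda>v. v)) (at (snd c x))" by simp
  then have "(snd c \<circ> chart_inv c has_derivative (\<lambda>v. v)) (at (snd c x))"
    by (rule has_derivative_transform_within_open[OF _ open_chart_range[OF assms(1)]])
      (use assms in \<open>auto simp: chart_inv_chart\<close>)
  then show ?thesis by (metis chart_deriv_def frechet_derivative_at)
qed

lemma differentiable_transition:
  assumes "c \<in> atlas M" "c' \<in> atlas M" "x \<in> fst c" "x \<in> fst c'"
  shows "(snd c' \<circ> chart_inv c) differentiable (at (snd c x))"
  using smooth_on_imp_differentiable[OF smooth_transition[OF assms(1,2)]] assms by blast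

lemma linear_coord_vec:
  assumes "c \<in> atlas M" "x \<in> fst c" shows "linear (coord_vec M c x)"
  using differentiable_transition[OF assms(1) chart_at(1) assms(2) chart_at(2)]
  unfolding coord_vec_eq chart_deriv_def
  by (simp add: linear_frechet_derivative)

lemma coord_vec_change:
  assumes "c \<in> atlas M" "c' \<in> atlas M" "x \<in> fst c" "x \<in> fst c'"
  shows "coord_vec M c x v = coord_vec M c' x (chart_deriv c (snd c') x v)"
  unfolding coord_vec_eq
  by (rule chart_deriv_chain(2)) (use assms chart_at differentiable_transition in auto)

text \<open>Names the components in \<open>c\<close> of an arbitrary tangent vector. For the
  preferred chart \<open>coord_vec\<close> is the identity, so the change of charts from there to
  \<open>c\<close> provides them.\<close>

lemma coord_vec_surj:
  assumes "c \<in> atlas M" "x \<in> fst c"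
  shows "coord_vec M c x (chart_deriv (chart_at M x) (snd c) x v) = v"
  using coord_vec_change[OF chart_at(1) assms(1) chart_at(2) assms(2), of v]
  by (simp add: coord_vec_eq[of M "chart_at M x"] chart_deriv_self chart_at)

lemma smooth_fun_on_differentiable:
  assumes "open S" "smooth_fun_on M S f" "x \<in> S" "c \<in> atlas M" "x \<in> fst c"
  shows "(f \<circ> chart_inv c) differentiable (at (snd c x))"
  by (rule smooth_on_imp_differentiable[OF smooth_fun_onD]) (use assms in auto)

lemma differential_coord_vec:
  assumes "open S" "smooth_fun_on M S f" "x \<in> S" "c \<in> atlas M" "x \<in> fst c"
  shows "differential M f x (coord_vec M c x v) = frechet_derivative (f \<circ> chart_inv c) (at (snd c x)) v"
  unfolding differential_eq coord_vec_eq
  by (subst chart_deriv_chain(2)[symmetric])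
    (use assms chart_at smooth_fun_on_differentiable[OF assms(1-3)] in \<open>auto simp: chart_deriv_def\<close>)

lemma has_derivative_differential:
  assumes "open S" "smooth_fun_on M S f" "x \<in> S"
  shows "(f \<circ> chart_inv (chart_at M x) has_derivative differential M f x) (at (snd (chart_at M x) x))"
  using smooth_fun_on_differentiable[OF assms chart_at]
  by (simp add: differential_eq chart_deriv_def frechet_derivative_works)

lemma linear_differential:
  assumes "open S" "smooth_fun_on M S f" "x \<in> S" shows "linear (differential M f x)"
  using has_derivative_differential[OF assms] has_derivative_linear by blast

lemma differential_unique:
  assumes "(f \<circ> chart_inv (chart_at M x) has_derivative D) (at (snd (chart_at M x) x))"
  shows "differential M f x = D"
  using frechet_derivative_at[OF assms] by (simp add: differential_eq chart_deriv_def)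

lemma differential_const: "differential M (\<lambda>x. k) x X = 0"
  by (subst differential_unique[where D="\<lambda>_. 0"]) (auto simp: comp_def)

lemma differential_add:
  assumes "open S" "smooth_fun_on M S f" "smooth_fun_on M S g" "x \<in> S"
  shows "differential M (\<lambda>x. f x + g x) x X = differential M f x X + differential M g x X"
  using has_derivative_add[OF has_derivative_differential[OF assms(1,2,4)] has_derivative_differential[OF assms(1,3,4)]]
  by (subst differential_unique) (auto simp: comp_def)

lemma differential_diff:
  assumes "open S" "smooth_fun_on M S f" "smooth_fun_on M S g" "x \<in> S"
  shows "differential M (\<lambda>x. f x - g x) x X = differential M f x X - differential M g x X"
  using has_derivative_diff[OF has_derivative_differential[OF assms(1,2,4)] has_derivative_differential[OF assms(1,3,4)]]
  by (subst differential_unique) (auto simp: comp_def)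

lemma differential_sum:
  assumes "open S" "\<And>i. i \<in> I \<Longrightarrow> smooth_fun_on M S (f i)" "x \<in> S"
  shows "differential M (\<lambda>x. \<Sum>i\<in>I. f i x) x X = (\<Sum>i\<in>I. differential M (f i) x X)"
  using assms(2)
proof (induction I rule: infinite_finite_induct)
  case (insert i I)
  then show ?case
    using differential_add[OF assms(1) _ smooth_fun_on_sum[OF assms(1)] assms(3), of "f i" I f] by simp
qed (auto simp: differential_const)

lemma differential_mult:
  assumes "open S" "smooth_fun_on M S f" "smooth_fun_on M S g" "x \<in> S"
  shows "differential M (\<lambda>x. f x * g x) x X = differential M f x X * g x + f x * differential M g x X"
  using has_derivative_mult[OF has_derivative_differential[OF assms(1,2,4)] has_derivative_differential[OF assms(1,3,4)]]
  by (subst differential_unique) (auto simp: comp_def chart_inv_chart chart_at add.commute)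

lemma differential_compose:
  assumes "open S" "smooth_fun_on M S f" "x \<in> S" "(g has_real_derivative g') (at (f x))"
  shows "differential M (\<lambda>x. g (f x)) x X = g' * differential M f x X"
proof -
  have "(g has_derivative (*) g') (at ((f \<circ> chart_inv (chart_at M x)) (snd (chart_at M x) x)))"
    using assms(4) by (simp add: chart_inv_chart chart_at has_field_derivative_def)
  from diff_chain_at[OF has_derivative_differential[OF assms(1-3)] this]
  show ?thesis by (subst differential_unique) (auto simp: comp_def)
qed

lemma differential_cong:
  assumes "open S" "x \<in> S" "\<And>y. y \<in> S \<Longrightarrow> f y = g y"
  shows "differential M f x = differential M g x"
proof -
  let ?c = "chart_at M x"
  have W: "open (snd ?c ` (S \<inter> fst ?c))" "snd ?c x \<in> snd ?c ` (S \<inter> fst ?c)"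
    using assms chart_at open_chart_image by auto
  have e: "(f \<circ> chart_inv ?c) p = (g \<circ> chart_inv ?c) p" if "p \<in> snd ?c ` (S \<inter> fst ?c)" for p
    using that assms(3) chart_inv_chart[OF chart_at(1)] by auto
  have "(f \<circ> chart_inv ?c has_derivative D) (at (snd ?c x)) \<longleftrightarrow> (g \<circ> chart_inv ?c has_derivative D) (at (snd ?c x))" for D
  proof
    assume "(f \<circ> chart_inv ?c has_derivative D) (at (snd ?c x))"
    then show "(g \<circ> chart_inv ?c has_derivative D) (at (snd ?c x))"
      by (rule has_derivative_transform_within_open[OF _ W]) (rule e)
  next
    assume "(g \<circ> chart_inv ?c has_derivative D) (at (snd ?c x))"
    then show "(f \<circ> chart_inv ?c has_derivative D) (at (snd ?c x))"
      by (rule has_derivative_transform_within_open[OF _ W]) (rule e[symmetric])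
  qed
  then show ?thesis by (simp add: differential_eq chart_deriv_def frechet_derivative_def)
qed

text \<open>The image of the larger closed ball is compact, hence closed in the Hausdorff space, so
  a bump transported by the chart extends by 0 to the whole manifold.\<close>

lemma smooth_bump:
  assumes c: "c \<in> atlas M" and r: "0 < r" "r < R" and sub: "cball p R \<subseteq> snd c ` fst c"
  obtains \<theta> where "smooth_fun_on M UNIV \<theta>" "\<And>x. 0 \<le> \<theta> x" "\<And>x. \<theta> x \<le> 1"
    "\<And>x. x \<in> chart_inv c ` cball p r \<Longrightarrow> \<theta> x = 1"
    "\<And>x. x \<notin> chart_inv c ` cball p R \<Longrightarrow> \<theta> x = 0"
proof -
  obtain \<beta> :: "real^'n \<Rightarrow> real" where b: "smooth_on UNIV \<beta>" "\<And>x. 0 \<le> \<beta> x" "\<And>x. \<beta> x \<le> 1"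
    "\<And>x. x \<in> cball p r \<Longrightarrow> \<beta> x = 1" "\<And>x. x \<notin> ball p R \<Longrightarrow> \<beta> x = 0"
    by (rule smooth_bump_exists[OF r, of p]) blast
  let ?K = "chart_inv c ` cball p R"
  define \<theta> where "\<theta> x = (if x \<in> fst c then \<beta> (snd c x) else 0)" for x
  have K: "?K \<subseteq> fst c" using sub by (intro image_subsetI chart_inv_mem) (rule subsetD)
  have z: "\<theta> x = 0" if "x \<notin> ?K" for x
  proof (cases "x \<in> fst c")
    case True
    have "snd c x \<notin> cball p R"
    proof
      assume "snd c x \<in> cball p R"
      then have "chart_inv c (snd c x) \<in> ?K" by (rule imageI)
      then show False using that chart_inv_chart[OF c True] by simp
    qed
    then show ?thesis using True b(5)[of "snd c x"] by (auto simp: \<theta>_def)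
  qed (simp add: \<theta>_def)
  have "smooth_fun_on M (fst c) (\<beta> \<circ> snd c)"
    by (rule smooth_fun_on_chart[OF c open_chart_domain[OF c] order_refl smooth_on_subset[OF b(1) subset_UNIV]])
  then have "smooth_fun_on M (fst c) \<theta>"
    by (rule smooth_fun_on_cong[OF open_chart_domain[OF c], rotated]) (simp add: \<theta>_def)
  moreover have "closed ?K"
    by (rule compact_imp_closed[OF compact_chart_inv_image[OF c compact_cball sub]])
  ultimately have "smooth_fun_on M UNIV \<theta>"
    using smooth_fun_on_zero_extend[OF open_chart_domain[OF c]] K z by blast
  moreover have "\<theta> x = 1" if "x \<in> chart_inv c ` cball p r" for x
  proof -
    from that obtain p' where p: "p' \<in> cball p r" "x = chart_inv c p'" by (rule imageE)
    then have "p' \<in> snd c ` fst c" using sub r by (intro subsetD[OF sub]) auto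
    then show ?thesis using p b(4) chart_chart_inv[OF c] chart_inv_mem by (simp add: \<theta>_def)
  qed
  ultimately show ?thesis using z b by (intro that[of \<theta>]) (auto simp: \<theta>_def)
qed

end

section \<open>Inner products and Gram matrices\<close>

lemma inner_product_on_lincomb:
  assumes "inner_product_on E b" "u \<in> E" "v \<in> E" "w \<in> E"
  shows "b (s *\<^sub>R u + t *\<^sub>R v) w = s * b u w + t * b v w"
  using assms by (simp add: inner_product_on_def)

lemma inner_product_on_sym: "inner_product_on E b \<Longrightarrow> u \<in> E \<Longrightarrow> v \<in> E \<Longrightarrow> b u v = b v u"
  by (simp add: inner_product_on_def)

lemma inner_product_on_pos: "inner_product_on E b \<Longrightarrow> v \<in> E \<Longrightarrow> v \<noteq> 0 \<Longrightarrow> 0 < b v v"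
  by (simp add: inner_product_on_def)

lemma inner_product_on_scale_left:
  assumes "inner_product_on E b" "u \<in> E" "w \<in> E"
  shows "b (s *\<^sub>R u) w = s * b u w"
  using inner_product_on_lincomb[OF assms(1,2,2,3), of s 0] by simp

lemma inner_product_on_scale_right:
  assumes "inner_product_on E b" "subspace E" "u \<in> E" "w \<in> E"
  shows "b w (s *\<^sub>R u) = s * b w u"
  using inner_product_on_scale_left[OF assms(1,3,4)] inner_product_on_sym[OF assms(1)] assms
    subspace_scale by metis

lemma inner_product_on_zero_left:
  assumes "inner_product_on E b" "w \<in> E" "0 \<in> E" shows "b 0 w = 0"
  using inner_product_on_scale_left[OF assms(1,3,2), of 0] by simp

lemma inner_product_on_sum_left:
  assumes "inner_product_on E b" "subspace E" "w \<in> E" "\<And>i. i \<in> I \<Longrightarrow> f i \<in> E"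
  shows "b (\<Sum>i\<in>I. a i *\<^sub>R f i) w = (\<Sum>i\<in>I. a i * b (f i) w)"
  using assms(4)
proof (induction I rule: infinite_finite_induct)
  case (insert i I)
  then show ?case
    using inner_product_on_lincomb[OF assms(1) _ _ assms(3), of "f i" "\<Sum>i\<in>I. a i *\<^sub>R f i" "a i" 1]
      subspace_sum[OF assms(2), of I "\<lambda>i. a i *\<^sub>R f i"] subspace_scale[OF assms(2)] by simp
qed (use inner_product_on_zero_left[OF assms(1,3)] subspace_0[OF assms(2)] in auto)

lemma inner_product_on_sum_right:
  assumes "inner_product_on E b" "subspace E" "w \<in> E" "\<And>i. i \<in> I \<Longrightarrow> f i \<in> E"
  shows "b w (\<Sum>i\<in>I. a i *\<^sub>R f i) = (\<Sum>i\<in>I. a i * b w (f i))"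
proof -
  have "b w (\<Sum>i\<in>I. a i *\<^sub>R f i) = b (\<Sum>i\<in>I. a i *\<^sub>R f i) w"
    by (intro inner_product_on_sym[OF assms(1,3)] subspace_sum subspace_scale assms)
  also have "\<dots> = (\<Sum>i\<in>I. a i * b (f i) w)" by (rule inner_product_on_sum_left[OF assms])
  also have "\<dots> = (\<Sum>i\<in>I. a i * b w (f i))"
    using assms inner_product_on_sym[OF assms(1)] by (intro sum.cong) auto
  finally show ?thesis .
qed

lemma inner_product_on_nonneg:
  assumes "inner_product_on E b" "v \<in> E" shows "0 \<le> b v v"
  using inner_product_on_pos[OF assms] inner_product_on_zero_left[OF assms(1)] assms(2)
  by (cases "v = 0") auto

text \<open>Gram-Schmidt for an abstract inner product, by induction on the set of indices already
  treated: as long as an index is left over, there are fewer than \<open>CARD('n)\<close> vectors,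
  and these cannot span.\<close>

lemma orthonormal_basis_exists:
  fixes b :: "real^'n \<Rightarrow> real^'n \<Rightarrow> real"
  assumes b: "inner_product_on UNIV b"
  obtains e :: "'n::finite \<Rightarrow> real^'n" where "\<And>i j. b (e i) (e j) = (if i = j then 1 else 0)"
proof -
  have "\<exists>e::'n \<Rightarrow> real^'n. \<forall>i\<in>I. \<forall>j\<in>I. b (e i) (e j) = (if i = j then 1 else 0)" for I :: "'n set"
  proof (induction I rule: finite_induct[OF finite])
    case 1 then show ?case by simp
  next
    case (2 k I)
    then obtain e where e: "\<And>i j. i \<in> I \<Longrightarrow> j \<in> I \<Longrightarrow> b (e i) (e j) = (if i = j then 1 else 0)" by blast
    have "card (e ` I) \<le> card I" by (rule card_image_le) simp
    also have "\<dots> < CARD('n)" using 2(2) by (intro psubset_card_mono) auto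
    finally have "dim (e ` I) < DIM(real^'n)" using dim_le_card'[of "e ` I"] by simp
    then have "span (e ` I) \<noteq> UNIV" using dim_eq_full[of "e ` I"] by auto
    then obtain v where v: "v \<notin> span (e ` I)" by blast
    define w where "w = v - (\<Sum>i\<in>I. b v (e i) *\<^sub>R e i)"
    have "(\<Sum>i\<in>I. b v (e i) *\<^sub>R e i) \<in> span (e ` I)"
      by (intro span_sum span_scale span_base) auto
    then have w0: "w \<noteq> 0" using v unfolding w_def by auto
    have we: "b w (e j) = 0" if "j \<in> I" for j
    proof -
      have "b w (e j) = b (1 *\<^sub>R v + (-1) *\<^sub>R (\<Sum>i\<in>I. b v (e i) *\<^sub>R e i)) (e j)"
        by (simp add: w_def)
      also have "\<dots> = b v (e j) - (\<Sum>i\<in>I. b v (e i) * b (e i) (e j))"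
        by (subst inner_product_on_lincomb[OF b]) (auto simp: inner_product_on_sum_left[OF b])
      also have "(\<Sum>i\<in>I. b v (e i) * b (e i) (e j)) = (\<Sum>i\<in>I. if i = j then b v (e i) else 0)"
        by (intro sum.cong) (use e that in auto)
      finally show ?thesis using that by simp
    qed
    have wp: "0 < b w w" by (rule inner_product_on_pos[OF b _ w0]) simp
    define f where "f = e(k := (1 / sqrt (b w w)) *\<^sub>R w)"
    note sc = inner_product_on_scale_left[OF b UNIV_I UNIV_I] inner_product_on_scale_right[OF b subspace_UNIV UNIV_I UNIV_I]
    have "b (f i) (f j) = (if i = j then 1 else 0)" if "i \<in> insert k I" "j \<in> insert k I" for i j
    proof (cases "i = k"; cases "j = k")
      assume "i = k" "j = k"
      then show ?thesis using wp by (simp add: f_def sc divide_simps)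
    next
      assume "i \<noteq> k" "j = k"
      then have "b (e i) w = 0" using we[of i] inner_product_on_sym[OF b, of "e i" w] that by simp
      then show ?thesis using \<open>i \<noteq> k\<close> \<open>j = k\<close> by (simp add: f_def sc)
    next
      assume "i = k" "j \<noteq> k"
      then show ?thesis using we[of j] that by (simp add: f_def sc)
    qed (use e that in \<open>auto simp: f_def\<close>)
    then show ?case by blast
  qed
  from this[of UNIV] show ?thesis using that by auto
qed

lemma double_sum_matrix:
  fixes A :: "real^'n^'n" and e :: "'n::finite \<Rightarrow> real^'n"
  shows "(\<Sum>i\<in>UNIV. \<Sum>j\<in>UNIV. e k $ i * e l $ j * A $ i $ j) =
    (transpose (\<chi> i k. e k $ i) ** (A ** (\<chi> i k. e k $ i))) $ k $ l"
  by (simp add: matrix_matrix_mult_def transpose_def sum_distrib_left mult_ac)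

lemma inner_product_expand:
  fixes b :: "real^'n \<Rightarrow> real^'n \<Rightarrow> real" and v w :: "real^'n"
  assumes b: "inner_product_on UNIV b"
  shows "b v w = (\<Sum>i\<in>UNIV. \<Sum>j\<in>UNIV. v $ i * w $ j * b (axis i 1) (axis j 1))"
proof -
  have "b v w = b (\<Sum>i\<in>UNIV. v $ i *\<^sub>R axis i 1) (\<Sum>j\<in>UNIV. w $ j *\<^sub>R axis j 1)"
    using basis_expansion[of v] basis_expansion[of w] by (simp add: scalar_mult_eq_scaleR)
  also have "\<dots> = (\<Sum>i\<in>UNIV. v $ i * b (axis i 1) (\<Sum>j\<in>UNIV. w $ j *\<^sub>R axis j 1))"
    by (rule inner_product_on_sum_left[OF b]) auto
  also have "\<dots> = (\<Sum>i\<in>UNIV. v $ i * (\<Sum>j\<in>UNIV. w $ j * b (axis i 1) (axis j 1)))"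
    by (intro sum.cong arg_cong2[where f="(*)"] inner_product_on_sum_right[OF b]) auto
  finally show ?thesis by (simp add: sum_distrib_left mult.assoc)
qed

text \<open>Orthonormality of the columns of \<open>F\<close> is the identity F^T B F = 1. Taking
  determinants gives det B (det F)^2 = 1, and cancelling F gives F F^T as the inverse of
  \<open>B\<close>.\<close>

lemma gram_orthonormal:
  fixes b :: "real^'n \<Rightarrow> real^'n \<Rightarrow> real" and e :: "'n::finite \<Rightarrow> real^'n"
  assumes b: "inner_product_on UNIV b" and e: "\<And>i j. b (e i) (e j) = (if i = j then 1 else 0)"
  defines "B \<equiv> (\<chi> i j. b (axis i 1) (axis j 1)) :: real^'n^'n" and "F \<equiv> (\<chi> i k. e k $ i) :: real^'n^'n"
  shows "transpose F ** (B ** F) = mat 1" "0 < det B" "matrix_inv B = F ** transpose F"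
proof -
  show 1: "transpose F ** (B ** F) = mat 1"
    by (simp add: vec_eq_iff F_def double_sum_matrix[symmetric] mat_def)
      (simp add: B_def inner_product_expand[OF b, symmetric] e)
  have "det (transpose F ** (B ** F)) = 1" unfolding 1 by simp
  then have d: "det B * (det F)\<^sup>2 = 1" by (simp add: det_mul det_transpose power2_eq_square mult_ac)
  then have "det F \<noteq> 0" by auto
  then have "0 < (det F)\<^sup>2" by simp
  with d show "0 < det B" by (metis zero_less_mult_pos2 zero_less_one)
  have "F ** (transpose F ** B) = mat 1"
    using 1 matrix_left_right_inverse[of F "transpose F ** B"] by (simp add: matrix_mul_assoc)
  then have l: "(F ** transpose F) ** B = mat 1" by (simp add: matrix_mul_assoc)
  then have r: "B ** (F ** transpose F) = mat 1" using matrix_left_right_inverse by blast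
  have "B ** matrix_inv B = mat 1 \<and> matrix_inv B ** B = mat 1"
    unfolding matrix_inv_def by (rule someI[of _ "F ** transpose F"]) (use l r in auto)
  then show "matrix_inv B = F ** transpose F"
    using l by (metis matrix_mul_assoc matrix_mul_lid matrix_mul_rid)
qed

text \<open>Since the inverse Gram matrix is F F^T, summing against its entries amounts to
  evaluating \<alpha> on the frame. This frees the norm of a form from the basis used in
  \<open>form_sq\<close> and reduces its estimates to estimates of \<open>h\<close>, one frame
  vector at a time.\<close>

lemma gram_inverse_sum:
  fixes b :: "real^'n \<Rightarrow> real^'n \<Rightarrow> real" and e :: "'n::finite \<Rightarrow> real^'n" and \<alpha> :: "real^'n \<Rightarrow> 'w::real_vector"
  assumes b: "inner_product_on UNIV b" and e: "\<And>i j. b (e i) (e j) = (if i = j then 1 else 0)"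
    and \<alpha>: "linear \<alpha>" "range \<alpha> \<subseteq> E" and h: "inner_product_on E h" "subspace E"
  shows "(\<Sum>i\<in>UNIV. \<Sum>j\<in>UNIV. matrix_inv (\<chi> i j. b (axis i 1) (axis j 1)) $ i $ j * h (\<alpha> (axis i 1)) (\<alpha> (axis j 1)))
    = (\<Sum>k\<in>UNIV. h (\<alpha> (e k)) (\<alpha> (e k)))"
proof -
  have "\<alpha> v = (\<Sum>i\<in>UNIV. v $ i *\<^sub>R \<alpha> (axis i 1))" for v
  proof -
    have "\<alpha> v = \<alpha> (\<Sum>i\<in>UNIV. v $ i *\<^sub>R axis i 1)"
      using basis_expansion[of v] by (simp add: scalar_mult_eq_scaleR)
    then show ?thesis by (simp add: linear_sum[OF \<alpha>(1)] linear_scale[OF \<alpha>(1)])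
  qed
  note ex = this
  have aE: "\<alpha> v \<in> E" for v using \<alpha>(2) by auto
  have "h (\<alpha> v) (\<alpha> v) = (\<Sum>i\<in>UNIV. \<Sum>j\<in>UNIV. v $ i * v $ j * h (\<alpha> (axis i 1)) (\<alpha> (axis j 1)))" for v
  proof -
    have "h (\<alpha> v) (\<alpha> v) = h (\<Sum>i\<in>UNIV. v $ i *\<^sub>R \<alpha> (axis i 1)) (\<Sum>i\<in>UNIV. v $ i *\<^sub>R \<alpha> (axis i 1))"
      using ex[of v] by simp
    also have "\<dots> = (\<Sum>i\<in>UNIV. v $ i * h (\<alpha> (axis i 1)) (\<Sum>i\<in>UNIV. v $ i *\<^sub>R \<alpha> (axis i 1)))"
      by (rule inner_product_on_sum_left[OF h]) (auto intro!: subspace_sum subspace_scale h aE)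
    also have "\<dots> = (\<Sum>i\<in>UNIV. v $ i * (\<Sum>j\<in>UNIV. v $ j * h (\<alpha> (axis i 1)) (\<alpha> (axis j 1))))"
      by (intro sum.cong arg_cong2[where f="(*)"] inner_product_on_sum_right[OF h]) (auto simp: aE)
    finally show ?thesis by (simp add: sum_distrib_left mult.assoc)
  qed
  then have "(\<Sum>k\<in>UNIV. h (\<alpha> (e k)) (\<alpha> (e k))) =
      (\<Sum>k\<in>UNIV. \<Sum>i\<in>UNIV. \<Sum>j\<in>UNIV. e k $ i * e k $ j * h (\<alpha> (axis i 1)) (\<alpha> (axis j 1)))"
    by simp
  also have "\<dots> = (\<Sum>i\<in>UNIV. \<Sum>k\<in>UNIV. \<Sum>j\<in>UNIV. e k $ i * e k $ j * h (\<alpha> (axis i 1)) (\<alpha> (axis j 1)))"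
    by (rule sum.swap)
  also have "\<dots> = (\<Sum>i\<in>UNIV. \<Sum>j\<in>UNIV. \<Sum>k\<in>UNIV. e k $ i * e k $ j * h (\<alpha> (axis i 1)) (\<alpha> (axis j 1)))"
    by (intro sum.cong refl sum.swap)
  finally show ?thesis
    by (simp add: gram_orthonormal(3)[OF b e] matrix_matrix_mult_def transpose_def sum_distrib_right)
qed

text \<open>Expresses the entries by determinants, from which continuity of the inverse is
  immediate.\<close>

lemma matrix_inv_cramer:
  fixes A :: "real^'n^'n::finite"
  assumes "det A \<noteq> 0"
  shows "matrix_inv A $ i $ j = det (\<chi> k l. if l = i then axis j 1 $ k else A $ k $ l) / det A"
proof -
  have "invertible A" using assms by (simp add: invertible_det_nz)
  then have "A ** matrix_inv A = mat 1" 
    unfolding invertible_def matrix_inv_def by (rule someI_ex[THEN conjunct1])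
  then have "A *v (matrix_inv A *v axis j 1) = axis j 1" by (simp add: matrix_vector_mul_assoc)
  then have "matrix_inv A *v axis j 1 = (\<chi> m. det (\<chi> k l. if l = m then axis j 1 $ k else A $ k $ l) / det A)"
    using cramer[OF assms] by blast
  moreover have "(matrix_inv A *v axis j 1) $ i = matrix_inv A $ i $ j"
    by (simp add: matrix_vector_mult_basis column_def)
  ultimately show ?thesis by simp
qed

lemma continuous_on_det:
  fixes A :: "'a::topological_space \<Rightarrow> real^'n^'n::finite"
  assumes "\<And>i j. continuous_on S (\<lambda>x. A x $ i $ j)" shows "continuous_on S (\<lambda>x. det (A x))"
  unfolding det_def by (intro continuous_intros assms)

lemma continuous_on_matrix_inv:
  fixes A :: "'a::topological_space \<Rightarrow> real^'n^'n::finite"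
  assumes "\<And>i j. continuous_on S (\<lambda>x. A x $ i $ j)" "\<And>x. x \<in> S \<Longrightarrow> det (A x) \<noteq> 0"
  shows "continuous_on S (\<lambda>x. matrix_inv (A x) $ i $ j)"
proof -
  have "continuous_on S (\<lambda>x. det (\<chi> k l. if l = i then axis j 1 $ k else A x $ k $ l) / det (A x))"
  proof (intro continuous_on_divide continuous_on_det)
    fix k l
    show "continuous_on S (\<lambda>x. (\<chi> k l. if l = i then axis j 1 $ k else A x $ k $ l) $ k $ l)"
      using assms(1) by (cases "l = i") auto
  qed (use assms in auto)
  then show ?thesis by (rule continuous_on_eq) (simp add: matrix_inv_cramer assms(2))
qed

context riem
begin

lemma inner_product_rmetric: "inner_product_on UNIV (rmetric M x)"
  using riemannian by (simp add: riemannian_manifold_def)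

text \<open>\<open>rmetric\<close> refers to the preferred charts, which jump from point to point.
  In the components of one chart the metric depends smoothly on the point.\<close>

definition chart_metric :: "('m, 'n) chart \<Rightarrow> 'm \<Rightarrow> real^'n \<Rightarrow> real^'n \<Rightarrow> real" where
  "chart_metric c x v w = rmetric M x (coord_vec M c x v) (coord_vec M c x w)"

lemma gram_eq: "gram M c x = (\<chi> i j. chart_metric c x (axis i 1) (axis j 1))"
  by (simp add: gram_def chart_metric_def)

lemma coord_vec_eq_0:
  assumes "c \<in> atlas M" "x \<in> fst c" "coord_vec M c x v = 0" shows "v = 0"
proof -
  have "surj (coord_vec M c x)" using coord_vec_surj[OF assms(1,2)] by (metis surjI)
  then have "inj (coord_vec M c x)"
    using linear_surjective_imp_injective[OF linear_coord_vec[OF assms(1,2)]] by simp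
  then show ?thesis
    using assms(3) linear_0[OF linear_coord_vec[OF assms(1,2)]] by (metis injD)
qed

lemma inner_product_chart_metric:
  assumes "c \<in> atlas M" "x \<in> fst c" shows "inner_product_on UNIV (chart_metric c x)"
proof -
  have "coord_vec M c x v \<noteq> 0" if "v \<noteq> 0" for v using coord_vec_eq_0[OF assms] that by blast
  then show ?thesis
    unfolding inner_product_on_def[of _ "chart_metric c x"] chart_metric_def
    using inner_product_on_sym[OF inner_product_rmetric, of _ _ x]
      inner_product_on_lincomb[OF inner_product_rmetric, of _ _ _ x]
      inner_product_on_pos[OF inner_product_rmetric, of _ x]
    by (simp add: linear_add[OF linear_coord_vec[OF assms]] linear_scale[OF linear_coord_vec[OF assms]])
qed

lemma smooth_fun_on_chart_metric:
  "c \<in> atlas M \<Longrightarrow> smooth_fun_on M (fst c) (\<lambda>x. chart_metric c x v w)"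
  using riemannian by (simp add: riemannian_manifold_def chart_metric_def)

lemma continuous_on_gram: "c \<in> atlas M \<Longrightarrow> continuous_on (fst c) (\<lambda>x. gram M c x $ i $ j)"
  using smooth_fun_on_continuous_on[OF open_chart_domain smooth_fun_on_chart_metric]
  by (simp add: gram_eq)

lemma det_gram_pos: "c \<in> atlas M \<Longrightarrow> x \<in> fst c \<Longrightarrow> 0 < det (gram M c x)"
  using orthonormal_basis_exists[OF inner_product_chart_metric]
    gram_orthonormal(2)[OF inner_product_chart_metric] unfolding gram_eq by metis

lemma continuous_on_gram_inv:
  "c \<in> atlas M \<Longrightarrow> continuous_on (fst c) (\<lambda>x. matrix_inv (gram M c x) $ i $ j)"
  by (rule continuous_on_matrix_inv) (auto simp: continuous_on_gram less_imp_neq[OF det_gram_pos, symmetric])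

lemma chart_metric_change:
  assumes "c \<in> atlas M" "c' \<in> atlas M" "x \<in> fst c" "x \<in> fst c'"
  shows "chart_metric c x v w = chart_metric c' x (chart_deriv c (snd c') x v) (chart_deriv c (snd c') x w)"
  by (simp add: chart_metric_def coord_vec_change[OF assms])

text \<open>In matrices, G = J^T G' J with the Jacobian J. The square root of the determinant
  therefore picks up |det J|, exactly the factor of the change of variables formula.\<close>

lemma det_gram_change:
  assumes "c \<in> atlas M" "c' \<in> atlas M" "x \<in> fst c" "x \<in> fst c'"
  shows "det (gram M c x) = (det (matrix (chart_deriv c (snd c') x)))\<^sup>2 * det (gram M c' x)"
proof -
  let ?J = "chart_deriv c (snd c') x"
  have "gram M c x = transpose (matrix ?J) ** (gram M c' x ** matrix ?J)"
  proof (simp add: vec_eq_iff, intro allI)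
    fix i j
    have "gram M c x $ i $ j = chart_metric c' x (?J (axis i 1)) (?J (axis j 1))"
      by (simp add: gram_eq chart_metric_change[OF assms])
    also have "\<dots> = (\<Sum>k\<in>UNIV. \<Sum>l\<in>UNIV. ?J (axis i 1) $ k * ?J (axis j 1) $ l * gram M c' x $ k $ l)"
      by (subst inner_product_expand[OF inner_product_chart_metric[OF assms(2,4)]]) (simp add: gram_eq)
    also have "\<dots> = (transpose (matrix ?J) ** (gram M c' x ** matrix ?J)) $ i $ j"
      by (simp add: double_sum_matrix[of "\<lambda>i. ?J (axis i 1)"] matrix_def)
    finally show "gram M c x $ i $ j = (transpose (matrix ?J) ** (gram M c' x ** matrix ?J)) $ i $ j" .
  qed
  then show ?thesis by (simp add: det_mul det_transpose power2_eq_square mult_ac)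
qed

lemma form_sq_orthonormal:
  fixes e :: "'n \<Rightarrow> real^'n"
  assumes "\<And>i j. rmetric M x (e i) (e j) = (if i = j then 1 else 0)"
    and "linear (\<alpha> x)" "range (\<alpha> x) \<subseteq> fibre V x" "inner_product_on (fibre V x) (fmetric V x)" "subspace (fibre V x)"
  shows "form_sq M V \<alpha> x = (\<Sum>k\<in>UNIV. fmetric V x (\<alpha> x (e k)) (\<alpha> x (e k)))"
  unfolding form_sq_def Let_def by (rule gram_inverse_sum[OF inner_product_rmetric assms])

text \<open>\<open>form_sq\<close> uses the standard basis of the preferred chart at each point, in
  which no continuity can be expected. That expression and the one in the frame of \<open>c\<close>
  both equal the sum over an orthonormal frame, so one chart may be fixed when measurability or
  continuity is at stake.\<close>

lemma form_sq_chart: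
  assumes c: "c \<in> atlas M" "x \<in> fst c"
    and \<alpha>: "linear (\<alpha> x)" "range (\<alpha> x) \<subseteq> fibre V x"
    and h: "inner_product_on (fibre V x) (fmetric V x)" "subspace (fibre V x)"
  shows "form_sq M V \<alpha> x = (\<Sum>i\<in>UNIV. \<Sum>j\<in>UNIV. matrix_inv (gram M c x) $ i $ j *
    fmetric V x (\<alpha> x (coord_vec M c x (axis i 1))) (\<alpha> x (coord_vec M c x (axis j 1))))"
proof -
  obtain e :: "'n \<Rightarrow> real^'n" where e: "\<And>i j. chart_metric c x (e i) (e j) = (if i = j then 1 else 0)"
    using orthonormal_basis_exists[OF inner_product_chart_metric[OF c]] by metis
  have lin: "linear (\<alpha> x \<circ> coord_vec M c x)" by (intro linear_compose linear_coord_vec c \<alpha>)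
  have "form_sq M V \<alpha> x = (\<Sum>k\<in>UNIV. fmetric V x (\<alpha> x (coord_vec M c x (e k))) (\<alpha> x (coord_vec M c x (e k))))"
    by (rule form_sq_orthonormal) (use e \<alpha> h in \<open>auto simp: chart_metric_def\<close>)
  also have "\<dots> = (\<Sum>i\<in>UNIV. \<Sum>j\<in>UNIV. matrix_inv (gram M c x) $ i $ j *
    fmetric V x ((\<alpha> x \<circ> coord_vec M c x) (axis i 1)) ((\<alpha> x \<circ> coord_vec M c x) (axis j 1)))"
    unfolding gram_eq by (subst gram_inverse_sum[OF inner_product_chart_metric[OF c] e lin _ h]) (use \<alpha> in auto)
  finally show ?thesis by simp
qed

end

section \<open>The change of variables formula\<close>

text \<open>The library states the change of variables formula for well-ordered index types only; the
  following copy of a finite type carries an arbitrary well-order.\<close>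

typedef 'a wo_copy = "UNIV :: 'a set" by simp

definition wo_rank :: "'a::finite wo_copy \<Rightarrow> nat" where
  "wo_rank x = (SOME f :: 'a \<Rightarrow> nat. inj f) (Rep_wo_copy x)"

lemma inj_wo_rank: "inj (wo_rank :: 'a::finite wo_copy \<Rightarrow> nat)"
proof -
  have "\<exists>f :: 'a \<Rightarrow> nat. inj f" using finite_imp_inj_to_nat_seg[OF finite, of "UNIV :: 'a set"] by blast
  then have "inj (SOME f :: 'a \<Rightarrow> nat. inj f)" by (rule someI_ex[of inj])
  then show ?thesis
    by (intro injI) (metis Rep_wo_copy_inject injD wo_rank_def)
qed

instantiation wo_copy :: (finite) "{finite, wellorder}"
begin

definition less_eq_wo_copy :: "'a wo_copy \<Rightarrow> 'a wo_copy \<Rightarrow> bool" where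
  "less_eq_wo_copy x y \<longleftrightarrow> wo_rank x \<le> wo_rank y"

definition less_wo_copy :: "'a wo_copy \<Rightarrow> 'a wo_copy \<Rightarrow> bool" where
  "less_wo_copy x y \<longleftrightarrow> wo_rank x < wo_rank y"

instance
proof
  have "(UNIV :: 'a wo_copy set) = Abs_wo_copy ` UNIV"
    by (rule type_definition.univ[OF type_definition_wo_copy])
  then show "finite (UNIV :: 'a wo_copy set)" by (metis finite finite_imageI)
  fix x y :: "'a wo_copy"
  show "x \<le> y \<Longrightarrow> y \<le> x \<Longrightarrow> x = y"
    using inj_wo_rank by (auto simp: less_eq_wo_copy_def dest: injD)
  fix P :: "'a wo_copy \<Rightarrow> bool" and a :: "'a wo_copy"
  assume IH: "\<And>x. (\<And>y. y < x \<Longrightarrow> P y) \<Longrightarrow> P x"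
  show "P a"
    by (induction a rule: measure_induct_rule[of wo_rank]) (use IH in \<open>simp add: less_wo_copy_def\<close>)
qed (auto simp: less_eq_wo_copy_def less_wo_copy_def)

end

lemma bij_Rep_wo_copy: "bij (Rep_wo_copy :: 'a wo_copy \<Rightarrow> 'a)"
  by (rule bijI') (auto simp: Rep_wo_copy_inject intro: Abs_wo_copy_inverse[symmetric])

definition wo_vec :: "real^'n \<Rightarrow> real^'n wo_copy" where
  "wo_vec v = (\<chi> i. v $ Rep_wo_copy i)"

definition unwo_vec :: "real^'n wo_copy \<Rightarrow> real^'n::finite" where
  "unwo_vec v = (\<chi> i. v $ Abs_wo_copy i)"

lemma wo_vec_inverse: "unwo_vec (wo_vec v) = v" "wo_vec (unwo_vec w) = w"
  by (simp_all add: wo_vec_def unwo_vec_def vec_eq_iff Rep_wo_copy_inverse Abs_wo_copy_inverse)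

lemma linear_wo_vec: "linear wo_vec" "linear unwo_vec"
  by (auto simp: linear_iff wo_vec_def unwo_vec_def vec_eq_iff)

lemma measurable_wo_vec: "wo_vec \<in> borel_measurable borel" "unwo_vec \<in> borel_measurable borel"
  by (auto intro!: borel_measurable_continuous_onI linear_continuous_on linear_wo_vec
      simp: linear_conv_bounded_linear[symmetric])

text \<open>Lebesgue measure is determined by boxes, and relabelling the coordinates only permutes
  the factors in the volume of a box.\<close>

lemma distr_wo_vec: "distr lborel borel wo_vec = (lborel :: (real^'n::finite wo_copy) measure)"
proof (rule lborel_eqI[symmetric])
  fix l u :: "real^'n wo_copy" assume le: "\<And>b. b \<in> Basis \<Longrightarrow> l \<bullet> b \<le> u \<bullet> b"
  have le': "l $ i \<le> u $ i" for i using le[of "axis i 1"] by (simp add: axis_in_Basis_iff inner_axis)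
  have vim: "wo_vec -` box l u \<inter> space lborel = box (unwo_vec l) (unwo_vec u)"
  proof -
    have "(\<forall>i. P i) \<longleftrightarrow> (\<forall>j. P (Abs_wo_copy j))" for P :: "'n wo_copy \<Rightarrow> bool"
      by (metis Rep_wo_copy_inverse)
    then show ?thesis
      by (simp add: set_eq_iff mem_box_cart wo_vec_def unwo_vec_def Abs_wo_copy_inverse)
  qed
  have "emeasure (distr lborel borel wo_vec) (box l u) = emeasure lborel (box (unwo_vec l) (unwo_vec u))"
    by (subst emeasure_distr) (use measurable_wo_vec vim in auto)
  also have "\<dots> = (\<Prod>b\<in>Basis. (unwo_vec u - unwo_vec l) \<bullet> b)"
    by (rule emeasure_lborel_box) (use le' in \<open>auto simp: Basis_vec_def inner_axis unwo_vec_def\<close>)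
  also have "(\<Prod>b\<in>Basis. (unwo_vec u - unwo_vec l) \<bullet> b) = (\<Prod>i\<in>UNIV. (unwo_vec u - unwo_vec l) $ i)"
    by (simp add: Basis_vec_def prod.UNION_disjoint inner_axis axis_eq_axis UNION_singleton_eq_range prod.reindex inj_on_def)
  also have "\<dots> = (\<Prod>i\<in>UNIV. (u - l) $ i)"
    using prod.reindex_bij_betw[OF bij_Rep_wo_copy, of "\<lambda>j. (unwo_vec u - unwo_vec l) $ j"]
    by (simp add: unwo_vec_def Rep_wo_copy_inverse)
  also have "\<dots> = (\<Prod>b\<in>Basis. (u - l) \<bullet> b)"
    by (simp add: Basis_vec_def prod.UNION_disjoint inner_axis axis_eq_axis UNION_singleton_eq_range prod.reindex inj_on_def)
  finally show "emeasure (distr lborel borel wo_vec) (box l u) = (\<Prod>b\<in>Basis. (u - l) \<bullet> b)" .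
qed simp

lemma nn_integral_wo_vec:
  "f \<in> borel_measurable borel \<Longrightarrow> (\<integral>\<^sup>+w. f w \<partial>lborel) = (\<integral>\<^sup>+v. f (wo_vec v) \<partial>lborel)"
  by (subst distr_wo_vec[symmetric]) (simp add: nn_integral_distr measurable_wo_vec)

text \<open>In the Leibniz formula, relabelling the index type conjugates the permutations by a
  bijection, which preserves their signs.\<close>

lemma det_wo_vec:
  fixes J :: "real^'n \<Rightarrow> real^'n::finite"
  shows "det (matrix (wo_vec \<circ> J \<circ> unwo_vec)) = det (matrix J)"
proof -
  let ?A = "matrix J" and ?R = "Rep_wo_copy :: 'n wo_copy \<Rightarrow> 'n"
  have "unwo_vec (axis i 1) = axis (?R i) 1" for i
    by (auto simp: unwo_vec_def axis_def vec_eq_iff Abs_wo_copy_inject Rep_wo_copy_inverse Abs_wo_copy_inverse)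
  then have A: "matrix (wo_vec \<circ> J \<circ> unwo_vec) = (\<chi> i j. ?A $ ?R i $ ?R j)"
    by (simp add: matrix_def wo_vec_def)
  let ?mp = "map_permutation UNIV (Abs_wo_copy :: 'n \<Rightarrow> 'n wo_copy)"
  have bR: "bij ?R" and bA: "bij (Abs_wo_copy :: 'n \<Rightarrow> 'n wo_copy)"
    using bij_Rep_wo_copy by (auto intro!: bijI' simp: Abs_wo_copy_inject intro: Rep_wo_copy_inverse[symmetric])
  have mp: "?mp p i = Abs_wo_copy (p (?R i))" for p i
  proof -
    have "inv_into UNIV Abs_wo_copy i = ?R i"
      using bA by (metis Rep_wo_copy_inverse bij_inv_eq_iff)
    moreover have "range (Abs_wo_copy :: 'n \<Rightarrow> 'n wo_copy) = UNIV" using bA by (simp add: bij_is_surj)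
    ultimately show ?thesis by (simp add: map_permutation_def restrict_id_def)
  qed
  have "det (matrix J) = (\<Sum>p | p permutes UNIV. of_int (sign p) * (\<Prod>j\<in>UNIV. ?A $ j $ p j))"
    by (simp add: det_def)
  also have "\<dots> = (\<Sum>q | q permutes UNIV. of_int (sign q) * (\<Prod>i\<in>UNIV. ?A $ ?R i $ ?R (q i)))"
  proof (rule sum.reindex_bij_witness[where j="?mp" and i="map_permutation UNIV ?R"])
    fix p :: "'n \<Rightarrow> 'n" assume p: "p \<in> {p. p permutes UNIV}"
    show "map_permutation UNIV ?R (?mp p) = p"
      by (rule map_permutation_compose_inv[OF bA]) (use p in \<open>auto simp: Abs_wo_copy_inverse\<close>)
    show "?mp p \<in> {q. q permutes UNIV}" using map_permutation_permutes[OF bA] p by simp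
    have "sign (?mp p) = sign p"
      by (rule sign_map_permutation) (use p bA in \<open>auto simp: bij_is_inj\<close>)
    moreover have "(\<Prod>i\<in>UNIV. ?A $ ?R i $ ?R (?mp p i)) = (\<Prod>j\<in>UNIV. ?A $ j $ p j)"
      by (simp add: mp Abs_wo_copy_inverse prod.reindex_bij_betw[OF bR, of "\<lambda>j. ?A $ j $ p j"])
    ultimately show "of_int (sign (?mp p)) * (\<Prod>i\<in>UNIV. ?A $ ?R i $ ?R (?mp p i)) =
        of_int (sign p) * (\<Prod>j\<in>UNIV. ?A $ j $ p j)" by simp
  next
    fix q :: "'n wo_copy \<Rightarrow> 'n wo_copy" assume q: "q \<in> {q. q permutes UNIV}"
    show "?mp (map_permutation UNIV ?R q) = q"
      by (rule map_permutation_compose_inv[OF bR]) (use q in \<open>auto simp: Rep_wo_copy_inverse\<close>)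
    show "map_permutation UNIV ?R q \<in> {p. p permutes UNIV}"
      using map_permutation_permutes[OF bR] q by simp
  qed
  finally show ?thesis unfolding A by (simp add: det_def)
qed

text \<open>If one of the two sides is finite, the function on that side is integrable, and the
  formula for absolutely integrable functions gives equality. Otherwise both sides are
  infinite.\<close>

lemma nn_integral_change_of_variables_wo:
  fixes g :: "real^'n::{finite,wellorder} \<Rightarrow> real^'n::_" and h :: "real^'n::_ \<Rightarrow> real"
  assumes S: "S \<in> sets borel" and g: "\<And>x. x \<in> S \<Longrightarrow> (g has_derivative g' x) (at x)" "inj_on g S"
    and h: "\<And>y. 0 \<le> h y"
    and mS: "(\<lambda>x. \<bar>det (matrix (g' x))\<bar> * h (g x) * indicator S x) \<in> borel_measurable borel"
    and mT: "(\<lambda>y. h y * indicator (g ` S) y) \<in> borel_measurable borel"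
  shows "(\<integral>\<^sup>+x. ennreal (\<bar>det (matrix (g' x))\<bar> * h (g x)) * indicator S x \<partial>lborel) =
    (\<integral>\<^sup>+y. ennreal (h y) * indicator (g ` S) y \<partial>lborel)"
proof -
  let ?H = "\<lambda>x. \<bar>det (matrix (g' x))\<bar> * h (g x)"
  have cov: "(?H has_integral b) S \<longleftrightarrow> (h has_integral b) (g ` S)" for b
  proof -
    have "S \<in> sets lebesgue" using S by auto
    \<comment> \<open>The formula for absolutely integrable functions concerns vector values, so
      \<open>h\<close> is viewed as a function into \<open>real^1\<close>.\<close>
    note * = has_absolute_integral_change_of_variables[OF this has_derivative_at_withinI[OF g(1)] g(2),
        of "\<lambda>y. vec (h y) :: real^1" "vec b"]
    have "(\<lambda>x. \<bar>det (matrix (g' x))\<bar> *\<^sub>R vec (h (g x)) :: real^1) = (\<lambda>x. vec (?H x))"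
      by (auto simp: vec_eq_iff)
    with * have "?H absolutely_integrable_on S \<and> integral S ?H = b \<longleftrightarrow>
        h absolutely_integrable_on g ` S \<and> integral (g ` S) h = b"
      unfolding absolutely_integrable_on_1_iff integral_on_1_eq by (simp add: vec_eq_iff)
    then show ?thesis
      using h by (simp add: absolutely_integrable_on_iff_nonneg has_integral_iff)
  qed
  have *: "(f has_integral r) T"
    if "(\<lambda>x. f x * indicator T x) \<in> borel_measurable borel" "\<And>x. 0 \<le> f x"
      "(\<integral>\<^sup>+x. ennreal (f x) * indicator T x \<partial>lborel) = ennreal r" "0 \<le> r"
    for f :: "real^'n::_ \<Rightarrow> real" and T r
  proof -
    have "(\<integral>\<^sup>+x. ennreal (f x * indicator T x) \<partial>lborel) = ennreal r"
      unfolding that(3)[symmetric] by (intro nn_integral_cong) (auto split: split_indicator)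
    then have "((\<lambda>x. f x * indicator T x) has_integral r) UNIV"
      by (intro nn_integral_has_integral that) (use that(2) in auto)
    moreover have "(\<lambda>x. f x * indicator T x) = (\<lambda>x. if x \<in> T then f x else 0)" by (auto split: split_indicator)
    ultimately show ?thesis by (simp add: has_integral_restrict_UNIV)
  qed
  have Hn: "0 \<le> ?H x" for x using h by simp
  show ?thesis
  proof (cases "(\<integral>\<^sup>+x. ennreal (?H x) * indicator S x \<partial>lborel)" rule: ennreal_cases)
    case (real r)
    have "(h has_integral r) (g ` S)"
      using *[OF mS Hn real(2,1)] cov by blast
    then show ?thesis using nn_integral_has_integral_lebesgue'[of "g ` S" h r] h real by simp
  next
    case top
    show ?thesis
    proof (cases "(\<integral>\<^sup>+y. ennreal (h y) * indicator (g ` S) y \<partial>lborel)" rule: ennreal_cases)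
      case (real r)
      have "(?H has_integral r) S"
        using *[OF mT h real(2,1)] cov by blast
      then show ?thesis using nn_integral_has_integral_lebesgue'[of S ?H r] Hn real by simp
    qed (use top in simp)
  qed
qed

lemma nn_integral_change_of_variables:
  fixes g :: "real^'n::finite \<Rightarrow> real^'n" and h :: "real^'n \<Rightarrow> real"
  assumes S: "S \<in> sets borel" and g: "\<And>x. x \<in> S \<Longrightarrow> (g has_derivative g' x) (at x)" "inj_on g S"
    and h: "\<And>y. 0 \<le> h y"
    and mS: "(\<lambda>x. \<bar>det (matrix (g' x))\<bar> * h (g x) * indicator S x) \<in> borel_measurable borel"
    and mT: "(\<lambda>y. h y * indicator (g ` S) y) \<in> borel_measurable borel"
  shows "(\<integral>\<^sup>+x. ennreal (\<bar>det (matrix (g' x))\<bar> * h (g x)) * indicator S x \<partial>lborel) =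
    (\<integral>\<^sup>+y. ennreal (h y) * indicator (g ` S) y \<partial>lborel)"
proof -
  \<comment> \<open>The map is conjugated by the relabelling of coordinates, which changes neither
    Lebesgue integrals nor determinants.\<close>
  let ?g = "wo_vec \<circ> g \<circ> unwo_vec" and ?g' = "\<lambda>w. wo_vec \<circ> g' (unwo_vec w) \<circ> unwo_vec"
  let ?S = "unwo_vec -` S" and ?h = "h \<circ> unwo_vec"
  have indS: "indicator ?S w = indicator S (unwo_vec w)" for w by (auto split: split_indicator)
  have im: "?g ` ?S = unwo_vec -` (g ` S)"
  proof (intro equalityI subsetI)
    fix w assume "w \<in> unwo_vec -` (g ` S)"
    then obtain s where "s \<in> S" "unwo_vec w = g s" by auto
    then have "wo_vec s \<in> ?S" "w = ?g (wo_vec s)" by (auto simp: wo_vec_inverse) (metis wo_vec_inverse(2))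
    then show "w \<in> ?g ` ?S" by blast
  qed (auto simp: wo_vec_inverse)
  have mem: "g x \<in> g ` S" if "x \<in> S" for x using that by blast
  have 1: "(\<lambda>w. \<bar>det (matrix (?g' w))\<bar> * ?h (?g w) * indicator ?S w) \<in> borel_measurable borel"
    using measurable_compose[OF measurable_wo_vec(2) mS] by (simp add: det_wo_vec indS wo_vec_inverse)
  have 2: "(\<lambda>w. ?h w * indicator (?g ` ?S) w) \<in> borel_measurable borel"
    using measurable_compose[OF measurable_wo_vec(2) mT] unfolding im
    by (simp add: indicator_def)
  have "(\<integral>\<^sup>+w. ennreal (\<bar>det (matrix (?g' w))\<bar> * ?h (?g w)) * indicator ?S w \<partial>lborel) =
    (\<integral>\<^sup>+w. ennreal (?h w) * indicator (?g ` ?S) w \<partial>lborel)"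
  proof (rule nn_integral_change_of_variables_wo[OF _ _ _ _ 1 2])
    show "?S \<in> sets borel" using measurable_sets_borel[OF measurable_wo_vec(2) S] by simp
    show "inj_on ?g ?S"
    proof (rule inj_onI)
      fix v w assume vw: "v \<in> ?S" "w \<in> ?S" "?g v = ?g w"
      then have "g (unwo_vec v) = g (unwo_vec w)"
        by (metis comp_apply wo_vec_inverse(1))
      then have "unwo_vec v = unwo_vec w" using vw g(2) by (auto dest: inj_onD)
      then show "v = w" by (metis wo_vec_inverse(2))
    qed
    show "(?g has_derivative ?g' w) (at w)" if "w \<in> ?S" for w
    proof -
      have wo: "(wo_vec has_derivative wo_vec) F" "(unwo_vec has_derivative unwo_vec) F'" for F F'
        using linear_wo_vec by (auto intro!: bounded_linear.has_derivative[OF _ has_derivative_ident]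
            simp: linear_conv_bounded_linear)
      have "(g has_derivative g' (unwo_vec w)) (at (unwo_vec w))" using g(1) that by simp
      from diff_chain_at[OF wo(2) diff_chain_at[OF this wo(1)]] show ?thesis .
    qed
  qed (use h in auto)
  moreover have "(\<integral>\<^sup>+w. ennreal (\<bar>det (matrix (?g' w))\<bar> * ?h (?g w)) * indicator ?S w \<partial>lborel) =
    (\<integral>\<^sup>+x. ennreal (\<bar>det (matrix (g' x))\<bar> * h (g x)) * indicator S x \<partial>lborel)"
  proof (subst nn_integral_wo_vec)
    have "(\<lambda>w. ennreal (\<bar>det (matrix (?g' w))\<bar> * ?h (?g w) * indicator ?S w)) \<in> borel_measurable borel"
      using 1 by measurable
    then show "(\<lambda>w. ennreal (\<bar>det (matrix (?g' w))\<bar> * ?h (?g w)) * indicator ?S w) \<in> borel_measurable borel"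
      by (rule measurable_cong[THEN iffD1, rotated]) (auto split: split_indicator)
  qed (simp add: det_wo_vec wo_vec_inverse indicator_def)
  moreover have "(\<integral>\<^sup>+w. ennreal (?h w) * indicator (?g ` ?S) w \<partial>lborel) = (\<integral>\<^sup>+y. ennreal (h y) * indicator (g ` S) y \<partial>lborel)"
  proof (subst nn_integral_wo_vec)
    have "(\<lambda>w. ennreal (?h w * indicator (?g ` ?S) w)) \<in> borel_measurable borel"
      using 2 by measurable
    then show "(\<lambda>w. ennreal (?h w) * indicator (?g ` ?S) w) \<in> borel_measurable borel"
      by (rule measurable_cong[THEN iffD1, rotated]) (auto split: split_indicator)
  qed (simp only: im, simp add: indicator_def wo_vec_inverse)
  ultimately show ?thesis by simp
qed

section \<open>The volume measure\<close>

context riem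
begin

definition chart_density :: "('m, 'n) chart \<Rightarrow> real^'n \<Rightarrow> real" where
  "chart_density c p = sqrt (det (gram M c (chart_inv c p)))"

definition chart_volume :: "('m, 'n) chart \<Rightarrow> 'm set \<Rightarrow> ennreal" where
  "chart_volume c B = (\<integral>\<^sup>+p. ennreal (chart_density c p) * indicator (snd c ` B) p \<partial>lborel)"

lemma borel_chart_image:
  assumes c: "c \<in> atlas M" and B: "B \<in> sets borel" "B \<subseteq> fst c"
  shows "snd c ` B \<in> sets borel"
proof -
  have "chart_inv c -` B \<inter> space (restrict_space borel (snd c ` fst c)) \<in> sets (restrict_space borel (snd c ` fst c))"
    by (rule measurable_sets[OF borel_measurable_continuous_on_restrict[OF continuous_on_chart_inv[OF c]] B(1)])
  moreover have "snd c ` B = chart_inv c -` B \<inter> space (restrict_space borel (snd c ` fst c))"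
    using chart_image_eq_vimage[OF c, of B] B(2) by (auto simp: space_restrict_space Int_absorb2)
  ultimately show ?thesis
    using open_chart_range[OF c] by (simp add: sets_restrict_space_iff)
qed

lemma continuous_on_chart_density:
  assumes "c \<in> atlas M" shows "continuous_on (snd c ` fst c) (chart_density c)"
proof -
  have "continuous_on (fst c) (\<lambda>x. sqrt (det (gram M c x)))"
    by (intro continuous_on_real_sqrt continuous_on_det continuous_on_gram assms)
  then show ?thesis unfolding chart_density_def
    by (rule continuous_on_compose2[OF _ continuous_on_chart_inv[OF assms]])
      (intro image_subsetI chart_inv_mem)
qed

lemma chart_density_measurable:
  assumes c: "c \<in> atlas M" and B: "B \<in> sets borel" "B \<subseteq> fst c"
  shows "(\<lambda>p. chart_density c p * indicator (snd c ` B) p) \<in> borel_measurable borel"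
proof -
  have "snd c ` B \<subseteq> snd c ` fst c" using B by blast
  from borel_measurable_continuous_on_indicator[OF borel_chart_image[OF assms]
      continuous_on_subset[OF continuous_on_chart_density[OF c] this]]
  show ?thesis by (simp add: mult.commute)
qed

lemma chart_density_ennreal_measurable:
  assumes "c \<in> atlas M" "B \<in> sets borel" "B \<subseteq> fst c"
  shows "(\<lambda>p. ennreal (chart_density c p) * indicator (snd c ` B) p) \<in> borel_measurable lborel"
proof -
  have "(\<lambda>p. ennreal (chart_density c p * indicator (snd c ` B) p)) \<in> borel_measurable lborel"
    using chart_density_measurable[OF assms] by measurable
  then show ?thesis by (rule measurable_cong[THEN iffD1, rotated]) (auto split: split_indicator)
qed

lemma chart_volume_UN:
  fixes B :: "nat \<Rightarrow> 'm set"
  assumes c: "c \<in> atlas M" and B: "\<And>n. B n \<in> sets borel" "\<And>n. B n \<subseteq> fst c" "disjoint_family B"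
  shows "chart_volume c (\<Union>n. B n) = (\<Sum>n. chart_volume c (B n))"
proof -
  have disj: "disjoint_family (\<lambda>n. snd c ` B n)"
    using B(3) inj_on_image_Int[OF inj_on_chart[OF c] B(2) B(2), symmetric]
    by (simp add: disjoint_family_on_def)
  have "chart_volume c (\<Union>n. B n) = (\<integral>\<^sup>+p. (\<Sum>n. ennreal (chart_density c p) * indicator (snd c ` B n) p) \<partial>lborel)"
    unfolding chart_volume_def image_UN
    by (intro nn_integral_cong) (simp add: suminf_indicator[OF disj, symmetric])
  also have "\<dots> = (\<Sum>n. chart_volume c (B n))"
    unfolding chart_volume_def by (rule nn_integral_suminf) (rule chart_density_ennreal_measurable[OF c B(1,2)])
  finally show ?thesis .
qed

lemma chart_volume_change:
  assumes c: "c \<in> atlas M" "c' \<in> atlas M" and B: "B \<in> sets borel" "B \<subseteq> fst c" "B \<subseteq> fst c'"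
  shows "chart_volume c B = chart_volume c' B"
proof -
  let ?g = "snd c' \<circ> chart_inv c" and ?g' = "\<lambda>p. chart_deriv c (snd c') (chart_inv c p)"
  \<comment> \<open>Outside the range of \<open>c'\<close> the expression
    \<open>chart_density\<close> has no meaning and could even be negative, since
    \<open>sqrt\<close> is negative on negative reals. It is replaced by 0 there because the change
    of variables formula wants \<open>h\<close> nonnegative everywhere.\<close>
  define h where "h q = (if q \<in> snd c' ` fst c' then chart_density c' q else 0)" for q
  have h0: "0 \<le> h q" for q
    using less_imp_le[OF det_gram_pos[OF c(2) chart_inv_mem]] by (simp add: h_def chart_density_def)
  have gx: "?g (snd c x) = snd c' x" if "x \<in> B" for x using that B chart_inv_chart[OF c(1)] by auto
  have im: "?g ` snd c ` B = snd c' ` B" using gx by (simp add: image_image)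
  \<comment> \<open>The square root of the squared Jacobian determinant in
    \<open>det_gram_change\<close> is its absolute value.\<close>
  have dens: "\<bar>det (matrix (?g' p))\<bar> * h (?g p) = chart_density c p" if p: "p \<in> snd c ` B" for p
  proof -
    from p obtain x where x: "x \<in> B" "p = snd c x" by auto
    then have x': "x \<in> fst c" "x \<in> fst c'" "chart_inv c p = x" "chart_inv c' (snd c' x) = x"
      using B chart_inv_chart c by auto
    then have "h (?g p) = sqrt (det (gram M c' x))"
      by (simp add: h_def chart_density_def)
    then show ?thesis
      unfolding chart_density_def using det_gram_change[OF c x'(1,2)] x'(3) by (simp add: real_sqrt_mult)
  qed
  have "(\<integral>\<^sup>+p. ennreal (\<bar>det (matrix (?g' p))\<bar> * h (?g p)) * indicator (snd c ` B) p \<partial>lborel) =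
      (\<integral>\<^sup>+q. ennreal (h q) * indicator (?g ` snd c ` B) q \<partial>lborel)"
  proof (rule nn_integral_change_of_variables[OF borel_chart_image[OF c(1) B(1,2)] _ _ h0])
    show "(?g has_derivative ?g' p) (at p)" if "p \<in> snd c ` B" for p
    proof -
      from that obtain x where x: "x \<in> B" "p = snd c x" by auto
      then have x': "x \<in> fst c" "x \<in> fst c'" "chart_inv c p = x" using B chart_inv_chart c by auto
      show ?thesis
        using differentiable_transition[OF c x'(1,2)] x(2) x'(3)
        by (simp add: chart_deriv_def frechet_derivative_works)
    qed
    show "inj_on ?g (snd c ` B)"
      using gx inj_on_chart[OF c(2)] B(3) by (auto simp: inj_on_def subset_iff)
    have "(\<lambda>p. \<bar>det (matrix (?g' p))\<bar> * h (?g p) * indicator (snd c ` B) p) = (\<lambda>p. chart_density c p * indicator (snd c ` B) p)"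
      by (rule ext) (use dens in \<open>simp split: split_indicator\<close>)
    then show "(\<lambda>p. \<bar>det (matrix (?g' p))\<bar> * h (?g p) * indicator (snd c ` B) p) \<in> borel_measurable borel"
      using chart_density_measurable[OF c(1) B(1,2)] by simp
    have "(\<lambda>q. h q * indicator (?g ` snd c ` B) q) = (\<lambda>q. chart_density c' q * indicator (snd c' ` B) q)"
    proof
      show "h q * indicator (?g ` snd c ` B) q = chart_density c' q * indicator (snd c' ` B) q" for q
        unfolding im using B(3) by (cases "q \<in> snd c' ` B") (auto simp: h_def)
    qed
    then show "(\<lambda>q. h q * indicator (?g ` snd c ` B) q) \<in> borel_measurable borel"
      using chart_density_measurable[OF c(2) B(1,3)] by simp
  qed
  moreover have "(\<integral>\<^sup>+p. ennreal (\<bar>det (matrix (?g' p))\<bar> * h (?g p)) * indicator (snd c ` B) p \<partial>lborel) = chart_volume c B"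
    unfolding chart_volume_def by (intro nn_integral_cong) (use dens in \<open>simp split: split_indicator\<close>)
  moreover have "(\<integral>\<^sup>+q. ennreal (h q) * indicator (?g ` snd c ` B) q \<partial>lborel) = chart_volume c' B"
    unfolding chart_volume_def im
    by (intro nn_integral_cong) (use B(3) in \<open>auto simp: h_def split: split_indicator\<close>)
  ultimately show ?thesis by simp
qed

section \<open>Existence and uniqueness of the volume measure; local finiteness\<close>

lemma countable_charts:
  obtains cs :: "nat \<Rightarrow> ('m, 'n) chart" where "\<And>i. cs i \<in> atlas M" "(\<Union>i. fst (cs i)) = UNIV"
proof -
  have "\<And>S. S \<in> fst ` atlas M \<Longrightarrow> open S" using open_chart_domain by auto
  from Lindelof[OF this] obtain \<F> where F: "\<F> \<subseteq> fst ` atlas M" "countable \<F>" "\<Union>\<F> = \<Union>(fst ` atlas M)" by metis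
  then obtain C where C: "C \<subseteq> atlas M" "countable C" "\<F> = fst ` C"
    using countable_subset_image[of \<F> fst "atlas M"] by blast
  have un: "\<Union>(fst ` C) = UNIV"
    using F(3) C(3) chart_at by blast
  then have "C \<noteq> {}" by auto
  show ?thesis
  proof (rule that[of "from_nat_into C"])
    show "from_nat_into C i \<in> atlas M" for i using C(1) from_nat_into[OF \<open>C \<noteq> {}\<close>] by blast
    have "range (from_nat_into C) = C" by (rule range_from_nat_into[OF \<open>C \<noteq> {}\<close> C(2)])
    then show "(\<Union>i. fst (from_nat_into C i)) = UNIV" using un by (metis image_image)
  qed
qed

definition is_volume :: "'m measure \<Rightarrow> bool" where
  "is_volume \<mu> \<longleftrightarrow> sets \<mu> = sets borel \<and>
    (\<forall>c\<in>atlas M. \<forall>B\<in>sets borel. B \<subseteq> fst c \<longrightarrow> emeasure \<mu> B = chart_volume c B)"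

text \<open>The manifold is cut into disjoint Borel pieces \<open>D i\<close>, each inside one of
  countably many charts, and the chart volumes of the pieces are added up. Since chart volumes agree
  on overlaps, the sum has the prescribed value in every chart of the atlas.\<close>

lemma is_volume_exists: "\<exists>\<mu>. is_volume \<mu>"
proof -
  obtain cs :: "nat \<Rightarrow> ('m, 'n) chart" where cs: "\<And>i. cs i \<in> atlas M" "(\<Union>i. fst (cs i)) = UNIV"
    using countable_charts by metis
  define D where "D = disjointed (\<lambda>i. fst (cs i))"
  have fb: "fst (cs i) \<in> sets borel" for i using open_chart_domain[OF cs(1)] by simp
  have Db: "D i \<in> sets borel" for i
    using sets.range_disjointed_sets[of "\<lambda>i. fst (cs i)" borel] fb unfolding D_def by auto
  have Ds: "D i \<subseteq> fst (cs i)" for i unfolding D_def by (rule disjointed_subset)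
  have Du: "(\<Union>i. D i) = UNIV" unfolding D_def UN_disjointed_eq by (rule cs(2))
  have Dd: "disjoint_family D" unfolding D_def by (rule disjoint_family_disjointed)
  define \<nu> where "\<nu> B = (\<Sum>i. chart_volume (cs i) (B \<inter> D i))" for B
  have ca: "countably_additive (sets borel) \<nu>"
  proof (rule countably_additiveI)
    fix B :: "nat \<Rightarrow> 'm set" assume B: "range B \<subseteq> sets borel" "disjoint_family B"
    have "\<nu> (\<Union>n. B n) = (\<Sum>i. \<Sum>n. chart_volume (cs i) (B n \<inter> D i))"
      unfolding \<nu>_def
    proof (intro arg_cong[where f=suminf] ext)
      fix i
      have "chart_volume (cs i) (\<Union>n. B n \<inter> D i) = (\<Sum>n. chart_volume (cs i) (B n \<inter> D i))"
        by (rule chart_volume_UN[OF cs(1)]) (use B Db in \<open>auto simp: disjoint_family_on_def dest: subsetD[OF Ds]\<close>)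
      then show "chart_volume (cs i) ((\<Union>n. B n) \<inter> D i) = (\<Sum>n. chart_volume (cs i) (B n \<inter> D i))"
        by (simp only: UN_extend_simps)
    qed
    \<comment> \<open>Reading the outer series as an integral over the counting measure permits the
      exchange of the two series.\<close>
    also have "\<dots> = (\<integral>\<^sup>+i. (\<Sum>n. chart_volume (cs i) (B n \<inter> D i)) \<partial>count_space UNIV)"
      by (simp add: nn_integral_count_space_nat)
    also have "\<dots> = (\<Sum>n. \<nu> (B n))"
      by (subst nn_integral_suminf) (auto simp: nn_integral_count_space_nat \<nu>_def)
    finally show "(\<Sum>n. \<nu> (B n)) = \<nu> (\<Union>n. B n)" by simp
  qed
  have pos: "positive (sets borel) \<nu>"
    by (auto simp: positive_def \<nu>_def chart_volume_def)
  define \<mu> where "\<mu> = measure_of UNIV (sets borel) \<nu>"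
  have sets: "sets \<mu> = sets borel"
    unfolding \<mu>_def using sets.sets_measure_of_eq[of borel] by simp
  have em: "emeasure \<mu> B = \<nu> B" if "B \<in> sets borel" for B
    unfolding \<mu>_def
    by (rule emeasure_measure_of_sigma[OF _ pos ca that]) (metis sets.sigma_algebra_axioms space_borel)
  have "emeasure \<mu> B = chart_volume c B" if c: "c \<in> atlas M" and B: "B \<in> sets borel" "B \<subseteq> fst c" for c B
  proof -
    have "emeasure \<mu> B = (\<Sum>i. chart_volume c (B \<inter> D i))"
      unfolding em[OF B(1)] \<nu>_def
    proof (intro arg_cong[where f=suminf] ext)
      show "chart_volume (cs i) (B \<inter> D i) = chart_volume c (B \<inter> D i)" for i
        by (rule chart_volume_change[OF cs(1) c]) (use B Db Ds in auto)
    qed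
    also have "\<dots> = chart_volume c (\<Union>i. B \<inter> D i)"
    proof (rule chart_volume_UN[symmetric, OF c])
      show "disjoint_family (\<lambda>i. B \<inter> D i)" using Dd unfolding disjoint_family_on_def by blast
    qed (use B Db in auto)
    also have "(\<Union>i. B \<inter> D i) = B" using Du by auto
    finally show ?thesis .
  qed
  then show ?thesis using sets unfolding is_volume_def by blast
qed

lemma is_volume_unique:
  assumes "is_volume \<mu>" "is_volume \<mu>'" shows "\<mu> = \<mu>'"
proof (rule measure_eqI)
  obtain cs :: "nat \<Rightarrow> ('m, 'n) chart" where cs: "\<And>i. cs i \<in> atlas M" "(\<Union>i. fst (cs i)) = UNIV"
    using countable_charts by metis
  define D where "D = disjointed (\<lambda>i. fst (cs i))"
  have fb: "fst (cs i) \<in> sets borel" for i using open_chart_domain[OF cs(1)] by simp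
  have Db: "D i \<in> sets borel" for i
    using sets.range_disjointed_sets[of "\<lambda>i. fst (cs i)" borel] fb unfolding D_def by auto
  have Ds: "D i \<subseteq> fst (cs i)" for i unfolding D_def by (rule disjointed_subset)
  have Du: "(\<Union>i. D i) = UNIV" unfolding D_def UN_disjointed_eq by (rule cs(2))
  have Dd: "disjoint_family D" unfolding D_def by (rule disjoint_family_disjointed)
  show "sets \<mu> = sets \<mu>'" using assms by (simp add: is_volume_def)
  fix B assume "B \<in> sets \<mu>"
  then have B: "B \<in> sets borel" using assms by (simp add: is_volume_def)
  have "emeasure \<nu> B = (\<Sum>i. chart_volume (cs i) (B \<inter> D i))" if "is_volume \<nu>" for \<nu>
  proof -
    have "emeasure \<nu> (\<Union>i. B \<inter> D i) = (\<Sum>i. emeasure \<nu> (B \<inter> D i))"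
      by (rule suminf_emeasure[symmetric])
        (use B Db Dd that in \<open>auto simp: disjoint_family_on_def is_volume_def\<close>)
    also have "(\<Union>i. B \<inter> D i) = B" using Du by auto
    also have "(\<Sum>i. emeasure \<nu> (B \<inter> D i)) = (\<Sum>i. chart_volume (cs i) (B \<inter> D i))"
    proof (intro arg_cong[where f=suminf] ext)
      fix i
      have "B \<inter> D i \<in> sets borel" "B \<inter> D i \<subseteq> fst (cs i)" using B Db Ds by auto
      then show "emeasure \<nu> (B \<inter> D i) = chart_volume (cs i) (B \<inter> D i)"
        using that cs(1) unfolding is_volume_def by blast
    qed
    finally show ?thesis .
  qed
  then show "emeasure \<mu> B = emeasure \<mu>' B" using assms by simp
qed

lemma is_volume_vol: "is_volume (vol M)"
proof -
  have "vol M = (THE \<mu>. is_volume \<mu>)"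
    by (simp add: vol_def is_volume_def chart_volume_def chart_density_def)
  then show ?thesis
    using is_volume_exists is_volume_unique theI'[of is_volume] by metis
qed

lemma sets_vol [simp, measurable_cong]: "sets (vol M) = sets borel"
  using is_volume_vol by (simp add: is_volume_def)

lemma space_vol [simp]: "space (vol M) = UNIV"
  using sets_eq_imp_space_eq[OF sets_vol] by simp

text \<open>The density is bounded on a closed coordinate ball, so every point has a neighbourhood
  of finite volume; finitely many of these cover a compact set.\<close>

lemma emeasure_vol_compact:
  assumes "compact K" shows "emeasure (vol M) K < \<infinity>"
proof -
  have "\<exists>U. open U \<and> x \<in> U \<and> emeasure (vol M) U < \<infinity>" for x
  proof -
    let ?c = "chart_at M x"
    note c = chart_at[of x]
    obtain R where R: "0 < R" "cball (snd ?c x) R \<subseteq> snd ?c ` fst ?c"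
      using chart_cball[OF c open_UNIV] by auto
    let ?B = "ball (snd ?c x) R"
    have sub: "?B \<subseteq> snd ?c ` fst ?c" using R(2) ball_subset_cball by blast
    define U where "U = chart_inv ?c ` ?B"
    have U: "open U" "U \<subseteq> fst ?c" "x \<in> U"
    proof -
      show "open U" unfolding U_def by (rule open_chart_inv_image[OF c(1) open_ball sub])
      show "U \<subseteq> fst ?c" unfolding U_def using sub by (intro image_subsetI chart_inv_mem) (rule subsetD)
      show "x \<in> U" unfolding U_def using R(1) chart_inv_chart[OF c] by (intro image_eqI[of _ _ "snd ?c x"]) auto
    qed
    have "compact (chart_density ?c ` cball (snd ?c x) R)"
      by (intro compact_continuous_image continuous_on_subset[OF continuous_on_chart_density[OF c(1)] R(2)]) simp
    from compact_imp_bounded[OF this]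
    have "\<exists>C. \<forall>p\<in>cball (snd ?c x) R. \<bar>chart_density ?c p\<bar> \<le> C" by (simp add: bounded_iff)
    then obtain C where C: "\<And>p. p \<in> cball (snd ?c x) R \<Longrightarrow> \<bar>chart_density ?c p\<bar> \<le> C" by blast
    have "snd ?c ` U \<subseteq> cball (snd ?c x) R"
      unfolding U_def using sub chart_chart_inv[OF c(1)] by fastforce
    then have "chart_density ?c p \<le> C" if "p \<in> snd ?c ` U" for p using C[of p] that by (auto simp: subset_iff)
    have "emeasure (vol M) U = chart_volume ?c U"
      using is_volume_vol U c unfolding is_volume_def by simp
    also have "\<dots> \<le> (\<integral>\<^sup>+p. ennreal C * indicator (cball (snd ?c x) R) p \<partial>lborel)"
      unfolding chart_volume_def
    proof (rule nn_integral_mono)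
      fix p
      show "ennreal (chart_density ?c p) * indicator (snd ?c ` U) p \<le> ennreal C * indicator (cball (snd ?c x) R) p"
        using C[of p] \<open>snd ?c ` U \<subseteq> cball (snd ?c x) R\<close>
        by (auto simp: indicator_def intro!: ennreal_leI)
    qed
    also have "\<dots> = ennreal C * emeasure lborel (cball (snd ?c x) R)"
      by (simp add: nn_integral_cmult_indicator)
    also have "\<dots> < \<infinity>"
      using emeasure_compact_finite[of "cball (snd ?c x) R"] by (simp add: ennreal_mult_less_top)
    finally show ?thesis using U by blast
  qed
  then obtain U where U: "\<And>x. open (U x)" "\<And>x. x \<in> U x" "\<And>x. emeasure (vol M) (U x) < \<infinity>" by metis
  obtain T where T: "T \<subseteq> K" "finite T" "K \<subseteq> (\<Union>x\<in>T. U x)"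
  proof -
    have "K \<subseteq> (\<Union>x\<in>K. U x)" using U(2) by blast
    from compactE_image[OF assms U(1) this] show ?thesis using that by blast
  qed
  have "emeasure (vol M) K \<le> emeasure (vol M) (\<Union>x\<in>T. U x)"
    by (rule emeasure_mono) (use T U in auto)
  also have "\<dots> \<le> (\<Sum>x\<in>T. emeasure (vol M) (U x))"
    by (rule emeasure_subadditive_finite) (use T U in auto)
  also have "\<dots> < \<infinity>" using T U by (simp add: less_top)
  finally show ?thesis .
qed

end

section \<open>Curves and their lengths\<close>

lemma C1_differentiable_on_open_Un:
  assumes "open A" "open B" "f C1_differentiable_on A" "f C1_differentiable_on B"
  shows "f C1_differentiable_on (A \<union> B)"
  using assms by (auto simp: C1_differentiable_on_eq intro!: continuous_on_open_Un)

lemma C1_differentiable_on_cong: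
  assumes "open A" "\<And>t. t \<in> A \<Longrightarrow> f t = g t" "f C1_differentiable_on A"
  shows "g C1_differentiable_on A"
proof -
  from assms(3) obtain D where D: "\<And>t. t \<in> A \<Longrightarrow> (f has_vector_derivative D t) (at t)" "continuous_on A D"
    unfolding C1_differentiable_on_def by blast
  have "(g has_vector_derivative D t) (at t)" if "t \<in> A" for t
    by (rule has_vector_derivative_transform_within_open[OF D(1)[OF that] assms(1) that assms(2)])
  then show ?thesis using D(2) unfolding C1_differentiable_on_def by blast
qed

text \<open>A Henstock-Kurzweil integral may exist although the norm of the integrand is not
  integrable, and then the right-hand side is infinite. If it is finite, \<open>h\<close> is
  Lebesgue integrable and the two integrals agree.\<close>

lemma norm_integral_le_nn_integral:
  fixes h :: "real \<Rightarrow> 'a::euclidean_space"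
  assumes "(h has_integral I) {a..b}"
  shows "ennreal (norm I) \<le> (\<integral>\<^sup>+t. ennreal (norm (h t)) * indicator {a..b} t \<partial>lborel)"
proof (cases "(\<integral>\<^sup>+t. ennreal (norm (h t)) * indicator {a..b} t \<partial>lborel) = \<infinity>")
  case False
  let ?h = "\<lambda>t. indicator {a..b} t *\<^sub>R h t"
  have m: "?h \<in> borel_measurable lebesgue"
    by (rule has_integral_implies_lebesgue_measurable[OF assms])
  have n: "(\<integral>\<^sup>+t. ennreal (norm (?h t)) \<partial>lebesgue) = (\<integral>\<^sup>+t. ennreal (norm (h t)) * indicator {a..b} t \<partial>lborel)"
    unfolding nn_integral_completion by (intro nn_integral_cong) (auto split: split_indicator)
  have i: "integrable lebesgue ?h"
    by (rule integrableI_bounded[OF m]) (use n False in \<open>simp add: less_top\<close>)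
  then have "(?h has_integral integral\<^sup>L lebesgue ?h) UNIV"
    by (rule has_integral_integral_lebesgue)
  moreover have "(?h has_integral I) UNIV"
    using assms has_integral_restrict_UNIV[of "{a..b}" h I]
    by (simp add: indicator_scaleR_eq_if)
  ultimately have "I = integral\<^sup>L lebesgue ?h" using has_integral_unique by blast
  then show ?thesis using integral_norm_bound_ennreal[OF i] n by simp
qed simp

context riem
begin

text \<open>The smoothness clause of \<open>piecewise_C1_curve\<close> with the set of good times as
  a parameter. Arbitrary open sets of times allow curves to be restricted, glued and reparametrised
  without case distinctions at end points.\<close>

definition regular_on :: "real set \<Rightarrow> (real \<Rightarrow> 'm) \<Rightarrow> bool" where
  "regular_on N \<gamma> \<longleftrightarrow> open N \<and> continuous_on N \<gamma> \<and>
    (\<forall>c\<in>atlas M. (snd c \<circ> \<gamma>) C1_differentiable_on {t \<in> N. \<gamma> t \<in> fst c})"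

definition speed :: "(real \<Rightarrow> 'm) \<Rightarrow> real \<Rightarrow> real" where
  "speed \<gamma> t = sqrt (rmetric M (\<gamma> t) (velocity M \<gamma> t) (velocity M \<gamma> t))"

lemma piecewise_C1_curve_iff:
  "piecewise_C1_curve M \<gamma> \<longleftrightarrow> continuous_on {0..1} \<gamma> \<and> (\<exists>S. finite S \<and> regular_on ({0<..<1} - S) \<gamma>)"
proof -
  have "open ({0<..<1} - S) \<and> continuous_on ({0<..<1} - S) \<gamma>" if "continuous_on {0..1} \<gamma>" "finite S" for S
    using that by (auto intro!: open_Diff finite_imp_closed intro: continuous_on_subset)
  then show ?thesis by (auto simp: piecewise_C1_curve_def regular_on_def)
qed

lemma open_curve_chart:
  assumes "regular_on N \<gamma>" "c \<in> atlas M" shows "open {t \<in> N. \<gamma> t \<in> fst c}"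
proof -
  have "open (\<gamma> -` fst c \<inter> N)"
    using assms continuous_on_open_vimage[of N \<gamma>] open_chart_domain by (auto simp: regular_on_def)
  moreover have "\<gamma> -` fst c \<inter> N = {t \<in> N. \<gamma> t \<in> fst c}" by auto
  ultimately show ?thesis by simp
qed

lemma regular_on_Un:
  assumes "regular_on A \<gamma>" "regular_on B \<gamma>" shows "regular_on (A \<union> B) \<gamma>"
proof -
  have "{t \<in> A \<union> B. \<gamma> t \<in> fst c} = {t \<in> A. \<gamma> t \<in> fst c} \<union> {t \<in> B. \<gamma> t \<in> fst c}" for c :: "('m, 'n) chart" by auto
  then show ?thesis
    using assms open_curve_chart[OF assms(1)] open_curve_chart[OF assms(2)]
    by (auto simp: regular_on_def intro!: continuous_on_open_Un C1_differentiable_on_open_Un)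
qed

lemma regular_on_cong:
  assumes "regular_on N \<gamma>" "\<And>t. t \<in> N \<Longrightarrow> \<gamma> t = \<gamma>' t" shows "regular_on N \<gamma>'"
proof -
  have eq: "{t \<in> N. \<gamma>' t \<in> fst c} = {t \<in> N. \<gamma> t \<in> fst c}" for c :: "('m, 'n) chart" using assms(2) by auto
  have "(snd c \<circ> \<gamma>') C1_differentiable_on {t \<in> N. \<gamma>' t \<in> fst c}" if "c \<in> atlas M" for c
    unfolding eq
    by (rule C1_differentiable_on_cong[OF open_curve_chart[OF assms(1) that], of "snd c \<circ> \<gamma>"])
      (use assms that in \<open>auto simp: regular_on_def\<close>)
  then show ?thesis using assms continuous_on_cong[of N N \<gamma> \<gamma>'] by (auto simp: regular_on_def)
qed

lemma regular_on_subset: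
  assumes "regular_on N \<gamma>" "open N'" "N' \<subseteq> N" shows "regular_on N' \<gamma>"
  using assms continuous_on_subset C1_differentiable_on_subset[of _ "{t \<in> N. \<gamma> t \<in> fst c}" "{t \<in> N'. \<gamma> t \<in> fst c}" for c]
  unfolding regular_on_def by blast

lemma regular_on_affine:
  assumes "regular_on N \<gamma>" "a \<noteq> 0" shows "regular_on ((\<lambda>t. a * t + b) -` N) (\<lambda>t. \<gamma> (a * t + b))"
  unfolding regular_on_def
proof (intro conjI ballI)
  have c: "continuous_on X (\<lambda>t. a * t + b)" for X by (intro continuous_intros)
  show "open ((\<lambda>t. a * t + b) -` N)" using assms c by (auto simp: regular_on_def intro: open_vimage)
  show "continuous_on ((\<lambda>t. a * t + b) -` N) (\<lambda>t. \<gamma> (a * t + b))"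
    by (rule continuous_on_compose2[of N \<gamma>]) (use assms c in \<open>auto simp: regular_on_def\<close>)
  fix c assume "c \<in> atlas M"
  then have "((snd c \<circ> \<gamma>) \<circ> (\<lambda>t. a * t + b)) C1_differentiable_on {t \<in> (\<lambda>t. a * t + b) -` N. \<gamma> (a * t + b) \<in> fst c}"
  proof (intro C1_differentiable_compose)
    show "(\<lambda>t. a * t + b) C1_differentiable_on {t \<in> (\<lambda>t. a * t + b) -` N. \<gamma> (a * t + b) \<in> fst c}"
      by (intro derivative_intros)
    show "(snd c \<circ> \<gamma>) C1_differentiable_on (\<lambda>t. a * t + b) ` {t \<in> (\<lambda>t. a * t + b) -` N. \<gamma> (a * t + b) \<in> fst c}"
      by (rule C1_differentiable_on_subset[of _ "{t \<in> N. \<gamma> t \<in> fst c}"])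
        (use assms \<open>c \<in> atlas M\<close> in \<open>auto simp: regular_on_def\<close>)
    \<comment> \<open>The composition rule for C1 functions asks for finite fibres, which
      \<open>a \<noteq> 0\<close> provides.\<close>
    have "{t. a * t + b = x} = {(x - b) / a}" for x using assms(2) by (auto simp: field_simps)
    then have fin: "finite {t. a * t + b = x}" for x by (metis finite.emptyI finite.insertI)
    show "finite ({t \<in> (\<lambda>t. a * t + b) -` N. \<gamma> (a * t + b) \<in> fst c} \<inter> (\<lambda>t. a * t + b) -` {x})" for x
      by (rule finite_subset[OF _ fin[of x]]) auto
  qed
  then show "(snd c \<circ> (\<lambda>t. \<gamma> (a * t + b))) C1_differentiable_on {t \<in> (\<lambda>t. a * t + b) -` N. \<gamma> (a * t + b) \<in> fst c}"
    by (simp add: comp_def)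
qed

lemma regular_on_has_vector_derivative:
  assumes "regular_on N \<gamma>" "t \<in> N" "c \<in> atlas M" "\<gamma> t \<in> fst c"
  shows "(snd c \<circ> \<gamma> has_vector_derivative vector_derivative (snd c \<circ> \<gamma>) (at t)) (at t)"
  using assms unfolding regular_on_def C1_differentiable_on_eq
  by (simp add: vector_derivative_works[symmetric])

lemma velocity_chart:
  assumes "c \<in> atlas M" "\<gamma> t \<in> fst c" "isCont \<gamma> t" "(snd c \<circ> \<gamma> has_vector_derivative D) (at t)"
  shows "velocity M \<gamma> t = coord_vec M c (\<gamma> t) D"
proof -
  let ?c' = "chart_at M (\<gamma> t)"
  have "((snd ?c' \<circ> chart_inv c) has_derivative coord_vec M c (\<gamma> t)) (at ((snd c \<circ> \<gamma>) t))"
    using differentiable_transition[OF assms(1) chart_at(1) assms(2) chart_at(2)]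
    by (simp add: frechet_derivative_works coord_vec_eq chart_deriv_def)
  from diff_chain_at[OF assms(4)[unfolded has_vector_derivative_def] this]
  have "((snd ?c' \<circ> chart_inv c) \<circ> (snd c \<circ> \<gamma>) has_vector_derivative coord_vec M c (\<gamma> t) D) (at t)"
    by (simp add: has_vector_derivative_def comp_def linear_scale[OF linear_coord_vec[OF assms(1,2)]])
  moreover have "\<forall>\<^sub>F s in at t. \<gamma> s \<in> fst c"
    using assms(2,3) open_chart_domain[OF assms(1)] unfolding isCont_def by (blast intro: topological_tendstoD)
  then have "\<forall>\<^sub>F s in nhds t. \<gamma> s \<in> fst c" using assms(2) by (simp add: eventually_nhds_conv_at)
  then obtain T where "open T" "t \<in> T" "\<And>s. s \<in> T \<Longrightarrow> \<gamma> s \<in> fst c" unfolding eventually_nhds by blast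
  ultimately have "(snd ?c' \<circ> \<gamma> has_vector_derivative coord_vec M c (\<gamma> t) D) (at t)"
    by (elim has_vector_derivative_transform_within_open) (auto simp: chart_inv_chart[OF assms(1)])
  then show ?thesis by (simp add: velocity_def vector_derivative_at)
qed

lemma regular_on_isCont: "regular_on N \<gamma> \<Longrightarrow> t \<in> N \<Longrightarrow> isCont \<gamma> t"
  by (auto simp: regular_on_def continuous_on_eq_continuous_at)

lemma speed_chart:
  assumes "c \<in> atlas M" "\<gamma> t \<in> fst c" "isCont \<gamma> t" "(snd c \<circ> \<gamma> has_vector_derivative D) (at t)"
  shows "speed \<gamma> t = sqrt (chart_metric c (\<gamma> t) D D)"
  by (simp add: speed_def velocity_chart[OF assms] chart_metric_def)

text \<open>Joint continuity in the point and in both vectors comes from the expansion in metric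
  coefficients, each of which depends on the point alone.\<close>

lemma continuous_on_chart_metric:
  fixes f :: "'a::topological_space \<Rightarrow> 'm" and v w :: "'a \<Rightarrow> real^'n"
  assumes "c \<in> atlas M" "continuous_on S f" "f ` S \<subseteq> fst c" "continuous_on S v" "continuous_on S w"
  shows "continuous_on S (\<lambda>s. chart_metric c (f s) (v s) (w s))"
proof -
  have g: "continuous_on S (\<lambda>s. gram M c (f s) $ i $ j)" for i j
    by (rule continuous_on_compose2[OF continuous_on_gram[OF assms(1)] assms(2,3)])
  have "continuous_on S (\<lambda>s. \<Sum>i\<in>UNIV. \<Sum>j\<in>UNIV. v s $ i * w s $ j * gram M c (f s) $ i $ j)"
    by (intro continuous_intros g assms)
  then show ?thesis
  proof (rule continuous_on_eq)
    fix s assume "s \<in> S"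
    then have "f s \<in> fst c" using assms(3) by auto
    then show "(\<Sum>i\<in>UNIV. \<Sum>j\<in>UNIV. v s $ i * w s $ j * gram M c (f s) $ i $ j) = chart_metric c (f s) (v s) (w s)"
      using inner_product_expand[OF inner_product_chart_metric[OF assms(1)]] by (simp add: gram_eq)
  qed
qed

lemma continuous_on_speed:
  assumes "regular_on N \<gamma>" shows "continuous_on N (speed \<gamma>)"
proof (intro continuous_at_imp_continuous_on ballI)
  fix t assume t: "t \<in> N"
  let ?c = "chart_at M (\<gamma> t)"
  let ?N = "{s \<in> N. \<gamma> s \<in> fst ?c}"
  let ?D = "\<lambda>s. vector_derivative (snd ?c \<circ> \<gamma>) (at s)"
  have "continuous_on ?N ?D" using assms chart_at(1) unfolding regular_on_def C1_differentiable_on_eq by blast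
  moreover have "continuous_on ?N \<gamma>" using assms continuous_on_subset[of N \<gamma> ?N] by (auto simp: regular_on_def)
  ultimately have "continuous_on ?N (\<lambda>s. sqrt (chart_metric ?c (\<gamma> s) (?D s) (?D s)))"
    by (intro continuous_on_real_sqrt continuous_on_chart_metric chart_at) auto
  then have "continuous_on ?N (speed \<gamma>)"
  proof (rule continuous_on_eq)
    fix s assume "s \<in> ?N"
    then show "sqrt (chart_metric ?c (\<gamma> s) (?D s) (?D s)) = speed \<gamma> s"
      using assms chart_at(1) by (intro speed_chart[symmetric] regular_on_has_vector_derivative[OF assms]
          regular_on_isCont[OF assms]) auto
  qed
  then show "isCont (speed \<gamma>) t"
    using t chart_at open_curve_chart[OF assms chart_at(1)] by (simp add: continuous_on_eq_continuous_at)
qed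

lemma speed_cong:
  assumes "open N" "t \<in> N" "\<And>s. s \<in> N \<Longrightarrow> \<gamma> s = \<gamma>' s" shows "speed \<gamma> t = speed \<gamma>' t"
proof -
  have "(snd c \<circ> \<gamma> has_vector_derivative D) (at t) \<longleftrightarrow> (snd c \<circ> \<gamma>' has_vector_derivative D) (at t)" for c :: "('m, 'n) chart" and D
  proof
    assume "(snd c \<circ> \<gamma> has_vector_derivative D) (at t)"
    then show "(snd c \<circ> \<gamma>' has_vector_derivative D) (at t)"
      by (rule has_vector_derivative_transform_within_open[OF _ assms(1,2)]) (simp add: assms(3))
  next
    assume "(snd c \<circ> \<gamma>' has_vector_derivative D) (at t)"
    then show "(snd c \<circ> \<gamma> has_vector_derivative D) (at t)"
      by (rule has_vector_derivative_transform_within_open[OF _ assms(1,2)]) (simp add: assms(3))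
  qed
  then show ?thesis using assms(2,3) by (simp add: speed_def velocity_def vector_derivative_def)
qed

lemma speed_affine:
  assumes "regular_on N \<gamma>" "a * t + b \<in> N"
  shows "speed (\<lambda>t. \<gamma> (a * t + b)) t = \<bar>a\<bar> * speed \<gamma> (a * t + b)"
proof -
  let ?x = "\<gamma> (a * t + b)"
  let ?c = "chart_at M ?x"
  let ?D = "vector_derivative (snd ?c \<circ> \<gamma>) (at (a * t + b))"
  have d: "(snd ?c \<circ> \<gamma> has_vector_derivative ?D) (at (a * t + b))"
    by (rule regular_on_has_vector_derivative[OF assms chart_at])
  have "((\<lambda>t. a * t + b) has_vector_derivative a) (at t)"
    by (auto intro!: derivative_eq_intros simp: has_real_derivative_iff_has_vector_derivative[symmetric])
  then have d': "(snd ?c \<circ> (\<lambda>t. \<gamma> (a * t + b)) has_vector_derivative a *\<^sub>R ?D) (at t)"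
    using vector_diff_chain_at[of "\<lambda>t. a * t + b" a t, OF _ d] by (simp add: comp_def)
  have "isCont (\<lambda>t. a * t + b) t" by (intro continuous_intros)
  then have "isCont (\<lambda>t. \<gamma> (a * t + b)) t"
    by (rule isCont_o2) (rule regular_on_isCont[OF assms])
  then have "speed (\<lambda>t. \<gamma> (a * t + b)) t = sqrt (chart_metric ?c ?x (a *\<^sub>R ?D) (a *\<^sub>R ?D))"
    by (intro speed_chart[OF chart_at _ d']) (simp add: comp_def)
  also have "\<dots> = sqrt (a\<^sup>2 * chart_metric ?c ?x ?D ?D)"
    using inner_product_on_scale_left[OF inner_product_chart_metric[OF chart_at]]
      inner_product_on_scale_right[OF inner_product_chart_metric[OF chart_at] subspace_UNIV]
    by (simp add: power2_eq_square mult.assoc)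
  also have "\<dots> = \<bar>a\<bar> * sqrt (chart_metric ?c ?x ?D ?D)" by (simp add: real_sqrt_mult)
  also have "sqrt (chart_metric ?c ?x ?D ?D) = speed \<gamma> (a * t + b)"
    by (rule speed_chart[OF chart_at regular_on_isCont[OF assms] d, symmetric])
  finally show ?thesis .
qed

text \<open>Finitely many times have measure 0, so arbitrary values of the velocity at end points
  and corners do not count.\<close>

lemma curve_length_eq:
  assumes "finite S"
  shows "curve_length M \<gamma> = (\<integral>\<^sup>+t. ennreal (speed \<gamma> t) * indicator ({0<..<1} - S) t \<partial>lborel)"
  unfolding curve_length_def
proof (rule nn_integral_cong_AE)
  have "finite (insert 0 (insert 1 S))" using assms by simp
  then have "AE t in lborel. t \<notin> insert 0 (insert 1 S)"
    by (rule AE_not_in[OF finite_imp_null_set_lborel])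
  then show "AE t in lborel. ennreal (sqrt (rmetric M (\<gamma> t) (velocity M \<gamma> t) (velocity M \<gamma> t))) * indicator {0..1} t =
      ennreal (speed \<gamma> t) * indicator ({0<..<1} - S) t"
    by eventually_elim (auto simp: speed_def split: split_indicator)
qed

lemma speed_measurable:
  assumes "regular_on N \<gamma>"
  shows "(\<lambda>t. ennreal (speed \<gamma> t) * indicator N t) \<in> borel_measurable lborel"
proof -
  have "(\<lambda>t. indicator N t *\<^sub>R speed \<gamma> t) \<in> borel_measurable borel"
    by (rule borel_measurable_continuous_on_indicator[OF _ continuous_on_speed[OF assms]])
      (use assms in \<open>auto simp: regular_on_def\<close>)
  then have "(\<lambda>t. ennreal (indicator N t *\<^sub>R speed \<gamma> t)) \<in> borel_measurable lborel" by measurable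
  then show ?thesis by (rule measurable_cong[THEN iffD1, rotated]) (auto split: split_indicator)
qed

text \<open>The speed of the reparametrised curve acquires the factor |a|, which is the Jacobian of
  the substitution. Reversal and concatenation of curves both rest on this.\<close>

lemma nn_integral_speed_affine:
  assumes "regular_on N \<gamma>" "a \<noteq> 0"
  shows "(\<integral>\<^sup>+t. ennreal (speed (\<lambda>t. \<gamma> (a * t + b)) t) * indicator ((\<lambda>t. a * t + b) -` N) t \<partial>lborel) =
    (\<integral>\<^sup>+t. ennreal (speed \<gamma> t) * indicator N t \<partial>lborel)"
proof -
  have m: "(\<lambda>t. ennreal (speed \<gamma> t) * indicator N t) \<in> borel_measurable borel"
    using speed_measurable[OF assms(1)] by simp
  have "(\<integral>\<^sup>+t. ennreal (speed \<gamma> t) * indicator N t \<partial>lborel) =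
      \<bar>a\<bar> * (\<integral>\<^sup>+t. ennreal (speed \<gamma> (b + a * t)) * indicator N (b + a * t) \<partial>lborel)"
    by (rule nn_integral_real_affine[OF m assms(2)])
  also have "\<dots> = (\<integral>\<^sup>+t. \<bar>a\<bar> * (ennreal (speed \<gamma> (b + a * t)) * indicator N (b + a * t)) \<partial>lborel)"
    by (rule nn_integral_cmult[symmetric]) (use measurable_compose[OF _ m, of "\<lambda>t. b + a * t" lborel] in simp)
  also have "\<dots> = (\<integral>\<^sup>+t. ennreal (speed (\<lambda>t. \<gamma> (a * t + b)) t) * indicator ((\<lambda>t. a * t + b) -` N) t \<partial>lborel)"
    by (intro nn_integral_cong)
      (use speed_affine[OF assms(1)] in \<open>auto simp: add.commute ennreal_mult' mult.assoc split: split_indicator\<close>)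
  finally show ?thesis by simp
qed

end

section \<open>The Riemannian distance\<close>

context riem
begin

lemma rdist_le: "piecewise_C1_curve M \<gamma> \<Longrightarrow> \<gamma> 0 = x \<Longrightarrow> \<gamma> 1 = y \<Longrightarrow> rdist M x y \<le> curve_length M \<gamma>"
  unfolding rdist_def by (rule INF_lower) simp

lemma rdist_greatest:
  assumes "\<And>\<gamma>. piecewise_C1_curve M \<gamma> \<Longrightarrow> \<gamma> 0 = x \<Longrightarrow> \<gamma> 1 = y \<Longrightarrow> k \<le> curve_length M \<gamma>"
  shows "k \<le> rdist M x y"
  unfolding rdist_def by (rule INF_greatest) (use assms in auto)

text \<open>Straight segments in a chart supply all explicit upper bounds for
  \<open>rdist\<close>.\<close>

lemma regular_on_segment:
  assumes c: "c \<in> atlas M" and N: "open N" "\<And>t. t \<in> N \<Longrightarrow> y + t *\<^sub>R v \<in> snd c ` fst c"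
  defines "\<gamma> \<equiv> \<lambda>t. chart_inv c (y + t *\<^sub>R v)"
  shows "regular_on N \<gamma>" "t \<in> N \<Longrightarrow> speed \<gamma> t = sqrt (chart_metric c (\<gamma> t) v v)"
proof -
  let ?l = "\<lambda>t. y + t *\<^sub>R v"
  have cl: "continuous_on X ?l" for X by (intro continuous_intros)
  have cont: "continuous_on N \<gamma>"
    unfolding \<gamma>_def by (rule continuous_on_compose2[OF continuous_on_chart_inv[OF c] cl]) (use N in auto)
  have mem: "\<gamma> t \<in> fst c" and inv: "snd c (\<gamma> t) = ?l t" if "t \<in> N" for t
    unfolding \<gamma>_def by (rule chart_inv_mem[OF N(2)[OF that]], rule chart_chart_inv[OF c N(2)[OF that]])
  have dl: "(?l has_derivative (\<lambda>s. s *\<^sub>R v)) (at t)" for t by (auto intro!: derivative_eq_intros)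
  show "regular_on N \<gamma>"
    unfolding regular_on_def
  proof (intro conjI ballI N(1) cont)
    fix c' assume c': "c' \<in> atlas M"
    let ?D = "\<lambda>t. frechet_derivative (snd c' \<circ> chart_inv c) (at (?l t)) v"
    have m: "?l t \<in> snd c ` (fst c \<inter> fst c')" if "t \<in> N" "\<gamma> t \<in> fst c'" for t
      using mem[OF that(1)] inv[OF that(1)] that(2) by (metis IntI imageI)
    have "(snd c' \<circ> \<gamma> has_vector_derivative ?D t) (at t)" if t: "t \<in> N" "\<gamma> t \<in> fst c'" for t
    proof -
      have d: "((snd c' \<circ> chart_inv c) has_derivative frechet_derivative (snd c' \<circ> chart_inv c) (at (?l t))) (at (?l t))"
        by (rule smooth_on_has_derivative[OF smooth_transition[OF c c'] m[OF t]])
      from diff_chain_at[OF dl d] has_derivative_linear[OF d]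
      show ?thesis by (simp add: has_vector_derivative_def comp_def \<gamma>_def linear_scale)
    qed
    moreover have "continuous_on {t \<in> N. \<gamma> t \<in> fst c'} ?D"
      by (rule continuous_on_compose2[OF smooth_on_imp_continuous_on[OF smooth_on_frechet_derivative[OF smooth_transition[OF c c']]] cl])
        (use m in auto)
    ultimately show "(snd c' \<circ> \<gamma>) C1_differentiable_on {t \<in> N. \<gamma> t \<in> fst c'}"
      unfolding C1_differentiable_on_def by (intro exI[of _ ?D]) auto
  qed
  assume t: "t \<in> N"
  have "(?l has_vector_derivative v) (at t)" using dl by (simp add: has_vector_derivative_def)
  then have "(snd c \<circ> \<gamma> has_vector_derivative v) (at t)"
    by (rule has_vector_derivative_transform_within_open[OF _ N(1) t]) (simp add: inv)
  then show "speed \<gamma> t = sqrt (chart_metric c (\<gamma> t) v v)"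
    using cont N(1) t by (intro speed_chart[where \<gamma>=\<gamma> and t=t, OF c mem[OF t]]) (simp add: continuous_on_eq_continuous_at)
qed

lemma rdist_segment_le:
  assumes c: "c \<in> atlas M" and W: "open W" "convex W" "W \<subseteq> snd c ` fst c" "y \<in> W" "z \<in> W"
    and L: "\<And>q. q \<in> W \<Longrightarrow> chart_metric c (chart_inv c q) (z - y) (z - y) \<le> L\<^sup>2" "0 \<le> L"
  shows "rdist M (chart_inv c y) (chart_inv c z) \<le> ennreal L"
proof -
  let ?l = "\<lambda>t. y + t *\<^sub>R (z - y)"
  define \<gamma> where "\<gamma> t = chart_inv c (?l t)" for t
  have cl: "continuous_on X ?l" for X by (intro continuous_intros)
  \<comment> \<open>An open set of times around [0, 1], because the segment runs inside the open
    convex set \<open>W\<close>.\<close>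
  define N where "N = ?l -` W"
  have N: "open N" unfolding N_def by (rule open_vimage[OF W(1) cl])
  have lW: "?l t \<in> W" if "t \<in> {0..1}" for t
  proof -
    have "?l t = (1 - t) *\<^sub>R y + t *\<^sub>R z" by (simp add: algebra_simps)
    then show ?thesis using convexD[OF W(2,4,5), of "1 - t" t] that by simp
  qed
  have NW: "?l t \<in> snd c ` fst c" if "t \<in> N" for t using that W(3) by (auto simp: N_def)
  note reg = regular_on_segment[OF c N NW, folded \<gamma>_def]
  have sub: "{0..1} \<subseteq> N" using lW by (auto simp: N_def)
  have "regular_on ({0<..<1} - {}) \<gamma>"
    by (rule regular_on_subset[OF reg(1)]) (use sub in auto)
  then have pw: "piecewise_C1_curve M \<gamma>"
  proof -
    have "continuous_on {0..1} \<gamma>"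
      by (rule continuous_on_subset[OF _ sub]) (use reg(1) in \<open>simp add: regular_on_def\<close>)
    with \<open>regular_on ({0<..<1} - {}) \<gamma>\<close> show ?thesis
      unfolding piecewise_C1_curve_iff by blast
  qed
  have "curve_length M \<gamma> = (\<integral>\<^sup>+t. ennreal (speed \<gamma> t) * indicator ({0<..<1} - {}) t \<partial>lborel)"
    by (rule curve_length_eq) simp
  also have "\<dots> \<le> (\<integral>\<^sup>+t. ennreal L * indicator {0..1::real} t \<partial>lborel)"
  proof (intro nn_integral_mono)
    fix t :: real
    have "speed \<gamma> t \<le> L" if "t \<in> {0..1}"
    proof -
      have "speed \<gamma> t = sqrt (chart_metric c (\<gamma> t) (z - y) (z - y))" using reg(2) that sub by blast
      also have "\<dots> \<le> sqrt (L\<^sup>2)"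
        unfolding \<gamma>_def by (rule real_sqrt_le_mono[OF L(1)[OF lW[OF that]]])
      finally show ?thesis using L(2) by simp
    qed
    then show "ennreal (speed \<gamma> t) * indicator ({0<..<1} - {}) t \<le> ennreal L * indicator {0..1} t"
      by (auto simp: indicator_def intro: ennreal_leI)
  qed
  also have "\<dots> = ennreal L" by (simp add: nn_integral_cmult_indicator)
  finally have "curve_length M \<gamma> \<le> ennreal L" .
  moreover have "rdist M (chart_inv c y) (chart_inv c z) \<le> curve_length M \<gamma>"
    by (rule rdist_le[OF pw]) (simp_all add: \<gamma>_def)
  ultimately show ?thesis by (rule order_trans[rotated])
qed

text \<open>A curve leaving a coordinate ball is at least as long as its part before the first exit.\<close>

lemma rdist_ge:
  assumes c: "c \<in> atlas M" and x: "x \<in> fst c" and r: "0 < r" "cball (snd c x) r \<subseteq> snd c ` fst c"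
    and m: "0 \<le> m" "\<And>q v. q \<in> cball (snd c x) r \<Longrightarrow> m\<^sup>2 * (norm v)\<^sup>2 \<le> chart_metric c (chart_inv c q) v v"
    and y: "y \<notin> chart_inv c ` ball (snd c x) r"
  shows "ennreal (m * r) \<le> rdist M x y"
proof (rule rdist_greatest)
  fix \<gamma> assume "piecewise_C1_curve M \<gamma>" and \<gamma>0: "\<gamma> 0 = x" and \<gamma>1: "\<gamma> 1 = y"
  then obtain S where \<gamma>: "continuous_on {0..1} \<gamma>" "finite S" "regular_on ({0<..<1} - S) \<gamma>"
    unfolding piecewise_C1_curve_iff by blast
  let ?B = "ball (snd c x) r" and ?C = "cball (snd c x) r"
  let ?U = "chart_inv c ` ?B" and ?K = "chart_inv c ` ?C"
  have BC: "?B \<subseteq> snd c ` fst c" using r(2) ball_subset_cball by blast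
  have U: "open ?U" by (rule open_chart_inv_image[OF c open_ball BC])
  have K: "closed ?K" by (rule compact_imp_closed[OF compact_chart_inv_image[OF c compact_cball r(2)]])
  have xU: "x \<in> ?U" using r(1) chart_inv_chart[OF c x] by (intro image_eqI[of _ _ "snd c x"]) auto
  \<comment> \<open>The times outside the open coordinate ball form a closed set that contains 1, so
    there is a first exit time \<open>t0\<close>. As a limit of earlier points the curve is still in
    the closed ball at \<open>t0\<close>, hence on the sphere of radius \<open>r\<close>.\<close>
  define E where "E = {t \<in> {0..1}. \<gamma> t \<notin> ?U}"
  have "closedin (top_of_set {0..1}) ({0..1} \<inter> \<gamma> -` (- ?U))"
    by (rule continuous_closedin_preimage[OF \<gamma>(1)]) (use U in auto)
  then have "closed ({0..1} \<inter> \<gamma> -` (- ?U))" using closedin_closed_trans[OF _ closed_atLeastAtMost] by blast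
  moreover have "E = {0..1} \<inter> \<gamma> -` (- ?U)" by (auto simp: E_def)
  ultimately have E: "closed E" "1 \<in> E" "bdd_below E"
    using y \<gamma>1 by (auto simp: E_def intro!: bdd_belowI[of _ 0])
  define t0 where "t0 = Inf E"
  have t0E: "t0 \<in> E" unfolding t0_def by (rule closed_contains_Inf) (use E in auto)
  have before: "\<gamma> t \<in> ?U" if "0 \<le> t" "t < t0" for t
  proof (rule ccontr)
    assume "\<gamma> t \<notin> ?U"
    then have "t \<in> E" using that t0E by (auto simp: E_def)
    then show False using cInf_lower[OF _ E(3), of t] that by (simp add: t0_def)
  qed
  have t0: "0 < t0" "t0 \<le> 1" using t0E \<gamma>0 xU by (auto simp: E_def less_le)
  have "\<gamma> t0 \<in> ?K"
  proof -
    have "((\<lambda>t. \<gamma> t) \<longlongrightarrow> \<gamma> t0) (at t0 within {0..t0})"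
      using \<gamma>(1) t0 continuous_on_subset[of "{0..1}" \<gamma> "{0..t0}"] by (auto simp: continuous_on_def)
    then have "(\<gamma> \<longlongrightarrow> \<gamma> t0) (at t0 within {0..<t0})"
      by (rule tendsto_within_subset) auto
    moreover have "at t0 within {0..<t0} \<noteq> bot"
      using t0 by (simp add: trivial_limit_within)
    moreover have "\<forall>\<^sub>F t in at t0 within {0..<t0}. \<gamma> t \<in> ?K"
      unfolding eventually_at_filter using before by (auto intro!: always_eventually image_mono[THEN subsetD, OF ball_subset_cball])
    ultimately show ?thesis using Lim_in_closed_set[OF K] by blast
  qed
  then obtain q where q: "q \<in> ?C" "\<gamma> t0 = chart_inv c q" by auto
  have qn: "norm (q - snd c x) = r"
    using q t0E by (auto simp: E_def dist_norm norm_minus_commute image_iff)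
  have KU: "?U \<subseteq> ?K" by (rule image_mono) (rule ball_subset_cball)
  have Kc: "?K \<subseteq> fst c" using r(2) by (intro image_subsetI chart_inv_mem) (rule subsetD)
  have inK: "\<gamma> t \<in> ?K" if "t \<in> {0..t0}" for t
    using that before[of t] KU \<open>\<gamma> t0 \<in> ?K\<close> by (cases "t = t0") auto
  let ?p = "snd c \<circ> \<gamma>"
  let ?D = "\<lambda>t. vector_derivative ?p (at t)"
  have pC: "?p t \<in> ?C" if "t \<in> {0..t0}" for t
    using inK[OF that] chart_chart_inv[OF c subsetD[OF r(2)]] by auto
  have "continuous_on {0..t0} ?p"
    by (rule continuous_on_compose[OF continuous_on_subset[OF \<gamma>(1)] continuous_on_subset[OF continuous_on_chart[OF c]]])
      (use t0 inK Kc in auto)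
  moreover have dp: "(?p has_vector_derivative ?D t) (at t)" if "t \<in> {0<..<t0} - S" for t
    by (rule regular_on_has_vector_derivative[OF \<gamma>(3) _ c]) (use that t0 inK[of t] Kc in auto)
  \<comment> \<open>The derivative of the coordinate curve integrates to its displacement, which has
    norm \<open>r\<close>; inside the ball \<open>m\<close> times the coordinate speed is at most
    the Riemannian speed.\<close>
  ultimately have "(?D has_integral (?p t0 - ?p 0)) {0..t0}"
    using t0 by (intro fundamental_theorem_of_calculus_interior_strong[OF \<gamma>(2)]) (assumption | simp only: less_imp_le)+
  from norm_integral_le_nn_integral[OF this]
  have "ennreal r \<le> (\<integral>\<^sup>+t. ennreal (norm (?D t)) * indicator {0..t0} t \<partial>lborel)"
    using qn q(2) \<gamma>0 chart_chart_inv[OF c subsetD[OF r(2) q(1)]] by simp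
  then have "ennreal (m * r) \<le> ennreal m * (\<integral>\<^sup>+t. ennreal (norm (?D t)) * indicator {0..t0} t \<partial>lborel)"
    using m(1) by (simp add: ennreal_mult' mult_left_mono)
  also have "\<dots> \<le> (\<integral>\<^sup>+t. ennreal (speed \<gamma> t) * indicator ({0<..<1} - S) t \<partial>lborel)"
  proof (cases "m = 0")
    case False
    then have m': "0 < m" using m(1) by simp
    have "AE t in lborel. ennreal (norm (?D t)) * indicator {0..t0} t \<le>
        ennreal (1 / m) * (ennreal (speed \<gamma> t) * indicator ({0<..<1} - S) t)"
    proof -
      have "finite (insert 0 (insert t0 S))" using \<gamma>(2) by simp
      then have "AE t in lborel. t \<notin> insert 0 (insert t0 S)"
        by (rule AE_not_in[OF finite_imp_null_set_lborel])
      then show ?thesis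
      proof eventually_elim
        case (elim t)
        show ?case
        proof (cases "t \<in> {0..t0}")
          case True
          then have t: "t \<in> {0<..<t0} - S" using elim by auto
          have "m\<^sup>2 * (norm (?D t))\<^sup>2 \<le> chart_metric c (\<gamma> t) (?D t) (?D t)"
            using m(2)[OF pC, of t "?D t"] True chart_inv_chart[OF c, of "\<gamma> t"] inK[of t] Kc by auto
          then have "m * norm (?D t) \<le> sqrt (chart_metric c (\<gamma> t) (?D t) (?D t))"
            by (intro real_le_rsqrt) (simp add: power_mult_distrib)
          also have "\<dots> = speed \<gamma> t"
            using t t0 inK[of t] Kc by (intro speed_chart[symmetric, OF c _ regular_on_isCont[OF \<gamma>(3)] dp]) auto
          finally have "norm (?D t) \<le> 1 / m * speed \<gamma> t" using m' by (simp add: field_simps)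
          then have "ennreal (norm (?D t)) \<le> ennreal (1 / m) * ennreal (speed \<gamma> t)"
            using m' by (simp add: ennreal_mult'[symmetric] ennreal_leI)
          then show ?thesis using t t0 by (simp add: indicator_def)
        qed simp
      qed
    qed
    then have "(\<integral>\<^sup>+t. ennreal (norm (?D t)) * indicator {0..t0} t \<partial>lborel) \<le>
        (\<integral>\<^sup>+t. ennreal (1 / m) * (ennreal (speed \<gamma> t) * indicator ({0<..<1} - S) t) \<partial>lborel)"
      by (rule nn_integral_mono_AE)
    also have "\<dots> = ennreal (1 / m) * (\<integral>\<^sup>+t. ennreal (speed \<gamma> t) * indicator ({0<..<1} - S) t \<partial>lborel)"
      by (rule nn_integral_cmult[OF speed_measurable[OF \<gamma>(3)]])
    finally have "ennreal m * (\<integral>\<^sup>+t. ennreal (norm (?D t)) * indicator {0..t0} t \<partial>lborel) \<le>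
        ennreal m * (ennreal (1 / m) * (\<integral>\<^sup>+t. ennreal (speed \<gamma> t) * indicator ({0<..<1} - S) t \<partial>lborel))"
      by (rule mult_left_mono) simp
    also have "\<dots> = (\<integral>\<^sup>+t. ennreal (speed \<gamma> t) * indicator ({0<..<1} - S) t \<partial>lborel)"
      using m' by (simp add: mult.assoc[symmetric] ennreal_mult'[symmetric])
    finally show ?thesis .
  qed simp
  also have "\<dots> = curve_length M \<gamma>" by (rule curve_length_eq[OF \<gamma>(2), symmetric])
  finally show "ennreal (m * r) \<le> curve_length M \<gamma>" .
qed

lemma rdist_self: "rdist M x x = 0"
proof -
  let ?c = "chart_at M x"
  note c = chart_at[of x]
  obtain R where R: "0 < R" "cball (snd ?c x) R \<subseteq> snd ?c ` fst ?c"
    using chart_cball[OF c open_UNIV] by auto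
  have "rdist M (chart_inv ?c (snd ?c x)) (chart_inv ?c (snd ?c x)) \<le> ennreal 0"
  proof (rule rdist_segment_le[OF c(1) open_ball convex_ball, of "snd ?c x" R])
    show "ball (snd ?c x) R \<subseteq> snd ?c ` fst ?c" using R(2) ball_subset_cball by blast
    fix q assume "q \<in> ball (snd ?c x) R"
    then have "chart_inv ?c q \<in> fst ?c" using R(2) by (intro chart_inv_mem) auto
    then show "chart_metric ?c (chart_inv ?c q) (snd ?c x - snd ?c x) (snd ?c x - snd ?c x) \<le> 0\<^sup>2"
      using inner_product_on_zero_left[OF inner_product_chart_metric[OF c(1)]] by simp
  qed (use R in auto)
  then show ?thesis by (simp add: chart_inv_chart[OF c])
qed

lemma rdist_le_commute: "rdist M y x \<le> rdist M x y"
proof (rule rdist_greatest)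
  fix \<gamma> assume "piecewise_C1_curve M \<gamma>" and 0: "\<gamma> 0 = x" and 1: "\<gamma> 1 = y"
  then obtain S where \<gamma>: "continuous_on {0..1} \<gamma>" "finite S" "regular_on ({0<..<1} - S) \<gamma>"
    unfolding piecewise_C1_curve_iff by blast
  let ?\<gamma> = "\<lambda>t. \<gamma> (- 1 * t + 1)" and ?S = "(\<lambda>t. - 1 * t + 1) -` S"
  have eq: "{0<..<1} - ?S = (\<lambda>t. - 1 * t + 1) -` ({0<..<1} - S)" by auto
  have fin: "finite ?S" by (rule finite_vimageI[OF \<gamma>(2)]) (simp add: inj_def)
  have reg: "regular_on ({0<..<1} - ?S) ?\<gamma>"
    unfolding eq by (rule regular_on_affine[OF \<gamma>(3)]) simp
  have "continuous_on {0..1} ?\<gamma>"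
    by (rule continuous_on_compose2[OF \<gamma>(1)]) (auto intro!: continuous_intros)
  then have "piecewise_C1_curve M ?\<gamma>" unfolding piecewise_C1_curve_iff using fin reg by blast
  then have "rdist M y x \<le> curve_length M ?\<gamma>" by (rule rdist_le) (use 0 1 in auto)
  also have "\<dots> = curve_length M \<gamma>"
    unfolding curve_length_eq[OF \<gamma>(2), of \<gamma>] curve_length_eq[OF fin, of ?\<gamma>] eq
    by (rule nn_integral_speed_affine[OF \<gamma>(3)]) simp
  finally show "rdist M y x \<le> curve_length M \<gamma>" .
qed

lemma rdist_commute: "rdist M x y = rdist M y x"
  by (intro antisym rdist_le_commute)

lemma rdist_triangle: "rdist M x z \<le> rdist M x y + rdist M y z"
proof -
  have "rdist M x z \<le> curve_length M \<alpha> + curve_length M \<beta>"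
    if "piecewise_C1_curve M \<alpha>" "\<alpha> 0 = x" "\<alpha> 1 = y" "piecewise_C1_curve M \<beta>" "\<beta> 0 = y" "\<beta> 1 = z" for \<alpha> \<beta>
  proof -
    from that obtain S where \<alpha>: "continuous_on {0..1} \<alpha>" "finite S" "regular_on ({0<..<1} - S) \<alpha>"
      unfolding piecewise_C1_curve_iff by blast
    from that obtain T where \<beta>: "continuous_on {0..1} \<beta>" "finite T" "regular_on ({0<..<1} - T) \<beta>"
      unfolding piecewise_C1_curve_iff by blast
    \<comment> \<open>The two curves are run one after the other at double speed. The forms
      \<open>2 * t + 0\<close> and \<open>2 * t + (-1)\<close> match the substitution
      \<open>a * t + b\<close> of the lemmas on affine reparametrisation.\<close>
    define \<gamma> where "\<gamma> t = (if t \<le> 1/2 then \<alpha> (2 * t + 0) else \<beta> (2 * t + (-1)))" for t :: real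
    define A where "A = (\<lambda>t::real. 2 * t + 0) -` ({0<..<1} - S)"
    define B where "B = (\<lambda>t::real. 2 * t + (-1)) -` ({0<..<1} - T)"
    \<comment> \<open>The exceptional times of both halves, together with the junction 1/2.\<close>
    define Q where "Q = {1/2} \<union> ((\<lambda>t. 2 * t + 0) -` S \<inter> {0<..<1/2}) \<union> ((\<lambda>t. 2 * t + (-1)) -` T \<inter> {1/2<..<1})"
    have Q: "finite Q"
      unfolding Q_def using \<alpha>(2) \<beta>(2) by (intro finite_UnI finite_Int disjI1 finite_vimageI) (auto simp: inj_def)
    have AB: "A \<union> B = {0<..<1} - Q" "A \<inter> B = {}"
      unfolding A_def B_def Q_def by auto
    have gA: "\<alpha> (2 * t + 0) = \<gamma> t" if "t \<in> A" for t using that by (auto simp: A_def \<gamma>_def)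
    have gB: "\<beta> (2 * t + (-1)) = \<gamma> t" if "t \<in> B" for t using that by (auto simp: B_def \<gamma>_def)
    have rA: "regular_on A \<gamma>"
      by (rule regular_on_cong[OF _ gA]) (auto simp: A_def intro: regular_on_affine[OF \<alpha>(3), of 2 0, simplified])
    have rB: "regular_on B \<gamma>"
      by (rule regular_on_cong[OF _ gB]) (auto simp: B_def intro: regular_on_affine[OF \<beta>(3), of 2 "-1", simplified])
    have "continuous_on ({0..1/2} \<union> {1/2..1}) \<gamma>"
      unfolding \<gamma>_def
    proof (rule continuous_on_If)
      show "continuous_on {0..1/2} (\<lambda>t. \<alpha> (2 * t + 0))" "continuous_on {1/2..1} (\<lambda>t. \<beta> (2 * t + (-1)))"
        by (rule continuous_on_compose2[OF \<alpha>(1)] continuous_on_compose2[OF \<beta>(1)]; auto intro!: continuous_intros)+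
      show "\<alpha> (2 * t + 0) = \<beta> (2 * t + (-1))" if "t \<in> {0..1/2}" "\<not> t \<le> 1/2" for t using that by simp
      show "\<alpha> (2 * t + 0) = \<beta> (2 * t + (-1))" if "t \<in> {1/2..1}" "t \<le> 1/2" for t
      proof -
        have "2 * t + 0 = 1" "2 * t + (-1) = 0" using that by simp_all
        then show ?thesis using \<open>\<alpha> 1 = y\<close> \<open>\<beta> 0 = y\<close> by (simp only:)
      qed
    qed auto
    moreover have "{0..1/2} \<union> {1/2..1} = {0..1::real}" by auto
    ultimately have "piecewise_C1_curve M \<gamma>"
      unfolding piecewise_C1_curve_iff using Q regular_on_Un[OF rA rB] AB by auto
    then have "rdist M x z \<le> curve_length M \<gamma>" by (rule rdist_le) (use that in \<open>auto simp: \<gamma>_def\<close>)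
    also have "\<dots> = (\<integral>\<^sup>+t. ennreal (speed \<gamma> t) * indicator A t + ennreal (speed \<gamma> t) * indicator B t \<partial>lborel)"
      unfolding curve_length_eq[OF Q] AB(1)[symmetric] using AB(2)
      by (intro nn_integral_cong) (auto split: split_indicator)
    also have "\<dots> = (\<integral>\<^sup>+t. ennreal (speed \<gamma> t) * indicator A t \<partial>lborel) + (\<integral>\<^sup>+t. ennreal (speed \<gamma> t) * indicator B t \<partial>lborel)"
      by (rule nn_integral_add[OF speed_measurable[OF rA] speed_measurable[OF rB]])
    also have "(\<integral>\<^sup>+t. ennreal (speed \<gamma> t) * indicator A t \<partial>lborel) =
        (\<integral>\<^sup>+t. ennreal (speed (\<lambda>t. \<alpha> (2 * t + 0)) t) * indicator A t \<partial>lborel)"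
      using speed_cong[of A _ \<gamma> "\<lambda>t. \<alpha> (2 * t + 0)"] gA rA
      by (intro nn_integral_cong) (auto simp: regular_on_def split: split_indicator)
    also have "\<dots> = curve_length M \<alpha>"
      unfolding A_def curve_length_eq[OF \<alpha>(2)] by (rule nn_integral_speed_affine[OF \<alpha>(3)]) simp
    also have "(\<integral>\<^sup>+t. ennreal (speed \<gamma> t) * indicator B t \<partial>lborel) =
        (\<integral>\<^sup>+t. ennreal (speed (\<lambda>t. \<beta> (2 * t + (-1))) t) * indicator B t \<partial>lborel)"
      using speed_cong[of B _ \<gamma> "\<lambda>t. \<beta> (2 * t + (-1))"] gB rB
      by (intro nn_integral_cong) (auto simp: regular_on_def split: split_indicator)
    also have "\<dots> = curve_length M \<beta>"
      unfolding B_def curve_length_eq[OF \<beta>(2)] by (rule nn_integral_speed_affine[OF \<beta>(3)]) simp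
    finally show ?thesis .
  qed
  note cat = this
  show ?thesis
  \<comment> \<open>Curves that are minimal up to an additive error exist only for finite distances,
    and this is the only case that remains.\<close>
  proof (rule ennreal_le_epsilon)
    fix e :: real assume fin: "rdist M x y + rdist M y z < top" and e: "0 < e"
    have ex: "\<exists>\<gamma>. piecewise_C1_curve M \<gamma> \<and> \<gamma> 0 = a \<and> \<gamma> 1 = b \<and> curve_length M \<gamma> \<le> rdist M a b + ennreal (e / 2)"
      if "rdist M a b < top" for a b
    proof -
      have "rdist M a b < rdist M a b + ennreal (e / 2)"
        using that e by (simp add: ennreal_add_left_cancel_less[of _ 0, simplified] less_top)
      then show ?thesis unfolding rdist_def INF_less_iff by (auto intro: less_imp_le)
    qed
    obtain \<alpha> where \<alpha>: "piecewise_C1_curve M \<alpha>" "\<alpha> 0 = x" "\<alpha> 1 = y" "curve_length M \<alpha> \<le> rdist M x y + ennreal (e / 2)"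
      using ex[of x y] fin by auto
    obtain \<beta> where \<beta>: "piecewise_C1_curve M \<beta>" "\<beta> 0 = y" "\<beta> 1 = z" "curve_length M \<beta> \<le> rdist M y z + ennreal (e / 2)"
      using ex[of y z] fin by auto
    have "rdist M x z \<le> (rdist M x y + ennreal (e / 2)) + (rdist M y z + ennreal (e / 2))"
      by (rule order_trans[OF cat[OF \<alpha>(1-3) \<beta>(1-3)] add_mono[OF \<alpha>(4) \<beta>(4)]])
    also have "\<dots> = rdist M x y + rdist M y z + (ennreal (e / 2) + ennreal (e / 2))"
      by (simp only: ac_simps)
    also have "ennreal (e / 2) + ennreal (e / 2) = ennreal e"
      using e by (simp add: ennreal_plus[symmetric] del: ennreal_plus)
    finally show "rdist M x z \<le> rdist M x y + rdist M y z + ennreal e" .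
  qed
qed

text \<open>By homogeneity in \<open>v\<close> it is enough to minimise over the compact product of
  \<open>K\<close> with the unit sphere, where the metric is positive.\<close>

lemma chart_metric_lower_bound:
  assumes c: "c \<in> atlas M" and K: "compact K" "K \<subseteq> snd c ` fst c"
  obtains m where "0 < m" "\<And>q v. q \<in> K \<Longrightarrow> m\<^sup>2 * (norm v)\<^sup>2 \<le> chart_metric c (chart_inv c q) v v"
proof (cases "K = {}")
  case True then show ?thesis using that[of 1] by simp
next
  case False
  let ?S = "sphere 0 1 :: (real^'n) set"
  let ?f = "\<lambda>(q, v). chart_metric c (chart_inv c q) v v"
  have pos: "0 < chart_metric c (chart_inv c q) v v" if "q \<in> K" "v \<noteq> 0" for q v
    using inner_product_on_pos[OF inner_product_chart_metric[OF c chart_inv_mem] UNIV_I that(2)] K(2) that(1) by blast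
  have "continuous_on (K \<times> ?S) ?f"
    unfolding split_beta
  proof (rule continuous_on_chart_metric[OF c])
    show "continuous_on (K \<times> ?S) (\<lambda>x. chart_inv c (fst x))"
      by (rule continuous_on_compose2[OF continuous_on_chart_inv[OF c]]) (use K in \<open>auto intro!: continuous_intros\<close>)
    show "(\<lambda>x. chart_inv c (fst x)) ` (K \<times> ?S) \<subseteq> fst c"
      using K(2) by (intro image_subsetI chart_inv_mem) auto
  qed (intro continuous_intros)+
  moreover have "compact (K \<times> ?S)" using K by (intro compact_Times) auto
  moreover have "axis undefined 1 \<in> ?S" by (simp add: norm_axis_1)
  then have "K \<times> ?S \<noteq> {}" using False by blast
  ultimately obtain q0 v0 where q0: "q0 \<in> K" "v0 \<in> ?S" "\<And>q v. q \<in> K \<Longrightarrow> v \<in> ?S \<Longrightarrow> ?f (q0, v0) \<le> ?f (q, v)"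
    using continuous_attains_inf[of "K \<times> ?S" ?f] by force
  define m where "m = sqrt (?f (q0, v0))"
  have m2: "0 < ?f (q0, v0)" using pos[OF q0(1), of v0] q0(2) by force
  show ?thesis
  proof (rule that[of m])
    show "0 < m" using m2 by (simp add: m_def)
    fix q and v :: "real^'n" assume q: "q \<in> K"
    show "m\<^sup>2 * (norm v)\<^sup>2 \<le> chart_metric c (chart_inv c q) v v"
    proof (cases "v = 0")
      case True
      then show ?thesis
        using inner_product_on_zero_left[OF inner_product_chart_metric[OF c chart_inv_mem]] K(2) q by auto
    next
      case False
      let ?w = "(1 / norm v) *\<^sub>R v"
      have ip: "inner_product_on UNIV (chart_metric c (chart_inv c q))"
        by (rule inner_product_chart_metric[OF c chart_inv_mem]) (use K(2) q in blast)
      have "?f (q0, v0) \<le> ?f (q, ?w)" using q0(3)[OF q, of ?w] False by simp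
      also have "\<dots> = (1 / norm v)\<^sup>2 * chart_metric c (chart_inv c q) v v"
        by (simp add: inner_product_on_scale_left[OF ip] inner_product_on_scale_right[OF ip subspace_UNIV] power2_eq_square)
      finally show ?thesis using False m2 by (simp add: m_def field_simps)
    qed
  qed
qed

text \<open>Near \<open>p\<close> the metric coefficients vary so little that the quadratic forms at
  two points of the ball differ by at most 2 m^2 |v|^2, where m^2 |v|^2 is a lower bound for each of
  them. So one is at most 3, hence at most 4 = 2^2, times the other, and a coordinate segment is at
  most twice as long as its direction vector measured at an arbitrary \<open>q\<close>.\<close>

lemma rdist_local_le:
  assumes c: "c \<in> atlas M" and p: "p \<in> snd c ` fst c"
  obtains r where "0 < r" "ball p r \<subseteq> snd c ` fst c"
    "\<And>y z q. y \<in> ball p r \<Longrightarrow> z \<in> ball p r \<Longrightarrow> q \<in> ball p r \<Longrightarrow>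
      rdist M (chart_inv c y) (chart_inv c z) \<le> ennreal (2 * sqrt (chart_metric c (chart_inv c q) (z - y) (z - y)))"
proof -
  obtain R where R: "0 < R" "cball p R \<subseteq> snd c ` fst c"
    using open_chart_range[OF c] p open_contains_cball by blast
  obtain m where m: "0 < m" "\<And>q v. q \<in> cball p R \<Longrightarrow> m\<^sup>2 * (norm v)\<^sup>2 \<le> chart_metric c (chart_inv c q) v v"
    using chart_metric_lower_bound[OF c compact_cball R(2)] by metis
  \<comment> \<open>The number of terms in the double sum over the metric coefficients; each term
    may contribute m^2 |v|^2 / n.\<close>
  define n where "n = real (CARD('n) * CARD('n))"
  have n: "0 < n" by (simp add: n_def)
  let ?g = "\<lambda>i j q. gram M c (chart_inv c q) $ i $ j"
  have "\<exists>d>0. \<forall>q\<in>ball p d. \<bar>?g i j q - ?g i j p\<bar> < m\<^sup>2 / n" for i j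
  proof -
    have "continuous_on (snd c ` fst c) (?g i j)"
      by (rule continuous_on_compose2[OF continuous_on_gram[OF c] continuous_on_chart_inv[OF c]])
        (intro image_subsetI chart_inv_mem)
    then have "isCont (?g i j) p" using p continuous_on_eq_continuous_at[OF open_chart_range[OF c]] by blast
    moreover have "0 < m\<^sup>2 / n" using m(1) n by simp
    ultimately show ?thesis
      unfolding continuous_at_eps_delta by (fastforce simp: dist_real_def dist_commute)
  qed
  then obtain d where d: "\<And>i j. 0 < d i j" "\<And>i j q. q \<in> ball p (d i j) \<Longrightarrow> \<bar>?g i j q - ?g i j p\<bar> < m\<^sup>2 / n" by metis
  define D where "D = Min (range (\<lambda>(i, j). d i j))"
  have D: "0 < D" unfolding D_def using d(1) by (subst Min_gr_iff) auto
  have Dle: "D \<le> d i j" for i j unfolding D_def by (rule Min_le) (auto intro: range_eqI[of _ _ "(i, j)"])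
  define r where "r = min D R"
  have r: "0 < r" "ball p r \<subseteq> cball p R" using D R(1) by (auto simp: r_def)
  have br: "ball p r \<subseteq> snd c ` fst c" using r(2) R(2) by blast
  have close: "\<bar>chart_metric c (chart_inv c q) v v - chart_metric c (chart_inv c p) v v\<bar> \<le> m\<^sup>2 * (norm v)\<^sup>2"
    if q: "q \<in> ball p r" for q v
  proof -
    have ip: "inner_product_on UNIV (chart_metric c (chart_inv c q'))" if "q' \<in> ball p r" for q'
      by (rule inner_product_chart_metric[OF c chart_inv_mem]) (use br that in blast)
    have "\<bar>chart_metric c (chart_inv c q) v v - chart_metric c (chart_inv c p) v v\<bar> =
        \<bar>\<Sum>i\<in>UNIV. \<Sum>j\<in>UNIV. v $ i * v $ j * (?g i j q - ?g i j p)\<bar>"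
      using q r(1) by (subst (1 2) inner_product_expand[OF ip]) (auto simp: gram_eq sum_subtractf right_diff_distrib)
    also have "\<dots> \<le> (\<Sum>i\<in>UNIV. \<Sum>j\<in>UNIV. \<bar>v $ i * v $ j * (?g i j q - ?g i j p)\<bar>)"
      by (intro order_trans[OF sum_abs] sum_mono sum_abs)
    also have "\<dots> \<le> (\<Sum>i\<in>(UNIV::'n set). \<Sum>j\<in>(UNIV::'n set). (norm v)\<^sup>2 * (m\<^sup>2 / n))"
    proof (intro sum_mono)
      fix i j
      have "\<bar>v $ i\<bar> * \<bar>v $ j\<bar> \<le> norm v * norm v" by (intro mult_mono component_le_norm_cart) auto
      moreover have "\<bar>?g i j q - ?g i j p\<bar> \<le> m\<^sup>2 / n" using d(2)[of q i j] q Dle[of i j] by (auto simp: r_def)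
      ultimately have "(\<bar>v $ i\<bar> * \<bar>v $ j\<bar>) * \<bar>?g i j q - ?g i j p\<bar> \<le> (norm v * norm v) * (m\<^sup>2 / n)"
        by (rule mult_mono) auto
      then show "\<bar>v $ i * v $ j * (?g i j q - ?g i j p)\<bar> \<le> (norm v)\<^sup>2 * (m\<^sup>2 / n)"
        by (simp add: abs_mult power2_eq_square)
    qed
    also have "\<dots> = m\<^sup>2 * (norm v)\<^sup>2" using n by (simp add: n_def field_simps)
    finally show ?thesis .
  qed
  show ?thesis
  proof (rule that[OF r(1) br])
    fix y z q assume yzq: "y \<in> ball p r" "z \<in> ball p r" "q \<in> ball p r"
    let ?Q = "\<lambda>q. chart_metric c (chart_inv c q) (z - y) (z - y)"
    have Q0: "0 \<le> ?Q q" using m(2)[of q "z - y"] yzq(3) r(2)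
      by (meson dual_order.trans mult_nonneg_nonneg subsetD zero_le_power2)
    have "?Q q' \<le> (2 * sqrt (?Q q))\<^sup>2" if "q' \<in> ball p r" for q'
    proof -
      have "m\<^sup>2 * (norm (z - y))\<^sup>2 \<le> ?Q q" using m(2) yzq(3) r(2) by blast
      then have "?Q q' \<le> 4 * ?Q q" using close[OF that, of "z - y"] close[OF yzq(3), of "z - y"] by linarith
      then show ?thesis using Q0 by (simp add: power_mult_distrib)
    qed
    then show "rdist M (chart_inv c y) (chart_inv c z) \<le> ennreal (2 * sqrt (?Q q))"
      using Q0 by (intro rdist_segment_le[OF c open_ball convex_ball br yzq(1,2)]) auto
  qed
qed

text \<open>\<open>rdist\<close> is infinite between components. Truncation at 1 gives a real-valued
  metric with the same small distances, hence with the same topology and the same Cauchy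
  sequences.\<close>

definition mdist :: "'m \<Rightarrow> 'm \<Rightarrow> real" where
  "mdist x y = enn2real (min 1 (rdist M x y))"

lemma ennreal_mdist: "ennreal (mdist x y) = min 1 (rdist M x y)"
  unfolding mdist_def by (rule ennreal_enn2real) (simp add: min_less_iff_disj)

lemma mdist_less_iff: "e \<le> 1 \<Longrightarrow> mdist x y < e \<longleftrightarrow> rdist M x y < ennreal e"
proof -
  assume e: "e \<le> 1"
  have "mdist x y < e \<longleftrightarrow> ennreal (mdist x y) < ennreal e"
    by (rule ennreal_less_iff[symmetric]) (simp add: mdist_def)
  also have "\<dots> \<longleftrightarrow> rdist M x y < ennreal e"
    unfolding ennreal_mdist using e by (auto simp: min_less_iff_disj not_less)
  finally show ?thesis .
qed

lemma mdist_le: "rdist M x y \<le> ennreal L \<Longrightarrow> 0 \<le> L \<Longrightarrow> mdist x y \<le> L"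
  using ennreal_mdist[of x y] by (metis ennreal_le_iff min.coboundedI2)

text \<open>Leaving a coordinate ball inside \<open>U\<close> costs a definite length, by
  \<open>rdist_ge\<close>. This is one half of the comparison between the distance and the manifold
  topology.\<close>

lemma rdist_small_nhds:
  assumes "open U" "x \<in> U"
  obtains e where "0 < e" "e \<le> 1" "\<And>y. rdist M x y < ennreal e \<Longrightarrow> y \<in> U"
proof -
  let ?c = "chart_at M x"
  note c = chart_at[of x]
  obtain r where r: "0 < r" "cball (snd ?c x) r \<subseteq> snd ?c ` (U \<inter> fst ?c)"
    using chart_cball[OF c assms] by metis
  then have r': "cball (snd ?c x) r \<subseteq> snd ?c ` fst ?c" by blast
  obtain m where m: "0 < m" "\<And>q v. q \<in> cball (snd ?c x) r \<Longrightarrow> m\<^sup>2 * (norm v)\<^sup>2 \<le> chart_metric ?c (chart_inv ?c q) v v"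
    using chart_metric_lower_bound[OF c(1) compact_cball r'] by metis
  show ?thesis
  proof (rule that[of "min 1 (m * r)"])
    fix y assume "rdist M x y < ennreal (min 1 (m * r))"
    then have "\<not> ennreal (m * r) \<le> rdist M x y"
      by (metis ennreal_leI leD min.cobounded2 order_trans)
    then have "y \<in> chart_inv ?c ` ball (snd ?c x) r"
      using rdist_ge[OF c r(1) r' less_imp_le[OF m(1)] m(2)] by blast
    then obtain q where q: "q \<in> ball (snd ?c x) r" "y = chart_inv ?c q" by blast
    have "q \<in> cball (snd ?c x) r" using q(1) by auto
    then obtain u where "u \<in> U" "u \<in> fst ?c" "q = snd ?c u" using subsetD[OF r(2)] by blast
    then show "y \<in> U" using q(2) chart_inv_chart[OF c(1)] by simp
  qed (use m r in auto)
qed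

text \<open>The other half of the comparison: coordinate segments near \<open>x\<close> are
  short.\<close>

lemma open_rdist_ball:
  assumes "0 < e" obtains U where "open U" "x \<in> U" "\<And>y. y \<in> U \<Longrightarrow> rdist M x y < ennreal e"
proof -
  let ?c = "chart_at M x"
  note c = chart_at[of x]
  obtain r where r: "0 < r" "ball (snd ?c x) r \<subseteq> snd ?c ` fst ?c"
    "\<And>y z q. y \<in> ball (snd ?c x) r \<Longrightarrow> z \<in> ball (snd ?c x) r \<Longrightarrow> q \<in> ball (snd ?c x) r \<Longrightarrow>
      rdist M (chart_inv ?c y) (chart_inv ?c z) \<le> ennreal (2 * sqrt (chart_metric ?c (chart_inv ?c q) (z - y) (z - y)))"
    by (rule rdist_local_le[OF c(1) imageI[OF c(2)]]) blast
  let ?p = "snd ?c x"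
  let ?f = "\<lambda>z. 2 * sqrt (chart_metric ?c x (z - ?p) (z - ?p))"
  have x: "chart_inv ?c ?p = x" by (rule chart_inv_chart[OF c])
  have "continuous_on UNIV ?f"
    by (intro continuous_intros continuous_on_chart_metric[OF c(1)]) (use c in auto)
  then have "open (?f -` {..<e})" by (intro open_vimage) auto
  moreover have "?p \<in> ?f -` {..<e}"
    using assms inner_product_on_zero_left[OF inner_product_chart_metric[OF c]] by simp
  ultimately have W: "open (?f -` {..<e} \<inter> ball ?p r)" "?p \<in> ?f -` {..<e} \<inter> ball ?p r" using r(1) by auto
  have Ws: "?f -` {..<e} \<inter> ball ?p r \<subseteq> snd ?c ` fst ?c" using r(2) by blast
  show ?thesis
  proof (rule that[of "chart_inv ?c ` (?f -` {..<e} \<inter> ball ?p r)"])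
    show "open (chart_inv ?c ` (?f -` {..<e} \<inter> ball ?p r))"
      by (rule open_chart_inv_image[OF c(1) W(1) Ws])
    show "x \<in> chart_inv ?c ` (?f -` {..<e} \<inter> ball ?p r)"
      using imageI[OF W(2), of "chart_inv ?c"] unfolding x .
    fix y assume "y \<in> chart_inv ?c ` (?f -` {..<e} \<inter> ball ?p r)"
    then obtain z where z: "?f z < e" "z \<in> ball ?p r" "y = chart_inv ?c z" by auto
    have "rdist M x y \<le> ennreal (?f z)"
      using r(3)[of ?p z ?p] z r(1) x by simp
    also have "\<dots> < ennreal e" using z(1) assms by (intro ennreal_lessI) auto
    finally show "rdist M x y < ennreal e" .
  qed
qed

sublocale metric: Metric_space UNIV mdist
proof
  fix x y z
  show "0 \<le> mdist x y" by (simp add: mdist_def)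
  show "mdist x y = mdist y x" by (simp add: mdist_def rdist_commute)
  show "mdist x y = 0 \<longleftrightarrow> x = y"
  proof
    assume "mdist x y = 0"
    show "x = y"
    proof (rule ccontr)
      assume "x \<noteq> y"
      then obtain U where "open U" "x \<in> U" "y \<notin> U" using t1_space by blast
      then obtain e where "0 < e" "e \<le> 1" "\<And>y. rdist M x y < ennreal e \<Longrightarrow> y \<in> U" using rdist_small_nhds by metis
      then show False using \<open>mdist x y = 0\<close> \<open>y \<notin> U\<close> mdist_less_iff[of e x y] by simp
    qed
  qed (simp add: mdist_def rdist_self)
  have "ennreal (mdist x z) \<le> ennreal (mdist x y + mdist y z)"
  proof -
    have "min 1 (rdist M x z) \<le> min 1 (rdist M x y) + min 1 (rdist M y z)"
    \<comment> \<open>If one of the distances on the right is truncated, the right-hand side is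
      already at least 1.\<close>
    proof (cases "1 \<le> rdist M x y \<or> 1 \<le> rdist M y z")
      case True
      then have "1 \<le> min 1 (rdist M x y) + min 1 (rdist M y z)"
        by (auto simp: min_absorb1 intro: add_increasing2 add_increasing)
      then show ?thesis by (rule min.coboundedI1)
    next
      case False
      then show ?thesis using rdist_triangle[of x z y] by (auto simp: min_absorb2 not_le intro: min.coboundedI2)
    qed
    moreover have "ennreal (mdist x y + mdist y z) = ennreal (mdist x y) + ennreal (mdist y z)"
      by (rule ennreal_plus) (simp_all add: mdist_def)
    ultimately show ?thesis by (simp only: ennreal_mdist)
  qed
  then show "mdist x z \<le> mdist x y + mdist y z"
    by (subst (asm) ennreal_le_iff) (auto simp: mdist_def)
qed

lemma mtopology_mdist: "metric.mtopology = euclidean"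
proof -
  have "openin metric.mtopology U \<longleftrightarrow> open U" for U
    unfolding metric.openin_mtopology
  proof safe
    assume h: "\<forall>x. x \<in> U \<longrightarrow> (\<exists>r>0. metric.mball x r \<subseteq> U)"
    show "open U"
    proof (subst open_subopen, intro ballI)
      fix x assume "x \<in> U"
      then obtain r where r: "0 < r" "metric.mball x r \<subseteq> U" using h by blast
      have "0 < min 1 r" using r(1) by simp
      then obtain W where W: "open W" "x \<in> W" "\<And>y. y \<in> W \<Longrightarrow> rdist M x y < ennreal (min 1 r)"
        by (rule open_rdist_ball[of _ x]) blast
      have "W \<subseteq> U"
      proof
        fix y assume "y \<in> W"
        then have "mdist x y < min 1 r" using W(3) by (subst mdist_less_iff) auto
        then show "y \<in> U" using r(2) by auto
      qed
      then show "\<exists>T. open T \<and> x \<in> T \<and> T \<subseteq> U" using W by blast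
    qed
  next
    fix x assume "open U" "x \<in> U"
    then obtain e where e: "0 < e" "e \<le> 1" "\<And>y. rdist M x y < ennreal e \<Longrightarrow> y \<in> U" using rdist_small_nhds by metis
    then have "metric.mball x e \<subseteq> U" using mdist_less_iff[OF e(2)] by auto
    then show "\<exists>r>0. metric.mball x r \<subseteq> U" using e(1) by blast
  qed simp
  then show ?thesis by (simp add: topology_eq)
qed

end

section \<open>The complement of a neighbourhood of the Cauchy boundary\<close>

lemma ennreal_pos_real_below:
  assumes "0 < (e::ennreal)" shows "\<exists>r>0. ennreal r < e"
proof (cases e)
  case (real r)
  then show ?thesis using assms by (intro exI[of _ "r / 2"]) (auto intro: ennreal_lessI)
next
  case top
  then show ?thesis by (intro exI[of _ 1]) simp
qed

context riem
begin

text \<open>Being Cauchy is a matter of small distances, which truncation leaves unchanged.\<close>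

lemma cauchy_seqs_mdist:
  "s \<in> cauchy_seqs M \<longleftrightarrow> metric.MCauchy s"
proof
  assume s: "s \<in> cauchy_seqs M"
  show "metric.MCauchy s"
    unfolding metric.MCauchy_def
  proof (intro conjI allI impI)
    fix e :: real assume "0 < e"
    then have "0 < ennreal (min 1 e)" by simp
    then obtain N where N: "\<And>m n. N \<le> m \<Longrightarrow> N \<le> n \<Longrightarrow> rdist M (s m) (s n) < ennreal (min 1 e)"
      using s unfolding cauchy_seqs_def by blast
    then have "mdist (s m) (s n) < min 1 e" if "N \<le> m" "N \<le> n" for m n
      using that by (subst mdist_less_iff) auto
    then show "\<exists>N. \<forall>n n'. N \<le> n \<longrightarrow> N \<le> n' \<longrightarrow> mdist (s n) (s n') < e" by fastforce
  qed simp
next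
  assume s: "metric.MCauchy s"
  show "s \<in> cauchy_seqs M"
    unfolding cauchy_seqs_def
  proof (intro CollectI allI impI)
    fix e :: ennreal assume "0 < e"
    then obtain r where r: "0 < r" "r \<le> 1" "ennreal r \<le> e"
      by (cases e) (auto intro: that[of 1] that[of "min 1 _"] simp: min_le_iff_disj ennreal_leI)
    then obtain N where "\<And>m n. N \<le> m \<Longrightarrow> N \<le> n \<Longrightarrow> mdist (s m) (s n) < r"
      using s unfolding metric.MCauchy_def by blast
    then have "rdist M (s m) (s n) < e" if "N \<le> m" "N \<le> n" for m n
      using that r mdist_less_iff[OF r(2)] by (meson less_le_trans)
    then show "\<exists>N. \<forall>m\<ge>N. \<forall>n\<ge>N. rdist M (s m) (s n) < e" by blast
  qed
qed

lemma cauchy_seqs_const: "(\<lambda>_. x) \<in> cauchy_seqs M"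
  by (simp add: cauchy_seqs_def rdist_self)

lemma cauchy_rel_refl: "s \<in> cauchy_seqs M \<Longrightarrow> s \<in> cauchy_rel M `` {s}"
  by (simp add: cauchy_rel_def rdist_self)

lemma class_in_completion: "s \<in> cauchy_seqs M \<Longrightarrow> cauchy_rel M `` {s} \<in> completion M"
  by (auto simp: completion_def quotient_def)

text \<open>By the triangle inequality a late value exceeds another late value by at most
  \<open>e\<close>. So either the tail is constantly infinite, or it is finite and Cauchy in the
  reals.\<close>

lemma rdist_cauchy_seqs_convergent:
  assumes "s \<in> cauchy_seqs M" "t \<in> cauchy_seqs M"
  shows "\<exists>L. (\<lambda>n. rdist M (s n) (t n)) \<longlonglongrightarrow> L"
proof -
  define a where "a n = rdist M (s n) (t n)" for n
  have C: "\<exists>N. \<forall>k\<ge>N. \<forall>l\<ge>N. a k \<le> a l + ennreal e" if "0 < e" for e :: real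
  proof -
    have e2: "0 < ennreal (e / 2)" using that by simp
    obtain N1 where N1: "\<And>m n. N1 \<le> m \<Longrightarrow> N1 \<le> n \<Longrightarrow> rdist M (s m) (s n) < ennreal (e / 2)"
      using assms(1) e2 unfolding cauchy_seqs_def by blast
    obtain N2 where N2: "\<And>m n. N2 \<le> m \<Longrightarrow> N2 \<le> n \<Longrightarrow> rdist M (t m) (t n) < ennreal (e / 2)"
      using assms(2) e2 unfolding cauchy_seqs_def by blast
    have "a k \<le> a l + ennreal e" if kl: "max N1 N2 \<le> k" "max N1 N2 \<le> l" for k l
    proof -
      have "a k \<le> rdist M (s k) (s l) + (rdist M (s l) (t l) + rdist M (t l) (t k))"
        unfolding a_def by (intro order_trans[OF rdist_triangle[of _ _ "s l"]] add_left_mono rdist_triangle)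
      also have "\<dots> \<le> ennreal (e / 2) + (a l + ennreal (e / 2))"
        unfolding a_def using kl by (intro add_mono less_imp_le[OF N1] less_imp_le[OF N2] order_refl) auto
      also have "\<dots> = a l + (ennreal (e / 2) + ennreal (e / 2))" by (simp only: ac_simps)
      also have "ennreal (e / 2) + ennreal (e / 2) = ennreal e"
        using \<open>0 < e\<close> by (simp add: ennreal_plus[symmetric] del: ennreal_plus)
      finally show ?thesis .
    qed
    then show ?thesis by blast
  qed
  obtain N where N: "\<And>k l. N \<le> k \<Longrightarrow> N \<le> l \<Longrightarrow> a k \<le> a l + ennreal 1" using C[of 1] by auto
  show ?thesis
  proof (cases "a N = top")
    case True
    then have "a l = top" if "N \<le> l" for l using N[of N l] that by (auto simp: top_unique)
    then have "a \<longlonglongrightarrow> top" by (intro tendsto_eventually) (auto simp: eventually_sequentially)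
    then show ?thesis unfolding a_def[abs_def] by blast
  next
    case False
    then have "a N + ennreal 1 < top" by (simp add: less_top)
    then have fin: "a l < top" if "N \<le> l" for l
      using N[of l N] that by (meson le_less_trans order_refl)
    then have ar: "a l = ennreal (enn2real (a l))" if "N \<le> l" for l using that by simp
    have "Cauchy (\<lambda>n. enn2real (a (n + N)))"
    proof (rule CauchyI')
      fix e :: real assume e: "0 < e"
      obtain N' where N': "\<And>k l. N' \<le> k \<Longrightarrow> N' \<le> l \<Longrightarrow> a k \<le> a l + ennreal (e / 2)" using C[of "e / 2"] e by auto
      have "dist (enn2real (a (m + N))) (enn2real (a (n + N))) < e" if "N' \<le> m" "m < n" for m n
      proof -
        have *: "enn2real (a k) \<le> enn2real (a l) + e / 2" if "N' \<le> k" "N' \<le> l" "N \<le> k" "N \<le> l" for k l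
        proof -
          have "ennreal (enn2real (a k)) \<le> ennreal (enn2real (a l) + e / 2)"
            using N'[OF that(1,2)] e ar[OF that(3)] ar[OF that(4)] by (simp add: ennreal_plus)
          then show ?thesis using e by (subst (asm) ennreal_le_iff) auto
        qed
        show ?thesis using *[of "m + N" "n + N"] *[of "n + N" "m + N"] that e by (simp add: dist_real_def)
      qed
      then show "\<exists>M. \<forall>m\<ge>M. \<forall>n>m. dist (enn2real (a (m + N))) (enn2real (a (n + N))) < e" by blast
    qed
    then obtain L where "(\<lambda>n. enn2real (a (n + N))) \<longlonglongrightarrow> L"
      using Cauchy_convergent convergent_def by blast
    then have "(\<lambda>n. ennreal (enn2real (a (n + N)))) \<longlonglongrightarrow> ennreal L" by (rule tendsto_ennrealI)
    then have "(\<lambda>n. a (n + N)) \<longlonglongrightarrow> ennreal L" using ar by simp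
    then have "a \<longlonglongrightarrow> ennreal L" by (rule LIMSEQ_offset)
    then show ?thesis unfolding a_def[abs_def] by blast
  qed
qed

text \<open>\<open>cdist\<close> is computed from representatives picked by \<open>SOME\<close>, of
  which only the equivalence to \<open>s\<close> and \<open>t\<close> is known. The bound passes to
  them because distances between equivalent sequences tend to 0.\<close>

lemma cdist_le:
  assumes s: "s \<in> cauchy_seqs M" and t: "t \<in> cauchy_seqs M"
    and b: "\<And>n. N \<le> n \<Longrightarrow> rdist M (s n) (t n) \<le> b"
  shows "cdist M (cauchy_rel M `` {s}) (cauchy_rel M `` {t}) \<le> b"
proof -
  define s' where "s' = (SOME s'. s' \<in> cauchy_rel M `` {s})"
  define t' where "t' = (SOME t'. t' \<in> cauchy_rel M `` {t})"
  have s': "s' \<in> cauchy_rel M `` {s}" unfolding s'_def by (rule someI[of _ s]) (rule cauchy_rel_refl[OF s])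
  have t': "t' \<in> cauchy_rel M `` {t}" unfolding t'_def by (rule someI[of _ t]) (rule cauchy_rel_refl[OF t])
  obtain L where L: "(\<lambda>n. rdist M (s' n) (t' n)) \<longlonglongrightarrow> L"
    using rdist_cauchy_seqs_convergent[of s' t'] s' t' by (auto simp: cauchy_rel_def)
  have "(\<lambda>n. rdist M (s n) (s' n) + (b + rdist M (t n) (t' n))) \<longlonglongrightarrow> 0 + (b + 0)"
    using s' t' by (intro tendsto_add) (auto simp: cauchy_rel_def)
  moreover have "\<exists>N. \<forall>n\<ge>N. rdist M (s' n) (t' n) \<le> rdist M (s n) (s' n) + (b + rdist M (t n) (t' n))"
  proof (intro exI allI impI)
    fix n assume "N \<le> n"
    have "rdist M (s' n) (t' n) \<le> rdist M (s' n) (s n) + (rdist M (s n) (t n) + rdist M (t n) (t' n))"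
      by (intro order_trans[OF rdist_triangle[of _ _ "s n"]] add_left_mono rdist_triangle)
    also have "\<dots> \<le> rdist M (s n) (s' n) + (b + rdist M (t n) (t' n))"
      using b[OF \<open>N \<le> n\<close>] by (intro add_mono) (auto simp: rdist_commute)
    finally show "rdist M (s' n) (t' n) \<le> rdist M (s n) (s' n) + (b + rdist M (t n) (t' n))" .
  qed
  ultimately have "L \<le> 0 + (b + 0)" using LIMSEQ_le[OF L] by blast
  moreover have "cdist M (cauchy_rel M `` {s}) (cauchy_rel M `` {t}) = L"
    using limI[OF L] by (simp add: cdist_def s'_def t'_def)
  ultimately show ?thesis by simp
qed

context
  fixes \<Omega> assumes \<Omega>: "open_in_completion M \<Omega>" "cauchy_boundary M \<subseteq> \<Omega>"
begin

text \<open>The embedding into the completion does not increase distances, so the preimage of the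
  open set \<Omega> is open.\<close>

lemma closed_complement: "closed {x. embed M x \<notin> \<Omega>}"
proof -
  have "open {x. embed M x \<in> \<Omega>}"
  proof (subst open_subopen, intro ballI)
    fix x assume "x \<in> {x. embed M x \<in> \<Omega>}"
    then obtain e where e: "0 < e" "\<And>\<eta>. \<eta> \<in> completion M \<Longrightarrow> cdist M (embed M x) \<eta> < e \<Longrightarrow> \<eta> \<in> \<Omega>"
      using \<Omega>(1) unfolding open_in_completion_def by blast
    then obtain r where r: "0 < r" "ennreal r < e"
      using ennreal_pos_real_below by blast
    obtain U where U: "open U" "x \<in> U" "\<And>y. y \<in> U \<Longrightarrow> rdist M x y < ennreal r"
      using open_rdist_ball[OF r(1), of x] by metis
    have "embed M y \<in> \<Omega>" if "y \<in> U" for y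
    proof (rule e(2))
      show "embed M y \<in> completion M" unfolding embed_def by (rule class_in_completion[OF cauchy_seqs_const])
      have "cdist M (embed M x) (embed M y) \<le> ennreal r"
        unfolding embed_def by (rule cdist_le[OF cauchy_seqs_const cauchy_seqs_const]) (use U(3)[OF that] in auto)
      then show "cdist M (embed M x) (embed M y) < e" using r(2) by (rule le_less_trans)
    qed
    then show "\<exists>T. open T \<and> x \<in> T \<and> T \<subseteq> {x. embed M x \<in> \<Omega>}" using U by blast
  qed
  moreover have "- {x. embed M x \<in> \<Omega>} = {x. embed M x \<notin> \<Omega>}" by auto
  ultimately show ?thesis by (simp add: closed_def Collect_neg_eq)
qed

text \<open>The sequence defines a point of the completion. If this were a boundary point, it would
  belong to the open set \<Omega>, and so would all late members of the sequence.\<close>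

lemma complete_complement:
  assumes "metric.MCauchy s" "\<And>n. embed M (s n) \<notin> \<Omega>"
  shows "\<exists>x. limitin metric.mtopology s x sequentially"
proof -
  have s: "s \<in> cauchy_seqs M" using assms(1) cauchy_seqs_mdist by blast
  define \<xi> where "\<xi> = cauchy_rel M `` {s}"
  have \<xi>: "\<xi> \<in> completion M" unfolding \<xi>_def by (rule class_in_completion[OF s])
  have "\<xi> \<in> range (embed M)"
  proof (rule ccontr)
    assume "\<xi> \<notin> range (embed M)"
    then have "\<xi> \<in> \<Omega>" using \<xi> \<Omega>(2) by (auto simp: cauchy_boundary_def)
    then obtain e where e: "0 < e" "\<And>\<eta>. \<eta> \<in> completion M \<Longrightarrow> cdist M \<xi> \<eta> < e \<Longrightarrow> \<eta> \<in> \<Omega>"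
      using \<Omega>(1) unfolding open_in_completion_def by blast
    then obtain r where r: "0 < r" "ennreal r < e"
      using ennreal_pos_real_below by blast
    then have "0 < ennreal r" by simp
    then obtain N where N: "\<And>m n. N \<le> m \<Longrightarrow> N \<le> n \<Longrightarrow> rdist M (s m) (s n) < ennreal r"
      using s unfolding cauchy_seqs_def by blast
    have "cdist M \<xi> (embed M (s N)) \<le> ennreal r"
      unfolding embed_def \<xi>_def by (rule cdist_le[OF s cauchy_seqs_const, of N]) (use N in \<open>auto intro: less_imp_le\<close>)
    then have "cdist M \<xi> (embed M (s N)) < e" using r(2) by (rule le_less_trans)
    moreover have "embed M (s N) \<in> completion M" unfolding embed_def by (rule class_in_completion[OF cauchy_seqs_const])
    ultimately show False using e(2) assms(2) by blast
  qed
  then obtain x where "\<xi> = embed M x" by blast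
  then have "s \<in> cauchy_rel M `` {\<lambda>_. x}" using cauchy_rel_refl[OF s] by (simp add: \<xi>_def embed_def)
  then have lim: "(\<lambda>n. rdist M x (s n)) \<longlonglongrightarrow> 0" by (simp add: cauchy_rel_def)
  have "\<exists>N. \<forall>n\<ge>N. mdist (s n) x < e" if "0 < e" for e
  proof -
    have "\<forall>\<^sub>F n in sequentially. rdist M x (s n) < ennreal (min 1 e)"
      using order_tendstoD(2)[OF lim] that by simp
    then obtain N where "\<And>n. N \<le> n \<Longrightarrow> rdist M x (s n) < ennreal (min 1 e)"
      unfolding eventually_sequentially by blast
    then have "mdist x (s n) < min 1 e" if "N \<le> n" for n using that by (subst mdist_less_iff) auto
    then show ?thesis by (auto simp: metric.commute)
  qed
  then show ?thesis unfolding metric.limit_metric_sequentially by auto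
qed

end

end

section \<open>Compactly supported cutoff functions on complete metric spaces\<close>

text \<open>The argument behind the Hopf--Rinow theorem, without length structure: starting from a compact
  set \<open>K\<close>, pass repeatedly to closed neighbourhoods whose radius is at least half the supremum of
  the radii (up to 1) for which the neighbourhood is compact. If the radii were summable,
  the union of these neighbourhoods would be totally bounded, hence it would have a compact
  neighbourhood of positive radius, which contradicts the choice of the radii.\<close>

locale complete_locally_compact =
  fixes c :: "'a::t2_space \<Rightarrow> 'a \<Rightarrow> real"
  assumes metric_space: "Metric_space UNIV c"
    and topology: "Metric_space.mtopology UNIV c = euclidean"
    and complete: "Metric_space.mcomplete UNIV c"
    and locally_compact: "\<exists>U K. open U \<and> compact K \<and> (x::'a) \<in> U \<and> U \<subseteq> K"
begin

sublocale Metric_space UNIV c by (rule metric_space)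

section \<open>Distance from a set and closed neighbourhoods\<close>

definition sdist :: "'a set \<Rightarrow> 'a \<Rightarrow> real" where
  "sdist K x = (INF k\<in>K. c k x)"

definition nbhd :: "'a set \<Rightarrow> real \<Rightarrow> 'a set" where
  "nbhd K s = {x. sdist K x \<le> s}"

lemma bdd: "bdd_below ((\<lambda>k. c k x) ` K)"
  by (rule bdd_belowI2[of _ 0]) simp

lemma sdist_le: "k \<in> K \<Longrightarrow> sdist K x \<le> c k x"
  unfolding sdist_def by (rule cINF_lower[OF bdd])

lemma sdist_lt: "K \<noteq> {} \<Longrightarrow> sdist K x < r \<Longrightarrow> \<exists>k\<in>K. c k x < r"
  unfolding sdist_def by (subst (asm) cINF_less_iff[OF _ bdd]) auto

lemma sdist_greatest: "K \<noteq> {} \<Longrightarrow> (\<And>k. k \<in> K \<Longrightarrow> r \<le> c k x) \<Longrightarrow> r \<le> sdist K x"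
  unfolding sdist_def by (rule cINF_greatest)

lemma sdist_nonneg: "K \<noteq> {} \<Longrightarrow> 0 \<le> sdist K x"
  by (rule sdist_greatest) auto

lemma sdist_eq_0: "k \<in> K \<Longrightarrow> sdist K k = 0"
  using sdist_le[of k K k] sdist_nonneg[of K k] by (auto simp: mdist_zero)

lemma sdist_triangle:
  assumes "K \<noteq> {}" shows "sdist K x \<le> sdist K y + c y x"
proof -
  have "sdist K x - c y x \<le> sdist K y"
  proof (rule sdist_greatest[OF assms])
    fix k assume "k \<in> K"
    then have "sdist K x \<le> c k x" by (rule sdist_le)
    also have "\<dots> \<le> c k y + c y x" by (rule triangle) auto
    finally show "sdist K x - c y x \<le> c k y" by simp
  qed
  then show ?thesis by simp
qed

lemma sdist_trans:
  assumes "K \<noteq> {}" "K' \<noteq> {}" "\<And>z. z \<in> K' \<Longrightarrow> sdist K z \<le> a"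
  shows "sdist K x \<le> a + sdist K' x"
proof -
  have "sdist K x - a \<le> sdist K' x"
  proof (rule sdist_greatest[OF assms(2)])
    fix k assume "k \<in> K'"
    then show "sdist K x - a \<le> c k x" using sdist_triangle[OF assms(1), of x k] assms(3)[of k] by simp
  qed
  then show ?thesis by simp
qed

lemma open_iff: "open U \<longleftrightarrow> (\<forall>x\<in>U. \<exists>r>0. mball x r \<subseteq> U)"
  using openin_mtopology[of U] by (auto simp: topology)

lemma closed_nbhd: assumes "K \<noteq> {}" shows "closed (nbhd K s)"
proof -
  have "open {x. s < sdist K x}"
    unfolding open_iff
  proof
    fix x assume x: "x \<in> {x. s < sdist K x}"
    have "y \<in> {x. s < sdist K x}" if "y \<in> mball x (sdist K x - s)" for y
      using sdist_triangle[OF assms, of x y] that by (auto simp: commute)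
    then show "\<exists>r>0. mball x r \<subseteq> {x. s < sdist K x}" using x by (intro exI[of _ "sdist K x - s"]) auto
  qed
  moreover have "- nbhd K s = {x. s < sdist K x}" by (auto simp: nbhd_def)
  ultimately show ?thesis by (simp add: closed_def)
qed

lemma subset_nbhd: "0 \<le> s \<Longrightarrow> K \<subseteq> nbhd K s"
  by (auto simp: nbhd_def sdist_eq_0)

text \<open>Finitely many open sets, each inside a compact set, cover \<open>K\<close>. Below a
  Lebesgue number of this cover the closed neighbourhood stays inside the finite union of those
  compact sets.\<close>

lemma compact_nbhd_exists:
  assumes K: "compact K" "K \<noteq> {}" shows "\<exists>s. 0 < s \<and> s \<le> 1 \<and> compact (nbhd K s)"
proof -
  obtain U C :: "'a \<Rightarrow> 'a set" where UC: "\<And>x. open (U x)" "\<And>x. compact (C x)" "\<And>x. x \<in> U x" "\<And>x. U x \<subseteq> C x"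
  proof -
    have "\<exists>p. open (fst p) \<and> compact (snd p) \<and> x \<in> fst p \<and> fst p \<subseteq> snd p" for x :: 'a
      using locally_compact[of x] by simp
    then obtain p :: "'a \<Rightarrow> 'a set \<times> 'a set"
      where "\<And>x. open (fst (p x)) \<and> compact (snd (p x)) \<and> x \<in> fst (p x) \<and> fst (p x) \<subseteq> snd (p x)"
      by metis
    then show ?thesis using that[of "\<lambda>x. fst (p x)" "\<lambda>x. snd (p x)"] by blast
  qed
  have "K \<subseteq> (\<Union>x\<in>K. U x)" using UC(3) by blast
  from compactE_image[OF K(1) UC(1) this] obtain T where T: "T \<subseteq> K" "finite T" "K \<subseteq> (\<Union>x\<in>T. U x)" by blast
  have "compactin mtopology K" using K(1) by (simp add: topology)
  from lebesgue_number[OF this T(3)] obtain e where e: "0 < e" "\<And>x. x \<in> K \<Longrightarrow> \<exists>t\<in>T. mball x e \<subseteq> U t"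
    using UC(1) by (force simp: topology)
  define s where "s = min 1 (e / 2)"
  have s: "0 < s" "s \<le> 1" "s < e" using e(1) by (auto simp: s_def)
  have "nbhd K s \<subseteq> (\<Union>t\<in>T. C t)"
  proof
    fix x assume "x \<in> nbhd K s"
    then have "sdist K x < e" using s by (simp add: nbhd_def)
    then obtain k where k: "k \<in> K" "c k x < e" using sdist_lt[OF K(2)] by blast
    then obtain t where t: "t \<in> T" "mball k e \<subseteq> U t" using e(2) by blast
    have "x \<in> mball k e" using k by simp
    then show "x \<in> (\<Union>t\<in>T. C t)" using t UC(4) by blast
  qed
  moreover have "compact (\<Union>t\<in>T. C t)" using T(2) UC(2) by (intro compact_UN) auto
  ultimately have "compact (nbhd K s)"
    using closed_nbhd[OF K(2)] by (metis compact_Int_closed inf.absorb_iff2)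
  then show ?thesis using s by blast
qed

text \<open>The supremum of the admissible radii need not be attained, hence the factor 2.\<close>

lemma good_radius_exists:
  assumes K: "compact K" "K \<noteq> {}"
  shows "\<exists>s. 0 < s \<and> compact (nbhd K s) \<and> (\<forall>t. t \<le> 1 \<and> compact (nbhd K t) \<longrightarrow> t \<le> 2 * s)"
proof -
  let ?T = "{t. 0 < t \<and> t \<le> 1 \<and> compact (nbhd K t)}"
  have T: "?T \<noteq> {}" "bdd_above ?T" using compact_nbhd_exists[OF K] by (auto intro!: bdd_aboveI[of _ 1])
  then obtain t0 where "t0 \<in> ?T" by blast
  then have "0 < Sup ?T" using cSup_upper[OF _ T(2), of t0] by auto
  then have "Sup ?T / 2 < Sup ?T" by simp
  then obtain s where s: "s \<in> ?T" "Sup ?T / 2 < s" using less_cSup_iff[OF T] by blast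
  have "t \<le> 2 * s" if "t \<le> 1" "compact (nbhd K t)" for t
  proof (cases "0 < t")
    case True
    then have "t \<le> Sup ?T" using that by (intro cSup_upper T) auto
    then show ?thesis using s(2) by simp
  qed (use s(1) in auto)
  then show ?thesis using s(1) by blast
qed

definition radius :: "'a set \<Rightarrow> real" where
  "radius K = (SOME s. 0 < s \<and> compact (nbhd K s) \<and> (\<forall>t. t \<le> 1 \<and> compact (nbhd K t) \<longrightarrow> t \<le> 2 * s))"

lemma radius:
  assumes "compact K" "K \<noteq> {}"
  shows "0 < radius K" "compact (nbhd K (radius K))"
    "\<And>t. t \<le> 1 \<Longrightarrow> compact (nbhd K t) \<Longrightarrow> t \<le> 2 * radius K"
  using someI_ex[OF good_radius_exists[OF assms]] unfolding radius_def by blast+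

section \<open>The exhaustion, the divergence of its radii and the cutoff function\<close>

primrec exhaust :: "'a set \<Rightarrow> nat \<Rightarrow> 'a set" where
  "exhaust K 0 = K"
| "exhaust K (Suc n) = nbhd (exhaust K n) (radius (exhaust K n))"

context
  fixes K :: "'a set" assumes K: "compact K" "K \<noteq> {}"
begin

lemma exhaust: "compact (exhaust K n)" "exhaust K n \<noteq> {}"
proof (induction n)
  case (Suc n)
  show "compact (exhaust K (Suc n))" using radius(2)[OF Suc] by simp
  show "exhaust K (Suc n) \<noteq> {}"
    using subset_nbhd[of "radius (exhaust K n)" "exhaust K n"] radius(1)[OF Suc] Suc(2) by auto
qed (use K in auto)

abbreviation (input) rad :: "nat \<Rightarrow> real" where "rad n \<equiv> radius (exhaust K n)"

lemma rad_pos: "0 < rad n"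
  by (rule radius(1)[OF exhaust])

lemma exhaust_Suc: "x \<in> exhaust K (Suc n) \<longleftrightarrow> sdist (exhaust K n) x \<le> rad n"
  by (simp add: nbhd_def)

lemma exhaust_mono: "m \<le> n \<Longrightarrow> exhaust K m \<subseteq> exhaust K n"
  by (rule lift_Suc_mono_le[of "exhaust K"]) (use subset_nbhd rad_pos in \<open>auto intro: less_imp_le\<close>)

lemma sdist_exhaust: "x \<in> exhaust K (n + k) \<Longrightarrow> sdist (exhaust K n) x \<le> (\<Sum>i\<in>{n..<n + k}. rad i)"
proof (induction k arbitrary: x)
  case 0 then show ?case by (simp add: sdist_eq_0)
next
  case (Suc k)
  have "sdist (exhaust K n) x \<le> (\<Sum>i\<in>{n..<n + k}. rad i) + sdist (exhaust K (n + k)) x"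
    by (rule sdist_trans[OF exhaust(2) exhaust(2) Suc.IH])
  also have "sdist (exhaust K (n + k)) x \<le> rad (n + k)" using Suc.prems exhaust_Suc[of x "n + k"] by simp
  finally show ?case by simp
qed

lemma not_summable_rad: "\<not> summable rad"
proof
  assume sm: "summable rad"
  let ?U = "\<Union>n. exhaust K n"
  have "mtotally_bounded ?U"
    unfolding mtotally_bounded_def
  proof (intro allI impI)
    fix e :: real assume e: "0 < e"
    obtain n where n: "norm (\<Sum>i. rad (i + n)) < e / 2"
      using suminf_exist_split[OF _ sm, of "e / 2"] e by auto
    \<comment> \<open>Beyond stage \<open>n\<close> the exhaustion reaches no further than the tail
      sum of the radii, so a finite net of mesh e/2 for the compact stage \<open>n\<close> is a net
      of mesh e for the union.\<close>
    have tail: "(\<Sum>i\<in>{n..<n + k}. rad i) < e / 2" for k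
    proof -
      have "(\<Sum>i\<in>{n..<n + k}. rad i) = (\<Sum>i<k. rad (i + n))"
        by (simp add: sum.atLeastLessThan_shift_0[of _ n] atLeast0LessThan add.commute)
      also have "\<dots> \<le> (\<Sum>i. rad (i + n))"
        using summable_ignore_initial_segment[OF sm] rad_pos by (intro sum_le_suminf) (auto intro: less_imp_le)
      finally show ?thesis using n by simp
    qed
    have "compactin mtopology (exhaust K n)" using exhaust(1) by (simp add: topology)
    then have "mtotally_bounded (exhaust K n)" by (rule compactin_imp_mtotally_bounded)
    then obtain F where F: "finite F" "F \<subseteq> exhaust K n" "exhaust K n \<subseteq> (\<Union>x\<in>F. mball x (e / 2))"
      unfolding mtotally_bounded_def using e by (meson half_gt_zero)
    have "?U \<subseteq> (\<Union>x\<in>F. mball x e)"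
    proof
      fix y assume "y \<in> ?U"
      then obtain m where "y \<in> exhaust K m" by blast
      then have "y \<in> exhaust K (n + m)" using exhaust_mono[of m "n + m"] by auto
      then have "sdist (exhaust K n) y < e / 2" using sdist_exhaust tail[of m] by fastforce
      then obtain z where z: "z \<in> exhaust K n" "c z y < e / 2" using sdist_lt[OF exhaust(2)] by blast
      then obtain x where x: "x \<in> F" "c x z < e / 2" using F(3) by auto
      have "c x y < e" using triangle[of x z y] x z by simp
      then show "y \<in> (\<Union>x\<in>F. mball x e)" using x by auto
    qed
    then show "\<exists>F. finite F \<and> F \<subseteq> ?U \<and> ?U \<subseteq> (\<Union>x\<in>F. mball x e)" using F by blast
  qed
  then have "compactin mtopology (mtopology closure_of ?U)"
    using mtotally_bounded_eq_compact_closure_of[OF complete] by blast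
  then have C: "compact (closure ?U)" by (simp add: topology)
  have ne: "closure ?U \<noteq> {}" using exhaust(2)[of 0] closure_subset[of ?U] by blast
  obtain t where t: "0 < t" "t \<le> 1" "compact (nbhd (closure ?U) t)" using compact_nbhd_exists[OF C ne] by blast
  \<comment> \<open>The compact \<open>t\<close>-neighbourhood of the closure of the union contains
    the \<open>t\<close>-neighbourhood of every stage. So the radius chosen at each stage is at
    least t/2, although summable radii tend to 0.\<close>
  have "t \<le> 2 * rad n" for n
  proof (rule radius(3)[OF exhaust t(2)])
    have "nbhd (exhaust K n) t \<subseteq> nbhd (closure ?U) t"
    proof
      fix x assume "x \<in> nbhd (exhaust K n) t"
      moreover have "sdist (closure ?U) x \<le> sdist (exhaust K n) x"
        by (rule sdist_greatest[OF exhaust(2)], rule sdist_le) (use closure_subset[of ?U] in blast)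
      ultimately show "x \<in> nbhd (closure ?U) t" by (simp add: nbhd_def)
    qed
    then show "compact (nbhd (exhaust K n) t)"
      using t(3) closed_nbhd[OF exhaust(2)] by (metis compact_Int_closed inf.absorb_iff2)
  qed
  moreover have "\<exists>n. rad n < t / 2"
    using order_tendstoD(2)[OF summable_LIMSEQ_zero[OF sm], of "t / 2"] t(1) by (auto simp: eventually_sequentially)
  ultimately show False by (metis (no_types, opaque_lifting) field_sum_of_halves leD mult_2 mult_strict_left_mono less_add_same_cancel1 add_strict_mono)
qed

text \<open>The function \<open>b\<close> climbs by \<open>rad n\<close> between stage n and stage n
  + 1, so outside stage \<open>N\<close> it equals the sum of the first \<open>N\<close> radii,
  which exceeds 1/e. The plain distance from \<open>K\<close> would not do, since without a length
  structure it may stay bounded. The summands of \<open>b\<close> are 1-Lipschitz, and at two points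
  closer than \<open>r\<close> at most two consecutive ones differ; hence the factor 2.\<close>

lemma cutoff_nonempty:
  assumes e: "0 < e"
  shows "\<exists>\<phi> S r. compact S \<and> 0 < r \<and> (\<forall>x. 0 \<le> \<phi> x \<and> \<phi> x \<le> (1::real)) \<and> (\<forall>x\<in>K. \<phi> x = 1) \<and>
    (\<forall>x. x \<notin> S \<longrightarrow> \<phi> x = 0) \<and> (\<forall>x y. c x y < r \<longrightarrow> \<bar>\<phi> x - \<phi> y\<bar> \<le> 2 * e * c x y)"
proof -
  have "\<not> (\<forall>n. (\<Sum>i<n. rad i) \<le> 1 / e)"
    using bounded_imp_summable[of rad "1 / e"] not_summable_rad rad_pos less_imp_le
    by (metis (no_types, lifting) lessThan_Suc_atMost)
  then obtain N where N: "1 / e < (\<Sum>i<N. rad i)" by (auto simp: not_le)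
  define g where "g n x = min (sdist (exhaust K n) x) (rad n)" for n x
  define b where "b x = (\<Sum>n<N. g n x)" for x
  \<comment> \<open>A move by less than \<open>r\<close> from a stage ends in the next
    stage.\<close>
  define r where "r = Min (rad ` {..Suc N})"
  have r: "0 < r" unfolding r_def using rad_pos by (subst Min_gr_iff) auto
  have rle: "r \<le> rad n" if "n \<le> Suc N" for n unfolding r_def using that by (intro Min_le) auto
  have g0: "0 \<le> g n x" for n x using sdist_nonneg[OF exhaust(2)] rad_pos by (auto simp: g_def intro: less_imp_le)
  have gl: "\<bar>g n x - g n y\<bar> \<le> c x y" for n x y
    using sdist_triangle[OF exhaust(2), of n x y] sdist_triangle[OF exhaust(2), of n y x] commute[of x y]
    by (auto simp: g_def min_def)
  have bl: "\<bar>b x - b y\<bar> \<le> 2 * c x y" if xy: "c x y < r" for x y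
  proof (cases "\<exists>n<N. sdist (exhaust K n) x < rad n \<or> sdist (exhaust K n) y < rad n")
    case False
    then have "rad n \<le> sdist (exhaust K n) x" "rad n \<le> sdist (exhaust K n) y" if "n < N" for n
      using False that by (meson not_less)+
    then have "g n x = g n y" if "n < N" for n using that by (simp add: g_def min_absorb2)
    then have "b x = b y" unfolding b_def by (intro sum.cong) auto
    then show ?thesis by simp
  next
    case True
    \<comment> \<open>The first shell that contains one of the points on its inner side. Earlier
      summands are saturated at both points. As one of the points is in stage i + 1, both are in
      stage i + 2, so later summands vanish at both.\<close>
    define i where "i = (LEAST n. n < N \<and> (sdist (exhaust K n) x < rad n \<or> sdist (exhaust K n) y < rad n))"
    have i: "i < N" "sdist (exhaust K i) x < rad i \<or> sdist (exhaust K i) y < rad i"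
      using LeastI_ex[OF True] unfolding i_def by blast+
    have lo: "g n x = g n y" if "n < i" for n
    proof -
      have "\<not> (sdist (exhaust K n) x < rad n \<or> sdist (exhaust K n) y < rad n)"
        using not_less_Least[of n, folded i_def] that i(1) unfolding i_def by fastforce
      then show ?thesis by (simp add: g_def min_absorb2 not_less)
    qed
    have step: "y' \<in> exhaust K (Suc (Suc i))" if "x' \<in> exhaust K (Suc i)" "c x' y' < r" for x' y'
    proof -
      have "sdist (exhaust K (Suc i)) y' \<le> c x' y'" by (rule sdist_le[OF that(1)])
      also have "\<dots> \<le> rad (Suc i)" using that(2) rle[of "Suc i"] i(1) by simp
      finally show ?thesis by (simp only: exhaust_Suc)
    qed
    have "x \<in> exhaust K (Suc i) \<or> y \<in> exhaust K (Suc i)" using i(2) by (auto simp only: exhaust_Suc)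
    then have xy2: "x \<in> exhaust K (Suc (Suc i))" "y \<in> exhaust K (Suc (Suc i))"
      using step[of x y] step[of y x] xy exhaust_mono[of "Suc i" "Suc (Suc i)"] commute[of x y] by auto
    have hi: "g n x = g n y" if "Suc (Suc i) \<le> n" for n
      unfolding g_def
      using sdist_eq_0[OF subsetD[OF exhaust_mono[OF that] xy2(1)]] sdist_eq_0[OF subsetD[OF exhaust_mono[OF that] xy2(2)]]
      by (simp del: exhaust.simps)
    have "b x - b y = (\<Sum>n<N. g n x - g n y)" by (simp add: b_def sum_subtractf)
    also have "\<dots> = (\<Sum>n\<in>{i, Suc i} \<inter> {..<N}. g n x - g n y)"
      by (rule sum.mono_neutral_right) (use lo hi in \<open>auto simp: not_less less_Suc_eq_le Suc_le_eq\<close>, metis lo hi linorder_neqE_nat less_Suc_eq not_less Suc_le_eq)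
    also have "\<bar>\<dots>\<bar> \<le> (\<Sum>n\<in>{i, Suc i} \<inter> {..<N}. \<bar>g n x - g n y\<bar>)" by (rule sum_abs)
    also have "\<dots> \<le> (\<Sum>n\<in>{i, Suc i}. \<bar>g n x - g n y\<bar>)" by (rule sum_mono2) auto
    also have "\<dots> \<le> 2 * c x y" using gl[of i x y] gl[of "Suc i" x y] by simp
    finally show ?thesis .
  qed
  have out: "1 / e \<le> b x" if "x \<notin> exhaust K N" for x
  proof -
    have "g n x = rad n" if "n < N" for n
    proof -
      have "x \<notin> exhaust K (Suc n)" using exhaust_mono[of "Suc n" N] that \<open>x \<notin> exhaust K N\<close> by auto
      then show ?thesis unfolding exhaust_Suc by (simp add: g_def)
    qed
    then have "b x = (\<Sum>n<N. rad n)" unfolding b_def by (intro sum.cong) auto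
    then show ?thesis using N by simp
  qed
  let ?\<phi> = "\<lambda>x. max 0 (1 - e * b x)"
  have b0: "0 \<le> b x" for x unfolding b_def by (rule sum_nonneg) (rule g0)
  show ?thesis
  proof (intro exI[of _ ?\<phi>] exI[of _ "exhaust K N"] exI[of _ r] conjI allI impI ballI)
    show "?\<phi> x \<le> 1" for x using b0[of x] e by simp
    show "?\<phi> x = 1" if "x \<in> K" for x
    proof -
      have "x \<in> exhaust K n" for n using exhaust_mono[of 0 n] that by auto
      then have "b x = 0" unfolding b_def g_def using rad_pos by (intro sum.neutral) (auto simp: sdist_eq_0 min_def intro: less_imp_le)
      then show ?thesis by simp
    qed
    show "?\<phi> x = 0" if "x \<notin> exhaust K N" for x using out[OF that] e by (simp add: field_simps)
    show "\<bar>?\<phi> x - ?\<phi> y\<bar> \<le> 2 * e * c x y" if "c x y < r" for x y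
    proof -
      have "\<bar>?\<phi> x - ?\<phi> y\<bar> \<le> \<bar>e * (b x - b y)\<bar>" by (auto simp: right_diff_distrib max_def abs_if)
      also have "\<dots> \<le> e * (2 * c x y)" unfolding abs_mult using bl[OF that] e by simp
      finally show ?thesis by simp
    qed
  qed (use exhaust r in auto)
qed

end

lemma cutoff:
  assumes "compact K" "0 < e"
  shows "\<exists>\<phi> S r. compact S \<and> 0 < r \<and> (\<forall>x. 0 \<le> \<phi> x \<and> \<phi> x \<le> (1::real)) \<and> (\<forall>x\<in>K. \<phi> x = 1) \<and>
    (\<forall>x. x \<notin> S \<longrightarrow> \<phi> x = 0) \<and> (\<forall>x y. c x y < r \<longrightarrow> \<bar>\<phi> x - \<phi> y\<bar> \<le> e * c x y)"
proof (cases "K = {}")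
  case True
  show ?thesis
    by (rule exI[of _ "\<lambda>_. 0"], rule exI[of _ "{}"], rule exI[of _ 1]) (use True assms in auto)
next
  case False
  from cutoff_nonempty[OF assms(1) False, of "e / 2"] assms(2) show ?thesis by simp
qed

end

context riem
begin

section \<open>Cutoff functions for the Riemannian distance\<close>

lemma open_mball: "open (metric.mball x r)"
  using metric.openin_mball[of x r] by (simp add: mtopology_mdist)

lemma open_iff_mball: "open U \<longleftrightarrow> (\<forall>x\<in>U. \<exists>r>0. metric.mball x r \<subseteq> U)"
  using metric.openin_mtopology[of U] by (auto simp: mtopology_mdist)

lemma compact_neighbourhood: "\<exists>U K. open U \<and> compact K \<and> (x::'m) \<in> U \<and> U \<subseteq> K"
proof -
  let ?c = "chart_at M x"
  note c = chart_at[of x]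
  obtain R where R: "0 < R" "cball (snd ?c x) R \<subseteq> snd ?c ` fst ?c"
    using chart_cball[OF c open_UNIV] by auto
  have sub: "ball (snd ?c x) R \<subseteq> snd ?c ` fst ?c" using R(2) ball_subset_cball by blast
  have "x \<in> chart_inv ?c ` ball (snd ?c x) R"
    using R(1) chart_inv_chart[OF c] by (intro image_eqI[of _ _ "snd ?c x"]) auto
  then show ?thesis
    by (intro exI[of _ "chart_inv ?c ` ball (snd ?c x) R"] exI[of _ "chart_inv ?c ` cball (snd ?c x) R"] conjI
        open_chart_inv_image[OF c(1) open_ball sub] compact_chart_inv_image[OF c(1) compact_cball R(2)]
        image_mono[OF ball_subset_cball])
qed

text \<open>A gauge of local compactness: positive and 1-Lipschitz, with the property that a Cauchy
  sequence along which it does not tend to 0 lies in one compact set from some index on. The cap at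
  1 makes the supremum exist.\<close>

definition compact_radius :: "'m \<Rightarrow> real" where
  "compact_radius x = Sup {r \<in> {0..1}. \<exists>K. compact K \<and> metric.mball x r \<subseteq> K}"

lemma compact_radius_bdd: "bdd_above {r \<in> {0..1::real}. \<exists>K. compact K \<and> metric.mball x r \<subseteq> K}"
  by (rule bdd_aboveI[of _ 1]) auto

lemma compact_radius_ge:
  "0 \<le> r \<Longrightarrow> r \<le> 1 \<Longrightarrow> compact K \<Longrightarrow> metric.mball x r \<subseteq> K \<Longrightarrow> r \<le> compact_radius x"
  unfolding compact_radius_def by (rule cSup_upper[OF _ compact_radius_bdd]) auto

lemma compact_radius_less:
  assumes "r < compact_radius x" shows "\<exists>K. compact K \<and> metric.mball x r \<subseteq> K"
proof -
  have "{r \<in> {0..1::real}. \<exists>K. compact K \<and> metric.mball x r \<subseteq> K} \<noteq> {}"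
    using metric.mball_eq_empty[of x 0] by (auto intro!: exI[of _ 0] exI[of _ "{}"])
  from less_cSup_iff[OF this compact_radius_bdd, of r] assms
  obtain r' K where "r < r'" "compact K" "metric.mball x r' \<subseteq> K" unfolding compact_radius_def by auto
  moreover have "metric.mball x r \<subseteq> metric.mball x r'"
    by (rule metric.mball_subset_concentric) (use \<open>r < r'\<close> in simp)
  ultimately show ?thesis by blast
qed

lemma compact_radius_pos: "0 < compact_radius x"
proof -
  obtain U K where UK: "open U" "compact K" "x \<in> U" "U \<subseteq> K" using compact_neighbourhood[of x] by (elim exE conjE)
  obtain r where r: "0 < r" "metric.mball x r \<subseteq> U" using UK(1,3) open_iff_mball[of U] by blast
  have "min 1 r \<le> compact_radius x"
    by (rule compact_radius_ge[OF _ _ UK(2)])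
      (use r UK(4) metric.mball_subset_concentric[of "min 1 r" r x] in auto)
  then show ?thesis using r(1) by simp
qed

text \<open>A ball around \<open>y\<close>, with its radius reduced by the distance from
  \<open>x\<close>, lies inside the ball around \<open>x\<close>.\<close>

lemma compact_radius_le: "compact_radius x \<le> compact_radius y + mdist x y"
proof (rule ccontr)
  assume "\<not> ?thesis"
  then have less: "compact_radius y + mdist x y < compact_radius x" by simp
  define r where "r = (compact_radius y + mdist x y + compact_radius x) / 2"
  have r: "compact_radius y < r - mdist x y" "r < compact_radius x" using less unfolding r_def by (simp_all add: field_simps)
  obtain K where K: "compact K" "metric.mball x r \<subseteq> K" using compact_radius_less[OF r(2)] by blast
  have "compact_radius x \<le> 1"
    unfolding compact_radius_def
    using metric.mball_eq_empty[of x 0] by (intro cSup_least) (auto intro!: exI[of _ 0] exI[of _ "{}"])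
  moreover have "metric.mball y (r - mdist x y) \<subseteq> K"
  proof
    fix z assume "z \<in> metric.mball y (r - mdist x y)"
    then have "mdist x z < r" using metric.triangle[of x y z] by simp
    then show "z \<in> K" using K(2) by auto
  qed
  ultimately have "r - mdist x y \<le> compact_radius y"
    using r compact_radius_pos[of y] metric.nonneg[of x y] by (intro compact_radius_ge[OF _ _ K(1)]) linarith+
  then show False using r(1) by simp
qed

lemma metric_add_pullback:
  "Metric_space UNIV (\<lambda>x y. mdist x y + \<bar>\<psi> x - \<psi> y\<bar>)" for \<psi> :: "'m \<Rightarrow> real"
proof
  fix x y z :: 'm
  show "mdist x y + \<bar>\<psi> x - \<psi> y\<bar> = 0 \<longleftrightarrow> x = y"
  proof
    assume "mdist x y + \<bar>\<psi> x - \<psi> y\<bar> = 0"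
    then have "mdist x y = 0" using metric.nonneg[of x y] by linarith
    then show "x = y" by simp
  qed simp
  show "mdist x z + \<bar>\<psi> x - \<psi> z\<bar> \<le> mdist x y + \<bar>\<psi> x - \<psi> y\<bar> + (mdist y z + \<bar>\<psi> y - \<psi> z\<bar>)"
    using metric.triangle[of x y z] by simp
qed (auto simp: metric.commute)

text \<open>Balls of the new metric lie inside balls of the old one; continuity of \<psi> gives the
  converse comparison.\<close>

lemma mtopology_add_pullback:
  assumes "continuous_on UNIV (\<psi> :: 'm \<Rightarrow> real)"
  shows "Metric_space.mtopology UNIV (\<lambda>x y. mdist x y + \<bar>\<psi> x - \<psi> y\<bar>) = euclidean"
proof -
  interpret c: Metric_space UNIV "\<lambda>x y. mdist x y + \<bar>\<psi> x - \<psi> y\<bar>" by (rule metric_add_pullback)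
  have "openin c.mtopology U \<longleftrightarrow> open U" for U
  proof
    assume "open U"
    then show "openin c.mtopology U"
      unfolding c.openin_mtopology open_iff_mball by (fastforce simp: subset_iff)
  next
    assume U: "openin c.mtopology U"
    show "open U"
      unfolding open_iff_mball
    proof
      fix x assume "x \<in> U"
      then obtain r where r: "0 < r" "c.mball x r \<subseteq> U" using U unfolding c.openin_mtopology by blast
      have "open (\<psi> -` ball (\<psi> x) (r / 2))" by (rule open_vimage[OF open_ball assms])
      then obtain s where s: "0 < s" "metric.mball x s \<subseteq> \<psi> -` ball (\<psi> x) (r / 2)"
        unfolding open_iff_mball using r(1) by fastforce
      have "metric.mball x (min s (r / 2)) \<subseteq> U"
      proof
        fix y assume y: "y \<in> metric.mball x (min s (r / 2))"
        then have "y \<in> metric.mball x s" by simp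
        then have "\<bar>\<psi> x - \<psi> y\<bar> < r / 2" using s(2) by (auto simp: dist_real_def)
        then have "y \<in> c.mball x r" using y by simp
        then show "y \<in> U" using r(2) by blast
      qed
      then show "\<exists>r>0. metric.mball x r \<subseteq> U" using s(1) r(1) by (intro exI[of _ "min s (r / 2)"]) auto
    qed
  qed
  then show ?thesis by (simp add: topology_eq)
qed

text \<open>Completeness is known for sequences in \<open>A\<close> only, whereas
  \<open>cutoff\<close> wants a complete metric on the whole space. Adding |\<psi> x - \<psi> y|
  with \<psi> = dA^2 / \<open>compact_radius\<close> provides one: \<psi> is bounded along a Cauchy
  sequence, so if the radius of compactness tends to 0, then so does dA, and the sequence merges
  with one in \<open>A\<close>. The square makes \<psi> so flat at \<open>A\<close> that the new
  metric is at most twice the old one there.\<close>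

lemma cutoff_exists:
  fixes A K :: "'m set"
  assumes A: "\<And>s. metric.MCauchy s \<Longrightarrow> range s \<subseteq> A \<Longrightarrow> \<exists>x. limitin metric.mtopology s x sequentially"
    and K: "compact K" and e: "0 < e"
  shows "\<exists>\<phi> S. compact S \<and> continuous_on UNIV \<phi> \<and> (\<forall>x. 0 \<le> \<phi> x \<and> \<phi> x \<le> (1::real)) \<and> (\<forall>x\<in>K. \<phi> x = 1) \<and>
    (\<forall>x. x \<notin> S \<longrightarrow> \<phi> x = 0) \<and>
    (\<forall>a\<in>A. \<exists>U. open U \<and> a \<in> U \<and> (\<forall>x\<in>U. \<forall>y\<in>U. \<bar>\<phi> x - \<phi> y\<bar> \<le> e * mdist x y))"
proof -
  \<comment> \<open>The distance from \<open>A\<close> capped at 1, which also provides a value if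
    \<open>A\<close> is empty.\<close>
  define dA where "dA x = Inf (insert 1 ((\<lambda>a. mdist a x) ` A))" for x
  have bdd: "bdd_below (insert 1 ((\<lambda>a. mdist a x) ` A))" for x by (rule bdd_belowI[of _ 0]) auto
  have dA0: "0 \<le> dA x" for x unfolding dA_def by (rule cInf_greatest) auto
  have dA1: "dA x \<le> 1" for x unfolding dA_def by (rule cInf_lower[OF _ bdd]) simp
  have dAA: "dA a = 0" if "a \<in> A" for a
    using cInf_lower[OF _ bdd[of a], of 0] dA0[of a] that by (auto simp: dA_def image_iff intro!: antisym)
  have dAl: "dA x \<le> dA y + mdist y x" for x y
  proof -
    have "dA x - mdist y x \<le> dA y"
      unfolding dA_def[of y]
    proof (rule cInf_greatest)
      fix r assume "r \<in> insert 1 ((\<lambda>a. mdist a y) ` A)"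
      then show "dA x - mdist y x \<le> r"
      proof
        assume "r = 1" then show ?thesis using dA1[of x] metric.nonneg[of y x] by linarith
      next
        assume "r \<in> (\<lambda>a. mdist a y) ` A"
        then obtain a where a: "a \<in> A" "r = mdist a y" by blast
        then have "dA x \<le> mdist a x" unfolding dA_def by (intro cInf_lower[OF _ bdd]) auto
        then show ?thesis using metric.triangle[of a y x] a by simp
      qed
    qed simp
    then show ?thesis by simp
  qed
  have dAlt: "\<exists>a\<in>A. mdist a x < r" if "dA x < r" "r \<le> 1" for x r
    using that cInf_less_iff[OF _ bdd[of x], of r] by (auto simp: dA_def)
  note \<delta>p = compact_radius_pos
  define \<psi> where "\<psi> x = (dA x)\<^sup>2 / compact_radius x" for x
  have \<psi>l: "\<bar>\<psi> x - \<psi> y\<bar> \<le> mdist x y * (\<bar>dA x + dA y\<bar> / compact_radius x + (dA y)\<^sup>2 / (compact_radius x * compact_radius y))" for x y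
  proof -
    let ?X = "compact_radius x" and ?Y = "compact_radius y"
    \<comment> \<open>The difference of the squares is separated from the change of the denominator,
      because both \<open>dA\<close> and \<open>compact_radius\<close> are 1-Lipschitz.\<close>
    have "\<psi> x - \<psi> y = (dA x - dA y) * ((dA x + dA y) / ?X) + (dA y)\<^sup>2 / (?X * ?Y) * (?Y - ?X)"
      using \<delta>p[of x] \<delta>p[of y] by (simp add: \<psi>_def field_simps power2_eq_square)
    also have "\<bar>\<dots>\<bar> \<le> \<bar>dA x - dA y\<bar> * (\<bar>dA x + dA y\<bar> / ?X) + (dA y)\<^sup>2 / (?X * ?Y) * \<bar>?Y - ?X\<bar>"
      by (rule order_trans[OF abs_triangle_ineq]) (use \<delta>p[of x] \<delta>p[of y] in \<open>simp add: abs_mult\<close>)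
    also have "\<dots> \<le> mdist x y * (\<bar>dA x + dA y\<bar> / ?X) + (dA y)\<^sup>2 / (?X * ?Y) * mdist x y"
    proof (intro add_mono mult_right_mono mult_left_mono)
      show "\<bar>dA x - dA y\<bar> \<le> mdist x y" using dAl[of x y] dAl[of y x] by (simp add: metric.commute)
      show "\<bar>?Y - ?X\<bar> \<le> mdist x y"
        using compact_radius_le[of x y] compact_radius_le[of y x] by (simp add: metric.commute)
    qed (use \<delta>p[of x] \<delta>p[of y] in auto)
    finally show ?thesis by (simp add: algebra_simps)
  qed
  have local: "\<exists>s>0. \<forall>x\<in>metric.mball a s. \<forall>y\<in>metric.mball a s. \<bar>\<psi> x - \<psi> y\<bar> \<le> mdist x y" if a: "a \<in> A" for a
  proof -
    \<comment> \<open>Within \<open>s\<close> of a point of \<open>A\<close> the distance from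
      \<open>A\<close> is at most s and the radius of compactness at least 7s, hence 4s. The
      Lipschitz factor of \<psi> is then at most 1/2 + 1/16.\<close>
    define s where "s = compact_radius a / 8"
    have s: "0 < s" using \<delta>p[of a] by (simp add: s_def)
    have "\<bar>\<psi> x - \<psi> y\<bar> \<le> mdist x y" if xy: "x \<in> metric.mball a s" "y \<in> metric.mball a s" for x y
    proof -
      have d: "dA x \<le> s" "dA y \<le> s" using xy dAl[of x a] dAl[of y a] dAA[OF a] by auto
      have r: "4 * s \<le> compact_radius x" "4 * s \<le> compact_radius y"
        using xy compact_radius_le[of a x] compact_radius_le[of a y] \<delta>p[of a] by (auto simp: s_def)
      have "\<bar>dA x + dA y\<bar> / compact_radius x \<le> (2 * s) / (4 * s)"
        using d r s dA0[of x] dA0[of y] by (intro frac_le) auto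
      moreover have "(dA y)\<^sup>2 / (compact_radius x * compact_radius y) \<le> s\<^sup>2 / ((4 * s) * (4 * s))"
        using d r s dA0[of y] by (intro frac_le power_mono mult_mono) auto
      ultimately have "\<bar>dA x + dA y\<bar> / compact_radius x + (dA y)\<^sup>2 / (compact_radius x * compact_radius y) \<le> 1"
      proof -
        have "(2 * s) / (4 * s) = 1 / 2" "s\<^sup>2 / ((4 * s) * (4 * s)) = 1 / 16" using s by (simp_all add: power2_eq_square)
        moreover assume "\<bar>dA x + dA y\<bar> / compact_radius x \<le> (2 * s) / (4 * s)"
          "(dA y)\<^sup>2 / (compact_radius x * compact_radius y) \<le> s\<^sup>2 / ((4 * s) * (4 * s))"
        ultimately show ?thesis by linarith
      qed
      then have "mdist x y * (\<bar>dA x + dA y\<bar> / compact_radius x + (dA y)\<^sup>2 / (compact_radius x * compact_radius y)) \<le> mdist x y * 1"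
        by (intro mult_left_mono) auto
      then show ?thesis using \<psi>l[of x y] by simp
    qed
    then show ?thesis using s by blast
  qed
  have cont1: "continuous_on UNIV f" if "\<And>x y. \<bar>f x - f y\<bar> \<le> mdist x y" for f :: "'m \<Rightarrow> real"
    unfolding continuous_on_open_vimage[OF open_UNIV]
  proof (intro allI impI)
    fix B :: "real set" assume B: "open B"
    have "open (f -` B)"
      unfolding open_iff_mball
    proof
      fix x assume "x \<in> f -` B"
      then obtain r where "0 < r" "ball (f x) r \<subseteq> B" using B open_contains_ball by blast
      then show "\<exists>r>0. metric.mball x r \<subseteq> f -` B"
        using that[of x] by (intro exI[of _ r]) (force simp: dist_real_def subset_iff intro: le_less_trans)
    qed
    then show "open (f -` B \<inter> UNIV)" by simp
  qed
  have c\<psi>: "continuous_on UNIV \<psi>"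
    unfolding \<psi>_def
  proof (intro continuous_intros cont1)
    show "\<bar>dA x - dA y\<bar> \<le> mdist x y" for x y using dAl[of x y] dAl[of y x] by (simp add: metric.commute)
    show "\<bar>compact_radius x - compact_radius y\<bar> \<le> mdist x y" for x y
      using compact_radius_le[of x y] compact_radius_le[of y x] by (simp add: metric.commute)
    show "\<forall>x\<in>UNIV. compact_radius x \<noteq> 0" using \<delta>p by (metis less_irrefl)
  qed
  let ?c = "\<lambda>x y. mdist x y + \<bar>\<psi> x - \<psi> y\<bar>"
  interpret c: Metric_space UNIV ?c by (rule metric_add_pullback)
  have top: "c.mtopology = euclidean" by (rule mtopology_add_pullback[OF c\<psi>])
  have complete: "c.mcomplete"
    unfolding c.mcomplete_def
  proof (intro allI impI)
    fix s assume s: "c.MCauchy s"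
    have sd: "metric.MCauchy s"
      unfolding metric.MCauchy_def
    proof (intro conjI allI impI)
      fix r :: real assume "0 < r"
      then obtain N where N: "\<And>n n'. N \<le> n \<Longrightarrow> N \<le> n' \<Longrightarrow> ?c (s n) (s n') < r"
        using s unfolding c.MCauchy_def by blast
      have "mdist (s n) (s n') < r" if "N \<le> n" "N \<le> n'" for n n' using N[OF that] by linarith
      then show "\<exists>N. \<forall>n n'. N \<le> n \<longrightarrow> N \<le> n' \<longrightarrow> mdist (s n) (s n') < r" by blast
    qed simp
    obtain N1 where N1: "\<And>n n'. N1 \<le> n \<Longrightarrow> N1 \<le> n' \<Longrightarrow> ?c (s n) (s n') < 1"
      using s zero_less_one unfolding c.MCauchy_def by blast
    define B where "B = \<bar>\<psi> (s N1)\<bar> + 1"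
    have B: "\<psi> (s n) \<le> B" if "N1 \<le> n" for n
      using N1[OF that order_refl] metric.nonneg[of "s n" "s N1"] unfolding B_def by linarith
    have "\<exists>x. limitin metric.mtopology s x sequentially"
    \<comment> \<open>Either the radius of compactness exceeds a fixed \<open>r\<close> infinitely
      often, and then a tail of the sequence lies in one compact set, or it tends to 0 and the bound
      on \<psi> drives \<open>dA\<close> to 0.\<close>
    proof (cases "\<exists>r>0. \<forall>N. \<exists>n\<ge>N. r < compact_radius (s n)")
      case True
      then obtain r where r: "0 < r" "\<And>N. \<exists>n\<ge>N. r < compact_radius (s n)" by blast
      then obtain N where N: "\<And>n n'. N \<le> n \<Longrightarrow> N \<le> n' \<Longrightarrow> mdist (s n) (s n') < r"
        using sd unfolding metric.MCauchy_def by blast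
      obtain n where n: "N \<le> n" "r < compact_radius (s n)" using r(2) by blast
      obtain C where C: "compact C" "metric.mball (s n) r \<subseteq> C" using compact_radius_less[OF n(2)] by blast
      have "s (k + n) \<in> C" for k using C(2) N[of n "k + n"] n(1) by auto
      moreover have "compactin metric.mtopology C" using C(1) by (simp add: mtopology_mdist)
      ultimately obtain l q where lq: "strict_mono q" "limitin metric.mtopology ((\<lambda>k. s (k + n)) \<circ> q) l sequentially"
        unfolding metric.compactin_sequentially by (metis image_subsetI)
      have "strict_mono ((\<lambda>k. k + n) \<circ> q)" using lq(1) by (simp add: strict_mono_def)
      moreover have "limitin metric.mtopology (s \<circ> ((\<lambda>k. k + n) \<circ> q)) l sequentially"
        using lq(2) by (simp add: comp_def)
      ultimately show ?thesis using metric.MCauchy_convergent_subsequence[OF sd] by blast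
    next
      case False
      have small: "\<exists>N. \<forall>n\<ge>N. dA (s n) < r" if "0 < r" for r
      proof -
        have Bp: "0 < B" by (simp add: B_def)
        \<comment> \<open>The factor 2 leaves room for the strict inequality
          \<open>dA (s n) < r\<close>.\<close>
        have "0 < r\<^sup>2 / (2 * B)" using that Bp by simp
        then obtain N where N: "\<And>n. N \<le> n \<Longrightarrow> compact_radius (s n) \<le> r\<^sup>2 / (2 * B)"
          using False by (meson not_le)
        have "dA (s n) < r" if n: "max N N1 \<le> n" for n
        proof -
          have "(dA (s n))\<^sup>2 = \<psi> (s n) * compact_radius (s n)" using \<delta>p[of "s n"] by (simp add: \<psi>_def)
          also have "\<dots> \<le> B * (r\<^sup>2 / (2 * B))"
            using B[of n] N[of n] n \<delta>p[of "s n"] Bp by (intro mult_mono) auto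
          also have "\<dots> < r\<^sup>2" using Bp \<open>0 < r\<close> by simp
          finally show ?thesis using \<open>0 < r\<close> by (meson less_imp_le power_less_imp_less_base)
        qed
        then show ?thesis by blast
      qed
      obtain N0 where N0: "\<And>n. N0 \<le> n \<Longrightarrow> dA (s n) < 1" using small[of 1] by auto
      \<comment> \<open>Because of the cap, \<open>dA\<close> is approached by distances from points
        of \<open>A\<close> only where it is below 1; the shift by \<open>N0\<close> ensures
        this.\<close>
      have "\<exists>a\<in>A. mdist a (s (n + N0)) < dA (s (n + N0)) + 1 / Suc n" for n
      proof (cases "dA (s (n + N0)) + 1 / Suc n \<le> 1")
        case True then show ?thesis by (intro dAlt) auto
      next
        case False
        then obtain a where "a \<in> A" "mdist a (s (n + N0)) < 1" using dAlt[OF N0[of "n + N0"]] by auto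
        then show ?thesis using False by force
      qed
      then obtain a where a: "\<And>n. a n \<in> A" "\<And>n. mdist (a n) (s (n + N0)) < dA (s (n + N0)) + 1 / Suc n" by metis
      have near: "\<exists>N. \<forall>n\<ge>N. mdist (a n) (s (n + N0)) < r" if rpos: "0 < r" for r
      proof -
        obtain N where N: "\<And>n. N \<le> n \<Longrightarrow> dA (s n) < r / 2" using small[of "r / 2"] rpos by auto
        obtain N' where N': "1 / real (Suc N') < r / 2" using reals_Archimedean[of "r / 2"] rpos by (auto simp: inverse_eq_divide)
        have "mdist (a n) (s (n + N0)) < r" if "max N N' \<le> n" for n
        proof -
          have "1 / real (Suc n) \<le> 1 / real (Suc N')" using that by (intro divide_left_mono) auto
          then show ?thesis using a(2)[of n] N[of "n + N0"] N' that by simp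
        qed
        then show ?thesis by blast
      qed
      have "metric.MCauchy a"
        unfolding metric.MCauchy_def
      proof (intro conjI allI impI)
        fix r :: real assume r: "0 < r"
        obtain N where N: "\<And>n. N \<le> n \<Longrightarrow> mdist (a n) (s (n + N0)) < r / 3" using near[of "r / 3"] r by auto
        obtain N' where N': "\<And>n n'. N' \<le> n \<Longrightarrow> N' \<le> n' \<Longrightarrow> mdist (s n) (s n') < r / 3"
          using sd r unfolding metric.MCauchy_def by (meson divide_pos_pos zero_less_numeral)
        have "mdist (a n) (a n') < r" if "max N N' \<le> n" "max N N' \<le> n'" for n n'
          using N[of n] N[of n'] N'[of "n + N0" "n' + N0"] that
            metric.triangle[of "a n" "s (n + N0)" "a n'"] metric.triangle[of "s (n + N0)" "s (n' + N0)" "a n'"]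
            metric.commute[of "a n'" "s (n' + N0)"] by simp
        then show "\<exists>N. \<forall>n n'. N \<le> n \<longrightarrow> N \<le> n' \<longrightarrow> mdist (a n) (a n') < r" by blast
      qed simp
      then obtain x where x: "limitin metric.mtopology a x sequentially" using A a(1) by blast
      have "\<exists>N. \<forall>n\<ge>N. mdist (s n) x < r" if r: "0 < r" for r
      proof -
        obtain N where N: "\<And>n. N \<le> n \<Longrightarrow> mdist (a n) (s (n + N0)) < r / 2" using near[of "r / 2"] r by auto
        obtain N' where N': "\<And>n. N' \<le> n \<Longrightarrow> mdist (a n) x < r / 2"
          using x r unfolding metric.limit_metric_sequentially by (meson half_gt_zero)
        have "mdist (s n) x < r" if "max N N' + N0 \<le> n" for n
        proof -
          have n: "N \<le> n - N0" "N' \<le> n - N0" "n - N0 + N0 = n" using that by auto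
          show ?thesis
            using N[OF n(1)] N'[OF n(2)] metric.triangle[of "s n" "a (n - N0)" x]
              metric.commute[of "s n" "a (n - N0)"] by (simp add: n(3))
        qed
        then show ?thesis by blast
      qed
      then show ?thesis unfolding metric.limit_metric_sequentially by auto
    qed
    then show "\<exists>x. limitin c.mtopology s x sequentially" by (simp add: top mtopology_mdist)
  qed
  interpret c: complete_locally_compact ?c
    by unfold_locales (rule top complete compact_neighbourhood)+
  \<comment> \<open>Half of \<open>e\<close> is prescribed, as the modified metric is at most
    \<open>2 * mdist\<close> near \<open>A\<close>.\<close>
  obtain \<phi> S r where \<phi>: "compact S" "0 < r" "\<And>x. 0 \<le> \<phi> x \<and> \<phi> x \<le> (1::real)" "\<And>x. x \<in> K \<Longrightarrow> \<phi> x = 1"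
    "\<And>x. x \<notin> S \<Longrightarrow> \<phi> x = 0" "\<And>x y. ?c x y < r \<Longrightarrow> \<bar>\<phi> x - \<phi> y\<bar> \<le> e / 2 * ?c x y"
  proof -
    have "0 < e / 2" using e by simp
    from c.cutoff[OF K this] show ?thesis using that by blast
  qed
  have "continuous_on UNIV \<phi>"
    unfolding continuous_on_open_vimage[OF open_UNIV]
  proof (intro allI impI)
    fix B :: "real set" assume B: "open B"
    have "openin c.mtopology (\<phi> -` B)"
      unfolding c.openin_mtopology
    proof (intro conjI ballI allI impI subset_UNIV)
      fix x assume "x \<in> \<phi> -` B"
      then obtain b where b: "0 < b" "ball (\<phi> x) b \<subseteq> B" using B open_contains_ball by blast
      have "c.mball x (min r (2 * b / e)) \<subseteq> \<phi> -` B"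
      proof
        fix y assume "y \<in> c.mball x (min r (2 * b / e))"
        then have y: "?c x y < r" "?c x y < 2 * b / e" by auto
        then have "e / 2 * ?c x y < b" using e by (simp add: field_simps)
        then have "\<bar>\<phi> x - \<phi> y\<bar> < b" using \<phi>(6)[OF y(1)] by linarith
        then show "y \<in> \<phi> -` B" using b(2) by (auto simp: dist_real_def)
      qed
      then show "\<exists>r>0. c.mball x r \<subseteq> \<phi> -` B" using b(1) e \<phi>(2) by (intro exI[of _ "min r (2 * b / e)"]) auto
    qed
    then show "open (\<phi> -` B \<inter> UNIV)" by (simp add: top)
  qed
  moreover have "\<exists>U. open U \<and> a \<in> U \<and> (\<forall>x\<in>U. \<forall>y\<in>U. \<bar>\<phi> x - \<phi> y\<bar> \<le> e * mdist x y)" if a: "a \<in> A" for a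
  proof -
    obtain s where s: "0 < s" "\<And>x y. x \<in> metric.mball a s \<Longrightarrow> y \<in> metric.mball a s \<Longrightarrow> \<bar>\<psi> x - \<psi> y\<bar> \<le> mdist x y"
      using local[OF a] by blast
    \<comment> \<open>Points of \<open>U\<close> have distance less than r/2, so their modified
      distance stays below the threshold \<open>r\<close> up to which \<phi> is controlled.\<close>
    define U where "U = metric.mball a (min s (r / 4))"
    have U: "open U" "a \<in> U" unfolding U_def using s(1) \<phi>(2) by (auto simp: open_mball)
    have "\<bar>\<phi> x - \<phi> y\<bar> \<le> e * mdist x y" if "x \<in> U" "y \<in> U" for x y
    proof -
      have "mdist x y < r / 2"
        using that metric.triangle[of x a y] metric.commute[of x a] by (auto simp: U_def)
      moreover have \<psi>: "\<bar>\<psi> x - \<psi> y\<bar> \<le> mdist x y" using that by (intro s(2)) (auto simp: U_def)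
      ultimately have "\<bar>\<phi> x - \<phi> y\<bar> \<le> e / 2 * ?c x y" by (intro \<phi>(6)) simp
      also have "\<dots> \<le> e / 2 * (2 * mdist x y)" using \<psi> e by (intro mult_left_mono) auto
      finally show ?thesis by simp
    qed
    then show ?thesis using U by blast
  qed
  ultimately show ?thesis using \<phi>(1,3,4,5) by blast
qed

end

section \<open>Smoothing of cutoff functions\<close>

text \<open>The sum telescopes. It makes the weights
  \<open>\<beta> i * (\<Prod>j<i. 1 - \<beta> j)\<close> a partition of unity wherever some \<beta>
  i equals 1.\<close>

lemma partition_sum:
  fixes \<beta> :: "nat \<Rightarrow> real"
  shows "(\<Sum>i<N. \<beta> i * (\<Prod>j<i. 1 - \<beta> j)) = 1 - (\<Prod>i<N. 1 - \<beta> i)"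
  by (induction N) (simp_all add: algebra_simps)

text \<open>The difference quotients along a ray tend to the directional derivative, and increments
  for small positive \<open>t\<close> are what an averaged Lipschitz bound supplies.\<close>

lemma derivative_le_of_one_sided:
  fixes G :: "'a::real_normed_vector \<Rightarrow> real"
  assumes "(G has_derivative G') (at q)" "0 < s" "\<And>t. 0 < t \<Longrightarrow> t < s \<Longrightarrow> G (q + t *\<^sub>R v) - G q \<le> t * L"
  shows "G' v \<le> L"
proof -
  have l: "((\<lambda>t. q + t *\<^sub>R v) has_derivative (\<lambda>t. t *\<^sub>R v)) (at 0)" by (auto intro!: derivative_eq_intros)
  have "(G has_derivative G') (at (q + 0 *\<^sub>R v))" using assms(1) by simp
  from diff_chain_at[OF l this] have "((\<lambda>t. G (q + t *\<^sub>R v)) has_derivative (\<lambda>t. t * G' v)) (at 0)"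
    using linear_scale[OF has_derivative_linear[OF assms(1)]] by (simp add: comp_def)
  then have "((\<lambda>t. G (q + t *\<^sub>R v)) has_real_derivative G' v) (at 0)"
    by (simp add: has_field_derivative_def mult.commute[of _ "G' v"])
  then have "((\<lambda>t. (G (q + t *\<^sub>R v) - G q) / t) \<longlongrightarrow> G' v) (at 0)"
    by (simp add: DERIV_def)
  then have "((\<lambda>t. (G (q + t *\<^sub>R v) - G q) / t) \<longlongrightarrow> G' v) (at_right 0)"
    by (rule filterlim_mono) (auto simp: at_le)
  moreover have "\<forall>\<^sub>F t in at_right 0. (G (q + t *\<^sub>R v) - G q) / t \<le> L"
    unfolding eventually_at_right_field using assms(2,3)
    by (intro exI[of _ s]) (auto simp: divide_le_eq mult.commute)
  ultimately show ?thesis by (rule tendsto_upperbound) simp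
qed

context riem
begin

text \<open>The coordinate derivatives are bounded on the compact set, and there the Riemannian norm
  of a vector controls its coordinate norm.\<close>

lemma chart_derivative_bound:
  assumes c: "c \<in> atlas M" and \<theta>: "smooth_fun_on M UNIV \<theta>" and K: "compact K" "K \<subseteq> snd c ` fst c"
  shows "\<exists>C\<ge>0. \<forall>x\<in>chart_inv c ` K. \<forall>X. \<bar>differential M \<theta> x X\<bar> \<le> C * sqrt (rmetric M x X X)"
proof -
  let ?D = "\<lambda>q v. frechet_derivative (\<theta> \<circ> chart_inv c) (at q) v"
  obtain m where m: "0 < m" "\<And>q v. q \<in> K \<Longrightarrow> m\<^sup>2 * (norm v)\<^sup>2 \<le> chart_metric c (chart_inv c q) v v"
    using chart_metric_lower_bound[OF c K] by metis
  have sm: "smooth_on (snd c ` fst c) (\<theta> \<circ> chart_inv c)" using smooth_fun_onD[OF \<theta> c] by simp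
  have "\<exists>B. \<forall>q\<in>K. \<bar>?D q (axis i 1)\<bar> \<le> B" for i
  proof -
    have "continuous_on K (\<lambda>q. ?D q (axis i 1))"
      by (rule continuous_on_subset[OF smooth_on_imp_continuous_on[OF smooth_on_frechet_derivative[OF sm]] K(2)])
    from compact_imp_bounded[OF compact_continuous_image[OF this K(1)]] show ?thesis by (simp add: bounded_iff)
  qed
  then obtain B where B: "\<And>i q. q \<in> K \<Longrightarrow> \<bar>?D q (axis i 1)\<bar> \<le> B i" by metis
  define C where "C = (\<Sum>i\<in>UNIV. \<bar>B i\<bar>) / m"
  have "\<bar>differential M \<theta> x X\<bar> \<le> C * sqrt (rmetric M x X X)" if "x \<in> chart_inv c ` K" for x X
  proof -
    from that obtain q where q: "q \<in> K" "x = chart_inv c q" by blast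
    have qr: "q \<in> snd c ` fst c" using q(1) K(2) by blast
    have x: "x \<in> fst c" "snd c x = q" using q chart_inv_mem[OF qr] chart_chart_inv[OF c qr] by auto
    define v where "v = chart_deriv (chart_at M x) (snd c) x X"
    have X: "coord_vec M c x v = X" unfolding v_def by (rule coord_vec_surj[OF c x(1)])
    have lin: "linear (?D q)"
      using has_derivative_linear[OF smooth_on_has_derivative[OF sm qr]] .
    have "\<bar>differential M \<theta> x X\<bar> = \<bar>?D q v\<bar>"
      using differential_coord_vec[OF open_UNIV \<theta> UNIV_I c x(1), of v] X x(2) by simp
    also have "?D q v = (\<Sum>i\<in>UNIV. v $ i * ?D q (axis i 1))"
    proof -
      have "?D q v = ?D q (\<Sum>i\<in>UNIV. v $ i *\<^sub>R axis i 1)"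
        using basis_expansion[of v] by (simp add: scalar_mult_eq_scaleR)
      then show ?thesis by (simp add: linear_sum[OF lin] linear_scale[OF lin])
    qed
    also have "\<bar>\<dots>\<bar> \<le> (\<Sum>i\<in>UNIV. norm v * \<bar>B i\<bar>)"
    proof (rule order_trans[OF sum_abs sum_mono])
      fix i
      have "\<bar>v $ i\<bar> * \<bar>?D q (axis i 1)\<bar> \<le> norm v * \<bar>B i\<bar>"
        using B[OF q(1), of i] by (intro mult_mono component_le_norm_cart) auto
      then show "\<bar>v $ i * ?D q (axis i 1)\<bar> \<le> norm v * \<bar>B i\<bar>" by (simp add: abs_mult)
    qed
    also have "\<dots> = C * (m * norm v)" using m(1) by (simp add: C_def sum_distrib_left[symmetric])
    also have "\<dots> \<le> C * sqrt (rmetric M x X X)"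
    proof (rule mult_left_mono)
      have "(m * norm v)\<^sup>2 \<le> rmetric M x X X"
        using m(2)[OF q(1), of v] q(2) X by (simp add: chart_metric_def power_mult_distrib)
      then show "m * norm v \<le> sqrt (rmetric M x X X)" by (rule real_le_rsqrt)
      show "0 \<le> C" using m(1) by (simp add: C_def sum_nonneg)
    qed
    finally show ?thesis .
  qed
  moreover have "0 \<le> C" using m(1) by (simp add: C_def sum_nonneg)
  ultimately show ?thesis by blast
qed

text \<open>A Lipschitz bound in terms of \<open>mdist\<close> is not invariant under translations
  of the chart. By \<open>rdist_local_le\<close> it implies a bound in terms of the norm frozen at
  the point \<open>q\<close>, at the price of a factor 2, and that bound survives averaging. The
  average at a point of \<open>A\<close> uses values nearby, so the bound is needed on balls whose
  size is uniform for \<open>q\<close> in the compact set \<open>C\<close>.\<close>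

lemma mollify_in_chart:
  fixes f :: "'m \<Rightarrow> real"
  assumes c: "c \<in> atlas M" and R: "0 < R" "cball p (3 * R) \<subseteq> snd c ` fst c"
    and f: "continuous_on UNIV f" "\<And>x. 0 \<le> f x" "\<And>x. f x \<le> 1"
    and A: "closed A" and e: "0 < e" "\<And>a. a \<in> A \<Longrightarrow> \<exists>U. open U \<and> a \<in> U \<and> (\<forall>x\<in>U. \<forall>y\<in>U. \<bar>f x - f y\<bar> \<le> e * mdist x y)"
    and \<tau>: "0 < \<tau>"
  shows "\<exists>g. smooth_fun_on M (fst c) g \<and>
    (\<forall>x\<in>chart_inv c ` cball p (2 * R). 0 \<le> g x \<and> g x \<le> 1 \<and> \<bar>g x - f x\<bar> \<le> \<tau>) \<and>
    (\<forall>x\<in>A \<inter> chart_inv c ` cball p (2 * R). \<forall>X. \<bar>differential M g x X\<bar> \<le> 2 * e * sqrt (rmetric M x X X))"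
proof -
  let ?h = "f \<circ> chart_inv c"
  have ch: "continuous_on (snd c ` fst c) ?h"
    by (rule continuous_on_compose[OF continuous_on_chart_inv[OF c] continuous_on_subset[OF f(1) subset_UNIV]])
  \<comment> \<open>The function is extended from a closed ball to the whole coordinate space and
    multiplied by a bump. The concentric radii 2R < 5R/2 < 3R leave a margin of R/2 for the
    averaging radius and the difference quotients.\<close>
  obtain H where H: "continuous_on UNIV H" "\<And>q. q \<in> cball p (3 * R) \<Longrightarrow> H q = ?h q"
    using Tietze_unbounded[of "cball p (3 * R)" ?h UNIV] continuous_on_subset[OF ch R(2)] by auto
  obtain \<beta> :: "real^'n \<Rightarrow> real" where b: "smooth_on UNIV \<beta>" "\<And>x. 0 \<le> \<beta> x" "\<And>x. \<beta> x \<le> 1"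
    "\<And>x. x \<in> cball p (5 / 2 * R) \<Longrightarrow> \<beta> x = 1" "\<And>x. x \<notin> ball p (3 * R) \<Longrightarrow> \<beta> x = 0"
    by (rule smooth_bump_exists[of "5 / 2 * R" "3 * R" p]) (use R(1) in auto)
  define F where "F q = \<beta> q * H q" for q
  have cF: "continuous_on UNIV F"
    unfolding F_def by (intro continuous_on_mult smooth_on_imp_continuous_on b(1) H(1))
  obtain a where a: "ball p (3 * R) \<subseteq> cbox (- a) a" using bounded_subset_cbox_symmetric[of "ball p (3 * R)"] by auto
  have F0: "F q = 0" if "q \<notin> cbox (- a) a" for q
    using b(5)[of q] subsetD[OF a, of q] that unfolding F_def by (metis mult_zero_left)
  have Fh: "F q = ?h q" if "q \<in> cball p (5 / 2 * R)" for q
    using b(4)[OF that] H(2)[of q] that R(1) by (auto simp: F_def)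
  define C where "C = cball p (2 * R) \<inter> chart_inv c -` A"
  have sub2: "cball p (2 * R) \<subseteq> snd c ` fst c" using R by (intro order_trans[OF _ R(2)] subset_cball) auto
  have "compact C"
  proof -
    have "closedin (top_of_set (cball p (2 * R))) (cball p (2 * R) \<inter> chart_inv c -` A)"
      by (rule continuous_closedin_preimage[OF continuous_on_subset[OF continuous_on_chart_inv[OF c] sub2] A])
    then show ?thesis unfolding C_def by (rule closedin_compact[OF compact_cball])
  qed
  have loc: "\<exists>r>0. \<forall>y\<in>ball q0 r. \<forall>z\<in>ball q0 r. \<forall>q\<in>ball q0 r. q0 \<in> C \<longrightarrow>
      \<bar>?h y - ?h z\<bar> \<le> 2 * e * sqrt (chart_metric c (chart_inv c q) (z - y) (z - y))" for q0
  proof (cases "q0 \<in> C")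
    case True
    then have q0: "q0 \<in> snd c ` fst c" "chart_inv c q0 \<in> A" using sub2 by (auto simp: C_def simp del: image_iff)
    obtain r where r: "0 < r" "ball q0 r \<subseteq> snd c ` fst c"
      "\<And>y z q. y \<in> ball q0 r \<Longrightarrow> z \<in> ball q0 r \<Longrightarrow> q \<in> ball q0 r \<Longrightarrow>
        rdist M (chart_inv c y) (chart_inv c z) \<le> ennreal (2 * sqrt (chart_metric c (chart_inv c q) (z - y) (z - y)))"
      by (rule rdist_local_le[OF c q0(1)]) blast
    obtain U where U: "open U" "chart_inv c q0 \<in> U" "\<And>x y. x \<in> U \<Longrightarrow> y \<in> U \<Longrightarrow> \<bar>f x - f y\<bar> \<le> e * mdist x y"
      using e(2)[OF q0(2)] by blast
    have "open (snd c ` (U \<inter> fst c))" by (rule open_chart_image[OF c U(1)])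
    moreover have "q0 \<in> snd c ` (U \<inter> fst c)"
      using U(2) chart_inv_mem[OF q0(1)] chart_chart_inv[OF c q0(1)] by (intro image_eqI[of _ _ "chart_inv c q0"]) auto
    ultimately obtain r' where r': "0 < r'" "ball q0 r' \<subseteq> snd c ` (U \<inter> fst c)" using open_contains_ball by blast
    have inU: "chart_inv c y \<in> U" if "y \<in> ball q0 r'" for y
    proof -
      from that r'(2) obtain u where "u \<in> U" "u \<in> fst c" "y = snd c u" by blast
      then show ?thesis using chart_inv_chart[OF c] by simp
    qed
    have "\<bar>?h y - ?h z\<bar> \<le> 2 * e * sqrt (chart_metric c (chart_inv c q) (z - y) (z - y))"
      if yzq: "y \<in> ball q0 (min r r')" "z \<in> ball q0 (min r r')" "q \<in> ball q0 (min r r')" for y z q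
    proof -
      have "q \<in> snd c ` fst c" using yzq(3) r(2) by auto
      then have "0 \<le> chart_metric c (chart_inv c q) (z - y) (z - y)"
        using inner_product_on_nonneg[OF inner_product_chart_metric[OF c chart_inv_mem]] by blast
      then have "mdist (chart_inv c y) (chart_inv c z) \<le> 2 * sqrt (chart_metric c (chart_inv c q) (z - y) (z - y))"
        using yzq by (intro mdist_le r(3)) auto
      then have "e * mdist (chart_inv c y) (chart_inv c z) \<le> e * (2 * sqrt (chart_metric c (chart_inv c q) (z - y) (z - y)))"
        using e(1) by simp
      moreover have "\<bar>?h y - ?h z\<bar> \<le> e * mdist (chart_inv c y) (chart_inv c z)"
        using U(3)[OF inU inU, of y z] yzq by simp
      ultimately show ?thesis by simp
    qed
    then show ?thesis using r(1) r'(1) by (intro exI[of _ "min r r'"]) auto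
  qed (auto intro: exI[of _ 1])
  then obtain r where r: "\<And>q0. 0 < r q0" "\<And>q0 y z q. q0 \<in> C \<Longrightarrow> y \<in> ball q0 (r q0) \<Longrightarrow> z \<in> ball q0 (r q0) \<Longrightarrow> q \<in> ball q0 (r q0) \<Longrightarrow>
      \<bar>?h y - ?h z\<bar> \<le> 2 * e * sqrt (chart_metric c (chart_inv c q) (z - y) (z - y))" by metis
  \<comment> \<open>A Lebesgue number \<rho> of this cover makes the size of the balls uniform in
    \<open>q\<close>.\<close>
  have "C \<subseteq> \<Union>((\<lambda>q0. ball q0 (r q0)) ` C)" using r(1) by auto
  from Heine_Borel_lemma[OF \<open>compact C\<close> this] obtain \<rho> where
    lam: "0 < \<rho>" "\<And>q. q \<in> C \<Longrightarrow> \<exists>q0\<in>C. ball q \<rho> \<subseteq> ball q0 (r q0)" by auto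
  have "uniformly_continuous_on (cball p (3 * R)) F"
    by (intro compact_uniformly_continuous continuous_on_subset[OF cF]) auto
  then obtain d where d: "0 < d" "\<And>x y. x \<in> cball p (3 * R) \<Longrightarrow> y \<in> cball p (3 * R) \<Longrightarrow> dist y x < d \<Longrightarrow> dist (F y) (F x) < \<tau>"
    using \<tau> unfolding uniformly_continuous_on_def by metis
  define \<delta> where "\<delta> = min (R / 4) (min (\<rho> / 2) (d / 2))"
  have \<delta>: "0 < \<delta>" "\<delta> \<le> R / 4" "\<delta> \<le> \<rho> / 2" "\<delta> < d" using R(1) lam(1) d(1) by (auto simp: \<delta>_def)
  obtain G where G: "smooth_on UNIV G"
    "\<And>x k. (\<And>z. z \<in> cball 0 \<delta> \<Longrightarrow> F (x + z) \<le> k) \<Longrightarrow> G x \<le> k"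
    "\<And>x k. (\<And>z. z \<in> cball 0 \<delta> \<Longrightarrow> k \<le> F (x + z)) \<Longrightarrow> k \<le> G x"
    "\<And>x y k. (\<And>z. z \<in> cball 0 \<delta> \<Longrightarrow> F (x + z) - F (y + z) \<le> k) \<Longrightarrow> G x - G y \<le> k"
    using mollification[OF cF F0 \<delta>(1)] by blast
  have near: "q + z \<in> cball p (5 / 2 * R)" if "q \<in> cball p (2 * R)" "z \<in> cball 0 \<delta>" for q z
  proof -
    have "dist p (q + z) \<le> dist p q + dist q (q + z)" by (rule dist_triangle)
    also have "dist q (q + z) = norm z" by (simp add: dist_norm)
    finally show ?thesis using that \<delta>(2) R(1) by auto
  qed
  define g where "g = G \<circ> snd c"
  have gq: "g (chart_inv c q) = G q" if "q \<in> cball p (2 * R)" for q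
    unfolding g_def using that sub2 chart_chart_inv[OF c] by (metis comp_apply subsetD)
  have sg: "smooth_fun_on M (fst c) g"
    unfolding g_def by (rule smooth_fun_on_chart[OF c open_chart_domain[OF c] order_refl smooth_on_subset[OF G(1) subset_UNIV]])
  have val: "0 \<le> g x \<and> g x \<le> 1 \<and> \<bar>g x - f x\<bar> \<le> \<tau>" if "x \<in> chart_inv c ` cball p (2 * R)" for x
  proof -
    from that obtain q where q: "q \<in> cball p (2 * R)" "x = chart_inv c q" by blast
    have Fq: "F q = f x" using Fh[of q] q R(1) by auto
    have cl: "\<bar>F (q + z) - F q\<bar> < \<tau>" if "z \<in> cball 0 \<delta>" for z
    proof -
      have "q + z \<in> cball p (3 * R)" "q \<in> cball p (3 * R)" using near[OF q(1) that] q(1) R(1) by auto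
      then show ?thesis using d(2)[of q "q + z"] that \<delta>(4) by (auto simp: dist_real_def dist_norm)
    qed
    have "G q \<le> f x + \<tau>" by (rule G(2)) (use cl Fq in force)
    moreover have "f x - \<tau> \<le> G q" by (rule G(3)) (use cl Fq in force)
    moreover have "G q \<le> 1" by (rule G(2)) (use Fh near[OF q(1)] f in auto)
    moreover have "0 \<le> G q" by (rule G(3)) (use Fh near[OF q(1)] f in auto)
    ultimately show ?thesis using gq[OF q(1)] q(2) by auto
  qed
  have der: "\<bar>differential M g x X\<bar> \<le> 2 * e * sqrt (rmetric M x X X)" if "x \<in> A \<inter> chart_inv c ` cball p (2 * R)" for x X
  proof -
    from that obtain q where q: "q \<in> cball p (2 * R)" "x = chart_inv c q" "x \<in> A" by blast
    have qr: "q \<in> snd c ` fst c" using q(1) sub2 by blast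
    have x: "x \<in> fst c" "snd c x = q" using q chart_inv_mem[OF qr] chart_chart_inv[OF c qr] by auto
    have "q \<in> C" using q by (simp add: C_def)
    then obtain q0 where q0: "q0 \<in> C" "ball q \<rho> \<subseteq> ball q0 (r q0)" using lam(2) by blast
    let ?Q = "chart_metric c (chart_inv c q)"
    have ip: "inner_product_on UNIV ?Q" by (rule inner_product_chart_metric[OF c chart_inv_mem[OF qr]])
    have dG: "(G has_derivative frechet_derivative G (at q)) (at q)" by (rule smooth_on_has_derivative[OF G(1) UNIV_I])
    have up: "frechet_derivative G (at q) v \<le> 2 * e * sqrt (?Q v v)" for v
    \<comment> \<open>For such \<open>t\<close> both q + t v + z and q + z stay within \<rho> of
      \<open>q\<close>, and within the ball where F is \<open>f\<close> in coordinates.\<close>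
    proof (rule derivative_le_of_one_sided[OF dG, of "min (\<rho> / 2) (R / 4) / (norm v + 1)"])
      show "0 < min (\<rho> / 2) (R / 4) / (norm v + 1)" using lam(1) R(1) by (auto intro!: divide_pos_pos simp: add_nonneg_pos)
      fix t assume t: "0 < t" "t < min (\<rho> / 2) (R / 4) / (norm v + 1)"
      have "t * (norm v + 1) < min (\<rho> / 2) (R / 4)" using t(2) by (simp add: less_divide_eq add_nonneg_pos)
      then have tv: "t * norm v < \<rho> / 2" "t * norm v < R / 4" using t(1) by (auto simp: algebra_simps)
      show "G (q + t *\<^sub>R v) - G q \<le> t * (2 * e * sqrt (?Q v v))"
      proof (rule G(4))
        fix z assume z: "z \<in> cball (0::real^'n) \<delta>"
        have zz: "norm z \<le> \<rho> / 2" using z \<delta>(3) by simp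
        have "norm (t *\<^sub>R v + z) < \<rho>" using norm_triangle_ineq[of "t *\<^sub>R v" z] tv(1) zz t(1) by simp
        moreover have dq: "dist q (q + w) = norm w" for w by (simp add: dist_norm)
        ultimately have "q + t *\<^sub>R v + z \<in> ball q \<rho>" "q + z \<in> ball q \<rho>" "q \<in> ball q \<rho>"
          using zz lam(1) by (simp_all add: add.assoc)
        then have *: "\<bar>?h (q + t *\<^sub>R v + z) - ?h (q + z)\<bar> \<le> 2 * e * sqrt (?Q ((q + z) - (q + t *\<^sub>R v + z)) ((q + z) - (q + t *\<^sub>R v + z)))"
          by (intro r(2)[OF q0(1)] subsetD[OF q0(2)])
        have "(q + z) - (q + t *\<^sub>R v + z) = (- t) *\<^sub>R v" by simp
        then have "sqrt (?Q ((q + z) - (q + t *\<^sub>R v + z)) ((q + z) - (q + t *\<^sub>R v + z))) = t * sqrt (?Q v v)"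
          using t(1) by (simp only: inner_product_on_scale_left[OF ip UNIV_I UNIV_I] inner_product_on_scale_right[OF ip subspace_UNIV UNIV_I UNIV_I])
            (simp add: real_sqrt_mult mult.assoc[symmetric])
        moreover have "F (q + z) = ?h (q + z)" by (rule Fh[OF near[OF q(1) z]])
        moreover have "F (q + t *\<^sub>R v + z) = ?h (q + t *\<^sub>R v + z)"
        proof (rule Fh)
          have "dist p (q + t *\<^sub>R v + z) \<le> dist p q + norm (t *\<^sub>R v) + norm z"
            using dist_triangle[of p "q + (t *\<^sub>R v + z)" q] norm_triangle_ineq[of "t *\<^sub>R v" z] dq[of "t *\<^sub>R v + z"]
            by (simp only: add.assoc)
          then have "dist p (q + t *\<^sub>R v + z) \<le> 2 * R + R / 4 + norm z" using q(1) tv(2) t(1) by simp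
          then show "q + t *\<^sub>R v + z \<in> cball p (5 / 2 * R)" using z \<delta>(2) R(1) by simp
        qed
        ultimately show "F (q + t *\<^sub>R v + z) - F (q + z) \<le> t * (2 * e * sqrt (?Q v v))"
          using * by (simp add: mult_ac)
      qed
    qed
    have lin: "linear (frechet_derivative G (at q))" by (rule has_derivative_linear[OF dG])
    have lo: "- frechet_derivative G (at q) v \<le> 2 * e * sqrt (?Q v v)" for v
      using up[of "(-1) *\<^sub>R v"] linear_scale[OF lin, of "-1" v]
      by (simp only: inner_product_on_scale_left[OF ip UNIV_I UNIV_I] inner_product_on_scale_right[OF ip subspace_UNIV UNIV_I UNIV_I]) simp
    define v where "v = chart_deriv (chart_at M x) (snd c) x X"
    have X: "coord_vec M c x v = X" unfolding v_def by (rule coord_vec_surj[OF c x(1)])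
    have "((g \<circ> chart_inv c) has_derivative frechet_derivative G (at q)) (at q)"
      by (rule has_derivative_transform_within_open[OF dG open_chart_range[OF c] qr])
        (simp add: g_def chart_chart_inv[OF c])
    then have "frechet_derivative (g \<circ> chart_inv c) (at q) = frechet_derivative G (at q)"
      by (rule frechet_derivative_at[symmetric])
    then have "differential M g x X = frechet_derivative G (at q) v"
      using differential_coord_vec[OF open_chart_domain[OF c] sg x(1) c x(1), of v] X x(2) by simp
    then show ?thesis using up[of v] lo[of v] X q(2) by (auto simp: chart_metric_def)
  qed
  show ?thesis using sg val der by (intro exI[of _ g]) auto
qed

text \<open>With a partition of unity, d\<phi> is the sum of the terms (g i - f(x)) d\<theta> i +
  \<theta> i d(g i), because f(x) times the sum of the d\<theta> i vanishes: the \<theta> i sum to 1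
  on a neighbourhood of \<open>S\<close>, and f is 0 outside \<open>S\<close>. The second part is at
  most 2e; the first is at most e if the g i are close enough to f. Together this is 3e.\<close>

lemma smooth_approximation:
  fixes f :: "'m \<Rightarrow> real"
  assumes f: "continuous_on UNIV f" "\<And>x. 0 \<le> f x" "\<And>x. f x \<le> 1"
    and S: "compact S" "\<And>x. x \<notin> S \<Longrightarrow> f x = 0"
    and A: "closed A" and e: "0 < e" "\<And>a. a \<in> A \<Longrightarrow> \<exists>U. open U \<and> a \<in> U \<and> (\<forall>x\<in>U. \<forall>y\<in>U. \<bar>f x - f y\<bar> \<le> e * mdist x y)"
    and \<tau>: "0 < \<tau>"
  shows "\<exists>\<phi> S. smooth_fun_on M UNIV \<phi> \<and> compact S \<and> (\<forall>x. x \<notin> S \<longrightarrow> \<phi> x = 0) \<and> (\<forall>x. 0 \<le> \<phi> x \<and> \<phi> x \<le> 1) \<and>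
    (\<forall>x. \<bar>\<phi> x - f x\<bar> \<le> \<tau>) \<and> (\<forall>x\<in>A. \<forall>X. \<bar>differential M \<phi> x X\<bar> \<le> 3 * e * sqrt (rmetric M x X X))"
proof -
  have "\<exists>R>0. cball (snd (chart_at M x) x) (3 * R) \<subseteq> snd (chart_at M x) ` fst (chart_at M x)" for x
  proof -
    obtain R where R: "0 < R" "cball (snd (chart_at M x) x) R \<subseteq> snd (chart_at M x) ` fst (chart_at M x)"
      using chart_cball[OF chart_at open_UNIV UNIV_I] by auto
    then show ?thesis by (intro exI[of _ "R / 3"]) auto
  qed
  then obtain rad where rad: "\<And>x. 0 < rad x"
    "\<And>x. cball (snd (chart_at M x) x) (3 * rad x) \<subseteq> snd (chart_at M x) ` fst (chart_at M x)" by metis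
  define V where "V x = chart_inv (chart_at M x) ` ball (snd (chart_at M x) x) (rad x)" for x
  have sub: "cball (snd (chart_at M x) x) r \<subseteq> snd (chart_at M x) ` fst (chart_at M x)" if "r \<le> 3 * rad x" for x r
    by (rule order_trans[OF subset_cball[OF that] rad(2)])
  have V: "open (V x)" "x \<in> V x" for x
  proof -
    show "open (V x)"
      unfolding V_def
      by (rule open_chart_inv_image[OF chart_at(1) open_ball order_trans[OF ball_subset_cball sub]]) (use rad(1)[of x] in simp)
    show "x \<in> V x"
      unfolding V_def using rad(1)[of x] chart_inv_chart[OF chart_at] by (intro image_eqI[of _ _ "snd (chart_at M x) x"]) auto
  qed
  have "S \<subseteq> (\<Union>x\<in>S. V x)" using V(2) by blast
  then obtain T where "T \<subseteq> S" and T: "finite T" "S \<subseteq> (\<Union>x\<in>T. V x)"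
    by (rule compactE_image[OF S(1) V(1)])
  \<comment> \<open>An enumeration of the finite cover is needed for the products over earlier
    indices in the partition of unity.\<close>
  obtain t :: "nat \<Rightarrow> 'm" and N where t: "T = t ` {..<N}"
    using finite_imp_nat_seg_image_inj_on[OF T(1)] by (auto simp: lessThan_def)
  define c where "c i = chart_at M (t i)" for i
  define p where "p i = snd (c i) (t i)" for i
  define R where "R i = rad (t i)" for i
  have c: "c i \<in> atlas M" for i by (simp add: c_def chart_at)
  have R: "0 < R i" "cball (p i) (3 * R i) \<subseteq> snd (c i) ` fst (c i)" "cball (p i) (2 * R i) \<subseteq> snd (c i) ` fst (c i)" for i
    using rad(1)[of "t i"] rad(2)[of "t i"] sub[of "2 * rad (t i)" "t i"] by (auto simp: c_def p_def R_def)
  define K where "K i = chart_inv (c i) ` cball (p i) (2 * R i)" for i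
  define W where "W = (\<Union>i<N. V (t i))"
  have W: "open W" "S \<subseteq> W" unfolding W_def using V(1) T(2) t by auto
  have K: "compact (K i)" "K i \<subseteq> fst (c i)" for i
    unfolding K_def using compact_chart_inv_image[OF c compact_cball R(3)] R(3)[of i]
    by (auto intro!: chart_inv_mem)
  have "\<exists>\<beta>. smooth_fun_on M UNIV \<beta> \<and> (\<forall>x. 0 \<le> \<beta> x \<and> \<beta> x \<le> 1) \<and> (\<forall>x\<in>V (t i). \<beta> x = 1) \<and> (\<forall>x. x \<notin> K i \<longrightarrow> \<beta> x = 0)" for i
  proof -
    obtain \<beta> where b: "smooth_fun_on M UNIV \<beta>" "\<And>x. 0 \<le> \<beta> x" "\<And>x. \<beta> x \<le> 1"
      "\<And>x. x \<in> chart_inv (c i) ` cball (p i) (R i) \<Longrightarrow> \<beta> x = 1"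
      "\<And>x. x \<notin> chart_inv (c i) ` cball (p i) (2 * R i) \<Longrightarrow> \<beta> x = 0"
      by (rule smooth_bump[OF c R(1)[of i] _ R(3)]) (use R(1)[of i] in auto)
    have "V (t i) \<subseteq> chart_inv (c i) ` cball (p i) (R i)"
      unfolding V_def c_def p_def R_def by (rule image_mono[OF ball_subset_cball])
    then show ?thesis using b unfolding K_def by (intro exI[of _ \<beta>]) blast
  qed
  then obtain \<beta> where \<beta>: "\<And>i. smooth_fun_on M UNIV (\<beta> i)" "\<And>i x. 0 \<le> \<beta> i x" "\<And>i x. \<beta> i x \<le> 1"
    "\<And>i x. x \<in> V (t i) \<Longrightarrow> \<beta> i x = 1" "\<And>i x. x \<notin> K i \<Longrightarrow> \<beta> i x = 0" by metis
  define \<theta> where "\<theta> i x = \<beta> i x * (\<Prod>j<i. 1 - \<beta> j x)" for i x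
  have s\<theta>: "smooth_fun_on M UNIV (\<theta> i)" for i
    unfolding \<theta>_def by (intro smooth_fun_on_mult smooth_fun_on_prod smooth_fun_on_diff smooth_fun_on_const \<beta>(1) open_UNIV)
  have \<theta>0: "0 \<le> \<theta> i x" for i x unfolding \<theta>_def using \<beta>(2,3) by (intro mult_nonneg_nonneg prod_nonneg) auto
  have \<theta>K: "\<theta> i x = 0" if "x \<notin> K i" for i x using \<beta>(5)[OF that] by (simp add: \<theta>_def)
  have \<theta>sum: "(\<Sum>i<N. \<theta> i x) = 1 - (\<Prod>i<N. 1 - \<beta> i x)" for x unfolding \<theta>_def by (rule partition_sum)
  have \<theta>le: "(\<Sum>i<N. \<theta> i x) \<le> 1" for x unfolding \<theta>sum using \<beta>(3) by (simp add: prod_nonneg)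
  have \<theta>1: "(\<Sum>i<N. \<theta> i x) = 1" if "x \<in> W" for x
  proof -
    from that obtain i where "i < N" "x \<in> V (t i)" by (auto simp: W_def)
    then have "(\<Prod>i<N. 1 - \<beta> i x) = 0" using \<beta>(4)[of x i] by (intro prod_zero) auto
    then show ?thesis by (simp add: \<theta>sum)
  qed
  have "\<exists>C\<ge>0. \<forall>x\<in>K i. \<forall>X. \<bar>differential M (\<theta> i) x X\<bar> \<le> C * sqrt (rmetric M x X X)" for i
    unfolding K_def by (rule chart_derivative_bound[OF c s\<theta> compact_cball R(3)])
  then obtain C where C: "\<And>i. 0 \<le> C i" "\<And>i x X. x \<in> K i \<Longrightarrow> \<bar>differential M (\<theta> i) x X\<bar> \<le> C i * sqrt (rmetric M x X X)" by metis
  \<comment> \<open>So small that the errors g i - f, multiplied by the bounds for the d\<theta> i,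
    sum up to at most \<open>e\<close>. The summand 1 avoids division by 0.\<close>
  define \<tau>' where "\<tau>' = min \<tau> (e / ((\<Sum>i<N. C i) + 1))"
  have Cs: "0 \<le> (\<Sum>i<N. C i)" using C(1) by (rule sum_nonneg)
  have \<tau>': "0 < \<tau>'" "\<tau>' \<le> \<tau>" using \<tau> e(1) Cs by (auto simp: \<tau>'_def add_nonneg_pos)
  have \<tau>C: "\<tau>' * (\<Sum>i<N. C i) \<le> e"
  proof -
    have "\<tau>' * (\<Sum>i<N. C i) \<le> e / ((\<Sum>i<N. C i) + 1) * ((\<Sum>i<N. C i) + 1)"
      using Cs e(1) \<tau>'(1) by (intro mult_mono) (auto simp: \<tau>'_def)
    then show ?thesis using Cs by simp
  qed
  have "\<exists>g. smooth_fun_on M (fst (c i)) g \<and>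
    (\<forall>x\<in>K i. 0 \<le> g x \<and> g x \<le> 1 \<and> \<bar>g x - f x\<bar> \<le> \<tau>') \<and>
    (\<forall>x\<in>A \<inter> K i. \<forall>X. \<bar>differential M g x X\<bar> \<le> 2 * e * sqrt (rmetric M x X X))" for i
    unfolding K_def by (rule mollify_in_chart[OF c R(1,2) f A e \<tau>'(1)])
  then obtain g where g: "\<And>i. smooth_fun_on M (fst (c i)) (g i)" "\<And>i x. x \<in> K i \<Longrightarrow> 0 \<le> g i x"
    "\<And>i x. x \<in> K i \<Longrightarrow> g i x \<le> 1" "\<And>i x. x \<in> K i \<Longrightarrow> \<bar>g i x - f x\<bar> \<le> \<tau>'"
    "\<And>i x X. x \<in> A \<Longrightarrow> x \<in> K i \<Longrightarrow> \<bar>differential M (g i) x X\<bar> \<le> 2 * e * sqrt (rmetric M x X X)"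
    by (metis IntI)
  define \<phi> where "\<phi> x = (\<Sum>i<N. \<theta> i x * g i x)" for x
  have sg: "smooth_fun_on M UNIV (\<lambda>x. \<theta> i x * g i x)" for i
    by (rule smooth_fun_on_zero_extend[OF open_chart_domain[OF c] _ compact_imp_closed[OF K(1)] K(2)])
      (auto intro!: smooth_fun_on_mult open_chart_domain c g(1) smooth_fun_on_subset[OF s\<theta>] simp: \<theta>K)
  have t0: "0 \<le> \<theta> i x * g i x" "\<theta> i x * g i x \<le> \<theta> i x" "\<bar>\<theta> i x * (g i x - f x)\<bar> \<le> \<theta> i x * \<tau>'" for i x
  proof -
    show "0 \<le> \<theta> i x * g i x" "\<theta> i x * g i x \<le> \<theta> i x"
      using \<theta>0[of i x] g(2,3)[of x i] \<theta>K[of x i] by (cases "x \<in> K i"; simp add: mult_left_le)+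
    show "\<bar>\<theta> i x * (g i x - f x)\<bar> \<le> \<theta> i x * \<tau>'"
      using \<theta>0[of i x] g(4)[of x i] \<theta>K[of x i] by (cases "x \<in> K i") (auto simp: abs_mult intro: mult_left_mono)
  qed
  have "smooth_fun_on M UNIV \<phi>" unfolding \<phi>_def by (intro smooth_fun_on_sum sg open_UNIV)
  moreover have "compact (\<Union>i<N. K i)" using K(1) by (intro compact_UN) auto
  moreover have "\<phi> x = 0" if "x \<notin> (\<Union>i<N. K i)" for x
    unfolding \<phi>_def using that by (intro sum.neutral) (auto simp: \<theta>K)
  moreover have "0 \<le> \<phi> x" for x unfolding \<phi>_def by (rule sum_nonneg) (rule t0)
  moreover have "\<phi> x \<le> 1" for x unfolding \<phi>_def by (rule order_trans[OF sum_mono \<theta>le]) (rule t0)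
  moreover have fS: "f x * (\<Sum>i<N. \<theta> i x) = f x" for x
    using \<theta>1[of x] S(2)[of x] W(2) by (cases "x \<in> S") auto
  moreover have "\<bar>\<phi> x - f x\<bar> \<le> \<tau>" for x
  proof -
    have "\<phi> x - f x = (\<Sum>i<N. \<theta> i x * (g i x - f x))"
      using fS[of x] by (simp add: \<phi>_def right_diff_distrib sum_subtractf sum_distrib_left mult.commute)
    also have "\<bar>\<dots>\<bar> \<le> (\<Sum>i<N. \<theta> i x * \<tau>')" by (rule order_trans[OF sum_abs sum_mono]) (rule t0)
    also have "\<dots> = (\<Sum>i<N. \<theta> i x) * \<tau>'" by (simp add: sum_distrib_right)
    also have "\<dots> \<le> 1 * \<tau>'" using \<theta>le[of x] \<tau>'(1) by (intro mult_right_mono) auto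
    finally show ?thesis using \<tau>'(2) by simp
  qed
  moreover have "\<bar>differential M \<phi> x X\<bar> \<le> 3 * e * sqrt (rmetric M x X X)" if x: "x \<in> A" for x X
  proof -
    let ?n = "sqrt (rmetric M x X X)"
    have n: "0 \<le> ?n" using inner_product_on_nonneg[OF inner_product_rmetric] by simp
    let ?d = "\<lambda>h. differential M h x X"
    have d\<theta>K: "?d (\<theta> i) = 0" if "x \<notin> K i" for i
    proof -
      have "open (- K i)" using compact_imp_closed[OF K(1)] by blast
      then have "?d (\<theta> i) = ?d (\<lambda>_. 0)"
        using that by (subst differential_cong[of "- K i" x "\<theta> i" "\<lambda>_. 0"]) (auto simp: \<theta>K)
      then show ?thesis by (simp add: differential_const)
    qed
    have d\<theta>: "\<bar>?d (\<theta> i)\<bar> \<le> C i * ?n" for i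
      using C(1)[of i] C(2)[of x i X] d\<theta>K[of i] n by (cases "x \<in> K i") auto
    \<comment> \<open>Outside \<open>K i\<close> nothing is known about \<open>g i\<close>, but
      there \<theta> i and its differential vanish.\<close>
    define E where "E i = (if x \<in> K i then ?d (g i) else 0)" for i
    have prod: "?d (\<lambda>x. \<theta> i x * g i x) = ?d (\<theta> i) * (g i x - f x) + f x * ?d (\<theta> i) + \<theta> i x * E i" for i
    proof (cases "x \<in> K i")
      case True
      then have "x \<in> fst (c i)" using K(2) by blast
      then have "?d (\<lambda>x. \<theta> i x * g i x) = ?d (\<theta> i) * g i x + \<theta> i x * ?d (g i)"
        by (intro differential_mult[OF open_chart_domain[OF c] smooth_fun_on_subset[OF s\<theta> subset_UNIV] g(1)])
      then show ?thesis using True by (simp add: E_def algebra_simps)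
    next
      case False
      have "open (- K i)" using compact_imp_closed[OF K(1)] by blast
      then have "?d (\<lambda>x. \<theta> i x * g i x) = ?d (\<lambda>_. 0)"
        using False by (subst differential_cong[of "- K i" x _ "\<lambda>_. 0"]) (auto simp: \<theta>K)
      then show ?thesis using False d\<theta>K[OF False] by (simp add: differential_const \<theta>K)
    qed
    have zero: "f x * (\<Sum>i<N. ?d (\<theta> i)) = 0"
    proof (cases "x \<in> W")
      case True
      have "(\<Sum>i<N. ?d (\<theta> i)) = ?d (\<lambda>x. \<Sum>i<N. \<theta> i x)"
        by (rule differential_sum[symmetric, OF open_UNIV s\<theta> UNIV_I])
      also have "\<dots> = ?d (\<lambda>_. 1)" by (subst differential_cong[OF W(1) True]) (auto simp: \<theta>1)
      finally show ?thesis by (simp add: differential_const)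
    qed (use S(2)[of x] W(2) in auto)
    have "?d \<phi> = (\<Sum>i<N. ?d (\<lambda>x. \<theta> i x * g i x))"
      unfolding \<phi>_def by (rule differential_sum[OF open_UNIV sg UNIV_I])
    also have "\<dots> = (\<Sum>i<N. ?d (\<theta> i) * (g i x - f x) + \<theta> i x * E i)"
      using zero by (simp add: prod sum.distrib sum_distrib_left)
    also have "\<bar>\<dots>\<bar> \<le> (\<Sum>i<N. (C i * ?n) * \<tau>' + \<theta> i x * (2 * e * ?n))"
    proof (rule order_trans[OF sum_abs sum_mono])
      fix i
      have "\<bar>?d (\<theta> i) * (g i x - f x)\<bar> \<le> (C i * ?n) * \<tau>'"
      proof (cases "x \<in> K i")
        case True
        then show ?thesis unfolding abs_mult using d\<theta>[of i] g(4)[of x i] C(1)[of i] n by (intro mult_mono) auto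
      next
        case False
        then show ?thesis using d\<theta>K[OF False] C(1)[of i] n \<tau>'(1) by simp
      qed
      moreover have "\<bar>\<theta> i x * E i\<bar> \<le> \<theta> i x * (2 * e * ?n)"
        using g(5)[OF x, of i X] \<theta>0[of i x] e(1) n by (auto simp: abs_mult E_def intro!: mult_left_mono)
      ultimately show "\<bar>?d (\<theta> i) * (g i x - f x) + \<theta> i x * E i\<bar> \<le> (C i * ?n) * \<tau>' + \<theta> i x * (2 * e * ?n)"
        by linarith
    qed
    also have "\<dots> = \<tau>' * (\<Sum>i<N. C i) * ?n + (\<Sum>i<N. \<theta> i x) * (2 * e * ?n)"
      by (simp add: sum.distrib sum_distrib_right sum_distrib_left mult_ac)
    also have "\<dots> \<le> e * ?n + 1 * (2 * e * ?n)"
      using \<tau>C \<theta>le[of x] n e(1) by (intro add_mono mult_right_mono) auto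
    finally show ?thesis by (simp add: algebra_simps)
  qed
  ultimately show ?thesis by (intro exI[of _ \<phi>] exI[of _ "\<Union>i<N. K i"]) blast
qed

lemma smooth_cutoff:
  assumes \<Omega>: "open_in_completion M \<Omega>" "cauchy_boundary M \<subseteq> \<Omega>" and K: "compact K" and e: "0 < e"
  shows "\<exists>\<phi> S. smooth_fun_on M UNIV \<phi> \<and> compact S \<and> (\<forall>x. x \<notin> S \<longrightarrow> \<phi> x = 0) \<and> (\<forall>x. 0 \<le> \<phi> x \<and> \<phi> x \<le> 1) \<and>
    (\<forall>x\<in>K. 1 - e \<le> \<phi> x) \<and>
    (\<forall>x. embed M x \<notin> \<Omega> \<longrightarrow> (\<forall>X. \<bar>differential M \<phi> x X\<bar> \<le> e * sqrt (rmetric M x X X)))"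
proof -
  let ?A = "{x. embed M x \<notin> \<Omega>}"
  have A: "\<exists>x. limitin metric.mtopology s x sequentially" if "metric.MCauchy s" "range s \<subseteq> ?A" for s
    by (rule complete_complement[OF \<Omega> that(1)]) (use that(2) in auto)
  \<comment> \<open>The smoothing triples the Lipschitz constant.\<close>
  have e3: "0 < e / 3" using e by simp
  have "\<exists>\<phi> S. compact S \<and> continuous_on UNIV \<phi> \<and> (\<forall>x. 0 \<le> \<phi> x \<and> \<phi> x \<le> (1::real)) \<and> (\<forall>x\<in>K. \<phi> x = 1) \<and>
    (\<forall>x. x \<notin> S \<longrightarrow> \<phi> x = 0) \<and>
    (\<forall>a\<in>?A. \<exists>U. open U \<and> a \<in> U \<and> (\<forall>x\<in>U. \<forall>y\<in>U. \<bar>\<phi> x - \<phi> y\<bar> \<le> e / 3 * mdist x y))"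
    by (rule cutoff_exists[OF _ K e3]) (rule A)
  then obtain f S where F: "compact S" "continuous_on UNIV f" "\<forall>x. 0 \<le> f x \<and> f x \<le> (1::real)" "\<forall>x\<in>K. f x = 1"
    "\<forall>x. x \<notin> S \<longrightarrow> f x = 0" "\<forall>a\<in>?A. \<exists>U. open U \<and> a \<in> U \<and> (\<forall>x\<in>U. \<forall>y\<in>U. \<bar>f x - f y\<bar> \<le> e / 3 * mdist x y)"
    by (elim exE conjE) (rule that)
  note f = F(1,2) F(3-6)[rule_format]
  obtain \<phi> S' where \<phi>: "smooth_fun_on M UNIV \<phi>" "compact S'" "\<And>x. x \<notin> S' \<Longrightarrow> \<phi> x = 0" "\<And>x. 0 \<le> \<phi> x \<and> \<phi> x \<le> 1"
    "\<And>x. \<bar>\<phi> x - f x\<bar> \<le> e" "\<And>x X. x \<in> ?A \<Longrightarrow> \<bar>differential M \<phi> x X\<bar> \<le> 3 * (e / 3) * sqrt (rmetric M x X X)"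
  proof -
    have "\<exists>\<phi> S. smooth_fun_on M UNIV \<phi> \<and> compact S \<and> (\<forall>x. x \<notin> S \<longrightarrow> \<phi> x = 0) \<and> (\<forall>x. 0 \<le> \<phi> x \<and> \<phi> x \<le> 1) \<and>
      (\<forall>x. \<bar>\<phi> x - f x\<bar> \<le> e) \<and> (\<forall>x\<in>?A. \<forall>X. \<bar>differential M \<phi> x X\<bar> \<le> 3 * (e / 3) * sqrt (rmetric M x X X))"
      by (rule smooth_approximation[OF f(2) f(3)[THEN conjunct1] f(3)[THEN conjunct2] f(1,5) closed_complement[OF \<Omega>] e3 f(6) e])
    then show ?thesis using that by blast
  qed
  have "1 - e \<le> \<phi> x" if "x \<in> K" for x using \<phi>(5)[of x] f(4)[OF that] by linarith
  then show ?thesis using \<phi>(1-4,6) by (intro exI[of _ \<phi>] exI[of _ S']) simp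
qed

end

section \<open>Sections of vector bundles\<close>

lemma inner_product_on_cauchy_schwarz:
  assumes b: "inner_product_on E b" "subspace E" and v: "v \<in> E" "w \<in> E"
  shows "(b v w)\<^sup>2 \<le> b v v * b w w"
proof (cases "w = 0")
  case True
  then show ?thesis using inner_product_on_zero_left[OF b(1) v(1)] inner_product_on_sym[OF b(1) v] subspace_0[OF b(2)]
      inner_product_on_zero_left[OF b(1) v(2)] v by simp
next
  case False
  have p: "0 < b w w" by (rule inner_product_on_pos[OF b(1) v(2) False])
  let ?t = "- b v w / b w w"
  let ?x = "1 *\<^sub>R v + ?t *\<^sub>R w"
  have x: "?x \<in> E" using v by (intro subspace_add[OF b(2)] subspace_scale[OF b(2)])
  have s: "b v ?x = b v v + ?t * b v w" "b w ?x = b v w + ?t * b w w"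
    using inner_product_on_sym[OF b(1) v(1) x] inner_product_on_sym[OF b(1) v(2) x]
      inner_product_on_lincomb[OF b(1) v v(1), of 1 ?t] inner_product_on_lincomb[OF b(1) v v(2), of 1 ?t]
      inner_product_on_sym[OF b(1) v(2) v(1)] by simp_all
  have "0 \<le> b ?x ?x" by (rule inner_product_on_nonneg[OF b(1) x])
  also have "b ?x ?x = b v ?x + ?t * b w ?x" using inner_product_on_lincomb[OF b(1) v x, of 1 ?t] by simp
  also have "\<dots> = b v v - (b v w)\<^sup>2 / b w w" unfolding s using p by (simp add: field_simps power2_eq_square)
  finally show ?thesis using p by (simp add: field_simps)
qed

text \<open>The difference of the two sides is the squared norm of v - w.\<close>

lemma inner_product_on_sum_le:
  assumes b: "inner_product_on E b" "subspace E" and v: "v \<in> E" "w \<in> E"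
  shows "b (v + w) (v + w) \<le> 2 * b v v + 2 * b w w"
proof -
  have m: "v + w \<in> E" "v - w \<in> E" using v by (auto intro: subspace_add[OF b(2)] subspace_diff[OF b(2)])
  have ex: "b (s *\<^sub>R v + t *\<^sub>R w) (s *\<^sub>R v + t *\<^sub>R w) = s\<^sup>2 * b v v + 2 * s * t * b v w + t\<^sup>2 * b w w" for s t
  proof -
    have x: "s *\<^sub>R v + t *\<^sub>R w \<in> E" using v by (intro subspace_add[OF b(2)] subspace_scale[OF b(2)])
    have "b v (s *\<^sub>R v + t *\<^sub>R w) = s * b v v + t * b v w" "b w (s *\<^sub>R v + t *\<^sub>R w) = s * b v w + t * b w w"
      using inner_product_on_sym[OF b(1) v(1) x] inner_product_on_sym[OF b(1) v(2) x]
        inner_product_on_lincomb[OF b(1) v v(1), of s t] inner_product_on_lincomb[OF b(1) v v(2), of s t]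
        inner_product_on_sym[OF b(1) v(2) v(1)] by simp_all
    then show ?thesis using inner_product_on_lincomb[OF b(1) v x, of s t] by (simp add: algebra_simps power2_eq_square)
  qed
  show ?thesis using ex[of 1 1] ex[of 1 "-1"] inner_product_on_nonneg[OF b(1) m(2)] by simp
qed

text \<open>By Lindelof's theorem countably many of the open sets suffice.\<close>

lemma borel_measurable_restrict_local:
  fixes f :: "'a::second_countable_topology \<Rightarrow> 'b::topological_space"
  assumes "open S" "\<And>x. x \<in> S \<Longrightarrow> \<exists>T. open T \<and> x \<in> T \<and> f \<in> borel_measurable (restrict_space borel (S \<inter> T))"
  shows "f \<in> borel_measurable (restrict_space borel S)"
proof -
  obtain T where T: "\<And>x. x \<in> S \<Longrightarrow> open (T x)" "\<And>x. x \<in> S \<Longrightarrow> x \<in> T x"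
    "\<And>x. x \<in> S \<Longrightarrow> f \<in> borel_measurable (restrict_space borel (S \<inter> T x))" using assms(2) by metis
  have "\<And>U. U \<in> T ` S \<Longrightarrow> open U" using T(1) by auto
  from Lindelof[OF this] obtain C where C: "C \<subseteq> T ` S" "countable C" "\<Union>C = \<Union>(T ` S)" by metis
  show ?thesis
  proof (rule measurable_piecewise_restrict[OF C(2)])
    fix U assume "U \<in> C"
    then obtain x where x: "x \<in> S" "U = T x" using C(1) by blast
    show "U \<inter> space (restrict_space borel S) \<in> sets (restrict_space borel S)"
      using assms(1) T(1)[OF x(1)] x(2) by (auto simp: space_restrict_space sets_restrict_space_iff)
    show "f \<in> borel_measurable (restrict_space (restrict_space borel S) U)"
      using T(3)[OF x(1)] x(2) assms(1) T(1)[OF x(1)] by (subst restrict_restrict_space) auto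
  next
    show "space (restrict_space borel S) \<subseteq> \<Union>C" using C(3) T(2) by (auto simp: space_restrict_space)
  qed
qed

locale riem_bundle = riem M for M :: "('m::{t2_space,second_countable_topology}, 'n::finite) riem_mfd" +
  fixes V :: "('m, 'n, 'w::real_vector) vbundle"
  assumes vbundle: "smooth_vbundle M V" and fmetric: "smooth_fmetric M V"
begin

section \<open>Local frames, smooth and measurable sections\<close>

lemma subspace_fibre: "subspace (fibre V x)"
  using vbundle by (simp add: smooth_vbundle_def)

lemma inner_product_fmetric: "inner_product_on (fibre V x) (fmetric V x)"
  using fmetric by (simp add: smooth_fmetric_def)

lemma triv_exists: "\<exists>U \<phi>. (U, \<phi>) \<in> trivs V \<and> x \<in> U"
proof -
  have "x \<in> (\<Union>(U, \<phi>)\<in>trivs V. U)" using vbundle by (simp add: smooth_vbundle_def)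
  then show ?thesis by auto
qed

lemma triv:
  assumes "(U, \<phi>) \<in> trivs V"
  shows open_triv: "open U"
    and bij_triv: "\<And>x. x \<in> U \<Longrightarrow> bij_betw (\<phi> x) (fibre V x) (coord_space (brank V))"
    and triv_lincomb: "\<And>x v w s t i. x \<in> U \<Longrightarrow> v \<in> fibre V x \<Longrightarrow> w \<in> fibre V x \<Longrightarrow>
      \<phi> x (s *\<^sub>R v + t *\<^sub>R w) i = s * \<phi> x v i + t * \<phi> x w i"
  using vbundle assms unfolding smooth_vbundle_def by blast+

definition unit_coord :: "nat \<Rightarrow> nat \<Rightarrow> real" where
  "unit_coord i j = (if j = i then 1 else 0)"

definition frame :: "('m \<Rightarrow> 'w \<Rightarrow> nat \<Rightarrow> real) \<Rightarrow> 'm \<Rightarrow> nat \<Rightarrow> 'w" where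
  "frame \<phi> x i = inv_into (fibre V x) (\<phi> x) (unit_coord i)"

lemma unit_coord_mem: "i < brank V \<Longrightarrow> unit_coord i \<in> coord_space (brank V)"
  by (auto simp: unit_coord_def coord_space_def)

lemma frame:
  assumes "(U, \<phi>) \<in> trivs V" "x \<in> U" "i < brank V"
  shows "frame \<phi> x i \<in> fibre V x" "\<phi> x (frame \<phi> x i) = unit_coord i"
  using bij_betw_inv_into_right[OF bij_triv[OF assms(1,2)] unit_coord_mem[OF assms(3)]]
    inv_into_into[of "unit_coord i" "\<phi> x" "fibre V x"] unit_coord_mem[OF assms(3)] bij_triv[OF assms(1,2)]
  by (auto simp: frame_def bij_betw_def)

lemma triv_sum:
  assumes "(U, \<phi>) \<in> trivs V" "x \<in> U" "\<And>i. i \<in> I \<Longrightarrow> f i \<in> fibre V x"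
  shows "\<phi> x (\<Sum>i\<in>I. a i *\<^sub>R f i) k = (\<Sum>i\<in>I. a i * \<phi> x (f i) k)"
proof -
  have z: "\<phi> x 0 k = 0"
    using triv_lincomb[OF assms(1,2) subspace_0[OF subspace_fibre] subspace_0[OF subspace_fibre], of 0 0 k] by simp
  show ?thesis
    using assms(3)
  proof (induction I rule: infinite_finite_induct)
    case (insert i I)
    have "(\<Sum>i\<in>I. a i *\<^sub>R f i) \<in> fibre V x"
      using insert by (intro subspace_sum[OF subspace_fibre] subspace_scale[OF subspace_fibre]) auto
    then show ?case using triv_lincomb[OF assms(1,2), of "f i" "\<Sum>i\<in>I. a i *\<^sub>R f i" "a i" 1 k] insert by simp
  qed (use z in auto)
qed

lemma frame_expansion:
  assumes t: "(U, \<phi>) \<in> trivs V" "x \<in> U" and v: "v \<in> fibre V x"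
  shows "v = (\<Sum>i<brank V. \<phi> x v i *\<^sub>R frame \<phi> x i)"
proof -
  let ?s = "\<Sum>i<brank V. \<phi> x v i *\<^sub>R frame \<phi> x i"
  have s: "?s \<in> fibre V x"
    by (intro subspace_sum[OF subspace_fibre] subspace_scale[OF subspace_fibre] frame(1)[OF t]) auto
  have "\<phi> x ?s = \<phi> x v"
  proof
    fix k
    have "\<phi> x ?s k = (\<Sum>i<brank V. \<phi> x v i * unit_coord i k)"
      by (subst triv_sum[OF t]) (auto simp: frame[OF t])
    also have "\<dots> = (\<Sum>i<brank V. if i = k then \<phi> x v i else 0)"
      by (intro sum.cong) (auto simp: unit_coord_def)
    also have "\<dots> = \<phi> x v k"
      using bij_betwE[OF bij_triv[OF t]] v by (auto simp: coord_space_def)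
    finally show "\<phi> x ?s k = \<phi> x v k" .
  qed
  then show ?thesis using bij_betw_imp_inj_on[OF bij_triv[OF t]] s v by (simp add: inj_on_eq_iff)
qed

text \<open>Smoothness and measurability of the inner product of two sections are read off from this
  sum, whose ingredients are the coordinates of the sections and the smooth coefficients of the
  metric in the frame.\<close>

lemma fmetric_triv:
  assumes t: "(U, \<phi>) \<in> trivs V" "x \<in> U" and v: "v \<in> fibre V x" "w \<in> fibre V x"
  shows "fmetric V x v w = (\<Sum>i<brank V. \<Sum>j<brank V. \<phi> x v i * \<phi> x w j * fmetric V x (frame \<phi> x i) (frame \<phi> x j))"
proof -
  note ip = inner_product_fmetric[of x] subspace_fibre[of x]
  have "fmetric V x v w = fmetric V x (\<Sum>i<brank V. \<phi> x v i *\<^sub>R frame \<phi> x i) w"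
    using frame_expansion[OF t v(1)] by simp
  also have "\<dots> = (\<Sum>i<brank V. \<phi> x v i * fmetric V x (frame \<phi> x i) w)"
    by (rule inner_product_on_sum_left[OF ip v(2)]) (auto simp: frame[OF t])
  also have "\<dots> = (\<Sum>i<brank V. \<phi> x v i * fmetric V x (frame \<phi> x i) (\<Sum>j<brank V. \<phi> x w j *\<^sub>R frame \<phi> x j))"
    using frame_expansion[OF t v(2)] by simp
  also have "\<dots> = (\<Sum>i<brank V. \<phi> x v i * (\<Sum>j<brank V. \<phi> x w j * fmetric V x (frame \<phi> x i) (frame \<phi> x j)))"
    by (intro sum.cong arg_cong2[where f="(*)"] inner_product_on_sum_right[OF ip]) (auto simp: frame[OF t])
  finally show ?thesis by (simp add: sum_distrib_left mult.assoc)
qed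

lemma smooth_frame_metric:
  assumes "(U, \<phi>) \<in> trivs V" "i < brank V" "j < brank V"
  shows "smooth_fun_on M U (\<lambda>x. fmetric V x (frame \<phi> x i) (frame \<phi> x j))"
  using fmetric assms unit_coord_mem unfolding smooth_fmetric_def frame_def by blast

lemma smooth_section_onD:
  assumes "smooth_section_on M V S u"
  shows "\<And>x. x \<in> S \<Longrightarrow> u x \<in> fibre V x"
    "\<And>U \<phi> i. (U, \<phi>) \<in> trivs V \<Longrightarrow> i < brank V \<Longrightarrow> smooth_fun_on M (S \<inter> U) (\<lambda>x. \<phi> x (u x) i)"
  using assms unfolding smooth_section_on_def by blast+

lemma meas_section_onD:
  assumes "meas_section_on M V S u"
  shows "\<And>x. x \<in> S \<Longrightarrow> u x \<in> fibre V x"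
    "\<And>U \<phi> i. (U, \<phi>) \<in> trivs V \<Longrightarrow> i < brank V \<Longrightarrow> (\<lambda>x. \<phi> x (u x) i) \<in> borel_measurable (restrict_space borel (S \<inter> U))"
  using assms unfolding meas_section_on_def by blast+

lemma smooth_section_onI:
  assumes "\<And>x. x \<in> S \<Longrightarrow> u x \<in> fibre V x"
    "\<And>U \<phi> i. (U, \<phi>) \<in> trivs V \<Longrightarrow> i < brank V \<Longrightarrow> smooth_fun_on M (S \<inter> U) (\<lambda>x. \<phi> x (u x) i)"
  shows "smooth_section_on M V S u"
  using assms unfolding smooth_section_on_def by blast

lemma meas_section_onI:
  assumes "\<And>x. x \<in> S \<Longrightarrow> u x \<in> fibre V x"
    "\<And>U \<phi> i. (U, \<phi>) \<in> trivs V \<Longrightarrow> i < brank V \<Longrightarrow> (\<lambda>x. \<phi> x (u x) i) \<in> borel_measurable (restrict_space borel (S \<inter> U))"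
  shows "meas_section_on M V S u"
  using assms unfolding meas_section_on_def by blast

lemma smooth_fun_on_measurable:
  "open S \<Longrightarrow> smooth_fun_on M S f \<Longrightarrow> f \<in> borel_measurable (restrict_space borel S)"
  by (rule borel_measurable_continuous_on_restrict[OF smooth_fun_on_continuous_on])

lemma smooth_imp_meas_section:
  assumes "open S" "smooth_section_on M V S u" shows "meas_section_on M V S u"
proof (rule meas_section_onI)
  fix U \<phi> i assume t: "(U, \<phi>) \<in> trivs V" "i < brank V"
  show "(\<lambda>x. \<phi> x (u x) i) \<in> borel_measurable (restrict_space borel (S \<inter> U))"
    by (rule smooth_fun_on_measurable[OF open_Int[OF assms(1) open_triv[OF t(1)]] smooth_section_onD(2)[OF assms(2) t]])
qed (rule smooth_section_onD(1)[OF assms(2)])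

lemma smooth_section_lincomb:
  assumes S: "open S" and f: "smooth_fun_on M S f" "smooth_fun_on M S g"
    and u: "smooth_section_on M V S u" "smooth_section_on M V S v"
  shows "smooth_section_on M V S (\<lambda>x. f x *\<^sub>R u x + g x *\<^sub>R v x)"
proof (rule smooth_section_onI)
  fix U \<phi> i assume t: "(U, \<phi>) \<in> trivs V" "i < brank V"
  have o: "open (S \<inter> U)" using S open_triv[OF t(1)] by auto
  have "smooth_fun_on M (S \<inter> U) (\<lambda>x. f x * \<phi> x (u x) i + g x * \<phi> x (v x) i)"
    by (intro smooth_fun_on_add smooth_fun_on_mult o smooth_section_onD(2)[OF u(1) t] smooth_section_onD(2)[OF u(2) t]
        smooth_fun_on_subset[OF f(1)] smooth_fun_on_subset[OF f(2)]) auto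
  then show "smooth_fun_on M (S \<inter> U) (\<lambda>x. \<phi> x (f x *\<^sub>R u x + g x *\<^sub>R v x) i)"
    by (rule smooth_fun_on_cong[OF o, rotated])
      (simp add: triv_lincomb[OF t(1)] smooth_section_onD(1)[OF u(1)] smooth_section_onD(1)[OF u(2)])
qed (auto intro!: subspace_add[OF subspace_fibre] subspace_scale[OF subspace_fibre]
    smooth_section_onD(1)[OF u(1)] smooth_section_onD(1)[OF u(2)])

lemma meas_section_lincomb:
  assumes S: "open S" and f: "f \<in> borel_measurable (restrict_space borel S)" "g \<in> borel_measurable (restrict_space borel S)"
    and u: "meas_section_on M V S u" "meas_section_on M V S v"
  shows "meas_section_on M V S (\<lambda>x. f x *\<^sub>R u x + g x *\<^sub>R v x)"
proof (rule meas_section_onI)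
  fix U \<phi> i assume t: "(U, \<phi>) \<in> trivs V" "i < brank V"
  have o: "open (S \<inter> U)" using S open_triv[OF t(1)] by auto
  have "f \<in> borel_measurable (restrict_space borel (S \<inter> U))" "g \<in> borel_measurable (restrict_space borel (S \<inter> U))"
    using f by (auto elim: measurable_restrict_mono)
  then have "(\<lambda>x. f x * \<phi> x (u x) i + g x * \<phi> x (v x) i) \<in> borel_measurable (restrict_space borel (S \<inter> U))"
    using meas_section_onD(2)[OF u(1) t] meas_section_onD(2)[OF u(2) t] by measurable
  then show "(\<lambda>x. \<phi> x (f x *\<^sub>R u x + g x *\<^sub>R v x) i) \<in> borel_measurable (restrict_space borel (S \<inter> U))"
    by (rule measurable_cong[THEN iffD1, rotated])
      (simp add: space_restrict_space triv_lincomb[OF t(1)] meas_section_onD(1)[OF u(1)] meas_section_onD(1)[OF u(2)])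
qed (auto intro!: subspace_add[OF subspace_fibre] subspace_scale[OF subspace_fibre]
    meas_section_onD(1)[OF u(1)] meas_section_onD(1)[OF u(2)])

lemma smooth_fmetric_sections:
  assumes S: "open S" and u: "smooth_section_on M V S u" "smooth_section_on M V S v"
  shows "smooth_fun_on M S (\<lambda>x. fmetric V x (u x) (v x))"
proof (rule smooth_fun_on_local)
  fix x assume x: "x \<in> S"
  obtain U \<phi> where t: "(U, \<phi>) \<in> trivs V" "x \<in> U" using triv_exists by blast
  have o: "open (S \<inter> U)" using S open_triv[OF t(1)] by auto
  have "smooth_fun_on M (S \<inter> U) (\<lambda>x. \<Sum>i<brank V. \<Sum>j<brank V. \<phi> x (u x) i * \<phi> x (v x) j * fmetric V x (frame \<phi> x i) (frame \<phi> x j))"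
    by (intro smooth_fun_on_sum smooth_fun_on_mult o smooth_section_onD(2)[OF u(1) t(1)] smooth_section_onD(2)[OF u(2) t(1)]
        smooth_fun_on_subset[OF smooth_frame_metric[OF t(1)]]) auto
  then have "smooth_fun_on M (S \<inter> U) (\<lambda>x. fmetric V x (u x) (v x))"
    by (rule smooth_fun_on_cong[OF o, rotated])
      (simp add: fmetric_triv[OF t(1)] smooth_section_onD(1)[OF u(1)] smooth_section_onD(1)[OF u(2)])
  then show "\<exists>T. open T \<and> x \<in> T \<and> smooth_fun_on M T (\<lambda>x. fmetric V x (u x) (v x))" using o x t(2) by blast
qed

lemma meas_fmetric_sections:
  assumes S: "open S" and u: "meas_section_on M V S u" "meas_section_on M V S v"
  shows "(\<lambda>x. fmetric V x (u x) (v x)) \<in> borel_measurable (restrict_space borel S)"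
proof (rule borel_measurable_restrict_local[OF S])
  fix x assume x: "x \<in> S"
  obtain U \<phi> where t: "(U, \<phi>) \<in> trivs V" "x \<in> U" using triv_exists by blast
  have o: "open (S \<inter> U)" using S open_triv[OF t(1)] by auto
  have "(\<lambda>x. \<Sum>i<brank V. \<Sum>j<brank V. \<phi> x (u x) i * \<phi> x (v x) j * fmetric V x (frame \<phi> x i) (frame \<phi> x j))
      \<in> borel_measurable (restrict_space borel (S \<inter> U))"
    by (intro borel_measurable_sum borel_measurable_times meas_section_onD(2)[OF u(1) t(1)] meas_section_onD(2)[OF u(2) t(1)]
        smooth_fun_on_measurable[OF o] smooth_fun_on_subset[OF smooth_frame_metric[OF t(1)]]) auto
  then have "(\<lambda>x. fmetric V x (u x) (v x)) \<in> borel_measurable (restrict_space borel (S \<inter> U))"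
    by (rule measurable_cong[THEN iffD1, rotated])
      (simp add: space_restrict_space fmetric_triv[OF t(1)] meas_section_onD(1)[OF u(1)] meas_section_onD(1)[OF u(2)])
  then show "\<exists>T. open T \<and> x \<in> T \<and> (\<lambda>x. fmetric V x (u x) (v x)) \<in> borel_measurable (restrict_space borel (S \<inter> T))"
    using open_triv[OF t(1)] t(2) by blast
qed

lemma sect_sq_nonneg: "u x \<in> fibre V x \<Longrightarrow> 0 \<le> sect_sq V u x"
  unfolding sect_sq_def by (rule inner_product_on_nonneg[OF inner_product_fmetric])

lemma sect_sq_add_le:
  "u x \<in> fibre V x \<Longrightarrow> v x \<in> fibre V x \<Longrightarrow> sect_sq V (\<lambda>x. u x + v x) x \<le> 2 * sect_sq V u x + 2 * sect_sq V v x"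
  unfolding sect_sq_def by (rule inner_product_on_sum_le[OF inner_product_fmetric subspace_fibre])

lemma sect_sq_scale: "u x \<in> fibre V x \<Longrightarrow> sect_sq V (\<lambda>x. f x *\<^sub>R u x) x = (f x)\<^sup>2 * sect_sq V u x"
  unfolding sect_sq_def
  by (simp add: inner_product_on_scale_left[OF inner_product_fmetric] inner_product_on_scale_right[OF inner_product_fmetric subspace_fibre]
      subspace_scale[OF subspace_fibre] power2_eq_square)

lemma meas_sect_sq: "meas_section_on M V UNIV u \<Longrightarrow> sect_sq V u \<in> borel_measurable borel"
  using meas_fmetric_sections[of UNIV u u] by (simp add: sect_sq_def[abs_def])

lemma continuous_on_sect_sq: "smooth_section M V u \<Longrightarrow> continuous_on UNIV (sect_sq V u)"
  unfolding sect_sq_def[abs_def] by (intro smooth_fun_on_continuous_on smooth_fmetric_sections open_UNIV)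

subsection \<open>One-forms with values in the bundle\<close>

definition form_at :: "'m \<Rightarrow> (real^'n \<Rightarrow> 'w) \<Rightarrow> bool" where
  "form_at x \<alpha> \<longleftrightarrow> linear \<alpha> \<and> range \<alpha> \<subseteq> fibre V x"

text \<open>One frame at \<open>x\<close> serves all forms at \<open>x\<close> at once, so that
  inequalities between their norms can be proved summand by summand in
  \<open>fmetric\<close>.\<close>

lemma form_sq_basis:
  obtains e :: "'n \<Rightarrow> real^'n" where "\<And>i j. rmetric M x (e i) (e j) = (if i = j then 1 else 0)"
    "\<And>\<alpha>. form_at x (\<alpha> x) \<Longrightarrow> form_sq M V \<alpha> x = (\<Sum>k\<in>UNIV. fmetric V x (\<alpha> x (e k)) (\<alpha> x (e k)))"
proof -
  obtain e :: "'n \<Rightarrow> real^'n" where e: "\<And>i j. rmetric M x (e i) (e j) = (if i = j then 1 else 0)"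
    using orthonormal_basis_exists[OF inner_product_rmetric] by metis
  show ?thesis
    by (rule that[OF e]) (auto simp: form_at_def intro!: form_sq_orthonormal[OF e] inner_product_fmetric subspace_fibre)
qed

lemma form_atD: "form_at x \<alpha> \<Longrightarrow> \<alpha> X \<in> fibre V x"
  by (auto simp: form_at_def)

lemma form_sq_nonneg: "form_at x (\<alpha> x) \<Longrightarrow> 0 \<le> form_sq M V \<alpha> x"
  by (rule form_sq_basis[of x])
    (auto intro!: sum_nonneg inner_product_on_nonneg[OF inner_product_fmetric] dest: form_atD)

lemma form_at_lincomb:
  assumes "form_at x \<alpha>" "form_at x \<beta>" shows "form_at x (\<lambda>X. s *\<^sub>R \<alpha> X + t *\<^sub>R \<beta> X)"
  using assms unfolding form_at_def
  by (auto intro!: subspace_add[OF subspace_fibre] subspace_scale[OF subspace_fibre] simp: linear_iff algebra_simps)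

lemma form_sq_add_le:
  assumes "form_at x (\<alpha> x)" "form_at x (\<beta> x)"
  shows "form_sq M V (\<lambda>x X. \<alpha> x X + \<beta> x X) x \<le> 2 * form_sq M V \<alpha> x + 2 * form_sq M V \<beta> x"
proof -
  obtain e :: "'n \<Rightarrow> real^'n" where e:
    "\<And>\<alpha>. form_at x (\<alpha> x) \<Longrightarrow> form_sq M V \<alpha> x = (\<Sum>k\<in>UNIV. fmetric V x (\<alpha> x (e k)) (\<alpha> x (e k)))"
    by (rule form_sq_basis[of x]) blast
  have "form_at x (\<lambda>X. \<alpha> x X + \<beta> x X)" using form_at_lincomb[OF assms, of 1 1] by simp
  then have "form_sq M V (\<lambda>x X. \<alpha> x X + \<beta> x X) x = (\<Sum>k\<in>UNIV. fmetric V x (\<alpha> x (e k) + \<beta> x (e k)) (\<alpha> x (e k) + \<beta> x (e k)))"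
    by (subst e) auto
  also have "\<dots> \<le> (\<Sum>k\<in>UNIV. 2 * fmetric V x (\<alpha> x (e k)) (\<alpha> x (e k)) + 2 * fmetric V x (\<beta> x (e k)) (\<beta> x (e k)))"
    by (intro sum_mono inner_product_on_sum_le[OF inner_product_fmetric subspace_fibre] form_atD assms)
  also have "\<dots> = 2 * form_sq M V \<alpha> x + 2 * form_sq M V \<beta> x"
    by (simp add: e[of \<alpha>, OF assms(1)] e[of \<beta>, OF assms(2)] sum.distrib sum_distrib_left)
  finally show ?thesis .
qed

lemma form_sq_scale:
  assumes "form_at x (\<alpha> x)" shows "form_sq M V (\<lambda>x X. f x *\<^sub>R \<alpha> x X) x = (f x)\<^sup>2 * form_sq M V \<alpha> x"
proof -
  obtain e :: "'n \<Rightarrow> real^'n" where e: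
    "\<And>\<alpha>. form_at x (\<alpha> x) \<Longrightarrow> form_sq M V \<alpha> x = (\<Sum>k\<in>UNIV. fmetric V x (\<alpha> x (e k)) (\<alpha> x (e k)))"
    by (rule form_sq_basis[of x]) blast
  have "form_at x (\<lambda>X. f x *\<^sub>R \<alpha> x X)" using form_at_lincomb[OF assms assms, of "f x" 0] by simp
  then have "form_sq M V (\<lambda>x X. f x *\<^sub>R \<alpha> x X) x = (\<Sum>k\<in>UNIV. fmetric V x (f x *\<^sub>R \<alpha> x (e k)) (f x *\<^sub>R \<alpha> x (e k)))"
    by (subst e) auto
  then show ?thesis
    using form_atD[OF assms] by (simp add: e[of \<alpha>, OF assms] sum_distrib_left power2_eq_square mult.assoc
        inner_product_on_scale_left[OF inner_product_fmetric] inner_product_on_scale_right[OF inner_product_fmetric subspace_fibre]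
        subspace_scale[OF subspace_fibre])
qed

lemma form_at_tensor:
  assumes "linear a" "u \<in> fibre V x" shows "form_at x (\<lambda>X. a X *\<^sub>R u)"
  using assms by (auto simp: form_at_def linear_iff algebra_simps intro!: subspace_scale[OF subspace_fibre])

lemma meas_formD:
  assumes "meas_form M V \<alpha>"
  shows "\<And>x. form_at x (\<alpha> x)" "\<And>c v. c \<in> atlas M \<Longrightarrow> meas_section_on M V (fst c) (\<lambda>x. \<alpha> x (coord_vec M c x v))"
  using assms by (auto simp: meas_form_def form_at_def)

lemma smooth_formD:
  assumes "smooth_form M V \<alpha>"
  shows "\<And>x. form_at x (\<alpha> x)" "\<And>c v. c \<in> atlas M \<Longrightarrow> smooth_section_on M V (fst c) (\<lambda>x. \<alpha> x (coord_vec M c x v))"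
  using assms by (auto simp: smooth_form_def form_at_def)

lemma meas_formI:
  assumes "\<And>x. form_at x (\<alpha> x)" "\<And>c v. c \<in> atlas M \<Longrightarrow> meas_section_on M V (fst c) (\<lambda>x. \<alpha> x (coord_vec M c x v))"
  shows "meas_form M V \<alpha>"
  using assms by (auto simp: meas_form_def form_at_def)

lemma smooth_imp_meas_form: "smooth_form M V \<alpha> \<Longrightarrow> meas_form M V \<alpha>"
  by (rule meas_formI) (auto dest: smooth_formD intro!: smooth_imp_meas_section open_chart_domain)

lemma meas_restrict: "f \<in> borel_measurable borel \<Longrightarrow> f \<in> borel_measurable (restrict_space borel S)"
  by (rule measurable_restrict_space1)

lemma meas_form_lincomb:
  assumes "meas_form M V \<alpha>" "meas_form M V \<beta>" "f \<in> borel_measurable borel" "g \<in> borel_measurable borel"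
  shows "meas_form M V (\<lambda>x X. f x *\<^sub>R \<alpha> x X + g x *\<^sub>R \<beta> x X)"
  by (rule meas_formI)
    (auto intro!: form_at_lincomb meas_section_lincomb meas_formD[OF assms(1)] meas_formD[OF assms(2)] open_chart_domain meas_restrict assms)

lemma meas_form_sq:
  assumes "meas_form M V \<alpha>" shows "form_sq M V \<alpha> \<in> borel_measurable borel"
proof -
  have "form_sq M V \<alpha> \<in> borel_measurable (restrict_space borel UNIV)"
  proof (rule borel_measurable_restrict_local[OF open_UNIV])
    fix x
    let ?c = "chart_at M x"
    note c = chart_at[of x]
    have "(\<lambda>y. \<Sum>i\<in>UNIV. \<Sum>j\<in>UNIV. matrix_inv (gram M ?c y) $ i $ j *
        fmetric V y (\<alpha> y (coord_vec M ?c y (axis i 1))) (\<alpha> y (coord_vec M ?c y (axis j 1))))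
      \<in> borel_measurable (restrict_space borel (fst ?c))"
      by (intro borel_measurable_sum borel_measurable_times meas_fmetric_sections meas_formD[OF assms] c(1) open_chart_domain
          borel_measurable_continuous_on_restrict continuous_on_gram_inv)
    then have "form_sq M V \<alpha> \<in> borel_measurable (restrict_space borel (fst ?c))"
      using meas_formD(1)[OF assms]
      by (intro measurable_cong[THEN iffD2, OF form_sq_chart[OF c(1)]])
        (auto simp: space_restrict_space form_at_def intro: inner_product_fmetric subspace_fibre)
    then show "\<exists>T. open T \<and> x \<in> T \<and> form_sq M V \<alpha> \<in> borel_measurable (restrict_space borel (UNIV \<inter> T))"
      using c open_chart_domain[OF c(1)] by (intro exI[of _ "fst ?c"]) simp
  qed
  then show ?thesis by simp
qed

lemma continuous_on_form_sq:
  assumes "smooth_form M V \<alpha>" shows "continuous_on UNIV (form_sq M V \<alpha>)"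
proof (intro continuous_at_imp_continuous_on ballI)
  fix x
  let ?c = "chart_at M x"
  note c = chart_at[of x]
  have "continuous_on (fst ?c) (\<lambda>y. \<Sum>i\<in>UNIV. \<Sum>j\<in>UNIV. matrix_inv (gram M ?c y) $ i $ j *
      fmetric V y (\<alpha> y (coord_vec M ?c y (axis i 1))) (\<alpha> y (coord_vec M ?c y (axis j 1))))"
    by (intro continuous_on_sum continuous_on_mult smooth_fun_on_continuous_on smooth_fmetric_sections
        smooth_formD[OF assms] c(1) open_chart_domain continuous_on_gram_inv)
  then have "continuous_on (fst ?c) (form_sq M V \<alpha>)"
    by (rule continuous_on_eq)
      (use smooth_formD(1)[OF assms] in \<open>auto simp: form_at_def intro!: form_sq_chart[OF c(1), symmetric] inner_product_fmetric subspace_fibre\<close>)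
  then show "isCont (form_sq M V \<alpha>) x"
    using c open_chart_domain[OF c(1)] by (simp add: continuous_on_eq_continuous_at)
qed

end

subsection \<open>The bundle of scalars\<close>

context riem
begin

text \<open>Makes the results on sections available for functions, in particular for the test
  functions of the capacity, under the prefix \<open>scalar\<close>.\<close>

lemma riem_bundle_scalar: "riem_bundle M (scalar_bundle M)"
proof unfold_locales
  let ?\<phi> = "\<lambda>a i. if i = 0 then a else 0 :: real"
  have inj: "inj ?\<phi>" by (rule injI) (metis (full_types))
  have "bij_betw ?\<phi> UNIV (coord_space 1)"
    unfolding bij_betw_def
  proof
    show "inj ?\<phi>" by (rule inj)
    show "range ?\<phi> = coord_space 1"
    proof (intro equalityI subsetI)
      fix a assume "a \<in> coord_space 1"
      then have "a = ?\<phi> (a 0)" by (auto simp: coord_space_def)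
      then show "a \<in> range ?\<phi>" by blast
    qed (auto simp: coord_space_def)
  qed
  then show "smooth_vbundle M (scalar_bundle M)"
    by (auto simp: smooth_vbundle_def scalar_bundle_def smooth_fun_on_const)
  show "smooth_fmetric M (scalar_bundle M)"
    by (auto simp: smooth_fmetric_def scalar_bundle_def smooth_fun_on_const inner_product_on_def algebra_simps
        zero_less_mult_iff linorder_neq_iff)
qed

sublocale scalar: riem_bundle M "scalar_bundle M"
  by (rule riem_bundle_scalar)

lemma scalar_bundle_simps [simp]:
  "fibre (scalar_bundle M) x = UNIV" "brank (scalar_bundle M) = 1"
  "trivs (scalar_bundle M) = {(UNIV, \<lambda>_ a i. if i = 0 then a else 0)}"
  "fmetric (scalar_bundle M) x a b = a * b" "conn (scalar_bundle M) = differential M"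
  by (simp_all add: scalar_bundle_def)

lemma scalar_smooth_section: "smooth_section_on M (scalar_bundle M) S f \<longleftrightarrow> smooth_fun_on M S f"
  by (simp add: smooth_section_on_def)

lemma scalar_meas_section:
  "meas_section_on M (scalar_bundle M) S f \<longleftrightarrow> f \<in> borel_measurable (restrict_space borel S)"
  by (simp add: meas_section_on_def)

lemma scalar_sect_sq: "sect_sq (scalar_bundle M) f x = (f x)\<^sup>2"
  by (simp add: sect_sq_def power2_eq_square)

lemma scalar_form_at: "scalar.form_at x a \<longleftrightarrow> linear a"
  by (simp add: scalar.form_at_def)

abbreviation grad_sq :: "('m \<Rightarrow> real^'n \<Rightarrow> real) \<Rightarrow> 'm \<Rightarrow> real" where
  "grad_sq \<equiv> form_sq M (scalar_bundle M)"

text \<open>Each vector of an orthonormal frame contributes at most C^2, which is where the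
  dimension comes from.\<close>

lemma grad_sq_le:
  assumes "linear (a x)" "\<And>X. \<bar>a x X\<bar> \<le> C * sqrt (rmetric M x X X)"
  shows "grad_sq a x \<le> real CARD('n) * C\<^sup>2"
proof -
  obtain e :: "'n \<Rightarrow> real^'n" where e: "\<And>i j. rmetric M x (e i) (e j) = (if i = j then 1 else 0)"
    "\<And>\<alpha>. scalar.form_at x (\<alpha> x) \<Longrightarrow> grad_sq \<alpha> x = (\<Sum>k\<in>UNIV. fmetric (scalar_bundle M) x (\<alpha> x (e k)) (\<alpha> x (e k)))"
    by (rule scalar.form_sq_basis[of x]) blast
  have "grad_sq a x = (\<Sum>k\<in>UNIV. a x (e k) * a x (e k))" using e(2)[of a] assms(1) by (simp add: scalar_form_at)
  also have "\<dots> \<le> (\<Sum>k\<in>(UNIV::'n set). C\<^sup>2)"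
  proof (rule sum_mono)
    fix k
    have "\<bar>a x (e k)\<bar> \<le> C" using assms(2)[of "e k"] e(1)[of k k] by simp
    then have "\<bar>a x (e k)\<bar>\<^sup>2 \<le> C\<^sup>2" by (rule power_mono) simp
    then show "a x (e k) * a x (e k) \<le> C\<^sup>2" by (simp add: power2_eq_square)
  qed
  finally show ?thesis by simp
qed

lemma smooth_form_differential:
  assumes "smooth_fun_on M UNIV f" shows "smooth_form M (scalar_bundle M) (differential M f)"
proof -
  have "smooth_fun_on M (fst c) (\<lambda>x. differential M f x (coord_vec M c x v))" if c: "c \<in> atlas M" for c v
  proof -
    have "smooth_on (snd c ` fst c) (\<lambda>p. frechet_derivative (f \<circ> chart_inv c) (at p) v)"
      using smooth_on_frechet_derivative[OF smooth_fun_onD[OF assms c]] by simp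
    from smooth_fun_on_chart[OF c open_chart_domain[OF c] order_refl this]
    show ?thesis
      by (rule smooth_fun_on_cong[OF open_chart_domain[OF c], rotated])
        (simp add: differential_coord_vec[OF open_UNIV assms UNIV_I c])
  qed
  then show ?thesis
    using linear_differential[OF open_UNIV assms] by (simp add: smooth_form_def scalar_smooth_section)
qed

end

context riem_bundle
begin

lemma form_sq_tensor:
  assumes "linear (a x)" "u x \<in> fibre V x"
  shows "form_sq M V (\<lambda>x X. a x X *\<^sub>R u x) x = grad_sq a x * sect_sq V u x"
proof -
  obtain e :: "'n \<Rightarrow> real^'n" where e0: "\<And>i j. rmetric M x (e i) (e j) = (if i = j then 1 else 0)" and e:
    "\<And>\<alpha>. form_at x (\<alpha> x) \<Longrightarrow> form_sq M V \<alpha> x = (\<Sum>k\<in>UNIV. fmetric V x (\<alpha> x (e k)) (\<alpha> x (e k)))"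
    by (rule form_sq_basis[of x]) blast
  have "grad_sq a x = (\<Sum>k\<in>UNIV. a x (e k) * a x (e k))"
    by (subst form_sq_orthonormal[OF e0]) (auto simp: assms scalar.inner_product_fmetric[simplified] inner_product_on_def algebra_simps zero_less_mult_iff linorder_neq_iff)
  moreover have "form_sq M V (\<lambda>x X. a x X *\<^sub>R u x) x = (\<Sum>k\<in>UNIV. fmetric V x (a x (e k) *\<^sub>R u x) (a x (e k) *\<^sub>R u x))"
    using form_at_tensor[OF assms] by (subst e) auto
  ultimately show ?thesis
    using assms(2) by (simp add: sum_distrib_right sect_sq_def mult.assoc
        inner_product_on_scale_left[OF inner_product_fmetric] inner_product_on_scale_right[OF inner_product_fmetric subspace_fibre]
        subspace_scale[OF subspace_fibre])
qed

lemma meas_section_scale: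
  assumes "open S" "f \<in> borel_measurable (restrict_space borel S)" "meas_section_on M V S u"
  shows "meas_section_on M V S (\<lambda>x. f x *\<^sub>R u x)"
  using meas_section_lincomb[OF assms(1,2) _ assms(3,3), of "\<lambda>_. 0"] by simp

lemma meas_form_tensor:
  assumes "meas_form M (scalar_bundle M) a" "meas_section_on M V UNIV u"
  shows "meas_form M V (\<lambda>x X. a x X *\<^sub>R u x)"
proof (rule meas_formI)
  show "form_at x (\<lambda>X. a x X *\<^sub>R u x)" for x
    using scalar.meas_formD(1)[OF assms(1), of x] meas_section_onD(1)[OF assms(2), of x]
    by (intro form_at_tensor) (auto simp: scalar_form_at)
  fix c v assume c: "c \<in> atlas M"
  have "meas_section_on M V (fst c) u"
    by (rule meas_section_onI)
      (auto intro!: meas_section_onD(1)[OF assms(2)] measurable_restrict_mono[OF meas_section_onD(2)[OF assms(2)]])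
  then show "meas_section_on M V (fst c) (\<lambda>x. a x (coord_vec M c x v) *\<^sub>R u x)"
    using scalar.meas_formD(2)[OF assms(1) c, of v] open_chart_domain[OF c]
    by (intro meas_section_scale) (auto simp: scalar_meas_section)
qed

lemma smooth_section_scale:
  assumes "open S" "smooth_fun_on M S f" "smooth_section_on M V S u"
  shows "smooth_section_on M V S (\<lambda>x. f x *\<^sub>R u x)"
  using smooth_section_lincomb[OF assms(1,2) smooth_fun_on_const[of S 0] assms(3,3)] by simp

end

section \<open>Convergence in the Sobolev norm\<close>

context riem
begin

lemma grad_sq_orthonormal:
  fixes e :: "'n \<Rightarrow> real^'n"
  assumes "\<And>i j. rmetric M x (e i) (e j) = (if i = j then 1 else 0)" "linear (a x)"
  shows "grad_sq a x = (\<Sum>k\<in>UNIV. (a x (e k))\<^sup>2)"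
  using form_sq_orthonormal[OF assms(1), where V="scalar_bundle M" and \<alpha>=a] assms(2) scalar.inner_product_fmetric scalar.subspace_fibre
  by (simp add: power2_eq_square)

lemma scaled_less:
  assumes "0 < (n::ennreal)" "n < \<infinity>" "a < e / n" shows "n * a < e"
proof -
  have "n * a < n * (e / n)"
    by (rule ennreal_mult_strict_left_mono) (use assms in auto)
  also have "\<dots> = e" using assms(1,2) by (simp add: ennreal_times_divide mult.commute ennreal_mult_divide_eq)
  finally show ?thesis .
qed

lemma meas_vol: "f \<in> borel_measurable borel \<Longrightarrow> f \<in> borel_measurable (vol M)"
  by simp

text \<open>Dominated convergence with majorant \<open>g\<close>. It serves the truncation of
  sections, the cutoff functions tending to 1, and the set where the density of a section is
  large.\<close>

lemma weighted_integral_small: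
  fixes h :: "nat \<Rightarrow> 'm \<Rightarrow> real"
  assumes h: "\<And>k. h k \<in> borel_measurable borel" "\<And>k x. 0 \<le> h k x" "\<And>k x. h k x \<le> 1" "\<And>x. (\<lambda>k. h k x) \<longlonglongrightarrow> 0"
    and g: "g \<in> borel_measurable borel" "\<And>x. 0 \<le> g x" "(\<integral>\<^sup>+x. ennreal (g x) \<partial>vol M) < \<infinity>"
    and e: "0 < e"
  shows "\<forall>\<^sub>F k in sequentially. (\<integral>\<^sup>+x. ennreal (h k x * g x) \<partial>vol M) < e"
proof -
  have "(\<lambda>k. \<integral>\<^sup>+x. ennreal (h k x * g x) \<partial>vol M) \<longlonglongrightarrow> (\<integral>\<^sup>+x. 0 \<partial>vol M)"
  proof (rule nn_integral_dominated_convergence[where w="\<lambda>x. ennreal (g x)"])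
    show "(\<lambda>x. ennreal (h k x * g x)) \<in> borel_measurable (vol M)" for k using h(1)[of k] g(1) by simp
    show "(\<lambda>x. ennreal (g x)) \<in> borel_measurable (vol M)" using g(1) by simp
    show "AE x in vol M. ennreal (h k x * g x) \<le> ennreal (g x)" for k
      using h(2,3)[of k] g(2) by (intro AE_I2 ennreal_leI) (simp add: mult_left_le_one_le)
    show "AE x in vol M. (\<lambda>k. ennreal (h k x * g x)) \<longlonglongrightarrow> 0"
    proof (rule AE_I2)
      fix x
      have "(\<lambda>k. ennreal (h k x * g x)) \<longlonglongrightarrow> ennreal (0 * g x)"
        by (intro tendsto_ennrealI tendsto_mult h(4) tendsto_const)
      then show "(\<lambda>k. ennreal (h k x * g x)) \<longlonglongrightarrow> 0" by simp
    qed
  qed (use g(3) in auto)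
  then show ?thesis using e by (simp add: order_tendstoD(2))
qed

end

context riem_bundle
begin

text \<open>Up to equivalence the square of the Sobolev norm, for a section whose gradient is given
  separately. Values in \<open>ennreal\<close> allow estimates before integrability is
  known.\<close>

definition energy :: "('m \<Rightarrow> 'w) \<Rightarrow> ('m \<Rightarrow> real^'n \<Rightarrow> 'w) \<Rightarrow> ennreal" where
  "energy u \<alpha> = (\<integral>\<^sup>+x. ennreal (sect_sq V u x + form_sq M V \<alpha> x) \<partial>vol M)"

lemma fibre_diff: "u \<in> fibre V x \<Longrightarrow> v \<in> fibre V x \<Longrightarrow> u - v \<in> fibre V x"
  by (rule subspace_diff[OF subspace_fibre])

lemma form_at_diff: "form_at x \<alpha> \<Longrightarrow> form_at x \<beta> \<Longrightarrow> form_at x (\<lambda>X. \<alpha> X - \<beta> X)"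
  using form_at_lincomb[of x \<alpha> \<beta> 1 "-1"] by simp

lemma meas_section_diff: "meas_section_on M V UNIV u \<Longrightarrow> meas_section_on M V UNIV v \<Longrightarrow> meas_section_on M V UNIV (\<lambda>x. u x - v x)"
  using meas_section_lincomb[OF open_UNIV, of "\<lambda>_. 1" "\<lambda>_. -1" u v] by simp

lemma meas_form_diff: "meas_form M V \<alpha> \<Longrightarrow> meas_form M V \<beta> \<Longrightarrow> meas_form M V (\<lambda>x X. \<alpha> x X - \<beta> x X)"
  using meas_form_lincomb[of \<alpha> \<beta> "\<lambda>_. 1" "\<lambda>_. -1"] by simp

lemma form_sq_diff_le:
  assumes "form_at x (\<alpha> x)" "form_at x (\<beta> x)"
  shows "form_sq M V (\<lambda>x X. \<alpha> x X - \<beta> x X) x \<le> 2 * form_sq M V \<alpha> x + 2 * form_sq M V \<beta> x"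
  using form_sq_add_le[of x \<alpha> "\<lambda>x X. (-1) *\<^sub>R \<beta> x X"] form_sq_scale[of x \<beta> "\<lambda>_. -1"] assms
    form_at_lincomb[OF assms(2) assms(2), of "-1" 0] by simp

text \<open>For squared norms the triangle inequality takes the form |a + b|^2 <= 2 |a|^2 + 2 |b|^2;
  the factor 2 is harmless where only smallness matters.\<close>

lemma energy_triangle:
  assumes m: "meas_section_on M V UNIV u" "meas_section_on M V UNIV v" "meas_section_on M V UNIV w"
    "meas_form M V \<alpha>" "meas_form M V \<beta>" "meas_form M V \<gamma>"
  shows "energy (\<lambda>x. u x - w x) (\<lambda>x X. \<alpha> x X - \<gamma> x X) \<le>
    2 * energy (\<lambda>x. u x - v x) (\<lambda>x X. \<alpha> x X - \<beta> x X) + 2 * energy (\<lambda>x. v x - w x) (\<lambda>x X. \<beta> x X - \<gamma> x X)"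
proof -
  let ?a = "\<lambda>x. sect_sq V (\<lambda>x. u x - v x) x + form_sq M V (\<lambda>x X. \<alpha> x X - \<beta> x X) x"
  let ?b = "\<lambda>x. sect_sq V (\<lambda>x. v x - w x) x + form_sq M V (\<lambda>x X. \<beta> x X - \<gamma> x X) x"
  note fib = fibre_diff meas_section_onD(1)[OF m(1)] meas_section_onD(1)[OF m(2)] meas_section_onD(1)[OF m(3)]
  note fat = form_at_diff meas_formD(1)[OF m(4)] meas_formD(1)[OF m(5)] meas_formD(1)[OF m(6)]
  have nn: "0 \<le> ?a x" "0 \<le> ?b x" for x by (auto intro!: add_nonneg_nonneg sect_sq_nonneg form_sq_nonneg fib fat)
  have ms: "?a \<in> borel_measurable (vol M)" "?b \<in> borel_measurable (vol M)"
    by (auto intro!: meas_vol borel_measurable_add meas_sect_sq meas_form_sq meas_section_diff meas_form_diff m)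
  have "ennreal (sect_sq V (\<lambda>x. u x - w x) x + form_sq M V (\<lambda>x X. \<alpha> x X - \<gamma> x X) x) \<le> 2 * ennreal (?a x) + 2 * ennreal (?b x)" for x
  proof -
    have "sect_sq V (\<lambda>x. u x - w x) x \<le> 2 * sect_sq V (\<lambda>x. u x - v x) x + 2 * sect_sq V (\<lambda>x. v x - w x) x"
      using sect_sq_add_le[of "\<lambda>x. u x - v x" x "\<lambda>x. v x - w x"] fib by simp
    moreover have "form_sq M V (\<lambda>x X. \<alpha> x X - \<gamma> x X) x \<le> 2 * form_sq M V (\<lambda>x X. \<alpha> x X - \<beta> x X) x + 2 * form_sq M V (\<lambda>x X. \<beta> x X - \<gamma> x X) x"
      using form_sq_add_le[of x "\<lambda>x X. \<alpha> x X - \<beta> x X" "\<lambda>x X. \<beta> x X - \<gamma> x X"] fat by simp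
    ultimately have "sect_sq V (\<lambda>x. u x - w x) x + form_sq M V (\<lambda>x X. \<alpha> x X - \<gamma> x X) x \<le> 2 * ?a x + 2 * ?b x" by simp
    then have "ennreal (sect_sq V (\<lambda>x. u x - w x) x + form_sq M V (\<lambda>x X. \<alpha> x X - \<gamma> x X) x) \<le> ennreal (2 * ?a x + 2 * ?b x)"
      by (rule ennreal_leI)
    also have "\<dots> = 2 * ennreal (?a x) + 2 * ennreal (?b x)"
      using nn[of x] by (subst ennreal_plus) (simp_all only: ennreal_mult'' ennreal_numeral mult_nonneg_nonneg zero_le_numeral)
    finally show ?thesis .
  qed
  then have "energy (\<lambda>x. u x - w x) (\<lambda>x X. \<alpha> x X - \<gamma> x X) \<le> (\<integral>\<^sup>+x. (2 * ennreal (?a x) + 2 * ennreal (?b x)) \<partial>vol M)"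
    unfolding energy_def by (intro nn_integral_mono)
  also have "\<dots> = 2 * (\<integral>\<^sup>+x. ennreal (?a x) \<partial>vol M) + 2 * (\<integral>\<^sup>+x. ennreal (?b x) \<partial>vol M)"
    using ms by (subst nn_integral_add) (auto simp: nn_integral_cmult)
  finally show ?thesis unfolding energy_def .
qed

lemma energy_finite_iff:
  assumes "meas_section_on M V UNIV u" "meas_form M V \<alpha>"
  shows "energy u \<alpha> < \<infinity> \<longleftrightarrow> u \<in> L2_sections M V \<and> \<alpha> \<in> L2_forms M V"
proof -
  have nn: "0 \<le> sect_sq V u x" "0 \<le> form_sq M V \<alpha> x" for x
    using meas_section_onD(1)[OF assms(1)] meas_formD(1)[OF assms(2)] by (auto intro: sect_sq_nonneg form_sq_nonneg)
  have ms: "sect_sq V u \<in> borel_measurable (vol M)" "form_sq M V \<alpha> \<in> borel_measurable (vol M)"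
    by (auto intro!: meas_vol meas_sect_sq meas_form_sq assms)
  have "energy u \<alpha> = (\<integral>\<^sup>+x. ennreal (sect_sq V u x) \<partial>vol M) + (\<integral>\<^sup>+x. ennreal (form_sq M V \<alpha> x) \<partial>vol M)"
    unfolding energy_def using nn ms by (simp add: nn_integral_add)
  then show ?thesis using ms nn assms by (simp add: L2_sections_def L2_forms_def integrable_iff_bounded)
qed

lemma energy_eq_norms:
  assumes "u \<in> L2_sections M V" "\<alpha> \<in> L2_forms M V"
  shows "energy u \<alpha> = ennreal ((section_norm M V u)\<^sup>2 + (form_norm M V \<alpha>)\<^sup>2)"
    "energy u \<alpha> = ennreal (\<integral>x. (sect_sq V u x + form_sq M V \<alpha> x) \<partial>vol M)"
proof -
  have m: "meas_section_on M V UNIV u" "meas_form M V \<alpha>" and i: "integrable (vol M) (sect_sq V u)" "integrable (vol M) (form_sq M V \<alpha>)"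
    using assms by (auto simp: L2_sections_def L2_forms_def)
  have nn: "0 \<le> sect_sq V u x" "0 \<le> form_sq M V \<alpha> x" for x
    using meas_section_onD(1)[OF m(1)] meas_formD(1)[OF m(2)] by (auto intro: sect_sq_nonneg form_sq_nonneg)
  show e: "energy u \<alpha> = ennreal (\<integral>x. (sect_sq V u x + form_sq M V \<alpha> x) \<partial>vol M)"
    unfolding energy_def using i nn by (intro nn_integral_eq_integral) auto
  show "energy u \<alpha> = ennreal ((section_norm M V u)\<^sup>2 + (form_norm M V \<alpha>)\<^sup>2)"
    unfolding e section_norm_def form_norm_def using i nn by (simp add: integral_nonneg)
qed

lemma energy_diff_finite:
  assumes "u \<in> L2_sections M V" "v \<in> L2_sections M V" "\<alpha> \<in> L2_forms M V" "\<beta> \<in> L2_forms M V"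
  shows "(\<lambda>x. u x - v x) \<in> L2_sections M V" "(\<lambda>x X. \<alpha> x X - \<beta> x X) \<in> L2_forms M V"
proof -
  have m: "meas_section_on M V UNIV u" "meas_section_on M V UNIV v" "meas_form M V \<alpha>" "meas_form M V \<beta>"
    using assms by (auto simp: L2_sections_def L2_forms_def)
  \<comment> \<open>The zero section and the zero form are the middle term in the triangle
    inequality.\<close>
  have z: "meas_section_on M V UNIV (\<lambda>x. 0)" "meas_form M V (\<lambda>x X. 0)"
    using meas_section_diff[OF m(1) m(1)] meas_form_diff[OF m(3) m(3)] by simp_all
  have f: "energy u \<alpha> < \<infinity>" "energy v \<beta> < \<infinity>" using assms energy_finite_iff[OF m(1,3)] energy_finite_iff[OF m(2,4)] by blast+
  have neg: "sect_sq V (\<lambda>x. 0 - v x) x = sect_sq V v x" "form_sq M V (\<lambda>x X. 0 - \<beta> x X) x = form_sq M V \<beta> x" for x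
    using sect_sq_scale[of v x "\<lambda>_. -1"] meas_section_onD(1)[OF m(2), of x] form_sq_scale[of x \<beta> "\<lambda>_. -1"] meas_formD(1)[OF m(4), of x] by auto
  have "energy (\<lambda>x. 0 - v x) (\<lambda>x X. 0 - \<beta> x X) = energy v \<beta>" unfolding energy_def neg ..
  then have "energy (\<lambda>x. u x - v x) (\<lambda>x X. \<alpha> x X - \<beta> x X) \<le> 2 * energy u \<alpha> + 2 * energy v \<beta>"
    using energy_triangle[OF m(1) z(1) m(2,3) z(2) m(4)] by simp
  also have "\<dots> < \<infinity>" using f by (simp add: ennreal_mult_less_top)
  finally show "(\<lambda>x. u x - v x) \<in> L2_sections M V" "(\<lambda>x X. \<alpha> x X - \<beta> x X) \<in> L2_forms M V"
    using energy_finite_iff[OF meas_section_diff[OF m(1,2)] meas_form_diff[OF m(3,4)]] by auto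
qed

text \<open>Replaces sequences by an approximation statement in which triangle inequalities can be
  chained. For nonnegative a and b, the sum a + b is small exactly when a^2 + b^2 is.\<close>

lemma has_grad_iff:
  assumes D: "D \<subseteq> S1 M V"
  shows "has_grad M V D u \<alpha> \<longleftrightarrow> u \<in> L2_sections M V \<and> \<alpha> \<in> L2_forms M V \<and>
    (\<forall>e>0. \<exists>w\<in>D. energy (\<lambda>x. w x - u x) (\<lambda>x X. conn V w x X - \<alpha> x X) < e)"
proof (cases "u \<in> L2_sections M V \<and> \<alpha> \<in> L2_forms M V")
  case True
  define a where "a w = section_norm M V (\<lambda>x. w x - u x)" for w
  define b where "b w = form_norm M V (\<lambda>x X. conn V w x X - \<alpha> x X)" for w
  have E: "energy (\<lambda>x. w x - u x) (\<lambda>x X. conn V w x X - \<alpha> x X) = ennreal ((a w)\<^sup>2 + (b w)\<^sup>2)" if "w \<in> D" for w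
    unfolding a_def b_def using that D True by (intro energy_eq_norms(1) energy_diff_finite) (auto simp: S1_def)
  have nn: "0 \<le> a w" "0 \<le> b w" if "w \<in> D" for w
  proof -
    have w: "w \<in> L2_sections M V" "conn V w \<in> L2_forms M V" using that D by (auto simp: S1_def)
    have "meas_section_on M V UNIV (\<lambda>x. w x - u x)" "meas_form M V (\<lambda>x X. conn V w x X - \<alpha> x X)"
      using w True by (auto simp: L2_sections_def L2_forms_def intro: meas_section_diff meas_form_diff)
    then show "0 \<le> a w" "0 \<le> b w" unfolding a_def b_def section_norm_def form_norm_def
      by (auto intro!: integral_nonneg_AE sect_sq_nonneg form_sq_nonneg dest: meas_section_onD(1) meas_formD(1))
  qed
  have "(\<exists>s. (\<forall>k. s k \<in> D) \<and> (\<lambda>k::nat. a (s k) + b (s k)) \<longlonglongrightarrow> 0) \<longleftrightarrow> (\<forall>e>0. \<exists>w\<in>D. ennreal ((a w)\<^sup>2 + (b w)\<^sup>2) < e)"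
  proof (intro iffI allI impI)
    fix e :: ennreal assume "\<exists>s. (\<forall>k. s k \<in> D) \<and> (\<lambda>k::nat. a (s k) + b (s k)) \<longlonglongrightarrow> 0" and e: "0 < e"
    then obtain s where s: "\<And>k. s k \<in> D" "(\<lambda>k::nat. a (s k) + b (s k)) \<longlonglongrightarrow> 0" by blast
    have "(\<lambda>k. ennreal ((a (s k) + b (s k))\<^sup>2)) \<longlonglongrightarrow> ennreal (0\<^sup>2)"
      by (intro tendsto_ennrealI tendsto_power s(2))
    then have "\<forall>\<^sub>F k in sequentially. ennreal ((a (s k) + b (s k))\<^sup>2) < e" using e by (simp add: order_tendstoD(2))
    then obtain k where k: "ennreal ((a (s k) + b (s k))\<^sup>2) < e" by (auto simp: eventually_sequentially)
    have "(a (s k))\<^sup>2 + (b (s k))\<^sup>2 \<le> (a (s k) + b (s k))\<^sup>2" using nn[OF s(1)[of k]] by (simp add: power2_sum)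
    then have "ennreal ((a (s k))\<^sup>2 + (b (s k))\<^sup>2) < e" using k by (meson ennreal_leI le_less_trans)
    then show "\<exists>w\<in>D. ennreal ((a w)\<^sup>2 + (b w)\<^sup>2) < e" using s(1) by blast
  next
    assume r: "\<forall>e>0. \<exists>w\<in>D. ennreal ((a w)\<^sup>2 + (b w)\<^sup>2) < e"
    have "\<exists>w\<in>D. ennreal ((a w)\<^sup>2 + (b w)\<^sup>2) < ennreal ((inverse (real (Suc k)))\<^sup>2)" for k
      by (rule r[rule_format]) simp
    then obtain s where s: "\<And>k. s k \<in> D" "\<And>k. ennreal ((a (s k))\<^sup>2 + (b (s k))\<^sup>2) < ennreal ((inverse (real (Suc k)))\<^sup>2)" by metis
    have le: "a (s k) + b (s k) \<le> 2 * inverse (real (Suc k))" for k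
    proof -
      have "(a (s k))\<^sup>2 + (b (s k))\<^sup>2 < (inverse (real (Suc k)))\<^sup>2" using s(2)[of k] by (subst (asm) ennreal_less_iff) auto
      then have "(a (s k))\<^sup>2 \<le> (inverse (real (Suc k)))\<^sup>2" "(b (s k))\<^sup>2 \<le> (inverse (real (Suc k)))\<^sup>2"
        using zero_le_power2[of "a (s k)"] zero_le_power2[of "b (s k)"] by linarith+
      then have "a (s k) \<le> inverse (real (Suc k))" "b (s k) \<le> inverse (real (Suc k))" by (auto intro: power2_le_imp_le)
      then show ?thesis by linarith
    qed
    have "(\<lambda>k. 2 * inverse (real (Suc k))) \<longlonglongrightarrow> 2 * 0" by (intro tendsto_mult tendsto_const LIMSEQ_inverse_real_of_nat)
    then have lim: "(\<lambda>k. 2 * inverse (real (Suc k))) \<longlonglongrightarrow> 0" by simp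
    have "(\<lambda>k. a (s k) + b (s k)) \<longlonglongrightarrow> 0"
      by (rule tendsto_sandwich[OF _ _ tendsto_const lim]) (intro always_eventually allI le add_nonneg_nonneg nn s(1))+
    then show "\<exists>s. (\<forall>k. s k \<in> D) \<and> (\<lambda>k::nat. a (s k) + b (s k)) \<longlonglongrightarrow> 0" using s(1) by blast
  qed
  then show ?thesis using True by (simp add: has_grad_def a_def[symmetric] b_def[symmetric] E cong: bex_cong)
qed (auto simp: has_grad_def)

lemma S1_meas:
  assumes "u \<in> S1 M V" shows "meas_section_on M V UNIV u" "meas_form M V (conn V u)"
  using assms by (auto simp: S1_def L2_sections_def L2_forms_def)

end

section \<open>Connections\<close>

locale riem_connection = riem_bundle M V for M :: "('m::{t2_space,second_countable_topology}, 'n::finite) riem_mfd"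
    and V :: "('m, 'n, 'w::real_vector) vbundle" +
  assumes connection: "connection M V" and compatible: "metric_compatible M V"
begin

lemma smooth_form_conn: "smooth_section M V u \<Longrightarrow> smooth_form M V (conn V u)"
  using connection by (simp add: connection_def)

lemma conn_scale:
  "smooth_fun_on M UNIV f \<Longrightarrow> smooth_section M V u \<Longrightarrow>
    conn V (\<lambda>y. f y *\<^sub>R u y) x X = differential M f x X *\<^sub>R u x + f x *\<^sub>R conn V u x X"
  using connection by (simp add: connection_def)

text \<open>For a bump \<theta> that vanishes outside \<open>W\<close> and is 1 at \<open>x\<close>,
  the Leibniz rule gives \<nabla>(\<theta>u) = \<nabla>u at \<open>x\<close>, as u vanishes there.
  But \<theta>u is the zero section; written as 0 times u, it has derivative 0 by the Leibniz rule
  again.\<close>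

lemma conn_local:
  assumes u: "smooth_section M V u" and W: "open W" "x \<in> W" "\<And>y. y \<in> W \<Longrightarrow> u y = 0"
  shows "conn V u x X = 0"
proof -
  let ?c = "chart_at M x"
  note c = chart_at[of x]
  obtain R where R: "0 < R" "cball (snd ?c x) R \<subseteq> snd ?c ` (W \<inter> fst ?c)" using chart_cball[OF c W(1,2)] by metis
  have R2: "0 < R / 2" "R / 2 < R" using R(1) by auto
  have sub: "cball (snd ?c x) R \<subseteq> snd ?c ` fst ?c" using R(2) by blast
  obtain \<theta> where \<theta>: "smooth_fun_on M UNIV \<theta>" "\<And>y. y \<in> chart_inv ?c ` cball (snd ?c x) (R / 2) \<Longrightarrow> \<theta> y = 1"
    "\<And>y. y \<notin> chart_inv ?c ` cball (snd ?c x) R \<Longrightarrow> \<theta> y = 0"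
    by (rule smooth_bump[OF c(1) R2 sub]) blast
  have "x = chart_inv ?c (snd ?c x)" using chart_inv_chart[OF c] by simp
  then have x1: "\<theta> x = 1" using R2(1) by (intro \<theta>(2)) (auto intro!: image_eqI)
  have z: "\<theta> y *\<^sub>R u y = 0 *\<^sub>R u y" for y
  proof (cases "y \<in> chart_inv ?c ` cball (snd ?c x) R")
    case True
    then obtain p where p: "p \<in> cball (snd ?c x) R" "y = chart_inv ?c p" by blast
    then obtain w where "w \<in> W" "w \<in> fst ?c" "p = snd ?c w" using R(2) by blast
    then have "y = w" using p(2) chart_inv_chart[OF c(1)] by simp
    then show ?thesis using W(3) \<open>w \<in> W\<close> by simp
  qed (simp add: \<theta>(3))
  have "conn V u x X = conn V (\<lambda>y. \<theta> y *\<^sub>R u y) x X"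
    using conn_scale[OF \<theta>(1) u] x1 W(3)[OF W(2)] by simp
  also have "\<dots> = conn V (\<lambda>y. 0 *\<^sub>R u y) x X" unfolding z ..
  also have "\<dots> = 0" by (subst conn_scale[OF smooth_fun_on_const u]) (simp add: differential_const)
  finally show ?thesis .
qed

text \<open>Outside \<open>K\<close> the section vanishes and, by locality, so does its derivative.
  On \<open>K\<close> the density is bounded, and \<open>K\<close> has finite volume.\<close>

lemma smooth_compact_support_S1:
  assumes u: "smooth_section M V u" and K: "compact K" "\<And>x. x \<notin> K \<Longrightarrow> u x = 0"
  shows "u \<in> S1 M V"
proof -
  let ?g = "\<lambda>x. sect_sq V u x + form_sq M V (conn V u) x"
  note sf = smooth_form_conn[OF u]
  have m: "meas_section_on M V UNIV u" "meas_form M V (conn V u)"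
    by (auto intro: smooth_imp_meas_section smooth_imp_meas_form u sf)
  have "continuous_on K ?g"
    by (rule continuous_on_subset[OF continuous_on_add[OF continuous_on_sect_sq[OF u] continuous_on_form_sq[OF sf]] subset_UNIV])
  from compact_imp_bounded[OF compact_continuous_image[OF this K(1)]]
  obtain C where C: "\<And>x. x \<in> K \<Longrightarrow> \<bar>?g x\<bar> \<le> C" by (auto simp: bounded_iff)
  have z: "?g x = 0" if "x \<notin> K" for x
  proof -
    have "conn V u x X = 0" for X
      by (rule conn_local[OF u open_Compl[OF compact_imp_closed[OF K(1)]]]) (use that K(2) in auto)
    then show ?thesis using K(2)[OF that] form_sq_scale[of x "conn V u" "\<lambda>_. 0"] smooth_formD(1)[OF sf, of x]
        sect_sq_scale[of u x "\<lambda>_. 0"] smooth_section_onD(1)[OF u, of x]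
      by (simp add: sect_sq_def form_sq_def)
  qed
  have "energy u (conn V u) \<le> (\<integral>\<^sup>+x. ennreal C * indicator K x \<partial>vol M)"
    unfolding energy_def
  proof (rule nn_integral_mono)
    fix x show "ennreal (?g x) \<le> ennreal C * indicator K x"
      using C[of x] z[of x] by (cases "x \<in> K") (auto intro!: ennreal_leI)
  qed
  also have "\<dots> = ennreal C * emeasure (vol M) K"
    using compact_imp_closed[OF K(1)] by (subst nn_integral_cmult_indicator) auto
  also have "\<dots> < \<infinity>" using emeasure_vol_compact[OF K(1)] by (simp add: ennreal_mult_less_top)
  finally have "u \<in> L2_sections M V \<and> conn V u \<in> L2_forms M V" using energy_finite_iff[OF m] by blast
  then show ?thesis using u sf by (simp add: S1_def)
qed

lemma Ccinf_subset_S1: "Ccinf M V \<subseteq> S1 M V"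
proof
  fix u assume "u \<in> Ccinf M V"
  then have u: "smooth_section M V u" "compact (closure {x. u x \<noteq> 0})" by (auto simp: Ccinf_def)
  show "u \<in> S1 M V"
  proof (rule smooth_compact_support_S1[OF u])
    fix x assume "x \<notin> closure {x. u x \<noteq> 0}"
    then show "u x = 0" using closure_subset[of "{x. u x \<noteq> 0}"] by blast
  qed
qed

text \<open>Compatibility gives d|u|^2 = 2 h(\<nabla>u, u), to which Cauchy-Schwarz is applied for
  each vector of an orthonormal frame.\<close>

lemma grad_sq_sect_sq_le:
  assumes u: "smooth_section M V u"
  shows "grad_sq (differential M (sect_sq V u)) x \<le> 4 * sect_sq V u x * form_sq M V (conn V u) x"
proof -
  note sf = smooth_formD(1)[OF smooth_form_conn[OF u], of x]
  have sm: "smooth_fun_on M UNIV (sect_sq V u)"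
    unfolding sect_sq_def[abs_def] by (rule smooth_fmetric_sections[OF open_UNIV u u])
  have ux: "u x \<in> fibre V x" using smooth_section_onD(1)[OF u] by simp
  obtain e :: "'n \<Rightarrow> real^'n" where e0: "\<And>i j. rmetric M x (e i) (e j) = (if i = j then 1 else 0)" and e:
    "\<And>\<alpha>. form_at x (\<alpha> x) \<Longrightarrow> form_sq M V \<alpha> x = (\<Sum>k\<in>UNIV. fmetric V x (\<alpha> x (e k)) (\<alpha> x (e k)))"
    by (rule form_sq_basis[of x]) blast
  have "grad_sq (differential M (sect_sq V u)) x = (\<Sum>k\<in>UNIV. (differential M (sect_sq V u) x (e k))\<^sup>2)"
    using grad_sq_orthonormal[OF e0 linear_differential[OF open_UNIV sm UNIV_I]] by simp
  also have "\<dots> \<le> (\<Sum>k\<in>UNIV. 4 * sect_sq V u x * fmetric V x (conn V u x (e k)) (conn V u x (e k)))"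
  proof (rule sum_mono)
    fix k
    have fb: "conn V u x (e k) \<in> fibre V x" using form_atD[OF sf] .
    have "differential M (sect_sq V u) x (e k) = 2 * fmetric V x (conn V u x (e k)) (u x)"
      using compatible u inner_product_on_sym[OF inner_product_fmetric fb ux]
      by (simp add: metric_compatible_def sect_sq_def[abs_def])
    then have "(differential M (sect_sq V u) x (e k))\<^sup>2 = 4 * (fmetric V x (conn V u x (e k)) (u x))\<^sup>2" by simp
    also have "\<dots> \<le> 4 * (fmetric V x (conn V u x (e k)) (conn V u x (e k)) * fmetric V x (u x) (u x))"
      using inner_product_on_cauchy_schwarz[OF inner_product_fmetric subspace_fibre fb ux] by simp
    finally show "(differential M (sect_sq V u) x (e k))\<^sup>2 \<le> 4 * sect_sq V u x * fmetric V x (conn V u x (e k)) (conn V u x (e k))"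
      by (simp add: sect_sq_def mult_ac)
  qed
  also have "\<dots> = 4 * sect_sq V u x * form_sq M V (conn V u) x"
    using e[of "conn V u", OF sf] by (simp add: sum_distrib_left)
  finally show ?thesis .
qed

lemma form_at_conn: "smooth_section M V u \<Longrightarrow> form_at x (conn V u x)"
  by (rule smooth_formD(1)[OF smooth_form_conn])

text \<open>Smoothness provides measurability, and the triangle inequality with \<open>u\<close> in
  the middle bounds the energy.\<close>

lemma S1_approx:
  assumes u: "u \<in> S1 M V" and w: "smooth_section M V w"
    and e: "energy (\<lambda>x. w x - u x) (\<lambda>x X. conn V w x X - conn V u x X) < \<infinity>"
  shows "w \<in> S1 M V"
proof -
  have m: "meas_section_on M V UNIV w" "meas_form M V (conn V w)"
    by (auto intro: smooth_imp_meas_section smooth_imp_meas_form w smooth_form_conn)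
  have z: "meas_section_on M V UNIV (\<lambda>x. 0)" "meas_form M V (\<lambda>x X. 0)"
    using meas_section_diff[OF m(1) m(1)] meas_form_diff[OF m(2) m(2)] by simp_all
  have fu: "energy u (conn V u) < \<infinity>"
    using energy_finite_iff[OF S1_meas[OF u]] u by (simp add: S1_def)
  have "energy w (conn V w) \<le> 2 * energy (\<lambda>x. w x - u x) (\<lambda>x X. conn V w x X - conn V u x X) + 2 * energy u (conn V u)"
    using energy_triangle[OF m(1) S1_meas(1)[OF u] z(1) m(2) S1_meas(2)[OF u] z(2)] by simp
  also have "\<dots> < \<infinity>" using e fu by (simp add: ennreal_mult_less_top)
  finally have "w \<in> L2_sections M V \<and> conn V w \<in> L2_forms M V" using energy_finite_iff[OF m] by blast
  then show ?thesis using w smooth_form_conn[OF w] by (simp add: S1_def)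
qed

text \<open>The truncations \<open>u / (1 + \<bar>u\<bar>\<^sup>2 / k)\<close> are bounded. With \<open>\<tau> = k / (k + \<bar>u\<bar>\<^sup>2)\<close> the term
  \<open>d\<tau> \<otimes> u\<close> in their derivative is at most \<open>2 (1 - \<tau>) \<bar>\<nabla>u\<bar>\<close> by compatibility of the connection with the metric.\<close>

lemma bounded_approximation:
  assumes u: "u \<in> S1 M V" and e: "0 < e"
  shows "\<exists>w\<in>S1 M V. (\<exists>B. \<forall>x. sect_sq V w x \<le> B) \<and>
    energy (\<lambda>x. w x - u x) (\<lambda>x X. conn V w x X - conn V u x X) < e"
proof -
  have us: "smooth_section M V u" using u by (simp add: S1_def)
  define r where "r = sect_sq V u"
  \<comment> \<open>\<open>Suc k\<close> in place of \<open>k\<close> keeps the denominator positive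
    where u vanishes.\<close>
  define \<tau> where "\<tau> k x = real (Suc k) * inverse (real (Suc k) + r x)" for k x
  define w where "w k x = \<tau> k x *\<^sub>R u x" for k x
  let ?g = "\<lambda>x. sect_sq V u x + form_sq M V (conn V u) x"
  have ux: "u x \<in> fibre V x" for x using smooth_section_onD(1)[OF us] by simp
  have r: "0 \<le> r x" for x unfolding r_def by (rule sect_sq_nonneg[OF ux])
  have rs: "smooth_fun_on M UNIV r"
    unfolding r_def sect_sq_def[abs_def] by (rule smooth_fmetric_sections[OF open_UNIV us us])
  have p: "0 < real (Suc k) + r x" for k x using r[of x] by simp
  have \<tau>01: "0 \<le> \<tau> k x" "\<tau> k x \<le> 1" for k x
    using p[of k x] r[of x] unfolding \<tau>_def by (simp_all add: field_simps)
  have \<tau>s: "smooth_fun_on M UNIV (\<tau> k)" for k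
    unfolding \<tau>_def[abs_def]
    by (intro smooth_fun_on_mult smooth_fun_on_const open_UNIV
        smooth_fun_on_compose[OF open_UNIV smooth_fun_on_add[OF open_UNIV smooth_fun_on_const rs] smooth_on_inverse])
      (use p[of k] in \<open>auto simp: less_imp_neq\<close>)
  have ws: "smooth_section M V (w k)" for k
    unfolding w_def[abs_def] by (rule smooth_section_scale[OF open_UNIV \<tau>s us])
  have d\<tau>: "differential M (\<tau> k) x X = - ((\<tau> k x)\<^sup>2 / real (Suc k)) * differential M r x X" for k x X
  proof -
    have "((\<lambda>t. real (Suc k) * inverse (real (Suc k) + t)) has_real_derivative
        - (real (Suc k) * inverse ((real (Suc k) + r x)\<^sup>2))) (at (r x))"
      using p[of k x] by (auto intro!: derivative_eq_intros simp: power2_eq_square)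
    moreover have "- (real (Suc k) * inverse ((real (Suc k) + r x)\<^sup>2)) = - ((\<tau> k x)\<^sup>2 / real (Suc k))"
    proof -
      have "a * inverse (b\<^sup>2) = (a * inverse b)\<^sup>2 / a" if "0 < a" for a b :: real
        using that by (simp add: field_simps power2_eq_square)
      then show ?thesis unfolding \<tau>_def by simp
    qed
    ultimately have "((\<lambda>t. real (Suc k) * inverse (real (Suc k) + t)) has_real_derivative - ((\<tau> k x)\<^sup>2 / real (Suc k))) (at (r x))"
      by simp
    from differential_compose[OF open_UNIV rs UNIV_I this] show ?thesis unfolding \<tau>_def[abs_def] .
  qed
  \<comment> \<open>The derivatives differ by d\<tau> \<otimes> u - (1 - \<tau>) \<nabla>u. The two
    terms contribute 2 times 4 and 2 times 1 multiples of (1 - \<tau>)^2 |\<nabla>u|^2, which makes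
    10.\<close>
  have le: "sect_sq V (\<lambda>x. w k x - u x) x + form_sq M V (\<lambda>x X. conn V (w k) x X - conn V u x X) x \<le> 10 * ((1 - \<tau> k x)\<^sup>2 * ?g x)" for k x
  proof -
    let ?q = "1 - \<tau> k x" and ?F = "form_sq M V (conn V u) x"
    have F: "0 \<le> ?F" by (rule form_sq_nonneg[OF form_at_conn[OF us]])
    have "(\<lambda>y. w k y - u y) = (\<lambda>y. (\<tau> k y - 1) *\<^sub>R u y)" by (simp add: w_def algebra_simps)
    then have 1: "sect_sq V (\<lambda>x. w k x - u x) x = ?q\<^sup>2 * r x"
      using sect_sq_scale[of u x "\<lambda>y. \<tau> k y - 1"] ux by (simp add: r_def power2_commute)
    have lin: "linear (differential M (\<tau> k) y)" for y by (rule linear_differential[OF open_UNIV \<tau>s UNIV_I])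
    have f1: "form_at y (\<lambda>X. differential M (\<tau> k) y X *\<^sub>R u y)" for y by (rule form_at_tensor[OF lin ux])
    have f2: "form_at y (\<lambda>X. (1 - \<tau> k y) *\<^sub>R conn V u y X)" for y
      using form_at_lincomb[OF form_at_conn[OF us, of y] form_at_conn[OF us, of y], of "1 - \<tau> k y" 0] by simp
    have "(\<lambda>y X. conn V (w k) y X - conn V u y X) =
        (\<lambda>y X. differential M (\<tau> k) y X *\<^sub>R u y - (1 - \<tau> k y) *\<^sub>R conn V u y X)"
      unfolding w_def[abs_def] by (simp add: conn_scale[OF \<tau>s us] algebra_simps)
    then have "form_sq M V (\<lambda>x X. conn V (w k) x X - conn V u x X) x \<le>
        2 * form_sq M V (\<lambda>y X. differential M (\<tau> k) y X *\<^sub>R u y) x + 2 * form_sq M V (\<lambda>y X. (1 - \<tau> k y) *\<^sub>R conn V u y X) x"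
      using form_sq_diff_le[of x "\<lambda>y X. differential M (\<tau> k) y X *\<^sub>R u y" "\<lambda>y X. (1 - \<tau> k y) *\<^sub>R conn V u y X"] f1 f2 by simp
    also have "form_sq M V (\<lambda>y X. (1 - \<tau> k y) *\<^sub>R conn V u y X) x = ?q\<^sup>2 * ?F"
      by (rule form_sq_scale[OF form_at_conn[OF us]])
    also have "form_sq M V (\<lambda>y X. differential M (\<tau> k) y X *\<^sub>R u y) x = grad_sq (differential M (\<tau> k)) x * r x"
      unfolding r_def by (rule form_sq_tensor[OF lin ux])
    also have "\<dots> \<le> 4 * (?q\<^sup>2 * ?F)"
    proof -
      have "grad_sq (differential M (\<tau> k)) x = ((\<tau> k x)\<^sup>2 / real (Suc k))\<^sup>2 * grad_sq (differential M r) x"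
      proof -
        have "differential M (\<tau> k) = (\<lambda>x X. (- ((\<tau> k x)\<^sup>2 / real (Suc k))) *\<^sub>R differential M r x X)"
          by (intro ext) (simp add: d\<tau>)
        then show ?thesis
          using scalar.form_sq_scale[of x "differential M r" "\<lambda>x. - ((\<tau> k x)\<^sup>2 / real (Suc k))"]
            linear_differential[OF open_UNIV rs UNIV_I, of x] by (simp add: scalar_form_at)
      qed
      also have "\<dots> \<le> ((\<tau> k x)\<^sup>2 / real (Suc k))\<^sup>2 * (4 * r x * ?F)"
        using grad_sq_sect_sq_le[OF us, of x] by (intro mult_left_mono) (auto simp: r_def)
      finally have "grad_sq (differential M (\<tau> k)) x * r x \<le> ((\<tau> k x)\<^sup>2 / real (Suc k))\<^sup>2 * (4 * r x * ?F) * r x"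
        using r[of x] by (rule mult_right_mono)
      \<comment> \<open>The powers of r = |u|^2 are absorbed into factors \<tau> r / (k + 1) = 1 -
        \<tau>; so the bound stays integrable although r is unbounded.\<close>
      also have "\<dots> = 4 * (\<tau> k x)\<^sup>2 * (\<tau> k x * r x / real (Suc k))\<^sup>2 * ?F"
        by (simp add: power2_eq_square)
      also have "\<tau> k x * r x / real (Suc k) = ?q"
      proof -
        have "a * b * s / a = 1 - a * b" if "0 < a" "(a + s) * b = 1" for a b s :: real
          using that by (simp add: algebra_simps)
        from this[of "real (Suc k)" "r x" "inverse (real (Suc k) + r x)"] p[of k x] show ?thesis unfolding \<tau>_def by simp
      qed
      also have "4 * (\<tau> k x)\<^sup>2 * ?q\<^sup>2 * ?F \<le> 4 * 1 * ?q\<^sup>2 * ?F"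
        using \<tau>01[of k x] F by (intro mult_right_mono mult_left_mono) (auto simp: power_le_one)
      finally show ?thesis by simp
    qed
    finally have 2: "form_sq M V (\<lambda>x X. conn V (w k) x X - conn V u x X) x \<le> 10 * (?q\<^sup>2 * ?F)" by linarith
    have "?q\<^sup>2 * r x \<le> 10 * (?q\<^sup>2 * r x)" using r[of x] by simp
    then show ?thesis using 1 2 by (simp add: r_def algebra_simps)
  qed
  have gm: "?g \<in> borel_measurable borel"
    by (intro borel_measurable_add meas_sect_sq meas_form_sq S1_meas u)
  have g0: "0 \<le> ?g x" for x by (intro add_nonneg_nonneg sect_sq_nonneg form_sq_nonneg ux form_at_conn us)
  have gi: "(\<integral>\<^sup>+x. ennreal (?g x) \<partial>vol M) < \<infinity>"
    using energy_finite_iff[OF S1_meas[OF u]] u unfolding energy_def by (simp add: S1_def)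
  have e10: "0 < e / 10" using e by (simp add: ennreal_divide_eq_0_iff zero_less_iff_neq_zero)
  have "\<forall>\<^sub>F k in sequentially. (\<integral>\<^sup>+x. ennreal ((1 - \<tau> k x)\<^sup>2 * ?g x) \<partial>vol M) < e / 10"
  proof (rule weighted_integral_small[OF _ _ _ _ gm g0 gi e10])
    show "(\<lambda>x. (1 - \<tau> k x)\<^sup>2) \<in> borel_measurable borel" for k
      using smooth_fun_on_measurable[OF open_UNIV \<tau>s] by simp
    show "0 \<le> (1 - \<tau> k x)\<^sup>2" for k x by simp
    show "(1 - \<tau> k x)\<^sup>2 \<le> 1" for k x using \<tau>01[of k x] by (intro power_le_one) auto
    show "(\<lambda>k. (1 - \<tau> k x)\<^sup>2) \<longlonglongrightarrow> 0" for x
    proof -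
      have "1 - \<tau> k x = r x * inverse (real (Suc k) + r x)" for k using p[of k x] unfolding \<tau>_def by (simp add: field_simps)
      moreover have "(\<lambda>k. inverse (real (Suc k) + r x)) \<longlonglongrightarrow> 0"
      proof (rule tendsto_sandwich[OF _ _ tendsto_const LIMSEQ_inverse_real_of_nat])
        show "\<forall>\<^sub>F k in sequentially. 0 \<le> inverse (real (Suc k) + r x)" using p[of _ x] by (intro always_eventually allI) (simp add: less_imp_le)
        show "\<forall>\<^sub>F k in sequentially. inverse (real (Suc k) + r x) \<le> inverse (real (Suc k))"
          using r[of x] by (intro always_eventually allI le_imp_inverse_le) auto
      qed
      ultimately have "(\<lambda>k. 1 - \<tau> k x) \<longlonglongrightarrow> r x * 0" by (simp only:) (intro tendsto_mult tendsto_const)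
      then have "(\<lambda>k. (1 - \<tau> k x)\<^sup>2) \<longlonglongrightarrow> (r x * 0)\<^sup>2" by (rule tendsto_power)
      then show ?thesis by simp
    qed
  qed
  then obtain k where k: "(\<integral>\<^sup>+x. ennreal ((1 - \<tau> k x)\<^sup>2 * ?g x) \<partial>vol M) < e / 10" by (auto simp: eventually_sequentially)
  have hm: "(\<lambda>x. ennreal ((1 - \<tau> k x)\<^sup>2 * ?g x)) \<in> borel_measurable (vol M)"
    using smooth_fun_on_measurable[OF open_UNIV \<tau>s] gm by simp
  have "energy (\<lambda>x. w k x - u x) (\<lambda>x X. conn V (w k) x X - conn V u x X) \<le> (\<integral>\<^sup>+x. 10 * ennreal ((1 - \<tau> k x)\<^sup>2 * ?g x) \<partial>vol M)"
    unfolding energy_def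
  proof (rule nn_integral_mono)
    fix x
    show "ennreal (sect_sq V (\<lambda>x. w k x - u x) x + form_sq M V (\<lambda>x X. conn V (w k) x X - conn V u x X) x) \<le> 10 * ennreal ((1 - \<tau> k x)\<^sup>2 * ?g x)"
      using ennreal_leI[OF le[of k x]] by (simp only: ennreal_mult'' ennreal_numeral zero_le_numeral ennreal_mult' )
  qed
  also have "\<dots> = 10 * (\<integral>\<^sup>+x. ennreal ((1 - \<tau> k x)\<^sup>2 * ?g x) \<partial>vol M)" by (rule nn_integral_cmult[OF hm])
  also have "\<dots> < e" by (rule scaled_less[OF _ _ k]) auto
  finally have E: "energy (\<lambda>x. w k x - u x) (\<lambda>x X. conn V (w k) x X - conn V u x X) < e" .
  have "w k \<in> S1 M V" by (rule S1_approx[OF u ws less_le_trans[OF E]]) simp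
  moreover have "sect_sq V (w k) x \<le> real (Suc k)" for x
  proof -
    have "sect_sq V (w k) x = \<tau> k x * (\<tau> k x * r x)" unfolding w_def[abs_def] sect_sq_scale[OF ux] r_def by (simp add: power2_eq_square)
    also have "\<dots> \<le> 1 * real (Suc k)"
    proof (rule mult_mono)
      show "\<tau> k x * r x \<le> real (Suc k)" using p[of k x] r[of x] unfolding \<tau>_def by (simp add: field_simps)
    qed (use \<tau>01[of k x] r[of x] in auto)
    finally show ?thesis by simp
  qed
  ultimately show ?thesis using E by blast
qed

end

section \<open>Approximation by sections with compact support\<close>

context riem
begin

lemma scalar_L2_meas:
  assumes "f \<in> L2_sections M (scalar_bundle M)" shows "f \<in> borel_measurable borel"
proof -
  have "f \<in> borel_measurable (restrict_space borel UNIV)" using assms by (simp add: L2_sections_def scalar_meas_section)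
  then show ?thesis by simp
qed

lemma polar_test_function:
  assumes "polar M \<Sigma>" "0 < e"
  obtains \<Omega> f a where "open_in_completion M \<Omega>" "\<Sigma> \<subseteq> \<Omega>" "has_grad M (scalar_bundle M) (S1 M (scalar_bundle M)) f a"
    "AE x in vol M. 0 \<le> f x \<and> f x \<le> 1" "AE x in vol M. embed M x \<in> \<Omega> \<longrightarrow> f x = 1" "scalar.energy f a < e"
proof -
  have "cap M \<Sigma> < e" using assms by (simp add: polar_def)
  then obtain \<Omega> where \<Omega>: "open_in_completion M \<Omega>" "\<Sigma> \<subseteq> \<Omega>" "cap_open M \<Omega> < e"
    unfolding cap_def by (auto simp: INF_less_iff)
  show ?thesis
  proof (cases "\<Omega> = {}")
    \<comment> \<open>The empty set has capacity 0 by convention, without any test function; the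
      zero function takes this role.\<close>
    case True
    let ?z = "\<lambda>x::'m. 0::real" and ?d = "\<lambda>(x::'m) (X::real^'n). 0::real"
    have d: "differential M ?z = ?d" by (intro ext) (simp add: differential_const)
    have sf: "smooth_form M (scalar_bundle M) ?d"
      using smooth_form_differential[OF smooth_fun_on_const[of UNIV 0]] unfolding d .
    have E: "scalar.energy ?z ?d = 0" by (simp add: scalar.energy_def sect_sq_def form_sq_def)
    have m: "meas_section_on M (scalar_bundle M) UNIV ?z" "meas_form M (scalar_bundle M) ?d"
      using scalar.smooth_imp_meas_form[OF sf] by (auto simp: scalar_meas_section)
    have L: "?z \<in> L2_sections M (scalar_bundle M)" "?d \<in> L2_forms M (scalar_bundle M)"
      using scalar.energy_finite_iff[OF m] E by auto
    have S: "?z \<in> S1 M (scalar_bundle M)"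
      using L sf d by (simp add: S1_def scalar_smooth_section smooth_fun_on_const)
    have "has_grad M (scalar_bundle M) (S1 M (scalar_bundle M)) ?z ?d"
      unfolding scalar.has_grad_iff[OF order_refl]
      by (intro conjI L allI impI bexI[OF _ S]) (simp add: d E)
    then show ?thesis by (rule that[OF \<Omega>(1,2)]) (use True E assms(2) in auto)
  next
    case False
    then obtain f a where f: "f \<in> test_funs M \<Omega>" "has_grad M (scalar_bundle M) (S1 M (scalar_bundle M)) f a"
      "ennreal (\<integral>x. (sect_sq (scalar_bundle M) f x + grad_sq a x) \<partial>vol M) < e"
      using \<Omega>(3) unfolding cap_open_def by (auto simp: Inf_less_iff)
    have "scalar.energy f a < e"
      using f(2,3) by (subst scalar.energy_eq_norms(2)) (auto simp: has_grad_def)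
    then show ?thesis by (intro that[OF \<Omega>(1,2) f(2)]) (use f(1) in \<open>auto simp: test_funs_def\<close>)
  qed
qed

text \<open>Finite unions along an enumerated cover increase, so a point once covered remains
  covered.\<close>

lemma compact_exhaustion:
  obtains K :: "nat \<Rightarrow> 'm set" where "\<And>j. compact (K j)" "\<And>x. \<forall>\<^sub>F j in sequentially. x \<in> K j"
proof -
  have "\<forall>x. \<exists>U K. open U \<and> compact K \<and> (x::'m) \<in> U \<and> U \<subseteq> K" using compact_neighbourhood by blast
  then obtain U L where UL: "\<And>x::'m. open (U x)" "\<And>x. compact (L x)" "\<And>x. x \<in> U x" "\<And>x. U x \<subseteq> L x" by metis
  have "\<And>W. W \<in> range U \<Longrightarrow> open W" using UL(1) by auto
  from Lindelof[OF this] obtain C where C: "C \<subseteq> range U" "countable C" "\<Union>C = \<Union>(range U)" by metis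
  then obtain X where X: "countable X" "C = U ` X" using countable_subset_image[of C U UNIV] by auto
  have cov: "\<exists>y\<in>X. x \<in> U y" for x using C(3) X(2) UL(3) by blast
  then have ne: "X \<noteq> {}" by blast
  show ?thesis
  proof (rule that)
    show "compact (\<Union>i\<le>j. L (from_nat_into X i))" for j :: nat by (intro compact_UN UL(2)) simp
    show "\<forall>\<^sub>F j in sequentially. x \<in> (\<Union>i\<le>j. L (from_nat_into X i))" for x
    proof -
      obtain y where y: "y \<in> X" "x \<in> U y" using cov by blast
      obtain i where "y = from_nat_into X i" using from_nat_into_surj[OF X(1) y(1)] by metis
      then have "x \<in> (\<Union>i\<le>j. L (from_nat_into X i))" if "i \<le> j" for j using that y(2) UL(4) by blast
      then show ?thesis by (auto simp: eventually_sequentially)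
    qed
  qed
qed

text \<open>Along an exhaustion by compact sets the cutoff functions tend to 1 pointwise, so the
  weighted integral becomes small by dominated convergence, while the gradients outside \<Omega>
  stay below a fixed bound.\<close>

lemma smooth_cutoff_weighted:
  assumes \<Omega>: "open_in_completion M \<Omega>" "cauchy_boundary M \<subseteq> \<Omega>" and c: "0 < c" and e: "0 < e"
    and g: "g \<in> borel_measurable borel" "\<And>x. 0 \<le> g x" "(\<integral>\<^sup>+x. ennreal (g x) \<partial>vol M) < \<infinity>"
  obtains \<phi> S where "smooth_fun_on M UNIV \<phi>" "compact S" "\<And>x. x \<notin> S \<Longrightarrow> \<phi> x = 0" "\<And>x. 0 \<le> \<phi> x" "\<And>x. \<phi> x \<le> 1"
    "(\<integral>\<^sup>+x. ennreal ((1 - \<phi> x)\<^sup>2 * g x) \<partial>vol M) < e"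
    "\<And>x. embed M x \<notin> \<Omega> \<Longrightarrow> grad_sq (differential M \<phi>) x \<le> c"
proof -
  let ?n = "real CARD('n)"
  obtain K :: "nat \<Rightarrow> 'm set" where K: "\<And>j. compact (K j)" "\<And>x. \<forall>\<^sub>F j in sequentially. x \<in> K j"
    by (rule compact_exhaustion) blast
  \<comment> \<open>The first entry yields \<open>grad_sq \<le> c\<close> in spite of the factor
    given by the dimension; the second forces convergence to 1.\<close>
  define d where "d j = min (sqrt (c / ?n)) (inverse (real (Suc j)))" for j
  define Q where "Q j \<phi> S \<longleftrightarrow> smooth_fun_on M UNIV \<phi> \<and> compact S \<and> (\<forall>x. x \<notin> S \<longrightarrow> \<phi> x = 0) \<and> (\<forall>x. 0 \<le> \<phi> x \<and> \<phi> x \<le> 1) \<and>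
    (\<forall>x\<in>K j. 1 - d j \<le> \<phi> x) \<and>
    (\<forall>x. embed M x \<notin> \<Omega> \<longrightarrow> (\<forall>X. \<bar>differential M \<phi> x X\<bar> \<le> d j * sqrt (rmetric M x X X)))" for j \<phi> S
  have d0: "0 < d j" for j using c by (simp add: d_def)
  have "\<exists>\<phi> S. Q j \<phi> S" for j unfolding Q_def by (rule smooth_cutoff[OF \<Omega> K(1) d0])
  then obtain \<phi> S where QS: "\<And>j. Q j (\<phi> j) (S j)" by metis
  then have \<phi>: "smooth_fun_on M UNIV (\<phi> j)" "compact (S j)" "x \<notin> S j \<Longrightarrow> \<phi> j x = 0" "0 \<le> \<phi> j x" "\<phi> j x \<le> 1"
    "x \<in> K j \<Longrightarrow> 1 - d j \<le> \<phi> j x" "embed M x \<notin> \<Omega> \<Longrightarrow> \<bar>differential M (\<phi> j) x X\<bar> \<le> d j * sqrt (rmetric M x X X)" for j x X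
    unfolding Q_def by blast+
  have "\<forall>\<^sub>F j in sequentially. (\<integral>\<^sup>+x. ennreal ((1 - \<phi> j x)\<^sup>2 * g x) \<partial>vol M) < e"
  proof (rule weighted_integral_small[OF _ _ _ _ g e])
    show "(\<lambda>x. (1 - \<phi> j x)\<^sup>2) \<in> borel_measurable borel" for j
      using scalar.smooth_fun_on_measurable[OF open_UNIV \<phi>(1)] by simp
    show "0 \<le> (1 - \<phi> j x)\<^sup>2" for j x by simp
    show "(1 - \<phi> j x)\<^sup>2 \<le> 1" for j x using \<phi>(4,5)[of j x] by (intro power_le_one) auto
    show "(\<lambda>j. (1 - \<phi> j x)\<^sup>2) \<longlonglongrightarrow> 0" for x
    proof -
      have "(\<lambda>j. 1 - \<phi> j x) \<longlonglongrightarrow> 0"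
      proof (rule tendsto_sandwich[OF _ _ tendsto_const LIMSEQ_inverse_real_of_nat])
        show "\<forall>\<^sub>F j in sequentially. 0 \<le> 1 - \<phi> j x" using \<phi>(5) by (intro always_eventually allI) simp
        show "\<forall>\<^sub>F j in sequentially. 1 - \<phi> j x \<le> inverse (real (Suc j))"
        proof (rule eventually_mono[OF K(2)[of x]])
          fix j assume "x \<in> K j"
          then have "1 - d j \<le> \<phi> j x" by (rule \<phi>(6))
          moreover have "d j \<le> inverse (real (Suc j))" unfolding d_def by (rule min.cobounded2)
          ultimately show "1 - \<phi> j x \<le> inverse (real (Suc j))" by linarith
        qed
      qed
      from tendsto_power[OF this, of 2] show ?thesis by simp
    qed
  qed
  then obtain j where j: "(\<integral>\<^sup>+x. ennreal ((1 - \<phi> j x)\<^sup>2 * g x) \<partial>vol M) < e" by (auto simp: eventually_sequentially)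
  show ?thesis
  proof (rule that[OF \<phi>(1)[of j] \<phi>(2)[of j] \<phi>(3)[of _ j] \<phi>(4)[of j] \<phi>(5)[of j] j])
    fix x assume x: "embed M x \<notin> \<Omega>"
    have "grad_sq (differential M (\<phi> j)) x \<le> ?n * (d j)\<^sup>2"
      by (rule grad_sq_le[where a="differential M (\<phi> j)"]) (rule linear_differential[OF open_UNIV \<phi>(1) UNIV_I], rule \<phi>(7)[OF x])
    also have "\<dots> \<le> ?n * (sqrt (c / ?n))\<^sup>2"
      using d0[of j] by (intro mult_left_mono power_mono) (auto simp: d_def)
    also have "\<dots> = c" using c by simp
    finally show "grad_sq (differential M (\<phi> j)) x \<le> c" .
  qed
qed

end

context riem_connection
begin

text \<open>The derivative that \<phi>(1 - f)u ought to have when f is only a Sobolev function with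
  gradient \<open>a\<close>. For smooth f it is the true derivative, by
  \<open>conn_cut\<close>.\<close>

definition cut_form :: "('m \<Rightarrow> real) \<Rightarrow> ('m \<Rightarrow> real) \<Rightarrow> ('m \<Rightarrow> real^'n \<Rightarrow> real) \<Rightarrow> ('m \<Rightarrow> 'w) \<Rightarrow> 'm \<Rightarrow> real^'n \<Rightarrow> 'w" where
  "cut_form \<phi> f a u x X =
    ((1 - f x) * differential M \<phi> x X - \<phi> x * a x X) *\<^sub>R u x + (\<phi> x * (1 - f x)) *\<^sub>R conn V u x X"

lemma conn_cut:
  assumes "smooth_fun_on M UNIV \<phi>" "smooth_fun_on M UNIV f" "smooth_section M V u"
  shows "conn V (\<lambda>x. (\<phi> x * (1 - f x)) *\<^sub>R u x) = cut_form \<phi> f (differential M f) u"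
proof (intro ext)
  fix x X
  have s: "smooth_fun_on M UNIV (\<lambda>x. 1 - f x)" by (intro smooth_fun_on_diff smooth_fun_on_const open_UNIV assms(2))
  show "conn V (\<lambda>x. (\<phi> x * (1 - f x)) *\<^sub>R u x) x X = cut_form \<phi> f (differential M f) u x X"
    by (simp add: conn_scale[OF smooth_fun_on_mult[OF open_UNIV assms(1) s] assms(3)] cut_form_def
        differential_mult[OF open_UNIV assms(1) s UNIV_I] differential_diff[OF open_UNIV smooth_fun_on_const assms(2) UNIV_I]
        differential_const mult.commute)
qed

lemma meas_cut:
  assumes "smooth_fun_on M UNIV \<phi>" "smooth_section M V u" "f \<in> borel_measurable borel" "meas_form M (scalar_bundle M) a"
  shows "meas_section_on M V UNIV (\<lambda>x. (\<phi> x * (1 - f x)) *\<^sub>R u x)" "meas_form M V (cut_form \<phi> f a u)"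
proof -
  have p: "\<phi> \<in> borel_measurable borel" using smooth_fun_on_measurable[OF open_UNIV assms(1)] by simp
  have u: "meas_section_on M V UNIV u" by (rule smooth_imp_meas_section[OF open_UNIV assms(2)])
  show "meas_section_on M V UNIV (\<lambda>x. (\<phi> x * (1 - f x)) *\<^sub>R u x)"
    using p assms(3) by (intro meas_section_scale u) auto
  have "meas_form M (scalar_bundle M) (\<lambda>x X. (1 - f x) *\<^sub>R differential M \<phi> x X + (- \<phi> x) *\<^sub>R a x X)"
    using p assms(3) by (intro scalar.meas_form_lincomb scalar.smooth_imp_meas_form smooth_form_differential assms) auto
  then have "meas_form M V (\<lambda>x X. ((1 - f x) *\<^sub>R differential M \<phi> x X + (- \<phi> x) *\<^sub>R a x X) *\<^sub>R u x)"
    by (rule meas_form_tensor[OF _ u])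
  from meas_form_lincomb[OF this smooth_imp_meas_form[OF smooth_form_conn[OF assms(2)]], of "\<lambda>_. 1" "\<lambda>x. \<phi> x * (1 - f x)"]
  show "meas_form M V (cut_form \<phi> f a u)" using p assms(3) by (simp add: cut_form_def[abs_def])
qed

text \<open>General coefficients \<open>s\<close>, \<open>t\<close>, \<open>r\<close> are kept
  because the estimate is used twice: to compare \<open>cut_form\<close> with \<nabla>u, and to
  compare the cut forms of two functions.\<close>

lemma form_sq_cut_le:
  assumes "linear (a x)" "linear (b x)" "smooth_section M V u"
  shows "form_sq M V (\<lambda>x X. (s x * a x X - t x * b x X) *\<^sub>R u x - r x *\<^sub>R conn V u x X) x \<le>
    4 * ((s x)\<^sup>2 * grad_sq a x + (t x)\<^sup>2 * grad_sq b x) * sect_sq V u x + 2 * (r x)\<^sup>2 * form_sq M V (conn V u) x"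
proof -
  have ux: "u x \<in> fibre V x" using smooth_section_onD(1)[OF assms(3)] by simp
  have fc: "form_at x (conn V u x)" by (rule form_at_conn[OF assms(3)])
  have l: "linear (\<lambda>X. s x * a x X - t x * b x X)" "linear (\<lambda>X. s x * a x X)" "linear (\<lambda>X. t x * b x X)"
    using assms(1,2) by (auto simp: linear_iff algebra_simps)
  have f2: "form_at x (\<lambda>X. r x *\<^sub>R conn V u x X)" using form_at_lincomb[OF fc fc, of "r x" 0] by simp
  have "form_sq M V (\<lambda>x X. (s x * a x X - t x * b x X) *\<^sub>R u x - r x *\<^sub>R conn V u x X) x \<le>
      2 * form_sq M V (\<lambda>x X. (s x * a x X - t x * b x X) *\<^sub>R u x) x + 2 * form_sq M V (\<lambda>x X. r x *\<^sub>R conn V u x X) x"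
    using form_sq_diff_le[of x "\<lambda>x X. (s x * a x X - t x * b x X) *\<^sub>R u x" "\<lambda>x X. r x *\<^sub>R conn V u x X"]
      form_at_tensor[OF l(1) ux] f2 by simp
  also have "form_sq M V (\<lambda>x X. (s x * a x X - t x * b x X) *\<^sub>R u x) x = grad_sq (\<lambda>x X. s x * a x X - t x * b x X) x * sect_sq V u x"
    by (rule form_sq_tensor[where a="\<lambda>x X. s x * a x X - t x * b x X" and u=u, OF l(1) ux])
  also have "form_sq M V (\<lambda>x X. r x *\<^sub>R conn V u x X) x = (r x)\<^sup>2 * form_sq M V (conn V u) x"
    by (rule form_sq_scale[where \<alpha>="conn V u" and f=r, OF fc])
  also have "2 * (grad_sq (\<lambda>x X. s x * a x X - t x * b x X) x * sect_sq V u x) \<le>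
      2 * (2 * ((s x)\<^sup>2 * grad_sq a x + (t x)\<^sup>2 * grad_sq b x) * sect_sq V u x)"
  proof (intro mult_left_mono mult_right_mono sect_sq_nonneg ux)
    show "grad_sq (\<lambda>x X. s x * a x X - t x * b x X) x \<le> 2 * ((s x)\<^sup>2 * grad_sq a x + (t x)\<^sup>2 * grad_sq b x)"
      using scalar.form_sq_diff_le[of x "\<lambda>x X. s x * a x X" "\<lambda>x X. t x * b x X"] l
        scalar.form_sq_scale[of x a s] scalar.form_sq_scale[of x b t] assms(1,2) by (simp add: scalar_form_at)
  qed simp
  finally show ?thesis by (simp add: algebra_simps)
qed

lemma sect_sq_scaled_diff:
  "smooth_section M V u \<Longrightarrow> sect_sq V (\<lambda>x. r x *\<^sub>R u x) x = (r x)\<^sup>2 * sect_sq V u x"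
  by (rule sect_sq_scale) (auto dest: smooth_section_onD(1))

text \<open>The deviation has three sources: the factor 1 - \<phi>(1 - f), which is at most (1 -
  \<phi>) + f; the gradient of \<phi>, which counts only through (1 - f) d\<phi>; and the gradient
  of f, which is multiplied by the bounded section.\<close>

lemma cut_density_le:
  assumes u: "smooth_section M V u" "\<And>x. sect_sq V u x \<le> B" and \<phi>: "smooth_fun_on M UNIV \<phi>" "0 \<le> \<phi> x" "\<phi> x \<le> 1"
    and a: "linear (a x)" and f: "0 \<le> f x" "f x \<le> 1" and c: "(1 - f x)\<^sup>2 * grad_sq (differential M \<phi>) x \<le> c"
    and g: "g x = sect_sq V u x + form_sq M V (conn V u) x"
  shows "sect_sq V (\<lambda>x. (\<phi> x * (1 - f x)) *\<^sub>R u x - u x) x + form_sq M V (\<lambda>x X. cut_form \<phi> f a u x X - conn V u x X) x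
    \<le> 4 * ((1 - \<phi> x)\<^sup>2 * g x) + 4 * c * g x + 4 * ((f x)\<^sup>2 * g x) + 4 * B * grad_sq a x"
proof -
  let ?q = "1 - \<phi> x * (1 - f x)" and ?U = "sect_sq V u x" and ?F = "form_sq M V (conn V u) x"
  have ux: "u x \<in> fibre V x" using smooth_section_onD(1)[OF u(1)] by simp
  have nn: "0 \<le> ?U" "0 \<le> ?F" "0 \<le> grad_sq (differential M \<phi>) x" "0 \<le> grad_sq a x"
    using linear_differential[OF open_UNIV \<phi>(1) UNIV_I, of x] a
    by (auto intro!: sect_sq_nonneg ux form_sq_nonneg form_at_conn u(1) scalar.form_sq_nonneg simp: scalar_form_at)
  have "(\<lambda>x. (\<phi> x * (1 - f x)) *\<^sub>R u x - u x) = (\<lambda>x. (\<phi> x * (1 - f x) - 1) *\<^sub>R u x)" by (simp add: algebra_simps)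
  then have 1: "sect_sq V (\<lambda>x. (\<phi> x * (1 - f x)) *\<^sub>R u x - u x) x = ?q\<^sup>2 * ?U"
    using sect_sq_scaled_diff[OF u(1), of "\<lambda>x. \<phi> x * (1 - f x) - 1" x] by (simp add: power2_commute)
  have "(\<lambda>x X. cut_form \<phi> f a u x X - conn V u x X) =
      (\<lambda>x X. ((1 - f x) * differential M \<phi> x X - \<phi> x * a x X) *\<^sub>R u x - (1 - \<phi> x * (1 - f x)) *\<^sub>R conn V u x X)"
    by (simp add: cut_form_def algebra_simps)
  then have 2: "form_sq M V (\<lambda>x X. cut_form \<phi> f a u x X - conn V u x X) x \<le>
      4 * ((1 - f x)\<^sup>2 * grad_sq (differential M \<phi>) x + (\<phi> x)\<^sup>2 * grad_sq a x) * ?U + 2 * ?q\<^sup>2 * ?F"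
    using form_sq_cut_le[of "differential M \<phi>" x a u "\<lambda>x. 1 - f x" \<phi> "\<lambda>x. 1 - \<phi> x * (1 - f x)"]
      linear_differential[OF open_UNIV \<phi>(1) UNIV_I, of x] a u(1) by simp
  have "\<bar>?q\<bar> \<le> (1 - \<phi> x) + f x"
  proof -
    have "?q = (1 - \<phi> x) * (1 - f x) + f x" by (simp add: algebra_simps)
    moreover have "0 \<le> (1 - \<phi> x) * (1 - f x)" "(1 - \<phi> x) * (1 - f x) \<le> 1 - \<phi> x"
      using \<phi>(2,3) f by (auto intro!: mult_nonneg_nonneg mult_right_le_one_le)
    ultimately show ?thesis using f by linarith
  qed
  then have "?q\<^sup>2 \<le> ((1 - \<phi> x) + f x)\<^sup>2" by (metis abs_le_square_iff abs_of_nonneg abs_ge_zero order_trans)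
  also have "\<dots> \<le> 2 * (1 - \<phi> x)\<^sup>2 + 2 * (f x)\<^sup>2"
    using sum_squares_bound[of "1 - \<phi> x" "f x"] by (simp add: power2_sum)
  finally have q: "?q\<^sup>2 * g x \<le> (2 * (1 - \<phi> x)\<^sup>2 + 2 * (f x)\<^sup>2) * g x" using nn g by (intro mult_right_mono) auto
  have t1: "(1 - f x)\<^sup>2 * grad_sq (differential M \<phi>) x * ?U \<le> c * g x"
    using c nn g by (intro mult_mono) (auto intro: order_trans[OF mult_nonneg_nonneg c])
  have t2: "(\<phi> x)\<^sup>2 * grad_sq a x * ?U \<le> 1 * grad_sq a x * B"
    using nn u(2)[of x] \<phi>(2,3) by (intro mult_mono) (auto simp: power_le_one)
  have t3: "?q\<^sup>2 * ?U + 2 * ?q\<^sup>2 * ?F \<le> 2 * (?q\<^sup>2 * g x)" using nn g by (simp add: algebra_simps)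
  have "sect_sq V (\<lambda>x. (\<phi> x * (1 - f x)) *\<^sub>R u x - u x) x + form_sq M V (\<lambda>x X. cut_form \<phi> f a u x X - conn V u x X) x
      \<le> 2 * (?q\<^sup>2 * g x) + 4 * ((1 - f x)\<^sup>2 * grad_sq (differential M \<phi>) x * ?U) + 4 * ((\<phi> x)\<^sup>2 * grad_sq a x * ?U)"
    using 1 2 t3 by (simp add: algebra_simps)
  also have "\<dots> \<le> 2 * ((2 * (1 - \<phi> x)\<^sup>2 + 2 * (f x)\<^sup>2) * g x) + 4 * (c * g x) + 4 * (1 * grad_sq a x * B)"
    using q t1 t2 by linarith
  finally show ?thesis by (simp add: algebra_simps)
qed

text \<open>For fixed \<phi> and u, the section \<phi>(1 - f)u is affine in f, with coefficients
  that are bounded because \<phi> has compact support. So it depends on f in a Lipschitz manner with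
  respect to the energy.\<close>

lemma cut_energy_le:
  assumes u: "smooth_section M V u" and \<phi>: "smooth_fun_on M UNIV \<phi>" "compact S" "\<And>x. x \<notin> S \<Longrightarrow> \<phi> x = 0"
    and f: "f \<in> borel_measurable borel" "meas_form M (scalar_bundle M) a"
  obtains C where "\<And>h. smooth_fun_on M UNIV h \<Longrightarrow>
    energy (\<lambda>x. (\<phi> x * (1 - h x)) *\<^sub>R u x - (\<phi> x * (1 - f x)) *\<^sub>R u x)
      (\<lambda>x X. cut_form \<phi> h (differential M h) u x X - cut_form \<phi> f a u x X)
    \<le> ennreal C * scalar.energy (\<lambda>x. h x - f x) (\<lambda>x X. differential M h x X - a x X)"
proof -
  let ?d = "differential M \<phi>"
  define U where "U = sect_sq V u"
  define F where "F = form_sq M V (conn V u)"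
  define D where "D = grad_sq ?d"
  \<comment> \<open>One majorant for the coefficients both of (h - f)^2 and of the squared gradient
    of h - f.\<close>
  define H where "H x = (\<phi> x)\<^sup>2 * U x + 4 * (D x + (\<phi> x)\<^sup>2) * U x + 2 * (\<phi> x)\<^sup>2 * F x" for x
  have ux: "u x \<in> fibre V x" for x using smooth_section_onD(1)[OF u] by simp
  have lin: "linear (?d x)" for x by (rule linear_differential[OF open_UNIV \<phi>(1) UNIV_I])
  have nn: "0 \<le> U x" "0 \<le> F x" "0 \<le> D x" for x unfolding U_def F_def D_def
    using lin[of x] by (auto intro!: sect_sq_nonneg ux form_sq_nonneg form_at_conn u(1) scalar.form_sq_nonneg simp: scalar_form_at)
  have "continuous_on UNIV H" unfolding H_def U_def F_def D_def
    by (intro continuous_intros continuous_on_sect_sq continuous_on_form_sq scalar.continuous_on_form_sq smooth_form_conn u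
        smooth_form_differential \<phi>(1) smooth_fun_on_continuous_on open_UNIV)
  then have "continuous_on S H" by (rule continuous_on_subset) simp
  from compact_imp_bounded[OF compact_continuous_image[OF this \<phi>(2)]]
  obtain C where C: "\<And>x. x \<in> S \<Longrightarrow> \<bar>H x\<bar> \<le> C" by (auto simp: bounded_iff)
  have HC: "H x \<le> \<bar>C\<bar>" for x
  proof (cases "x \<in> S")
    case False
    have "?d x = differential M (\<lambda>_. 0) x"
      by (rule differential_cong[OF open_Compl[OF compact_imp_closed[OF \<phi>(2)]]]) (use False \<phi>(3) in auto)
    then have "?d x = (\<lambda>X. 0)" by (simp add: differential_const fun_eq_iff)
    then have "D x = 0" by (simp add: D_def form_sq_def)
    then show ?thesis using \<phi>(3)[OF False] by (simp add: H_def)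
  qed (use C[of x] in auto)
  show ?thesis
  proof (rule that[of "\<bar>C\<bar>"])
    fix h assume h: "smooth_fun_on M UNIV h"
    let ?e = "\<lambda>x. sect_sq (scalar_bundle M) (\<lambda>x. h x - f x) x + grad_sq (\<lambda>x X. differential M h x X - a x X) x"
    have la: "linear (a x)" for x using scalar.meas_formD(1)[OF f(2), of x] by (simp add: scalar_form_at)
    have lh: "linear (differential M h x)" for x by (rule linear_differential[OF open_UNIV h UNIV_I])
    have lb: "linear (\<lambda>X. differential M h x X - a x X)" for x using la lh by (simp add: linear_iff algebra_simps)
    have le: "sect_sq V (\<lambda>x. (\<phi> x * (1 - h x)) *\<^sub>R u x - (\<phi> x * (1 - f x)) *\<^sub>R u x) x +
        form_sq M V (\<lambda>x X. cut_form \<phi> h (differential M h) u x X - cut_form \<phi> f a u x X) x \<le> \<bar>C\<bar> * ?e x" for x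
    proof -
      let ?k = "f x - h x" and ?A = "grad_sq (\<lambda>x X. differential M h x X - a x X) x"
      have A: "0 \<le> ?A" using lb[of x] by (intro scalar.form_sq_nonneg) (simp add: scalar_form_at)
      have "(\<lambda>x. (\<phi> x * (1 - h x)) *\<^sub>R u x - (\<phi> x * (1 - f x)) *\<^sub>R u x) = (\<lambda>x. (\<phi> x * (f x - h x)) *\<^sub>R u x)"
        by (simp add: algebra_simps)
      then have 1: "sect_sq V (\<lambda>x. (\<phi> x * (1 - h x)) *\<^sub>R u x - (\<phi> x * (1 - f x)) *\<^sub>R u x) x = (\<phi> x)\<^sup>2 * ?k\<^sup>2 * U x"
        using sect_sq_scaled_diff[OF u, of "\<lambda>x. \<phi> x * (f x - h x)" x] by (simp add: U_def power_mult_distrib)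
      have "(\<lambda>x X. cut_form \<phi> h (differential M h) u x X - cut_form \<phi> f a u x X) =
          (\<lambda>x X. ((f x - h x) * ?d x X - \<phi> x * (differential M h x X - a x X)) *\<^sub>R u x - (\<phi> x * (h x - f x)) *\<^sub>R conn V u x X)"
        by (simp add: cut_form_def algebra_simps)
      then have 2: "form_sq M V (\<lambda>x X. cut_form \<phi> h (differential M h) u x X - cut_form \<phi> f a u x X) x \<le>
          4 * (?k\<^sup>2 * D x + (\<phi> x)\<^sup>2 * ?A) * U x + 2 * (\<phi> x * (h x - f x))\<^sup>2 * F x"
        using form_sq_cut_le[of ?d x "\<lambda>x X. differential M h x X - a x X" u "\<lambda>x. f x - h x" \<phi> "\<lambda>x. \<phi> x * (h x - f x)"]
          lin lb u by (simp add: U_def F_def D_def)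
      have k: "(\<phi> x * (h x - f x))\<^sup>2 = (\<phi> x)\<^sup>2 * ?k\<^sup>2" by (simp add: power_mult_distrib power2_commute)
      have e: "?e x = ?k\<^sup>2 + ?A" by (simp add: scalar_sect_sq power2_commute)
      have "(\<phi> x)\<^sup>2 * ?k\<^sup>2 * U x + (4 * (?k\<^sup>2 * D x + (\<phi> x)\<^sup>2 * ?A) * U x + 2 * ((\<phi> x)\<^sup>2 * ?k\<^sup>2) * F x) =
          H x * (?k\<^sup>2 + ?A) - ((\<phi> x)\<^sup>2 * U x + 4 * D x * U x + 2 * (\<phi> x)\<^sup>2 * F x) * ?A - 4 * (\<phi> x)\<^sup>2 * U x * ?k\<^sup>2"
        by (simp add: H_def algebra_simps)
      also have "\<dots> \<le> H x * (?k\<^sup>2 + ?A)"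
      proof -
        have "0 \<le> ((\<phi> x)\<^sup>2 * U x + 4 * D x * U x + 2 * (\<phi> x)\<^sup>2 * F x) * ?A"
          using nn[of x] A by (intro mult_nonneg_nonneg add_nonneg_nonneg) auto
        moreover have "0 \<le> 4 * (\<phi> x)\<^sup>2 * U x * ?k\<^sup>2" using nn[of x] by (intro mult_nonneg_nonneg) auto
        ultimately show ?thesis by linarith
      qed
      also have "\<dots> \<le> \<bar>C\<bar> * (?k\<^sup>2 + ?A)" using HC[of x] A by (intro mult_right_mono) auto
      finally show ?thesis using 1 2 unfolding k e by linarith
    qed
    have m: "?e \<in> borel_measurable (vol M)"
    proof (intro meas_vol borel_measurable_add scalar.meas_sect_sq scalar.meas_form_sq scalar.meas_form_diff f(2)
        scalar.smooth_imp_meas_form smooth_form_differential h)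
      show "meas_section_on M (scalar_bundle M) UNIV (\<lambda>x. h x - f x)"
        using f(1) smooth_fun_on_measurable[OF open_UNIV h] by (simp add: scalar_meas_section)
    qed
    have "energy (\<lambda>x. (\<phi> x * (1 - h x)) *\<^sub>R u x - (\<phi> x * (1 - f x)) *\<^sub>R u x)
        (\<lambda>x X. cut_form \<phi> h (differential M h) u x X - cut_form \<phi> f a u x X) \<le> (\<integral>\<^sup>+x. ennreal \<bar>C\<bar> * ennreal (?e x) \<partial>vol M)"
      unfolding energy_def
    proof (rule nn_integral_mono)
      fix x
      show "ennreal (sect_sq V (\<lambda>x. (\<phi> x * (1 - h x)) *\<^sub>R u x - (\<phi> x * (1 - f x)) *\<^sub>R u x) x +
          form_sq M V (\<lambda>x X. cut_form \<phi> h (differential M h) u x X - cut_form \<phi> f a u x X) x) \<le> ennreal \<bar>C\<bar> * ennreal (?e x)"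
        using ennreal_leI[OF le[of x]] by (simp only: ennreal_mult' abs_ge_zero)
    qed
    also have "\<dots> = ennreal \<bar>C\<bar> * scalar.energy (\<lambda>x. h x - f x) (\<lambda>x X. differential M h x X - a x X)"
      unfolding scalar.energy_def using m by (subst nn_integral_cmult) auto
    finally show "energy (\<lambda>x. (\<phi> x * (1 - h x)) *\<^sub>R u x - (\<phi> x * (1 - f x)) *\<^sub>R u x)
        (\<lambda>x X. cut_form \<phi> h (differential M h) u x X - cut_form \<phi> f a u x X)
      \<le> ennreal \<bar>C\<bar> * scalar.energy (\<lambda>x. h x - f x) (\<lambda>x X. differential M h x X - a x X)" .
  qed
qed

end

context riem_connection
begin

section \<open>Density of the sections with compact support\<close>

lemma compact_support_approximation:
  assumes polar: "polar M (cauchy_boundary M)" and u: "u \<in> S1 M V" "\<And>x. sect_sq V u x \<le> B" and e: "0 < e"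
  shows "\<exists>s\<in>Ccinf M V. energy (\<lambda>x. s x - u x) (\<lambda>x X. conn V s x X - conn V u x X) \<le> ennreal e"
proof -
  have us: "smooth_section M V u" using u(1) by (simp add: S1_def)
  define g where "g x = sect_sq V u x + form_sq M V (conn V u) x" for x
  have ux: "u x \<in> fibre V x" for x using smooth_section_onD(1)[OF us] by simp
  have gm: "g \<in> borel_measurable borel"
    unfolding g_def by (intro borel_measurable_add meas_sect_sq meas_form_sq S1_meas u(1))
  have g0: "0 \<le> g x" for x unfolding g_def by (intro add_nonneg_nonneg sect_sq_nonneg form_sq_nonneg ux form_at_conn us)
  have gi: "(\<integral>\<^sup>+x. ennreal (g x) \<partial>vol M) < \<infinity>"
    using energy_finite_iff[OF S1_meas[OF u(1)]] u(1) unfolding energy_def g_def by (simp add: S1_def)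
  then obtain G where G: "0 \<le> G" "(\<integral>\<^sup>+x. ennreal (g x) \<partial>vol M) = ennreal G"
    by (cases "\<integral>\<^sup>+x. ennreal (g x) \<partial>vol M") auto
  \<comment> \<open>Cutting off with the original f costs four times 4d and smoothing f costs d;
    doubled by the triangle inequality this is 34d.\<close>
  define d where "d = e / 64"
  have d: "0 < d" using e by (simp add: d_def)
  \<comment> \<open>The indicator of the set where the density is large. There f^2 g is at most g,
    whose integral over this set is small; elsewhere f^2 g is at most k + 1 times f^2, which the
    energy of f controls.\<close>
  define h where "h k x = (indicator {x. real (Suc k) < g x} x :: real)" for k x
  have hm: "h k \<in> borel_measurable borel" for k unfolding h_def[abs_def] using gm by measurable
  have "\<forall>\<^sub>F k in sequentially. (\<integral>\<^sup>+x. ennreal (h k x * g x) \<partial>vol M) < ennreal d"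
  proof (rule weighted_integral_small[OF hm _ _ _ gm g0 gi])
    show "(\<lambda>k. h k x) \<longlonglongrightarrow> 0" for x
    proof (rule tendsto_eventually)
      obtain n where n: "g x < real n" using reals_Archimedean2 by blast
      show "\<forall>\<^sub>F k in sequentially. h k x = 0"
        using n by (intro eventually_sequentiallyI[of n]) (auto simp: h_def indicator_def)
    qed
  qed (use d in \<open>auto simp: h_def indicator_def\<close>)
  then obtain k where k: "(\<integral>\<^sup>+x. ennreal (h k x * g x) \<partial>vol M) < ennreal d" by (auto simp: eventually_sequentially)
  \<comment> \<open>Dominates both the level k + 1, which multiplies f^2, and the bound of |u|^2,
    which multiplies the squared gradient of f.\<close>
  define N where "N = real (Suc k) + \<bar>B\<bar>"
  have N: "0 < N" by (simp add: N_def)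
  have "0 < ennreal (d / N)" using d N by simp
  from polar_test_function[OF polar this] obtain \<Omega> f a where \<Omega>: "open_in_completion M \<Omega>" "cauchy_boundary M \<subseteq> \<Omega>"
    and f: "has_grad M (scalar_bundle M) (S1 M (scalar_bundle M)) f a" "AE x in vol M. 0 \<le> f x \<and> f x \<le> 1"
      "AE x in vol M. embed M x \<in> \<Omega> \<longrightarrow> f x = 1" "scalar.energy f a < ennreal (d / N)" by blast
  have fL: "f \<in> L2_sections M (scalar_bundle M)" "a \<in> L2_forms M (scalar_bundle M)" using f(1) by (auto simp: has_grad_def)
  have fm: "f \<in> borel_measurable borel" "meas_form M (scalar_bundle M) a"
    using fL scalar_L2_meas by (auto simp: L2_forms_def)
  have la: "linear (a x)" for x using scalar.meas_formD(1)[OF fm(2), of x] by (simp add: scalar_form_at)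
  \<comment> \<open>The squared gradient of \<phi> outside \<Omega> is weighed against the total
    energy \<open>G\<close> of u; the summand 1 covers G = 0.\<close>
  define c where "c = d / (G + 1)"
  have c: "0 < c" "c * G \<le> d" using d G(1) by (auto simp: c_def field_simps)
  have dpos: "0 < ennreal d" using d by simp
  obtain \<phi> S where \<phi>: "smooth_fun_on M UNIV \<phi>" "compact S"
    "\<And>x. x \<notin> S \<Longrightarrow> \<phi> x = 0" "\<And>x. 0 \<le> \<phi> x" "\<And>x. \<phi> x \<le> 1"
    "(\<integral>\<^sup>+x. ennreal ((1 - \<phi> x)\<^sup>2 * g x) \<partial>vol M) < ennreal d"
    "\<And>x. embed M x \<notin> \<Omega> \<Longrightarrow> grad_sq (differential M \<phi>) x \<le> c"
    by (rule smooth_cutoff_weighted[OF \<Omega> c(1) dpos gm g0 gi]) blast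
  let ?v = "\<lambda>x. (\<phi> x * (1 - f x)) *\<^sub>R u x" and ?\<beta> = "cut_form \<phi> f a u"
  let ?E = "\<lambda>x. sect_sq (scalar_bundle M) f x + grad_sq a x"
  have E0: "0 \<le> ?E x" for x
    using la[of x] by (intro add_nonneg_nonneg scalar.form_sq_nonneg) (auto simp: scalar_sect_sq scalar_form_at)
  have Em: "?E \<in> borel_measurable borel"
    using fm by (intro borel_measurable_add scalar.meas_sect_sq scalar.meas_form_sq) (auto simp: scalar_meas_section)
  have pm: "\<phi> \<in> borel_measurable borel" using smooth_fun_on_measurable[OF open_UNIV \<phi>(1)] by simp
  let ?R = "\<lambda>x. 4 * ennreal ((1 - \<phi> x)\<^sup>2 * g x) + ennreal (4 * c) * ennreal (g x) + 4 * ennreal (h k x * g x) + ennreal (4 * N) * ennreal (?E x)"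
  have pw: "AE x in vol M. ennreal (sect_sq V (\<lambda>x. ?v x - u x) x + form_sq M V (\<lambda>x X. ?\<beta> x X - conn V u x X) x) \<le> ?R x"
    using f(2,3)
  proof eventually_elim
    case (elim x)
    have f01: "0 \<le> f x" "f x \<le> 1" using elim by auto
    \<comment> \<open>On \<Omega> the factor 1 - f is 0, which removes the gradient of \<phi> where
      no bound for it is available.\<close>
    have cc: "(1 - f x)\<^sup>2 * grad_sq (differential M \<phi>) x \<le> c"
    proof (cases "embed M x \<in> \<Omega>")
      case False
      have "0 \<le> grad_sq (differential M \<phi>) x"
        using linear_differential[OF open_UNIV \<phi>(1) UNIV_I, of x] by (intro scalar.form_sq_nonneg) (simp add: scalar_form_at)
      then have "(1 - f x)\<^sup>2 * grad_sq (differential M \<phi>) x \<le> 1 * grad_sq (differential M \<phi>) x"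
        using f01 by (intro mult_right_mono) (auto intro: power_le_one)
      then show ?thesis using \<phi>(7)[OF False] by simp
    qed (use elim c(1) in auto)
    have A: "0 \<le> grad_sq a x" using la[of x] by (intro scalar.form_sq_nonneg) (simp add: scalar_form_at)
    have hg: "0 \<le> h k x * g x" using g0[of x] by (simp add: h_def)
    have fg: "(f x)\<^sup>2 * g x \<le> real (Suc k) * (f x)\<^sup>2 + h k x * g x"
    proof (cases "real (Suc k) < g x")
      case True
      then have "(f x)\<^sup>2 * g x \<le> 1 * g x" using f01 g0[of x] by (intro mult_right_mono) (auto intro: power_le_one)
      moreover have "0 \<le> real (Suc k) * (f x)\<^sup>2" by simp
      moreover have "h k x * g x = g x" using True by (simp add: h_def)
      ultimately show ?thesis by linarith
    next
      case False
      then have "(f x)\<^sup>2 * g x \<le> (f x)\<^sup>2 * real (Suc k)" by (intro mult_left_mono) auto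
      then show ?thesis using hg by (simp add: mult.commute)
    qed
    have "sect_sq V (\<lambda>x. ?v x - u x) x + form_sq M V (\<lambda>x X. ?\<beta> x X - conn V u x X) x
        \<le> 4 * ((1 - \<phi> x)\<^sup>2 * g x) + 4 * c * g x + 4 * ((f x)\<^sup>2 * g x) + 4 * B * grad_sq a x"
      by (rule cut_density_le[where g=g and x=x and a=a and f=f and \<phi>=\<phi>, OF us u(2) \<phi>(1) \<phi>(4)[of x] \<phi>(5)[of x] la[of x] f01 cc g_def[of x]])
    also have "\<dots> \<le> 4 * ((1 - \<phi> x)\<^sup>2 * g x) + 4 * c * g x + 4 * (h k x * g x) + 4 * N * ?E x"
    proof -
      have 1: "(f x)\<^sup>2 * g x \<le> N * (f x)\<^sup>2 + h k x * g x"
        by (rule order_trans[OF fg add_right_mono], rule mult_right_mono) (auto simp: N_def)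
      have 2: "B * grad_sq a x \<le> N * grad_sq a x" using A by (intro mult_right_mono) (auto simp: N_def)
      have "4 * p + 4 * q \<le> 4 * r + 4 * (s + t)" if "p \<le> s + r" "q \<le> t" for p q r s t :: real
        using that by simp
      from this[OF 1 2] have "4 * ((f x)\<^sup>2 * g x) + 4 * (B * grad_sq a x) \<le> 4 * (h k x * g x) + 4 * (N * (f x)\<^sup>2 + N * grad_sq a x)" .
      then show ?thesis by (simp add: scalar_sect_sq algebra_simps)
    qed
    finally have "ennreal (sect_sq V (\<lambda>x. ?v x - u x) x + form_sq M V (\<lambda>x X. ?\<beta> x X - conn V u x X) x)
        \<le> ennreal (4 * ((1 - \<phi> x)\<^sup>2 * g x) + 4 * c * g x + 4 * (h k x * g x) + 4 * N * ?E x)" by (rule ennreal_leI)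
    also have "\<dots> = ennreal (4 * ((1 - \<phi> x)\<^sup>2 * g x)) + ennreal (4 * c * g x) + ennreal (4 * (h k x * g x)) + ennreal (4 * N * ?E x)"
    proof -
      have "ennreal (p + q + r + s) = ennreal p + ennreal q + ennreal r + ennreal s" if "0 \<le> p" "0 \<le> q" "0 \<le> r" "0 \<le> s" for p q r s
        using that by simp
      from this show ?thesis
        by (rule) (use g0[of x] c(1) hg N E0[of x] in simp_all)
    qed
    also have "\<dots> = ?R x"
      using c(1) N by (simp only: ennreal_mult' ennreal_numeral zero_le_numeral mult_nonneg_nonneg less_imp_le)
    finally show ?case .
  qed
  have "energy (\<lambda>x. ?v x - u x) (\<lambda>x X. ?\<beta> x X - conn V u x X) \<le> (\<integral>\<^sup>+x. ?R x \<partial>vol M)"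
    unfolding energy_def by (rule nn_integral_mono_AE[OF pw])
  also have "\<dots> = 4 * (\<integral>\<^sup>+x. ennreal ((1 - \<phi> x)\<^sup>2 * g x) \<partial>vol M) + ennreal (4 * c) * ennreal G
      + 4 * (\<integral>\<^sup>+x. ennreal (h k x * g x) \<partial>vol M) + ennreal (4 * N) * scalar.energy f a"
  proof -
    have m: "(\<lambda>x. ennreal ((1 - \<phi> x)\<^sup>2 * g x)) \<in> borel_measurable (vol M)" "(\<lambda>x. ennreal (g x)) \<in> borel_measurable (vol M)"
      "(\<lambda>x. ennreal (h k x * g x)) \<in> borel_measurable (vol M)" "(\<lambda>x. ennreal (?E x)) \<in> borel_measurable (vol M)"
      using pm gm hm[of k] Em by (auto intro!: meas_vol measurable_compose[OF _ measurable_ennreal])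
    show ?thesis using m unfolding scalar.energy_def G(2)[symmetric]
      by (simp only: nn_integral_add nn_integral_cmult borel_measurable_add borel_measurable_times_ennreal borel_measurable_const)
  qed
  also have "\<dots> \<le> 4 * ennreal d + ennreal (4 * d) + 4 * ennreal d + ennreal (4 * N) * ennreal (d / N)"
  proof (intro add_mono mult_left_mono)
    show "ennreal (4 * c) * ennreal G \<le> ennreal (4 * d)"
      using c G(1) by (simp add: ennreal_mult[symmetric] ennreal_leI)
  qed (use \<phi>(6) k f(4) in \<open>auto simp: less_imp_le\<close>)
  also have "\<dots> = ennreal (16 * d)"
  proof -
    have "ennreal (4 * N) * ennreal (d / N) = ennreal (4 * d)" using N d by (simp add: ennreal_mult[symmetric])
    moreover have "4 * ennreal d = ennreal (4 * d)" using d by (simp add: ennreal_mult')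
    ultimately show ?thesis using d by (simp add: ennreal_plus[symmetric] del: ennreal_plus)
  qed
  finally have 1: "energy (\<lambda>x. ?v x - u x) (\<lambda>x X. ?\<beta> x X - conn V u x X) \<le> ennreal (16 * d)" .
  obtain C where C: "\<And>h. smooth_fun_on M UNIV h \<Longrightarrow>
    energy (\<lambda>x. (\<phi> x * (1 - h x)) *\<^sub>R u x - ?v x) (\<lambda>x X. cut_form \<phi> h (differential M h) u x X - ?\<beta> x X)
    \<le> ennreal C * scalar.energy (\<lambda>x. h x - f x) (\<lambda>x X. differential M h x X - a x X)"
    using cut_energy_le[OF us \<phi>(1-3) fm] by blast
  \<comment> \<open>As \<open>C\<close> depends on \<phi>, the smooth function \<open>w\<close> in
    place of f is chosen last.\<close>
  have "0 < ennreal (d / (\<bar>C\<bar> + 1))" using d by simp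
  then obtain w where w: "w \<in> S1 M (scalar_bundle M)"
    "scalar.energy (\<lambda>x. w x - f x) (\<lambda>x X. differential M w x X - a x X) < ennreal (d / (\<bar>C\<bar> + 1))"
    using f(1) unfolding scalar.has_grad_iff[OF order_refl] scalar_bundle_simps by blast
  have ws: "smooth_fun_on M UNIV w" using w(1) by (simp add: S1_def scalar_smooth_section)
  let ?s = "\<lambda>x. (\<phi> x * (1 - w x)) *\<^sub>R u x"
  note conn_s = conn_cut[OF \<phi>(1) ws us]
  have ss: "smooth_section M V ?s"
    by (intro smooth_section_scale open_UNIV smooth_fun_on_mult smooth_fun_on_diff smooth_fun_on_const \<phi>(1) ws us)
  have sup: "{x. ?s x \<noteq> 0} \<subseteq> S" using \<phi>(3) by auto
  have "closure {x. ?s x \<noteq> 0} \<subseteq> S" by (rule closure_minimal[OF sup compact_imp_closed[OF \<phi>(2)]])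
  then have "compact (S \<inter> closure {x. ?s x \<noteq> 0})" "S \<inter> closure {x. ?s x \<noteq> 0} = closure {x. ?s x \<noteq> 0}"
    using \<phi>(2) by (auto intro: compact_Int_closed)
  then have sC: "?s \<in> Ccinf M V" using ss by (simp add: Ccinf_def)
  have "energy (\<lambda>x. ?s x - ?v x) (\<lambda>x X. conn V ?s x X - ?\<beta> x X) \<le> ennreal \<bar>C\<bar> * ennreal (d / (\<bar>C\<bar> + 1))"
    unfolding conn_s by (rule order_trans[OF C[OF ws] mult_mono[OF ennreal_leI less_imp_le[OF w(2)]]]) auto
  also have "\<dots> \<le> ennreal d"
    using d by (subst ennreal_mult[symmetric]) (auto intro!: ennreal_leI simp: field_simps)
  finally have 2: "energy (\<lambda>x. ?s x - ?v x) (\<lambda>x X. conn V ?s x X - ?\<beta> x X) \<le> ennreal d" .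
  have "energy (\<lambda>x. ?s x - u x) (\<lambda>x X. conn V ?s x X - conn V u x X) \<le>
      2 * energy (\<lambda>x. ?s x - ?v x) (\<lambda>x X. conn V ?s x X - ?\<beta> x X) + 2 * energy (\<lambda>x. ?v x - u x) (\<lambda>x X. ?\<beta> x X - conn V u x X)"
    by (rule energy_triangle[OF smooth_imp_meas_section[OF open_UNIV ss] meas_cut(1)[OF \<phi>(1) us fm]
          S1_meas(1)[OF u(1)] smooth_imp_meas_form[OF smooth_form_conn[OF ss]] meas_cut(2)[OF \<phi>(1) us fm] S1_meas(2)[OF u(1)]])
  also have "\<dots> \<le> 2 * ennreal d + 2 * ennreal (16 * d)" using 1 2 by (intro add_mono mult_left_mono) auto
  also have "\<dots> = ennreal (2 * d) + ennreal (32 * d)" using d by (simp add: ennreal_mult')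
  also have "\<dots> \<le> ennreal e" using d by (subst ennreal_plus[symmetric]) (auto simp: d_def intro!: ennreal_leI)
  finally show ?thesis by (rule bexI[OF _ sC])
qed

lemma compact_support_dense:
  assumes polar: "polar M (cauchy_boundary M)" and u: "u \<in> S1 M V" and e: "0 < e"
  shows "\<exists>s\<in>Ccinf M V. energy (\<lambda>x. s x - u x) (\<lambda>x X. conn V s x X - conn V u x X) < e"
proof -
  \<comment> \<open>Truncation and cutting off each cost \<open>d\<close>, and the triangle
    inequality doubles both.\<close>
  obtain d where d: "0 < d" "ennreal (4 * d) < e"
  proof (cases e)
    case (real r)
    show ?thesis by (rule that[of "r / 8"]) (use e real in \<open>auto simp: ennreal_less_iff\<close>)
  next
    case top
    show ?thesis by (rule that[of 1]) (use top in auto)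
  qed
  have "0 < ennreal d" using d(1) by simp
  from bounded_approximation[OF u this] obtain w B where w: "w \<in> S1 M V" "\<And>x. sect_sq V w x \<le> B"
    "energy (\<lambda>x. w x - u x) (\<lambda>x X. conn V w x X - conn V u x X) < ennreal d" by blast
  from compact_support_approximation[OF polar w(1,2) d(1)] obtain s where s: "s \<in> Ccinf M V"
    "energy (\<lambda>x. s x - w x) (\<lambda>x X. conn V s x X - conn V w x X) \<le> ennreal d" by blast
  have sS: "s \<in> S1 M V" using s(1) Ccinf_subset_S1 by blast
  have "energy (\<lambda>x. s x - u x) (\<lambda>x X. conn V s x X - conn V u x X) \<le>
      2 * energy (\<lambda>x. s x - w x) (\<lambda>x X. conn V s x X - conn V w x X) + 2 * energy (\<lambda>x. w x - u x) (\<lambda>x X. conn V w x X - conn V u x X)"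
    by (intro energy_triangle S1_meas sS w(1) u)
  also have "\<dots> \<le> 2 * ennreal d + 2 * ennreal d" using s(2) w(3) by (intro add_mono mult_left_mono) auto
  also have "\<dots> = ennreal (2 * d) + ennreal (2 * d)" using d by (simp add: ennreal_mult')
  also have "\<dots> = ennreal (4 * d)" using d by (subst ennreal_plus[symmetric]) auto
  finally show ?thesis using s(1) d(2) by (intro bexI[of _ s]) auto
qed

text \<open>Even the relations \<open>has_grad\<close> coincide: a section of \<open>S1\<close> that
  approximates u together with \<alpha> is itself approximated, together with its derivative, by
  sections in \<open>Ccinf\<close>.\<close>

lemma W12_0_eq_W12:
  assumes "polar M (cauchy_boundary M)" shows "W12_0 M V = W12 M V"
proof -
  have "has_grad M V (Ccinf M V) u \<alpha> \<longleftrightarrow> has_grad M V (S1 M V) u \<alpha>" for u \<alpha>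
  proof
    assume "has_grad M V (Ccinf M V) u \<alpha>"
    then show "has_grad M V (S1 M V) u \<alpha>"
      unfolding has_grad_iff[OF Ccinf_subset_S1] has_grad_iff[OF order_refl] using Ccinf_subset_S1 by blast
  next
    assume h: "has_grad M V (S1 M V) u \<alpha>"
    then have L: "u \<in> L2_sections M V" "\<alpha> \<in> L2_forms M V" by (auto simp: has_grad_def)
    have m: "meas_section_on M V UNIV u" "meas_form M V \<alpha>" using L by (auto simp: L2_sections_def L2_forms_def)
    have "\<exists>s\<in>Ccinf M V. energy (\<lambda>x. s x - u x) (\<lambda>x X. conn V s x X - \<alpha> x X) < e" if e: "0 < e" for e
    proof -
      have e4: "0 < e / 4" using e by (simp add: ennreal_divide_eq_0_iff zero_less_iff_neq_zero)
      obtain w where w: "w \<in> S1 M V" "energy (\<lambda>x. w x - u x) (\<lambda>x X. conn V w x X - \<alpha> x X) < e / 4"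
        using h e4 unfolding has_grad_iff[OF order_refl] by blast
      obtain s where s: "s \<in> Ccinf M V" "energy (\<lambda>x. s x - w x) (\<lambda>x X. conn V s x X - conn V w x X) < e / 4"
        using compact_support_dense[OF assms w(1) e4] by blast
      \<comment> \<open>The maximum preserves strictness: both energies are below e/4, hence 4 times
        their maximum is below e.\<close>
      let ?m = "max (energy (\<lambda>x. s x - w x) (\<lambda>x X. conn V s x X - conn V w x X)) (energy (\<lambda>x. w x - u x) (\<lambda>x X. conn V w x X - \<alpha> x X))"
      have "energy (\<lambda>x. s x - u x) (\<lambda>x X. conn V s x X - \<alpha> x X) \<le>
          2 * energy (\<lambda>x. s x - w x) (\<lambda>x X. conn V s x X - conn V w x X) + 2 * energy (\<lambda>x. w x - u x) (\<lambda>x X. conn V w x X - \<alpha> x X)"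
        using s(1) Ccinf_subset_S1 by (intro energy_triangle S1_meas w(1) m) auto
      also have "\<dots> \<le> 2 * ?m + 2 * ?m" by (intro add_mono mult_left_mono) auto
      also have "\<dots> = 4 * ?m" using distrib_right[of 2 2 ?m] by simp
      also have "\<dots> < e" by (rule scaled_less) (use s(2) w(2) in auto)
      finally show ?thesis using s(1) by blast
    qed
    then show "has_grad M V (Ccinf M V) u \<alpha>" using L unfolding has_grad_iff[OF Ccinf_subset_S1] by blast
  qed
  then show ?thesis by (simp add: W12_def W12_0_def)
qed

end

theorem theorem4p3:
  fixes M :: "('m::{t2_space,second_countable_topology}, 'n::finite) riem_mfd"
    and V :: "('m, 'n, 'w::real_vector) vbundle"
  assumes "riemannian_manifold M"
    and "smooth_vbundle M V"
    and "smooth_fmetric M V"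
    and "connection M V"
    and "metric_compatible M V"
    and "polar M (cauchy_boundary M)"
  shows "W12_0 M V = W12 M V"
proof -
  interpret riem_connection M V by unfold_locales (use assms in auto)
  show ?thesis by (rule W12_0_eq_W12[OF assms(6)])
qed

end
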